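(* Let $r_*\in(1/3,3/8)$ be the unique solution in that interval of $r_*\ln(2e/r_* )=1$, and set $b_*=\ln(2/r_* )$, $c_*=(3/2-4r_*/3)/b_*$, $\gamma=1-r_*\ln2$, $\beta=1-c_*\ln2$. There is a constant $C_1>0$ such that for every fixed $\zeta$ with $0<\zeta<(1-\gamma)/\gamma$ and all sufficiently large integers $m$ there is an $m$-mode density operator $\rho_m$ whose Wigner function is strictly positive everywhere and which satisfies $$\operatorname{Tr}(N_m\rho_m)\le m^{-\zeta},\qquad d_{\mathcal F_m}(\rho_m)\le T(\rho_m,\nu_m)\le m^{-\zeta/2},\qquad \mathcal D_m(\rho_m)\ge C_1\frac{m^{1-\gamma(1+\zeta)}}{[(1+\zeta)\ln m]^\beta}.$$ In particular, as $m\to\infty$, the total energy $\operatorname{Tr}(N_m\rho_m)$, the trace distance $T(\rho_m,\nu_m)$ to the vacuum and $d_{\mathcal F_m}(\rho_m)$ all tend to $0$, while $\mathcal D_m(\rho_m)\to+\infty$.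
   Context: $m$ bosonic modes on $L^2(\mathbb R^m)$ with $[\hat q_j,\hat p_k]=i\delta_{jk}$, $\hat N_j=(\hat q_j^2+\hat p_j^2-1)/2$, $N_m=\sum_{j=1}^m\hat N_j$, and $\nu_m=|0\rangle\langle0|^{\otimes m}$ the $m$-mode vacuum. The Wigner function of a density operator is $W_\rho(q,p)=\pi^{-m}\int_{\mathbb R^m}e^{2ip\cdot y}\langle q-y|\rho|q+y\rangle\,dy$, $(q,p)\in\mathbb R^{2m}$. For $W_\rho\ge0$, $h(W_\rho)=-\int_{\mathbb R^{2m}}W_\rho\ln W_\rho$ (natural logarithm), $h_0=1+\ln\pi$ (so the vacuum $\nu_m$ has $h=mh_0$), and $\mathcal D_m(\rho)=mh_0-h(W_\rho)$. $T(\rho,\sigma)=\frac12\|\rho-\sigma\|_1$ is trace distance. $\mathcal F_m$ is the trace-norm-closed convex hull of the $m$-mode Gaussian states (density operators whose Wigner function is Gaussian), and $d_{\mathcal F_m}(\rho)=\inf_{\sigma\in\mathcal F_m}\frac12\|\rho-\sigma\|_1$. *)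

theory Defs
  imports "HOL-Analysis.Analysis"
begin

section \<open>The Hilbert space of \<open>m\<close> modes\<close>

text \<open>The number of modes is a quantified natural number, so a point of \<open>m\<close>-dimensional
  configuration space is an extensional function on \<open>{..<m}\<close>. Elements of the Hilbert space
  are square-integrable functions, with equality read almost everywhere.\<close>

type_synonym point = "nat \<Rightarrow> real"
type_synonym wavefun = "point \<Rightarrow> complex"
type_synonym oper = "wavefun \<Rightarrow> wavefun"

definition config :: "nat \<Rightarrow> point measure" where
  "config m = PiM {..<m} (\<lambda>_. lborel)"

definition L2 :: "nat \<Rightarrow> wavefun set" where
  "L2 m = {f \<in> borel_measurable (config m). integrable (config m) (\<lambda>x. (cmod (f x))\<^sup>2)}"

definition braket :: "nat \<Rightarrow> wavefun \<Rightarrow> wavefun \<Rightarrow> complex" where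
  "braket m f g = (LINT x|config m. cnj (f x) * g x)"

definition L2norm :: "nat \<Rightarrow> wavefun \<Rightarrow> real" where
  "L2norm m f = sqrt (LINT x|config m. (cmod (f x))\<^sup>2)"

definition bounded_oper :: "nat \<Rightarrow> oper \<Rightarrow> bool" where
  "bounded_oper m A \<longleftrightarrow>
     (\<forall>f\<in>L2 m. A f \<in> L2 m) \<and>
     (\<forall>f\<in>L2 m. \<forall>g\<in>L2 m. \<forall>a b. AE x in config m.
        A (\<lambda>u. a * f u + b * g u) x = a * A f x + b * A g x) \<and>
     (\<exists>C. \<forall>f\<in>L2 m. L2norm m (A f) \<le> C * L2norm m f)"

definition positive_oper :: "nat \<Rightarrow> oper \<Rightarrow> bool" where
  "positive_oper m A \<longleftrightarrow> bounded_oper m A \<and>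
     (\<forall>f\<in>L2 m. Im (braket m f (A f)) = 0 \<and> Re (braket m f (A f)) \<ge> 0)"


section \<open>Canonical operators and the Fock basis\<close>

definition q_op :: "nat \<Rightarrow> oper" where
  "q_op j f = (\<lambda>x. complex_of_real (x j) * f x)"

definition p_op :: "nat \<Rightarrow> oper" where
  "p_op j f = (\<lambda>x. - \<i> * vector_derivative (\<lambda>t. f (x(j := t))) (at (x j)))"

definition mode_number :: "nat \<Rightarrow> oper" where
  "mode_number j f = (\<lambda>x. (q_op j (q_op j f) x + p_op j (p_op j f) x - f x) / 2)"

definition total_number :: "nat \<Rightarrow> oper" where
  "total_number m f = (\<lambda>x. \<Sum>j<m. mode_number j f x)"

text \<open>One-mode number states: the creation operator \<open>(q - i p)/sqrt 2\<close>, divided by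
  \<open>sqrt (n + 1)\<close>, is applied repeatedly to the ground state.\<close>

primrec hermite_fun :: "nat \<Rightarrow> real \<Rightarrow> real" where
  "hermite_fun 0 = (\<lambda>x. pi powr (-1/4) * exp (- x\<^sup>2 / 2))"
| "hermite_fun (Suc n) =
     (\<lambda>x. (x * hermite_fun n x - deriv (hermite_fun n) x) / sqrt (2 * real (Suc n)))"

definition fock_index :: "nat \<Rightarrow> (nat \<Rightarrow> nat) set" where
  "fock_index m = ({..<m} \<rightarrow>\<^sub>E UNIV)"

definition fock :: "nat \<Rightarrow> (nat \<Rightarrow> nat) \<Rightarrow> wavefun" where
  "fock m n = (\<lambda>x. complex_of_real (\<Prod>j<m. hermite_fun (n j) (x j)))"

definition vacuum :: "nat \<Rightarrow> oper" where
  "vacuum m f = (\<lambda>x. braket m (fock m (\<lambda>_. 0)) f * fock m (\<lambda>_. 0) x)"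


section \<open>Trace, trace norm, density operators, energy\<close>

text \<open>The trace of a positive operator (a value in \<open>[0, \<infinity>]\<close>, the same for every orthonormal
  basis) is evaluated in the Fock basis.\<close>

definition trace_pos :: "nat \<Rightarrow> oper \<Rightarrow> ennreal" where
  "trace_pos m A = (\<Sum>\<^sub>\<infinity>n\<in>fock_index m. ennreal (Re (braket m (fock m n) (A (fock m n)))))"

text \<open>\<open>P\<close> is the absolute value of \<open>A\<close>: the positive operator with \<open>P\<^sup>2 = A\<^sup>* A\<close>.\<close>

definition is_abs_oper :: "nat \<Rightarrow> oper \<Rightarrow> oper \<Rightarrow> bool" where
  "is_abs_oper m A P \<longleftrightarrow> positive_oper m P \<and>
     (\<forall>f\<in>L2 m. \<forall>g\<in>L2 m. braket m (P f) (P g) = braket m (A f) (A g))"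

text \<open>The trace norm is the trace of the absolute value. For bounded \<open>A\<close> the absolute value
  exists and is unique up to null sets, so the infimum ranges over a single number; it only
  serves to turn the relation \<open>is_abs_oper\<close> into a value.\<close>

definition trace_norm :: "nat \<Rightarrow> oper \<Rightarrow> ennreal" where
  "trace_norm m A = (INF P\<in>{P. is_abs_oper m A P}. trace_pos m P)"

definition trace_dist :: "nat \<Rightarrow> oper \<Rightarrow> oper \<Rightarrow> ennreal" where
  "trace_dist m \<rho> \<sigma> = trace_norm m (\<lambda>f x. \<rho> f x - \<sigma> f x) / 2"

definition density_oper :: "nat \<Rightarrow> oper \<Rightarrow> bool" where
  "density_oper m \<rho> \<longleftrightarrow> positive_oper m \<rho> \<and> trace_pos m \<rho> = 1"

text \<open>The total energy, i.e. the trace of (number operator times \<open>\<rho>\<close>), evaluated in the Fock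
  basis with the symmetric unbounded factor moved to the left. Fock vectors are eigenvectors
  of the number operator, so all terms are nonnegative; the value may be \<open>\<infinity>\<close>.\<close>

definition energy :: "nat \<Rightarrow> oper \<Rightarrow> ennreal" where
  "energy m \<rho> = (\<Sum>\<^sub>\<infinity>n\<in>fock_index m.
     ennreal (Re (braket m (total_number m (fock m n)) (\<rho> (fock m n)))))"


section \<open>Wigner functions and the entropy deficit\<close>

definition is_kernel :: "nat \<Rightarrow> oper \<Rightarrow> (point \<Rightarrow> point \<Rightarrow> complex) \<Rightarrow> bool" where
  "is_kernel m A K \<longleftrightarrow>
     (\<lambda>(x, y). K x y) \<in> borel_measurable (config m \<Otimes>\<^sub>M config m) \<and>
     (\<forall>f\<in>L2 m. AE x in config m.
        integrable (config m) (\<lambda>y. K x y * f y) \<and> A f x = (LINT y|config m. K x y * f y))"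

text \<open>\<open>W\<close> is the Wigner function of \<open>\<rho>\<close>. The kernel of \<open>\<rho>\<close> is determined only almost
  everywhere, which fixes the integral below for almost every \<open>q\<close>; the pointwise meaning of
  the Wigner function is that of its continuous version. For a density operator exactly one such
  \<open>W\<close> exists (as a function on phase space).\<close>

definition is_wigner :: "nat \<Rightarrow> oper \<Rightarrow> (point \<Rightarrow> point \<Rightarrow> real) \<Rightarrow> bool" where
  "is_wigner m \<rho> W \<longleftrightarrow>
     continuous_on (space (config m) \<times> space (config m)) (\<lambda>(q, p). W q p) \<and>
     (\<exists>K. is_kernel m \<rho> K \<and>
       (\<forall>q\<in>space (config m). \<forall>p\<in>space (config m).
          let F = (\<lambda>y. exp (2 * \<i> * complex_of_real (\<Sum>j<m. p j * y j)) *
                       K (\<lambda>j\<in>{..<m}. q j - y j) (\<lambda>j\<in>{..<m}. q j + y j))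
          in integrable (config m) F \<and>
             complex_of_real (W q p) = (LINT y|config m. F y) / complex_of_real (pi ^ m)))"

text \<open>Differential entropy as an extended real: positive part minus negative part. The undefined
  case \<open>\<infinity> - \<infinity>\<close> evaluates to \<open>\<infinity>\<close>, which makes the deficit below \<open>-\<infinity>\<close>.\<close>

definition diff_entropy :: "nat \<Rightarrow> (point \<Rightarrow> point \<Rightarrow> real) \<Rightarrow> ereal" where
  "diff_entropy m W =
     enn2ereal (\<integral>\<^sup>+(q, p). ennreal (- (W q p * ln (W q p))) \<partial>(config m \<Otimes>\<^sub>M config m)) -
     enn2ereal (\<integral>\<^sup>+(q, p). ennreal (W q p * ln (W q p)) \<partial>(config m \<Otimes>\<^sub>M config m))"

definition h0 :: real where
  "h0 = 1 + ln pi"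

definition entropy_deficit :: "nat \<Rightarrow> (point \<Rightarrow> point \<Rightarrow> real) \<Rightarrow> ereal" where
  "entropy_deficit m W = ereal (real m * h0) - diff_entropy m W"


section \<open>Gaussian states and their closed convex hull\<close>

definition phase_point :: "nat \<Rightarrow> point \<Rightarrow> point \<Rightarrow> point" where
  "phase_point m q p = (\<lambda>i. if i < m then q i else p (i - m))"

text \<open>Gaussian function on phase space with mean \<open>\<mu>\<close> and inverse covariance matrix \<open>S\<close>. The
  prefactor of a Gaussian Wigner function is determined by the trace being 1.\<close>

definition gaussian_fun :: "nat \<Rightarrow> (point \<Rightarrow> point \<Rightarrow> real) \<Rightarrow> bool" where
  "gaussian_fun m W \<longleftrightarrow> (\<exists>c \<mu> S. c > 0 \<and>
     (\<forall>i<2*m. \<forall>j<2*m. S i j = S j i) \<and>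
     (\<forall>v. (\<exists>i<2*m. v i \<noteq> 0) \<longrightarrow> (\<Sum>i<2*m. \<Sum>j<2*m. v i * S i j * v j) > (0::real)) \<and>
     (\<forall>q\<in>space (config m). \<forall>p\<in>space (config m).
        W q p = c * exp (- (\<Sum>i<2*m. \<Sum>j<2*m.
          (phase_point m q p i - \<mu> i) * S i j * (phase_point m q p j - \<mu> j)) / 2)))"

definition gaussian_state :: "nat \<Rightarrow> oper \<Rightarrow> bool" where
  "gaussian_state m \<rho> \<longleftrightarrow> density_oper m \<rho> \<and> (\<exists>W. is_wigner m \<rho> W \<and> gaussian_fun m W)"

definition gaussian_hull :: "nat \<Rightarrow> oper set" where
  "gaussian_hull m = {\<tau>. \<exists>(n::nat) (c :: nat \<Rightarrow> real) G.
     (\<forall>k<n. 0 \<le> c k \<and> gaussian_state m (G k)) \<and> (\<Sum>k<n. c k) = 1 \<and>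
     \<tau> = (\<lambda>f x. \<Sum>k<n. complex_of_real (c k) * G k f x)}"

definition closed_gaussian_hull :: "nat \<Rightarrow> oper set" where
  "closed_gaussian_hull m = {\<sigma>. bounded_oper m \<sigma> \<and>
     (\<forall>\<epsilon>>0. \<exists>\<tau>\<in>gaussian_hull m. trace_norm m (\<lambda>f x. \<sigma> f x - \<tau> f x) < \<epsilon>)}"

definition dist_gaussian_hull :: "nat \<Rightarrow> oper \<Rightarrow> ennreal" where
  "dist_gaussian_hull m \<rho> = (INF \<sigma>\<in>closed_gaussian_hull m. trace_dist m \<rho> \<sigma>)"


section \<open>The numerical constants\<close>

definition is_r_star :: "real \<Rightarrow> bool" where
  "is_r_star r \<longleftrightarrow> 1/3 < r \<and> r < 3/8 \<and> r * ln (2 * exp 1 / r) = 1"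

definition r_star :: real where
  "r_star = (THE r. is_r_star r)"

definition b_star :: real where
  "b_star = ln (2 / r_star)"

definition c_star :: real where
  "c_star = (3/2 - 4 * r_star / 3) / b_star"

definition gamma_exp :: real where
  "gamma_exp = 1 - r_star * ln 2"

definition beta_exp :: real where
  "beta_exp = 1 - c_star * ln 2"

end

theory Submission
  imports Defs "HOL-Probability.Characteristic_Functions" "HOL-Computational_Algebra.Polynomial" "HOL-Real_Asymp.Real_Asymp"
begin

text \<open>Every mode is put in the state \<open>(1 - p) |\<psi>><\<psi>| + p |K><K|\<close> with \<open>\<psi> = sqrt (1 - \<eta>) |0> + sqrt \<eta> |k>\<close>,
  and the total state is the tensor power. For an energy \<open>\<epsilon>\<close> per mode, \<open>\<eta>\<close> is of order \<open>\<epsilon> / k\<close>. The coherence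
  between \<open>|0>\<close> and \<open>|k>\<close> changes the vacuum Wigner function by a factor \<open>1 + a\<close>, where the Gaussian mean of
  \<open>a\<^sup>2\<close> is of order \<open>\<eta> * 2 ^ k\<close>. This is also the size of the relative entropy to the vacuum, and it is much
  larger than \<open>\<epsilon>\<close>.

  The coherence would make the Wigner function negative at large radius. The component \<open>|K>\<close> with \<open>p\<close> of order
  \<open>\<epsilon> / K\<close> prevents this: beyond its turning point \<open>q\<^sup>2 + p\<^sup>2 = 2 * K + 1\<close> its Wigner function is positive and,
  relative to the vacuum, grows faster than the coherence, while before that point the coherence is small and the
  negative part of \<open>|K>\<close> is harmless. So the weight must satisfy \<open>p * exp (2 * K) \<ge> K powr (1/3)\<close> up to
  constants, hence \<open>2 * K\<close> is about \<open>ln (1 / \<epsilon>)\<close>, and the largest \<open>k\<close> for which the coherence is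
  still small at the turning point is about \<open>r_star * ln (1 / \<epsilon>)\<close>, so that \<open>\<eta> * 2 ^ k\<close> is about
  \<open>\<epsilon> powr gamma_exp\<close>. Finally \<open>\<epsilon> = m powr (- 1 - \<zeta>)\<close>.\<close>

text \<open>The factor [(1 + zeta) ln m]^beta fixes the precision that is needed: a constant factor
  lost in a pointwise estimate shifts k by a bounded amount and is absorbed in C_1, but a lost power
  of K would change \<open>beta_exp\<close>. Hence the value of |K> at its turning point is needed
  to the exact order exp (2 K + 1) / K^(1/3). The exponent 1/3 is the Airy scale: near the turning
  point the recursion in the index varies on windows of length K^(1/3). Together with the 1 / K in p
  it makes Y = 2 K + 1 exceed L = ln (1 / epsilon) by (4/3) ln K, which is the summand 4
  \<open>r_star\<close> / 3 of \<open>c_star\<close>. There eta u^k / k! carries K^(4/3) from Y - L,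
  K^(-1) from eta and K^(-1/2) from Stirling, that is, a spare K^(-1/6); spending it on a larger k
  gives the other summand 1 / (6 \<open>b_star\<close>). The gain eta 2^k comes from values of q^2 +
  p^2 near k, about \<open>r_star\<close> Y < 3 Y / 8, well inside the turning point Y. An entropy
  bound that is quadratic on the disc q^2 + p^2 <= 6 Y / 10 therefore loses only a constant.\<close>

section \<open>Laguerre functions\<close>

text \<open>With the Laguerre polynomials \<open>L\<^sub>n\<close>, \<open>lag n u\<close> is \<open>(- 1) ^ n * L\<^sub>n u\<close>; at \<open>u = 2 * (q\<^sup>2 + p\<^sup>2)\<close> it is the
  ratio of the Wigner functions of the number state \<open>n\<close> and of the vacuum.\<close>
fun lag :: "nat \<Rightarrow> real \<Rightarrow> real" where
  "lag 0 u = 1"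
| "lag (Suc 0) u = u - 1"
| "lag (Suc (Suc n)) u = ((u - 2 * real n - 3) * lag (Suc n) u - real (Suc n) * lag n u) / real (Suc (Suc n))"

lemma lag_rec: "real (Suc n) * lag (Suc n) u = (u - 2 * real n - 1) * lag n u - real n * lag (n - 1) u"
  by (cases n) (auto simp: field_simps)

text \<open>The recursion reads \<open>dlag (n + 1) u - dlag n u = (u - 4 * n - 2) * lag n u\<close>, a discrete Airy equation with
  turning point \<open>u = 4 * n + 2\<close>.\<close>
definition dlag :: "nat \<Rightarrow> real \<Rightarrow> real" where
  "dlag n u = real n * (lag n u - lag (n - 1) u)"

lemma dlag_0 [simp]: "dlag 0 u = 0"
  by (simp add: dlag_def)

lemma dlag_Suc: "dlag (Suc n) u = dlag n u + (u - 4 * real n - 2) * lag n u"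
  using lag_rec[of n u] by (simp add: dlag_def algebra_simps)

lemma lag_Suc: "lag (Suc n) u = lag n u + dlag (Suc n) u / real (Suc n)"
  by (simp add: dlag_def)

text \<open>Every index n below N satisfies u - 4 n - 2 >= 0, so each step of the recursion adds a
  nonnegative amount to \<open>dlag\<close>, and then to \<open>lag\<close>: nothing oscillates up
  to the turning index. The three conclusions feed each other and are proved by one
  induction.\<close>

lemma lag_pos_mono:
  assumes "4 * real N \<le> u + 2"
  shows "1 \<le> lag N u \<and> 0 \<le> dlag N u \<and> (\<forall>k\<le>N. lag k u \<le> lag N u \<and> dlag k u \<le> dlag N u)"
  using assms
proof (induction N)
  case (Suc N)
  then have IH: "1 \<le> lag N u" "0 \<le> dlag N u" "\<forall>k\<le>N. lag k u \<le> lag N u \<and> dlag k u \<le> dlag N u"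
    and u: "0 \<le> u - 4 * real N - 2" by auto
  have "0 \<le> (u - 4 * real N - 2) * lag N u" using IH(1) u by (intro mult_nonneg_nonneg) auto
  then have d: "dlag N u \<le> dlag (Suc N) u" by (simp add: dlag_Suc)
  then have "0 \<le> dlag (Suc N) u / real (Suc N)" using IH(2) by simp
  then have "lag N u \<le> lag (Suc N) u" using lag_Suc[of N u] by linarith
  with d IH show ?case by (auto simp: le_Suc_eq intro: order_trans)
qed simp

lemmas lag_ge_1 = lag_pos_mono[THEN conjunct1]

text \<open>This is u L_n' = n (L_n - L_(n-1)) in the sign convention of \<open>lag\<close>. The
  recursion has three terms, so the induction carries the formula for two consecutive
  indices.\<close>

lemma lag_deriv:
  assumes "u > 0"
  shows "(lag n has_real_derivative real n * (lag n u + lag (n - 1) u) / u) (at u)"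
proof -
  have "(lag n has_real_derivative real n * (lag n u + lag (n - 1) u) / u) (at u) \<and>
    (lag (Suc n) has_real_derivative real (Suc n) * (lag (Suc n) u + lag n u) / u) (at u)"
  proof (induction n)
    case 0
    have "((\<lambda>u. u - 1) has_real_derivative 1) (at u)"
      by (auto intro!: derivative_eq_intros)
    moreover have "lag (Suc 0) = (\<lambda>u. u - 1)" "lag 0 = (\<lambda>u. 1)" by auto
    ultimately show ?case using assms by auto
  next
    case (Suc n)
    let ?a = "lag n u" let ?b = "lag (Suc n) u"
    have d1: "((\<lambda>u. u - 2 * real n - 3) has_real_derivative 1) (at u)"
      by (auto intro!: derivative_eq_intros)
    have "((\<lambda>u. ((u - 2 * real n - 3) * lag (Suc n) u - real (Suc n) * lag n u) / real (Suc (Suc n)))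
      has_real_derivative
       (?b + (u - 2 * real n - 3) * (real (Suc n) * (?b + ?a) / u)
         - real (Suc n) * (real n * (?a + lag (n - 1) u) / u)) / real (Suc (Suc n))) (at u)"
      by (rule DERIV_cong[OF DERIV_cdivide[OF DERIV_diff[OF DERIV_mult[OF d1 Suc[THEN conjunct2]]
            DERIV_cmult[OF Suc[THEN conjunct1]]]]]) (simp add: mult.commute)
    moreover have "(?b + (u - 2 * real n - 3) * (real (Suc n) * (?b + ?a) / u)
         - real (Suc n) * (real n * (?a + lag (n - 1) u) / u)) / real (Suc (Suc n))
       = real (Suc (Suc n)) * (lag (Suc (Suc n)) u + lag (Suc n) u) / u"
    proof -
      have r: "real n * lag (n - 1) u = (u - 2 * real n - 1) * ?a - real (Suc n) * ?b"
        using lag_rec[of n u] by simp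
      have e: "real n * (?a + lag (n - 1) u) = real n * ?a + (u - 2 * real n - 1) * ?a - real (Suc n) * ?b"
        using r by (simp add: algebra_simps)
      define x d where "x = real n" and "d = lag (Suc (Suc n)) u"
      have d: "(x + 2) * d = (u - 2 * x - 3) * ?b - (x + 1) * ?a"
        unfolding d_def x_def by (simp add: field_simps)
      have x: "x + 2 > 0" "real (Suc n) = x + 1" "real (Suc (Suc n)) = x + 2" by (auto simp: x_def)
      have "(u * ?b + (u - 2 * x - 3) * ((x + 1) * (?b + ?a))
         - (x + 1) * (x * ?a + (u - 2 * x - 1) * ?a - (x + 1) * ?b)) = (x + 2) * ((x + 2) * d + (x + 2) * ?b)"
        unfolding d by (simp add: algebra_simps)
      then have "(u * ?b + (u - 2 * x - 3) * ((x + 1) * (?b + ?a))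
         - (x + 1) * (x * ?a + (u - 2 * x - 1) * ?a - (x + 1) * ?b)) / (u * (x + 2)) = (x + 2) * (d + ?b) / u"
        using x assms by (simp add: divide_simps) (simp add: algebra_simps)?
      moreover obtain E where E: "E = x * ?a + (u - 2 * x - 1) * ?a - (x + 1) * ?b" by blast
      ultimately have "(u * ?b + (u - 2 * x - 3) * ((x + 1) * (?b + ?a)) - (x + 1) * E) / (u * (x + 2)) = (x + 2) * (d + ?b) / u"
        by (simp only: E)
      moreover have "x * (?a + lag (n - 1) u) = E"
        using e x by (simp add: x_def E)
      ultimately show ?thesis unfolding x d_def[symmetric] x_def[symmetric] using x(1) assms
        by (simp only: ) (simp add: add_divide_distrib diff_divide_distrib mult.commute)
    qed
    moreover have "lag (Suc (Suc n)) = (\<lambda>u. ((u - 2 * real n - 3) * lag (Suc n) u - real (Suc n) * lag n u) / real (Suc (Suc n)))"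
      by auto
    ultimately show ?case using Suc by (metis diff_Suc_1)
  qed
  then show ?thesis by blast
qed

text \<open>By \<open>lag_deriv\<close>, the derivative of lag N x / x^N is a nonnegative multiple
  of lag (N - 1) x, which is at least 1 in this range: from there on the number state grows at least
  like its leading power.\<close>

lemma lag_growth:
  assumes "4 * real N \<le> u0 + 2" "0 < u0" "u0 \<le> u"
  shows "lag N u0 * (u / u0) ^ N \<le> lag N u"
proof -
  have "lag N u0 / u0 ^ N \<le> lag N u / u ^ N"
  proof (rule DERIV_nonneg_imp_nondecreasing[OF assms(3)])
    fix x assume x: "u0 \<le> x" "x \<le> u"
    then have x0: "x > 0" using assms by auto
    have d: "((\<lambda>x. lag N x / x ^ N) has_real_derivative
      (real N * (lag N x + lag (N - 1) x) / x * x ^ N - lag N x * (real N * x ^ (N - 1))) / (x ^ N * x ^ N)) (at x)"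
      using x0 by (auto intro!: derivative_eq_intros lag_deriv)
    have "1 \<le> lag (N - 1) x" using x assms by (intro lag_ge_1) auto
    moreover have "real N * (lag N x + lag (N - 1) x) / x * x ^ N - lag N x * (real N * x ^ (N - 1))
       = real N * lag (N - 1) x * x ^ N / x"
      using x0 by (cases N) (auto simp: field_simps)
    ultimately have "0 \<le> (real N * (lag N x + lag (N - 1) x) / x * x ^ N - lag N x * (real N * x ^ (N - 1))) / (x ^ N * x ^ N)"
      using x0 by (intro divide_nonneg_nonneg) (auto intro!: mult_nonneg_nonneg)
    with d show "\<exists>y. ((\<lambda>x. lag N x / x ^ N) has_real_derivative y) (at x) \<and> 0 \<le> y" by blast
  qed
  then show ?thesis using assms by (simp add: field_simps power_divide)
qed

text \<open>If the slope were smaller, the values would hardly change over the last T indices before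
  R and would stay above half of the final value. But then the increments of the slope over these
  indices would add up to T (T - 1) times the final value, which is more than the slope that was
  assumed.\<close>

lemma dlag_lower:
  assumes "1 \<le> R" "4 * real R \<le> u + 2" "96 * (J + 2) ^ 3 \<le> R"
  shows "8 * real ((J + 1) * (J + 2)) * lag R u \<le> dlag R u"
proof (rule ccontr)
  define Th where "Th = 8 * real ((J + 1) * (J + 2))"
  \<comment> \<open>T (T - 1) exceeds \<open>Th\<close> for this T, while T times \<open>Th\<close>
    is still of order (J + 2)^3 and hence small against R.\<close>
  define T where "T = 3 * (J + 2)"
  assume "\<not> ?thesis"
  then have neg: "dlag R u < Th * lag R u" by (simp add: Th_def)
  have pm: "1 \<le> lag R u" "0 \<le> dlag R u" using lag_pos_mono[OF assms(2)] by auto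
  have pk: "1 \<le> lag k u" "0 \<le> dlag k u" "dlag k u \<le> dlag R u" if "k \<le> R" for k
    using lag_pos_mono[OF assms(2)] lag_pos_mono[of k u] assms(2) that by auto
  have T4: "4 * real T * Th \<le> real R"
  proof -
    have "4 * T * (8 * ((J + 1) * (J + 2))) \<le> 96 * (J + 2) ^ 3"
      by (simp add: T_def power3_eq_cube algebra_simps)
    then have "real (4 * T * (8 * ((J + 1) * (J + 2)))) \<le> real R" using assms(3) by linarith
    then show ?thesis by (simp add: Th_def)
  qed
  have Th1: "Th \<ge> 1" by (simp add: Th_def)
  have TR: "2 * T \<le> R"
  proof -
    have "4 * real T * 1 \<le> 4 * real T * Th" using Th1 by (intro mult_left_mono) auto
    with T4 show ?thesis by linarith
  qed
  have bck: "lag R u - 2 * real j * dlag R u / real R \<le> lag (R - j) u" if "j \<le> T" for j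
    using that
  proof (induction j)
    case (Suc j)
    define k where "k = R - Suc j"
    have k: "R - j = Suc k" "k < R" "2 * Suc k \<ge> R" using Suc TR by (auto simp: k_def)
    have "lag (Suc k) u = lag k u + dlag (Suc k) u / real (Suc k)" by (rule lag_Suc)
    moreover have "dlag (Suc k) u / real (Suc k) \<le> dlag R u / (real R / 2)"
      using k pk[of "Suc k"] pm assms(1) by (intro frac_le) auto
    ultimately show ?case using Suc k by (auto simp: k_def algebra_simps add_divide_distrib)
  qed simp
  have half: "lag R u / 2 \<le> lag (R - j) u" if "j \<le> T" for j
  proof -
    have "2 * real j * dlag R u \<le> 2 * real T * (Th * lag R u)"
      using that neg pm by (intro mult_mono) auto
    also have "\<dots> \<le> real R / 2 * lag R u" using T4 pm
      by (simp add: mult.assoc[symmetric] mult_right_mono)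
    finally have "2 * real j * dlag R u / real R \<le> lag R u / 2"
      using assms(1) by (simp add: field_simps)
    with bck[OF that] show ?thesis by linarith
  qed
  have low: "real j * (real j - 1) * lag R u + dlag (R - j) u \<le> dlag R u" if "j \<le> T" for j
    using that
  proof (induction j)
    case (Suc j)
    define k where "k = R - Suc j"
    have k: "R - j = Suc k" "real k = real R - real j - 1" using Suc TR by (auto simp: k_def)
    have "4 * real j * (lag R u / 2) \<le> (u - 4 * real k - 2) * lag k u"
      using half[of "Suc j"] Suc.prems pm k assms(2) by (intro mult_mono) (auto simp: k_def)
    then have "2 * real j * lag R u + dlag k u \<le> dlag (R - j) u"
      by (simp add: k dlag_Suc)
    with Suc show ?case by (simp add: k_def algebra_simps)
  qed simp
  have "real T * (real T - 1) * lag R u \<le> dlag R u"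
    using low[of T] pk[of "R - T"] by auto
  moreover have "Th \<le> real T * (real T - 1)"
    by (simp add: Th_def T_def algebra_simps)
  then have "Th * lag R u \<le> real T * (real T - 1) * lag R u"
    using pm by (intro mult_right_mono) auto
  ultimately show False using neg by linarith
qed

text \<open>From R on the coefficient in the recursion is negative and the slope falls. While the
  values stay below B, i steps cost at most 2 i (i + 1) B of slope, and \<open>dlag_lower\<close>
  provides a slope at R that pays for J + 1 such steps.\<close>

lemma lag_pos_after_turning:
  assumes "1 \<le> R" "4 * real R \<le> u + 2" "u < 4 * real R + 2" "96 * (J + 2) ^ 3 \<le> R" "i \<le> J"
  shows "0 < lag (R + i) u"
proof -
  have pm: "1 \<le> lag R u" "0 \<le> dlag R u" using lag_pos_mono[OF assms(2)] by auto
  have dl: "8 * real ((J + 1) * (J + 2)) * lag R u \<le> dlag R u"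
    using dlag_lower[OF assms(1,2,4)] .
  have J3: "48 * ((real J + 1) * (real J + 2)) * real J \<le> real R"
  proof -
    have "48 * ((J + 1) * (J + 2)) * J \<le> 96 * (J + 2) ^ 3"
      by (simp add: power3_eq_cube algebra_simps)
    then have "real (48 * ((J + 1) * (J + 2)) * J) \<le> real R" using assms(4) by linarith
    then show ?thesis by (simp add: algebra_simps)
  qed
  \<comment> \<open>Bounds the next J values if the slope never exceeds its value at R. Since R is
    of order (J + 2)^3 at least, the second summand is a negligible fraction of that slope.\<close>
  define B where "B = lag R u + real J * dlag R u / real R"
  have B0: "0 \<le> B" using pm by (auto simp: B_def)
  have big: "2 * ((real J + 1) * (real J + 2)) * B \<le> dlag R u"
  proof -
    have "2 * ((real J + 1) * (real J + 2)) * (real J * dlag R u / real R) =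
       (2 * ((real J + 1) * (real J + 2)) * real J / real R) * dlag R u" by simp
    also have "\<dots> \<le> 1 / 24 * dlag R u"
      using J3 assms(1) pm by (intro mult_right_mono) (auto simp: field_simps)
    finally have X: "2 * ((real J + 1) * (real J + 2)) * (real J * dlag R u / real R) \<le> 1 / 24 * dlag R u" .
    have "8 * ((real J + 1) * (real J + 2)) * lag R u \<le> dlag R u" using dl by (simp add: algebra_simps)
    define y where "y = (real J + 1) * (real J + 2)"
    show ?thesis using X pm \<open>8 * ((real J + 1) * (real J + 2)) * lag R u \<le> dlag R u\<close>
      unfolding B_def y_def[symmetric] distrib_left[of "2 * y"] by linarith
  qed
  have "0 < lag (R + i) u \<and> lag (R + i) u \<le> lag R u + real i * dlag R u / real R \<and>
    dlag R u - 2 * (real i * (real i + 1)) * B \<le> dlag (R + i) u \<and> dlag (R + i) u \<le> dlag R u"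
    if "i \<le> J + 1" for i
    using that
  proof (induction i)
    case (Suc i)
    then have IH: "0 < lag (R + i) u" "lag (R + i) u \<le> lag R u + real i * dlag R u / real R"
      "dlag R u - 2 * (real i * (real i + 1)) * B \<le> dlag (R + i) u" "dlag (R + i) u \<le> dlag R u"
      by auto
    have "real i * dlag R u / real R \<le> real J * dlag R u / real R"
      using Suc.prems pm by (intro divide_right_mono mult_right_mono) auto
    then have B: "lag (R + i) u \<le> B" using IH by (simp add: B_def)
    have "(4 * real (R + i) + 2 - u) * lag (R + i) u \<le> 4 * (real i + 1) * B"
      using IH B B0 assms(2) by (intro mult_mono) auto
    then have D1: "dlag R u - 2 * (real (Suc i) * (real (Suc i) + 1)) * B \<le> dlag (R + Suc i) u"
      using IH by (simp add: dlag_Suc algebra_simps)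
    have "0 \<le> (4 * real (R + i) + 2 - u) * lag (R + i) u"
      using IH assms(3) by (intro mult_nonneg_nonneg) auto
    then have D2: "dlag (R + Suc i) u \<le> dlag R u" using IH by (simp add: dlag_Suc algebra_simps)
    have "2 * (real (Suc i) * (real (Suc i) + 1)) * B \<le> 2 * ((real J + 1) * (real J + 2)) * B"
      using Suc.prems B0 by (intro mult_right_mono mult_left_mono mult_mono) auto
    with D1 big have D0: "0 \<le> dlag (R + Suc i) u" by linarith
    then have q: "0 \<le> dlag (R + Suc i) u / real (R + Suc i)" by simp
    have "dlag (R + Suc i) u / real (R + Suc i) \<le> dlag R u / real R"
      using D0 D2 assms(1) pm by (intro frac_le) auto
    moreover have "lag (R + Suc i) u = lag (R + i) u + dlag (R + Suc i) u / real (R + Suc i)"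
      using lag_Suc[of "R + i" u] by simp
    ultimately have "0 < lag (R + Suc i) u \<and> lag (R + Suc i) u \<le> lag R u + real (Suc i) * dlag R u / real R"
      using IH q by (auto simp: algebra_simps add_divide_distrib)
    with D1 D2 show ?case by blast
  qed (use pm in auto)
  then show ?thesis using assms(5) by auto
qed

text \<open>For fixed u the index K lies at most J steps beyond the last index R with 4 R <= u + 2,
  and the preceding lemma covers these steps. The point of the margin 4 J in u: the crude bound exp
  (u / 2) is then needed only where it is smaller than at the turning point by exp (- 2 J).\<close>

lemma lag_pos:
  assumes "96 * (J + 2) ^ 3 + J \<le> K" "4 * real K + 2 - 4 * real J \<le> u"
  shows "0 < lag K u"
proof (cases "4 * real K \<le> u + 2")
  case True
  then show ?thesis using lag_ge_1 by (smt (verit))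
next
  case False
  define R where "R = nat \<lfloor>(u + 2) / 4\<rfloor>"
  have u0: "0 \<le> u + 2" using assms by auto
  have R: "real R \<le> (u + 2) / 4" "(u + 2) / 4 < real R + 1"
    unfolding R_def using u0 of_int_floor_le[of "(u + 2) / 4"] real_of_int_floor_add_one_gt[of "(u + 2) / 4"] by (simp_all del: of_int_floor_le)
  have R': "4 * real R \<le> u + 2" "u + 2 < 4 * real R + 4" using R by auto
  have "4 * real R < 4 * real K" using R'(1) False by argo
  moreover have "4 * real K < 4 * real R + 4 * real J + 4" using R'(2) assms(2) by argo
  ultimately have RK: "R \<le> K" "K \<le> R + J" by linarith+
  have "8 \<le> (J + 2) ^ 3"
    using power_mono[of 2 "J + 2" 3] by auto
  then have "0 < lag (R + (K - R)) u"
    using R' RK assms by (intro lag_pos_after_turning[of R u J]) auto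
  then show ?thesis using RK by simp
qed

text \<open>A large slope at K cannot persist backwards, since the values, which are at least 1,
  would become negative within j steps. The term with the square of j is the possible loss of slope
  over these steps. For j of order K^(1/3) both terms are of order K^(2/3).\<close>

lemma dlag_upper:
  assumes "1 \<le> j" "j \<le> K"
  shows "dlag K (4 * real K + 2) \<le> lag K (4 * real K + 2) * (real K / real j + 4 * (real j)\<^sup>2)"
proof -
  define u where "u = 4 * real K + 2"
  have u: "4 * real K \<le> u + 2" by (simp add: u_def)
  have pk: "1 \<le> lag k u" "lag k u \<le> lag K u" "0 \<le> dlag k u" "dlag k u \<le> dlag K u" if "k \<le> K" for k
    using lag_pos_mono[OF u] lag_pos_mono[of k u] u that by auto
  have dd: "dlag K u - 4 * real i * real j * lag K u \<le> dlag (K - i) u" if "i \<le> j" for i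
    using that
  proof (induction i)
    case (Suc i)
    define k where "k = K - Suc i"
    have k: "K - i = Suc k" "real k = real K - real i - 1" using Suc assms by (auto simp: k_def)
    have "(u - 4 * real k - 2) * lag k u \<le> 4 * real j * lag K u"
      using Suc.prems pk[of k] pk[of K] k by (intro mult_mono) (auto simp: k_def u_def)
    moreover have "dlag (K - i) u = dlag k u + (u - 4 * real k - 2) * lag k u"
      by (simp add: k dlag_Suc)
    ultimately show ?case using Suc by (simp add: k_def algebra_simps)
  qed simp
  define X where "X = dlag K u - 4 * (real j)\<^sup>2 * lag K u"
  have "real i * X / real K \<le> lag K u - lag (K - i) u" if "i \<le> j" for i
    using that
  proof (induction i)
    case (Suc i)
    define k where "k = K - Suc i"
    have k: "K - i = Suc k" "Suc k \<le> K" using Suc assms by (auto simp: k_def)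
    have "4 * real i * real j * lag K u \<le> 4 * (real j)\<^sup>2 * lag K u"
      using Suc.prems pk[of K] by (intro mult_right_mono) (auto simp: power2_eq_square intro!: mult_right_mono)
    then have "X \<le> dlag (Suc k) u" using dd[of i] Suc.prems k by (simp add: X_def)
    then have "X / real K \<le> dlag (Suc k) u / real K" by (intro divide_right_mono) auto
    also have "\<dots> \<le> dlag (Suc k) u / real (Suc k)"
      using k pk[of "Suc k"] by (intro divide_left_mono) auto
    finally show ?case using Suc lag_Suc[of k u] k by (simp add: k_def algebra_simps add_divide_distrib)
  qed simp
  from this[of j] have "real j * X / real K \<le> lag K u" using pk[of "K - j"] by auto
  then have "X \<le> lag K u * (real K / real j)" using assms by (simp add: field_simps)
  then show ?thesis unfolding u_def[symmetric] X_def by (simp add: algebra_simps)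
qed

text \<open>A discrete Gronwall argument for |lag| + |dlag| / s^2, where s of order K^(1/3) makes
  the two summands comparable: one step multiplies this quantity by at most exp (8 C / s), and there
  are at most C s steps. The 13 is 1 + 12, where 12 comes from \<open>dlag_upper\<close> with j =
  s.\<close>

lemma lag_window:
  assumes "1 \<le> s" "s ^ 3 \<le> K" "K \<le> 8 * s ^ 3" "1 \<le> C" "N \<le> K + C * s"
  shows "\<bar>lag N (4 * real K + 2)\<bar> \<le> 13 * exp (8 * real C ^ 2) * lag K (4 * real K + 2)"
proof -
  define u where "u = 4 * real K + 2"
  have u: "4 * real K \<le> u + 2" by (simp add: u_def)
  have pk: "1 \<le> lag k u" "lag k u \<le> lag K u" if "k \<le> K" for k
    using lag_pos_mono[OF u] lag_pos_mono[of k u] u that by auto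
  have dK: "0 \<le> dlag K u" using lag_pos_mono[OF u] by auto
  have s0: "real s > 0" using assms by auto
  have K3: "real s ^ 3 \<le> real K" "real K \<le> 8 * real s ^ 3"
    using assms(2,3) by (metis of_nat_le_iff of_nat_power, metis of_nat_le_iff of_nat_power of_nat_mult of_nat_numeral)
  have sK: "s \<le> K"
  proof -
    have "s ^ 1 \<le> s ^ 3" using assms(1) by (intro power_increasing) auto
    then show ?thesis using assms by auto
  qed
  have "dlag K u \<le> lag K u * (real K / real s + 4 * (real s)\<^sup>2)"
    unfolding u_def by (rule dlag_upper) (use assms sK in auto)
  also have "\<dots> \<le> lag K u * (12 * (real s)\<^sup>2)"
    using K3 s0 pk[of K] by (intro mult_left_mono) (auto simp: field_simps power3_eq_cube power2_eq_square)
  finally have dK12: "dlag K u / (real s)\<^sup>2 \<le> 12 * lag K u" using s0 by (simp add: field_simps)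
  define E where "E i = \<bar>lag (K + i) u\<bar> + \<bar>dlag (K + i) u\<bar> / (real s)\<^sup>2" for i
  have E0: "E 0 \<le> 13 * lag K u" using pk[of K] dK dK12 by (simp add: E_def)
  have step: "E (Suc i) \<le> E i * exp (8 * real C / real s)" if "i < C * s" for i
  proof -
    define a d where "a = \<bar>lag (K + i) u\<bar>" and "d = \<bar>dlag (K + i) u\<bar>"
    define d' where "d' = \<bar>dlag (K + Suc i) u\<bar>"
    have ad: "0 \<le> a" "0 \<le> d" "0 \<le> d'" by (auto simp: a_def d_def d'_def)
    have "dlag (K + Suc i) u = dlag (K + i) u - 4 * real i * lag (K + i) u"
      by (simp add: dlag_Suc u_def)
    then have "d' \<le> d + \<bar>4 * real i * lag (K + i) u\<bar>" unfolding d'_def d_def by linarith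
    also have "\<bar>4 * real i * lag (K + i) u\<bar> \<le> 4 * (real C * real s) * a"
      unfolding abs_mult a_def using that
      by (intro mult_mono) (auto simp: of_nat_mult[symmetric] simp del: of_nat_mult)
    finally have d': "d' \<le> d + 4 * (real C * real s) * a" by simp
    have le: "real s ^ 3 \<le> real (K + Suc i)" using K3(1) by linarith
    have "\<bar>lag (K + Suc i) u\<bar> \<le> a + \<bar>dlag (K + Suc i) u / real (K + Suc i)\<bar>"
      using lag_Suc[of "K + i" u] unfolding a_def by (simp add: abs_triangle_ineq del: abs_divide)
    also have "\<bar>dlag (K + Suc i) u / real (K + Suc i)\<bar> = d' / real (K + Suc i)" by (simp add: d'_def)
    also have "d' / real (K + Suc i) \<le> d' / real s ^ 3"
      using le s0 ad by (intro divide_left_mono) (auto intro!: mult_pos_pos simp del: of_nat_power)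
    finally have l: "\<bar>lag (K + Suc i) u\<bar> \<le> a + d' / real s ^ 3" by simp
    have "E (Suc i) \<le> a + d' / real s ^ 3 + d' / (real s)\<^sup>2"
      using l by (simp add: E_def d'_def)
    also have "\<dots> \<le> a + (d + 4 * (real C * real s) * a) / real s ^ 3 + (d + 4 * (real C * real s) * a) / (real s)\<^sup>2"
      using d' s0 by (intro add_mono divide_right_mono) auto
    also have "\<dots> = a * (1 + 4 * real C * (1 / (real s)\<^sup>2 + 1 / real s)) + d / (real s)\<^sup>2 * (1 + 1 / real s)"
      using s0 by (simp add: field_simps power3_eq_cube power2_eq_square)
    also have "\<dots> \<le> a * (1 + 8 * real C / real s) + d / (real s)\<^sup>2 * (1 + 8 * real C / real s)"
    proof (rule add_mono[OF mult_left_mono mult_left_mono])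
      have "1 / (real s)\<^sup>2 \<le> 1 / real s" using assms(1) by (simp add: field_simps power2_eq_square)
      then have "4 * real C * (1 / (real s)\<^sup>2 + 1 / real s) \<le> 4 * real C * (2 / real s)"
        by (intro mult_left_mono) auto
      then show "1 + 4 * real C * (1 / (real s)\<^sup>2 + 1 / real s) \<le> 1 + 8 * real C / real s" by simp
      show "1 + 1 / real s \<le> 1 + 8 * real C / real s" using assms s0 by (simp add: field_simps)
    qed (use ad in auto)
    also have "\<dots> = E i * (1 + 8 * real C / real s)"
      by (simp add: E_def a_def d_def algebra_simps)
    also have "\<dots> \<le> E i * exp (8 * real C / real s)"
      using exp_ge_add_one_self[of "8 * real C / real s"] by (intro mult_left_mono) (auto simp: E_def)
    finally show ?thesis .
  qed
  have Ei: "E i \<le> 13 * lag K u * exp (8 * real C / real s * real i)" if "i \<le> C * s" for i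
    using that
  proof (induction i)
    case (Suc i)
    then have "E (Suc i) \<le> E i * exp (8 * real C / real s)" using step by auto
    also have "\<dots> \<le> 13 * lag K u * exp (8 * real C / real s * real i) * exp (8 * real C / real s)"
      using Suc by (intro mult_right_mono) auto
    also have "\<dots> = 13 * lag K u * exp (8 * real C / real s * real (Suc i))"
      by (simp add: exp_add[symmetric] algebra_simps add_divide_distrib)
    finally show ?case .
  qed (use E0 in simp)
  show ?thesis
  proof (cases "N \<le> K")
    case True
    have "\<bar>lag N u\<bar> \<le> 1 * lag K u" using pk[OF True] by simp
    also have "\<dots> \<le> 13 * exp (8 * real C ^ 2) * lag K u"
    proof (intro mult_right_mono)
      have "1 \<le> exp (8 * real C ^ 2)" by simp
      then show "1 \<le> 13 * exp (8 * real C ^ 2)" by linarith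
    qed (use pk[of K] in auto)
    finally show ?thesis by (simp add: u_def)
  next
    case False
    define i where "i = N - K"
    have i: "N = K + i" "i \<le> C * s" using False assms by (auto simp: i_def)
    have "\<bar>lag N u\<bar> \<le> E i" by (simp add: E_def i)
    also have "\<dots> \<le> 13 * lag K u * exp (8 * real C / real s * real i)" using Ei i by auto
    also have "\<dots> \<le> 13 * lag K u * exp (8 * real C ^ 2)"
    proof -
      have "real i \<le> real C * real s" using i(2) by (metis of_nat_le_iff of_nat_mult)
      then have "8 * real C / real s * real i \<le> 8 * real C / real s * (real C * real s)"
        by (intro mult_left_mono) auto
      also have "\<dots> = 8 * real C ^ 2" using s0 by (simp add: power2_eq_square)
      finally show ?thesis using pk[of K] by (intro mult_left_mono) auto
    qed
    finally show ?thesis by (simp add: u_def mult.commute mult.left_commute)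
  qed
qed

section \<open>A lower bound at the turning point\<close>

text \<open>In contrast to \<open>lag\<close>, the generating function of \<open>lagb\<close> has no pole, so that its Fourier
  integral has an integrand of modulus 1.\<close>
definition lagb :: "nat \<Rightarrow> real \<Rightarrow> real" where
  "lagb N u = (if N = 0 then 1 else lag N u + lag (N - 1) u)"

lemma lagb_rec: "real (Suc N) * lagb (Suc N) u + real N * lagb N u = u * lag N u"
  using lag_rec[of N u] by (cases N) (simp_all add: lagb_def algebra_simps)

section \<open>Generating function of \<open>lagb\<close> and its boundary values\<close>

lemma sums_shift:
  fixes c :: "nat \<Rightarrow> complex"
  assumes "(\<lambda>N. c N * t ^ N) sums S"
  shows "(\<lambda>N. (if N = 0 then 0 else c (N - 1)) * t ^ N) sums (t * S)"
proof -
  have "(\<lambda>N. t * (c N * t ^ N)) sums (t * S)" using assms by (rule sums_mult)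
  then have "(\<lambda>N. (\<lambda>N. (if N = 0 then 0 else c (N - 1)) * t ^ N) (Suc N)) sums (t * S - (\<lambda>N. (if N = 0 then 0 else c (N - 1)) * t ^ N) 0)"
    by (simp add: algebra_simps)
  then show ?thesis by (subst (asm) sums_Suc_iff) simp
qed

text \<open>\<open>lagb_rec\<close> becomes the differential equation (1 + x)^2 g' = u g for the
  power series g. Hence g divided by exp (u x / (1 + x)) has derivative zero on the unit disc, and
  it equals 1 at the origin. The bound on \<open>lag\<close> supplies the radius of
  convergence.\<close>

lemma lagb_sums:
  fixes t :: complex
  assumes B: "\<And>N. \<bar>lag N u\<bar> \<le> B" and t: "cmod t < 1"
  shows "(\<lambda>N. complex_of_real (lagb N u) * t ^ N) sums exp (complex_of_real u * (t / (1 + t)))"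
proof -
  define c where "c N = complex_of_real (lagb N u)" for N
  define d where "d = diffs c"
  define g where "g x = (\<Sum>N. c N * x ^ N)" for x
  have B0: "1 \<le> B" using B[of 0] by simp
  have cB: "cmod (c N) \<le> 2 * B" for N
    using B[of N] B[of "N - 1"] B0 by (auto simp: c_def lagb_def)
  have sm: "summable (\<lambda>N. c N * x ^ N)" if "cmod x < 1" for x
  proof (rule summable_comparison_test')
    show "summable (\<lambda>N. 2 * B * cmod x ^ N)" using that by (intro summable_mult summable_geometric) auto
    show "cmod (c N * x ^ N) \<le> 2 * B * cmod x ^ N" for N
      unfolding norm_mult norm_power using cB by (intro mult_right_mono) auto
  qed
  have sg: "(\<lambda>N. c N * x ^ N) sums g x" if "cmod x < 1" for x
    using sm[OF that] by (simp add: g_def summable_sums)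
  have dg: "(g has_field_derivative (\<Sum>N. d N * x ^ N)) (at x) \<and> summable (\<lambda>N. d N * x ^ N)" if x: "cmod x < 1" for x
  proof -
    obtain k where k: "cmod x < k" "k < 1" using dense[OF x] by auto
    have k0: "k > 0" using k norm_ge_zero[of x] by linarith
    have "summable (\<lambda>N. c N * complex_of_real k ^ N)" using k k0 by (intro sm) auto
    from termdiffs_strong[OF this, of x] termdiff_converges[of x k c] k k0 sm
    show ?thesis by (auto simp: g_def[abs_def] d_def)
  qed
  have ode: "(1 + x)\<^sup>2 * (\<Sum>N. d N * x ^ N) = of_real u * g x" if x: "cmod x < 1" for x
  proof -
    let ?S = "\<Sum>N. d N * x ^ N"
    have s0: "(\<lambda>N. d N * x ^ N) sums ?S" using dg[OF x] by (simp add: summable_sums)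
    let ?d1 = "\<lambda>N. if N = 0 then 0 else d (N - 1)"
    let ?d2 = "\<lambda>N. if N = 0 then 0 else ?d1 (N - 1)"
    have s1: "(\<lambda>N. ?d1 N * x ^ N) sums (x * ?S)" by (rule sums_shift[OF s0])
    have s2: "(\<lambda>N. ?d2 N * x ^ N) sums (x * (x * ?S))" by (rule sums_shift[OF s1])
    have "(\<lambda>N. d N * x ^ N + 2 * (?d1 N * x ^ N) + ?d2 N * x ^ N) sums (?S + 2 * (x * ?S) + x * (x * ?S))"
      by (intro sums_add sums_mult s0 s1 s2)
    moreover have "d N * x ^ N + 2 * (?d1 N * x ^ N) + ?d2 N * x ^ N = of_real u * (c N * x ^ N)" for N
    proof -
      have "d N + 2 * ?d1 N + ?d2 N = of_real u * c N"
      proof (cases N)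
        case 0
        then show ?thesis using lagb_rec[of 0 u] by (simp add: d_def diffs_def c_def lagb_def)
      next
        case (Suc n)
        \<comment> \<open>\<open>lagb_rec\<close> is added at n + 1 and at n; the right-hand sides u
          lag (n + 1) and u lag n combine to u times \<open>lagb\<close> at n + 1.\<close>
        have "real (Suc (Suc n)) * lagb (Suc (Suc n)) u + 2 * (real (Suc n) * lagb (Suc n) u) + real n * lagb n u = u * lagb (Suc n) u"
          using lagb_rec[of "Suc n" u] lagb_rec[of n u] by (simp add: lagb_def algebra_simps split: if_splits)
        from this[THEN arg_cong, of complex_of_real]
        show ?thesis using Suc by (cases n) (simp_all add: d_def diffs_def c_def)
      qed
      then show ?thesis by (metis (no_types, lifting) distrib_right mult.assoc)
    qed
    ultimately have "(\<lambda>N. of_real u * (c N * x ^ N)) sums (?S + 2 * (x * ?S) + x * (x * ?S))" by simp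
    moreover have "(\<lambda>N. of_real u * (c N * x ^ N)) sums (of_real u * g x)"
      by (intro sums_mult sg x)
    ultimately have "?S + 2 * (x * ?S) + x * (x * ?S) = of_real u * g x" by (rule sums_unique2)
    then show ?thesis by (simp add: power2_eq_square algebra_simps)
  qed
  define F where "F x = g x * exp (- (complex_of_real u * (x / (1 + x))))" for x
  have "\<exists>k. \<forall>x\<in>ball 0 1. F x = k"
  proof (rule has_field_derivative_zero_constant)
    fix x :: complex assume "x \<in> ball 0 1"
    then have x: "cmod x < 1" by (simp add: dist_norm)
    then have nz: "1 + x \<noteq> 0" by (auto simp: add_eq_0_iff)
    have e: "((\<lambda>x. exp (- (complex_of_real u * (x / (1 + x))))) has_field_derivative
       (- (of_real u / (1 + x)\<^sup>2)) * exp (- (complex_of_real u * (x / (1 + x))))) (at x)"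
      using nz by (auto intro!: derivative_eq_intros simp: power2_eq_square divide_simps) (simp add: algebra_simps)
    have "(F has_field_derivative ((\<Sum>N. d N * x ^ N) * exp (- (complex_of_real u * (x / (1 + x)))) +
       (- (of_real u / (1 + x)\<^sup>2)) * exp (- (complex_of_real u * (x / (1 + x)))) * g x)) (at x)"
      unfolding F_def[abs_def] using DERIV_mult[OF dg[OF x, THEN conjunct1] e] by simp
    moreover have "(\<Sum>N. d N * x ^ N) = of_real u / (1 + x)\<^sup>2 * g x" using ode[OF x] nz by (simp add: field_simps)
    ultimately show "(F has_field_derivative 0) (at x within ball 0 1)"
      by (auto intro: has_field_derivative_at_within)
  qed auto
  then obtain k where k: "\<And>x. cmod x < 1 \<Longrightarrow> F x = k" by (auto simp: dist_norm)
  have "g 0 = 1" using powser_sums_zero_iff[of c] sg[of 0] by (simp add: g_def powser_zero c_def lagb_def)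
  then have "k = 1" using k[of 0] by (simp add: F_def)
  then have "F t = 1" using k t by auto
  then have "g t = exp (of_real u * (t / (1 + t)))"
    by (simp add: F_def exp_minus field_simps)
  then show ?thesis using sg[OF t] by (simp add: c_def)
qed

lemma has_integral_cis_int:
  "((\<lambda>\<theta>. cis (of_int j * \<theta>)) has_integral (if j = 0 then 2 * of_real pi else 0)) {-pi..pi}"
proof (cases "j = 0")
  case True
  then show ?thesis using has_integral_const_real[of "1::complex" "-pi" pi] by (simp add: scaleR_conv_of_real)
next
  case False
  define F where "F \<theta> = cis (of_int j * \<theta>) / (\<i> * of_int j)" for \<theta>
  have "((\<lambda>\<theta>. cis (of_int j * \<theta>)) has_integral (F pi - F (-pi))) {-pi..pi}"
  proof (rule fundamental_theorem_of_calculus)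
    fix x assume "x \<in> {-pi..pi}"
    have "((\<lambda>\<theta>. exp (\<i> * of_int j * \<theta>)) has_field_derivative (\<i> * of_int j * exp (\<i> * of_int j * z))) (at z)" for z
      by (auto intro!: derivative_eq_intros)
    then have "((\<lambda>\<theta>. exp (\<i> * of_int j * of_real \<theta>)) has_vector_derivative (\<i> * of_int j * exp (\<i> * of_int j * of_real x))) (at x)"
      by (rule has_vector_derivative_real_field)
    then have "((\<lambda>\<theta>. exp (\<i> * of_int j * of_real \<theta>) / (\<i> * of_int j)) has_vector_derivative (\<i> * of_int j * exp (\<i> * of_int j * of_real x)) / (\<i> * of_int j)) (at x)"
      by (rule has_vector_derivative_divide)
    moreover have "exp (\<i> * of_int j * of_real \<theta>) = cis (of_int j * \<theta>)" for \<theta>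
      by (simp add: cis_conv_exp mult_ac)
    ultimately show "(F has_vector_derivative cis (of_int j * x)) (at x within {-pi..pi})"
      using False by (auto simp: F_def[abs_def] intro: has_vector_derivative_at_within)
  qed simp
  moreover have "cis (of_int j * pi) = cis (of_int j * (-pi))"
    by (simp add: complex_eq_iff sin_npi_int mult.commute[of _ pi])
  ultimately show ?thesis using False by (simp add: F_def)
qed

text \<open>Supplies the dominating constant exp (u / 2) when the circle of integration is pushed
  out to the unit circle; the Moebius map sends the unit disc to a half plane.\<close>

lemma Re_moebius_le:
  assumes "cmod t < 1" shows "Re (t / (1 + t)) \<le> 1 / 2"
proof -
  have nz: "1 + t \<noteq> 0" using assms by (auto simp: add_eq_0_iff)
  have n: "(Re t)\<^sup>2 + (Im t)\<^sup>2 < 1" using power_strict_mono[OF assms, of 2] by (simp add: cmod_power2)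
  have p: "(1 + Re t)\<^sup>2 + (Im t)\<^sup>2 > 0" using nz complex_neq_0[of "1 + t"] by simp
  have "Re (t / (1 + t)) = (Re t * (1 + Re t) + Im t * Im t) / ((1 + Re t)\<^sup>2 + (Im t)\<^sup>2)"
    by (simp add: Re_divide)
  also have "\<dots> \<le> 1 / 2" using p n by (simp add: divide_simps power2_eq_square algebra_simps)
  finally show ?thesis .
qed

text \<open>Cauchy's coefficient formula on the circle of radius r < 1, followed by r -> 1. On the
  unit circle t / (1 + t) is 1/2 + (i/2) tan (theta / 2), so the integrand has the constant modulus
  exp (u / 2), which is moved to the right-hand side. The essential singularity t = -1 is met only
  at the end points of the interval.\<close>

lemma lagb_integral:
  assumes B: "\<And>N. \<bar>lag N u\<bar> \<le> B" and u: "0 < u"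
  shows "((\<lambda>\<theta>. cis (u / 2 * tan (\<theta> / 2) - real N * \<theta>)) has_integral
     complex_of_real (2 * pi * exp (- u / 2) * lagb N u)) {-pi..pi}"
proof -
  define G where "G t = exp (complex_of_real u * (t / (1 + t)))" for t
  have B0: "1 \<le> B" using B[of 0] by simp
  have cB: "\<bar>lagb i u\<bar> \<le> 2 * B" for i
    using B[of i] B[of "i - 1"] B0 by (auto simp: lagb_def)
  have coef: "((\<lambda>\<theta>. G (of_real r * cis \<theta>) * cis (- real N * \<theta>)) has_integral
      complex_of_real (2 * pi * lagb N u * r ^ N)) {-pi..pi}" if r: "0 < r" "r < 1" for r
  proof -
    define f where "f k \<theta> = (\<Sum>i<k. complex_of_real (lagb i u) * (of_real r * cis \<theta>) ^ i) * cis (- real N * \<theta>)" for k \<theta>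
    have fi: "(f k has_integral (\<Sum>i<k. complex_of_real (lagb i u * r ^ i) * (if i = N then 2 * of_real pi else 0))) {-pi..pi}" for k
    proof -
      have "((\<lambda>\<theta>. \<Sum>i<k. complex_of_real (lagb i u * r ^ i) * cis (of_int (int i - int N) * \<theta>)) has_integral
         (\<Sum>i<k. complex_of_real (lagb i u * r ^ i) * (if int i - int N = 0 then 2 * of_real pi else 0))) {-pi..pi}"
        by (intro has_integral_sum has_integral_mult_right has_integral_cis_int) auto
      moreover have "(\<Sum>i<k. complex_of_real (lagb i u * r ^ i) * cis (of_int (int i - int N) * \<theta>)) = f k \<theta>" for \<theta>
        unfolding f_def sum_distrib_right
      proof (intro sum.cong refl)
        fix i
        have "cis (of_int (int i - int N) * \<theta>) = cis \<theta> ^ i * cis (- real N * \<theta>)"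
          unfolding Complex.DeMoivre by (simp add: cis_mult left_diff_distrib)
        then show "complex_of_real (lagb i u * r ^ i) * cis (of_int (int i - int N) * \<theta>) =
            complex_of_real (lagb i u) * (of_real r * cis \<theta>) ^ i * cis (- real N * \<theta>)"
          by (simp add: power_mult_distrib)
      qed
      ultimately show ?thesis by simp
    qed
    have nr: "cmod (of_real r * cis \<theta>) = r" for \<theta> using r by (simp add: norm_mult)
    have bd: "cmod (f k \<theta>) \<le> 2 * B / (1 - r)" for k \<theta>
    proof -
      have "cmod (f k \<theta>) \<le> (\<Sum>i<k. cmod (complex_of_real (lagb i u) * (of_real r * cis \<theta>) ^ i))"
        using norm_sum[of "\<lambda>i. complex_of_real (lagb i u) * (of_real r * cis \<theta>) ^ i" "{..<k}"]
        by (simp add: f_def norm_mult[of _ "cis _"])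
      also have "\<dots> \<le> (\<Sum>i<k. 2 * B * r ^ i)"
        by (intro sum_mono) (simp add: norm_mult norm_power r cB mult_right_mono less_imp_le)
      also have "\<dots> \<le> (\<Sum>i. 2 * B * r ^ i)"
        using r B0 by (intro sum_le_suminf summable_mult summable_geometric) auto
      also have "\<dots> = 2 * B / (1 - r)"
        using r by (subst suminf_mult) (auto simp: suminf_geometric)
      finally show ?thesis .
    qed
    have lim: "(\<lambda>k. f k \<theta>) \<longlonglongrightarrow> G (of_real r * cis \<theta>) * cis (- real N * \<theta>)" for \<theta>
    proof -
      have "(\<lambda>i. complex_of_real (lagb i u) * (of_real r * cis \<theta>) ^ i) sums G (of_real r * cis \<theta>)"
        unfolding G_def by (rule lagb_sums[OF B]) (simp add: nr r)
      then show ?thesis unfolding f_def sums_def by (intro tendsto_mult_right)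
    qed
    have ig: "(\<lambda>\<theta>. G (of_real r * cis \<theta>) * cis (- real N * \<theta>)) integrable_on {-pi..pi}"
      and il: "(\<lambda>k. integral {-pi..pi} (f k)) \<longlonglongrightarrow> integral {-pi..pi} (\<lambda>\<theta>. G (of_real r * cis \<theta>) * cis (- real N * \<theta>))"
      using dominated_convergence[of f "{-pi..pi}" "\<lambda>_. 2 * B / (1 - r)" "\<lambda>\<theta>. G (of_real r * cis \<theta>) * cis (- real N * \<theta>)"]
        fi bd lim by (auto simp: has_integral_integrable integrable_const_ivl)
    have "integral {-pi..pi} (f k) = complex_of_real (2 * pi * lagb N u * r ^ N)" if "k > N" for k
      using integral_unique[OF fi[of k]] that by (simp add: if_distrib cong: if_cong)
    then have "(\<lambda>k. integral {-pi..pi} (f k)) \<longlonglongrightarrow> complex_of_real (2 * pi * lagb N u * r ^ N)"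
      by (intro tendsto_eventually) (auto simp: eventually_at_top_dense)
    with il have "integral {-pi..pi} (\<lambda>\<theta>. G (of_real r * cis \<theta>) * cis (- real N * \<theta>)) = complex_of_real (2 * pi * lagb N u * r ^ N)"
      by (rule LIMSEQ_unique)
    with ig show ?thesis by (simp add: has_integral_iff)
  qed
  define r where "r k = 1 - 1 / (real k + 2)" for k
  have r: "0 < r k" "r k < 1" for k by (auto simp: r_def field_simps)
  have rl: "r \<longlonglongrightarrow> 1" unfolding r_def by real_asymp
  \<comment> \<open>The value 0 at the end points is the radial limit there: t tends to -1 along the
    real axis and u t / (1 + t) to minus infinity.\<close>
  define L where "L \<theta> = (if \<bar>\<theta>\<bar> < pi then of_real (exp (u / 2)) * cis (u / 2 * tan (\<theta> / 2) - real N * \<theta>) else 0 :: complex)" for \<theta>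
  define f where "f k \<theta> = G (of_real (r k) * cis \<theta>) * cis (- real N * \<theta>)" for k \<theta>
  have fi: "(f k has_integral complex_of_real (2 * pi * lagb N u * r k ^ N)) {-pi..pi}" for k
    unfolding f_def using coef r by blast
  have bd: "cmod (f k \<theta>) \<le> exp (u / 2)" for k \<theta>
  proof -
    have "cmod (of_real (r k) * cis \<theta>) < 1" using r[of k] by (simp add: norm_mult)
    from Re_moebius_le[OF this] have "u * Re (of_real (r k) * cis \<theta> / (1 + of_real (r k) * cis \<theta>)) \<le> u * (1 / 2)"
      using u by (intro mult_left_mono) auto
    then show ?thesis by (simp add: f_def G_def norm_mult del: times_divide_eq_right)
  qed
  have lim: "(\<lambda>k. f k \<theta>) \<longlonglongrightarrow> L \<theta>" if "\<theta> \<in> {-pi..pi}" for \<theta>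
  proof (cases "\<bar>\<theta>\<bar> < pi")
    case True
    define y where "y = \<theta> / 2"
    have c: "cos y > 0" using True by (intro cos_gt_zero_pi) (auto simp: y_def)
    have d: "cis \<theta> = cis y * cis y" by (simp add: y_def cis_mult)
    have e: "1 + cis \<theta> = of_real (2 * cos y) * cis y"
      unfolding d by (simp add: complex_eq_iff) (use sin_cos_squared_add3[of y] in linarith)
    have nz: "1 + cis \<theta> \<noteq> 0" using c by (simp add: e)
    have q: "cis \<theta> / (1 + cis \<theta>) = cis y / of_real (2 * cos y)"
      unfolding e unfolding d using c by (simp add: divide_simps)
    have q2: "cis y / of_real (2 * cos y) = of_real (1 / 2) + \<i> * of_real (tan y / 2)"
      using c by (simp add: complex_eq_iff tan_def)
    have "(\<lambda>k. f k \<theta>) \<longlonglongrightarrow> exp (of_real u * (of_real 1 * cis \<theta> / (1 + of_real 1 * cis \<theta>))) * cis (- real N * \<theta>)"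
      unfolding f_def G_def by (intro tendsto_intros rl) (use nz in auto)
    also have "exp (of_real u * (of_real 1 * cis \<theta> / (1 + of_real 1 * cis \<theta>))) = of_real (exp (u / 2)) * cis (u / 2 * tan y)"
    proof -
      have "of_real u * (of_real 1 * cis \<theta> / (1 + of_real 1 * cis \<theta>)) = of_real (u / 2) + \<i> * of_real (u / 2 * tan y)"
        using q q2 by (simp add: algebra_simps)
      then show ?thesis by (simp only: exp_add exp_of_real cis_conv_exp)
    qed
    also have "of_real (exp (u / 2)) * cis (u / 2 * tan y) * cis (- real N * \<theta>) = L \<theta>"
      using True by (simp add: L_def cis_mult y_def mult.assoc)
    finally show ?thesis .
  next
    case False
    then have "\<theta> = pi \<or> \<theta> = - pi" using that by auto
    then have c: "cis \<theta> = -1" by (auto simp: complex_eq_iff)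
    have "f k \<theta> = of_real (exp (- (u * (real k + 1)))) * cis (- real N * \<theta>)" for k
    proof -
      have "of_real (r k) * cis \<theta> / (1 + of_real (r k) * cis \<theta>) = complex_of_real (- r k / (1 - r k))"
        by (simp add: c)
      also have "- r k / (1 - r k) = - (real k + 1)" by (simp add: r_def field_simps)
      finally have e: "of_real (r k) * cis \<theta> / (1 + of_real (r k) * cis \<theta>) = complex_of_real (- (real k + 1))" .
      show ?thesis unfolding f_def G_def e by (simp only: of_real_mult[symmetric] exp_of_real mult_minus_right)
    qed
    moreover have "(\<lambda>k. exp (- (u * (real k + 1)))) \<longlonglongrightarrow> 0" using u by real_asymp
    then have "(\<lambda>k. of_real (exp (- (u * (real k + 1)))) * cis (- real N * \<theta>)) \<longlonglongrightarrow> of_real 0 * cis (- real N * \<theta>)"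
      by (intro tendsto_intros)
    ultimately show ?thesis using False by (simp add: L_def)
  qed
  have ig: "L integrable_on {-pi..pi}" and il: "(\<lambda>k. integral {-pi..pi} (f k)) \<longlonglongrightarrow> integral {-pi..pi} L"
    using dominated_convergence[of f "{-pi..pi}" "\<lambda>_. exp (u / 2)" L] fi bd lim
    by (auto simp: has_integral_integrable integrable_const_ivl)
  have "(\<lambda>k. complex_of_real (2 * pi * lagb N u * r k ^ N)) \<longlonglongrightarrow> complex_of_real (2 * pi * lagb N u * 1 ^ N)"
    by (intro tendsto_intros rl)
  from LIMSEQ_unique[OF il[unfolded integral_unique[OF fi]] this]
  have "integral {-pi..pi} L = complex_of_real (2 * pi * lagb N u)" by simp
  with ig have "(L has_integral complex_of_real (2 * pi * lagb N u)) {-pi..pi}" by (simp add: has_integral_iff)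
  then have "((\<lambda>\<theta>. of_real (exp (- u / 2)) * L \<theta>) has_integral of_real (exp (- u / 2)) * complex_of_real (2 * pi * lagb N u)) {-pi..pi}"
    by (rule has_integral_mult_right)
  then have "((\<lambda>\<theta>. cis (u / 2 * tan (\<theta> / 2) - real N * \<theta>)) has_integral of_real (exp (- u / 2)) * complex_of_real (2 * pi * lagb N u)) {-pi..pi}"
    by (rule has_integral_spike_finite[of "{-pi, pi}", rotated 2])
       (auto simp: L_def of_real_mult[symmetric] exp_add[symmetric] mult.assoc[symmetric] simp del: of_real_mult)
  then show ?thesis by (simp add: mult_ac)
qed

section \<open>Dirichlet kernels and the phase of the Fourier integral\<close>

definition dirichlet_kernel :: "nat \<Rightarrow> real \<Rightarrow> complex" where
  "dirichlet_kernel M \<theta> = (\<Sum>j<M. cis (real j * \<theta>))"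

lemma dirichlet_kernel_norm2: "of_real ((cmod (dirichlet_kernel M \<theta>))\<^sup>2) = (\<Sum>(a, b)\<in>{..<M} \<times> {..<M}. cis ((real a - real b) * \<theta>))"
proof -
  have "of_real ((cmod (dirichlet_kernel M \<theta>))\<^sup>2) = dirichlet_kernel M \<theta> * cnj (dirichlet_kernel M \<theta>)" by (rule complex_norm_square)
  also have "\<dots> = (\<Sum>(a, b)\<in>{..<M} \<times> {..<M}. cis (real a * \<theta>) * cis (- (real b * \<theta>)))"
    unfolding dirichlet_kernel_def cnj_sum sum_product sum.cartesian_product by (simp add: cis_cnj)
  finally show ?thesis by (simp add: cis_mult algebra_simps)
qed

lemma dirichlet_kernel_norm2_integral: "((\<lambda>\<theta>. (cmod (dirichlet_kernel M \<theta>))\<^sup>2) has_integral 2 * pi * real M) {-pi..pi}"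
proof -
  have "((\<lambda>\<theta>. \<Sum>(a, b)\<in>{..<M} \<times> {..<M}. cis (of_int (int a - int b) * \<theta>)) has_integral
     (\<Sum>(a, b)\<in>{..<M} \<times> {..<M}. if int a - int b = 0 then 2 * of_real pi else 0)) {-pi..pi}"
    unfolding split_def by (intro has_integral_sum has_integral_cis_int) auto
  moreover have "(\<Sum>(a, b)\<in>{..<M} \<times> {..<M}. if int a - int b = 0 then 2 * of_real pi else 0) = complex_of_real (2 * pi * real M)"
    by (simp add: sum.cartesian_product[symmetric] mult_ac)
  ultimately have "((\<lambda>\<theta>. complex_of_real ((cmod (dirichlet_kernel M \<theta>))\<^sup>2)) has_integral complex_of_real (2 * pi * real M)) {-pi..pi}"
    by (simp only: dirichlet_kernel_norm2) simp
  from has_integral_linear[OF this bounded_linear_Re] show ?thesis by (simp add: o_def)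
qed

text \<open>Away from theta = 0 this bounds the kernel uniformly in M, the regime opposite to
  \<open>dirichlet_kernel_lower\<close>.\<close>

lemma dirichlet_kernel_bound: "(cmod (dirichlet_kernel M \<theta>))\<^sup>2 * (1 - cos \<theta>) \<le> 2"
proof -
  have "(1 - cis \<theta>) * dirichlet_kernel M \<theta> = 1 - cis (real M * \<theta>)"
    unfolding dirichlet_kernel_def
  proof (induction M)
    case (Suc M)
    have "cis \<theta> * cis (real M * \<theta>) = cis (real (Suc M) * \<theta>)" by (simp add: cis_mult algebra_simps)
    with Suc show ?case unfolding sum.lessThan_Suc distrib_left by (simp add: left_diff_distrib)
  qed simp
  then have "cmod ((1 - cis \<theta>) * dirichlet_kernel M \<theta>) \<le> 2"
    using norm_triangle_ineq4[of 1 "cis (real M * \<theta>)"] by simp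
  then have "(cmod (1 - cis \<theta>) * cmod (dirichlet_kernel M \<theta>))\<^sup>2 \<le> 2\<^sup>2"
    unfolding norm_mult by (intro power_mono) auto
  moreover have "(cmod (1 - cis \<theta>))\<^sup>2 = 2 * (1 - cos \<theta>)"
    by (simp add: cmod_power2 power2_diff sin_squared_eq)
  ultimately have "2 * (1 - cos \<theta>) * (cmod (dirichlet_kernel M \<theta>))\<^sup>2 \<le> 4" by (simp add: power_mult_distrib)
  then show ?thesis by (simp add: algebra_simps)
qed

text \<open>All M unit vectors have an argument of modulus at most 1 < pi / 3, so each contributes
  at least 1/2 to the real part.\<close>

lemma dirichlet_kernel_lower:
  assumes "\<bar>real M * \<theta>\<bar> \<le> 1" shows "real M / 2 \<le> cmod (dirichlet_kernel M \<theta>)"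
proof -
  have "1 / 2 \<le> cos (real j * \<theta>)" if "j < M" for j
  proof -
    have "\<bar>real j * \<theta>\<bar> \<le> \<bar>real M * \<theta>\<bar>" unfolding abs_mult using that by (intro mult_right_mono) auto
    then have "\<bar>real j * \<theta>\<bar> \<le> pi / 3" using assms pi_gt3 by linarith
    then have "cos (pi / 3) \<le> cos \<bar>real j * \<theta>\<bar>" using pi_gt3 by (intro cos_monotone_0_pi_le) auto
    then show ?thesis by (simp add: cos_60)
  qed
  then have "(\<Sum>j<M. 1 / 2) \<le> (\<Sum>j<M. cos (real j * \<theta>))" by (intro sum_mono) auto
  also have "\<dots> = Re (dirichlet_kernel M \<theta>)" by (simp add: dirichlet_kernel_def)
  also have "\<dots> \<le> cmod (dirichlet_kernel M \<theta>)" by (rule complex_Re_le_cmod)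
  finally show ?thesis by simp
qed


text \<open>With y = theta / 2 the phase at the turning point is (2 K + 1) tan y - 2 K y. The linear
  terms nearly cancel, and the cubic remainder keeps the phase bounded for theta of order
  K^(-1/3).\<close>

lemma tan_upper:
  fixes y :: real
  assumes "0 \<le> y" "y \<le> 1 / 4"
  shows "y \<le> tan y" "tan y \<le> y + y ^ 3"
proof -
  have pos: "cos x > 0" if "0 \<le> x" "x \<le> y" for x
    using that assms pi_gt3 by (intro cos_gt_zero_pi) auto
  have "tan 0 - 0 \<le> tan y - y"
  proof (rule DERIV_nonneg_imp_nondecreasing[OF assms(1)])
    fix x assume x: "0 \<le> x" "x \<le> y"
    have "((\<lambda>x. tan x - x) has_real_derivative inverse ((cos x)\<^sup>2) - 1) (at x)"
      using pos[OF x] by (auto intro!: derivative_eq_intros)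
    moreover have "(cos x)\<^sup>2 \<le> 1" by (simp add: abs_square_le_1)
    then have "1 \<le> inverse ((cos x)\<^sup>2)" using pos[OF x] by (intro one_le_inverse) auto
    ultimately show "\<exists>d. ((\<lambda>x. tan x - x) has_real_derivative d) (at x) \<and> 0 \<le> d" by force
  qed
  then show "y \<le> tan y" by simp
  have "(sin (y / 2))\<^sup>2 \<le> (y / 2)\<^sup>2"
    using assms sin_x_le_x[of "y / 2"] sin_ge_zero[of "y / 2"] pi_gt3 by (intro power_mono) auto
  then have c: "1 - y\<^sup>2 / 2 \<le> cos y"
    using cos_double_sin[of "y / 2"] by (simp add: power_divide)
  have y2: "y\<^sup>2 \<le> 1 / 16" using power_mono[of y "1/4" 2] assms by (simp add: power_divide)
  have "0 \<le> (y ^ 3 / 2) * (1 - y\<^sup>2)" using assms y2 by (intro mult_nonneg_nonneg) auto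
  then have "y \<le> (y + y ^ 3) * (1 - y\<^sup>2 / 2)" by (simp add: algebra_simps power2_eq_square power3_eq_cube)
  also have "\<dots> \<le> (y + y ^ 3) * cos y" using c assms by (intro mult_left_mono) auto
  finally have "sin y \<le> (y + y ^ 3) * cos y" using sin_x_le_x[of y] assms by linarith
  then show "tan y \<le> y + y ^ 3" using pos[of y] assms by (simp add: tan_def field_simps)
qed

lemma sum_cartesian_mult:
  fixes c :: "'c :: comm_semiring_0"
  shows "(\<Sum>(x, y)\<in>A \<times> B. c * (f x * g y)) = c * ((\<Sum>x\<in>A. f x) * (\<Sum>y\<in>B. g y))"
  by (subst sum_product) (simp only: sum.cartesian_product[symmetric] sum_distrib_left)

text \<open>The phase of the Fourier integral is cubic at \<open>\<theta> = 0\<close>. Averaging over a window of about \<open>s\<close>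
  indices against the fourth power of a Dirichlet kernel localises the integral to \<open>\<bar>\<theta>\<bar> \<le> 1 / (2 * s)\<close>,
  where the phase is bounded; \<open>lag_window\<close> compares the average with its central term.\<close>
lemma lag_turning_lower_scale:
  assumes bound: "\<And>N u. 0 \<le> u \<Longrightarrow> \<bar>lag N u\<bar> \<le> exp (u / 2)"
    and s: "1 \<le> s" "s ^ 3 \<le> K" "K \<le> 8 * s ^ 3" "200 * s \<le> K"
  shows "exp (2 * real K + 1) / (450000 * exp 320000 * real s) \<le> lag K (4 * real K + 2)"
proof -
  define u where "u = 4 * real K + 2"
  \<comment> \<open>The central peak contributes M^3 / 16 to the integral, while the term subtracted
    for the outer region costs at most 256 s^2 M; so M has to exceed 64 s.\<close>
  define M where "M = 100 * s"
  \<comment> \<open>Chosen so that the cubic part of the phase is at most 1/4 for |theta| <= th: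
    with K <= 8 s^3 one has 2 K (th / 2)^3 <= 1/4.\<close>
  define th where "th = 1 / (2 * real s)"
  define ph where "ph \<theta> = u / 2 * tan (\<theta> / 2) - real K * \<theta>" for \<theta>
  define g where "g \<theta> = cos (ph \<theta>) * ((cmod (dirichlet_kernel M \<theta>))\<^sup>2)\<^sup>2" for \<theta>
  define I where "I = {..<M} \<times> {..<M}"
  have u0: "u > 0" by (simp add: u_def)
  have s0: "real s > 0" using s by simp
  have K3: "real K \<le> 8 * real s ^ 3"
    using s(3) by (metis of_nat_le_iff of_nat_power of_nat_mult of_nat_numeral)
  \<comment> \<open>Keeps the natural-number subtraction in K + a + d - b - c from being cut off at
    0 for a, b, c, d < M.\<close>
  have MK: "2 * M \<le> K" using s by (simp add: M_def)
  have th: "0 < th" "th \<le> 1 / 2" using s by (auto simp: th_def field_simps)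
  have c1: "cos (1::real) \<ge> 1 / 2"
    using cos_monotone_0_pi_le[of 1 "pi / 3"] pi_gt3 by (simp add: cos_60)

  \<comment> \<open>Multiplying out the fourth power of the kernel shifts the Fourier index by a + d
    - b - c, so the integral of g is a sum of \<open>lagb\<close> over indices closer to K than 2
    M.\<close>
  have gi: "(g has_integral (\<Sum>(x, y)\<in>I \<times> I. 2 * pi * exp (- u / 2) * lagb (K + fst x + snd y - snd x - fst y) u)) {-pi..pi}"
  proof -
    have "((\<lambda>\<theta>. \<Sum>(x, y)\<in>I \<times> I. cis (u / 2 * tan (\<theta> / 2) - real (K + fst x + snd y - snd x - fst y) * \<theta>)) has_integral
      (\<Sum>(x, y)\<in>I \<times> I. complex_of_real (2 * pi * exp (- u / 2) * lagb (K + fst x + snd y - snd x - fst y) u))) {-pi..pi}"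
      unfolding split_def using u0 bound[of u]
      by (intro has_integral_sum lagb_integral[where B = "exp (u / 2)"]) (auto simp: I_def)
    from has_integral_linear[OF this bounded_linear_Re]
    have "((\<lambda>\<theta>. Re (\<Sum>(x, y)\<in>I \<times> I. cis (u / 2 * tan (\<theta> / 2) - real (K + fst x + snd y - snd x - fst y) * \<theta>))) has_integral
      (\<Sum>(x, y)\<in>I \<times> I. 2 * pi * exp (- u / 2) * lagb (K + fst x + snd y - snd x - fst y) u)) {-pi..pi}"
      by (simp add: o_def split_def)
    moreover have "Re (\<Sum>(x, y)\<in>I \<times> I. cis (u / 2 * tan (\<theta> / 2) - real (K + fst x + snd y - snd x - fst y) * \<theta>)) = g \<theta>" for \<theta>
    proof -
      have "(\<Sum>(x, y)\<in>I \<times> I. cis (u / 2 * tan (\<theta> / 2) - real (K + fst x + snd y - snd x - fst y) * \<theta>))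
        = (\<Sum>(x, y)\<in>I \<times> I. cis (ph \<theta>) * (cis ((real (snd x) - real (fst x)) * \<theta>) * cis ((real (fst y) - real (snd y)) * \<theta>)))"
      proof (intro sum.cong refl)
        fix z assume "z \<in> I \<times> I"
        then obtain a b c d where z: "z = ((a, b), (c, d))" "a < M" "b < M" "c < M" "d < M" by (auto simp: I_def)
        then have r: "real (K + a + d - b - c) = real K + real a + real d - real b - real c" using MK by linarith
        show "(case z of (x, y) \<Rightarrow> cis (u / 2 * tan (\<theta> / 2) - real (K + fst x + snd y - snd x - fst y) * \<theta>)) =
          (case z of (x, y) \<Rightarrow> cis (ph \<theta>) * (cis ((real (snd x) - real (fst x)) * \<theta>) * cis ((real (fst y) - real (snd y)) * \<theta>)))"
          unfolding z(1) prod.case fst_conv snd_conv r by (simp add: cis_mult ph_def algebra_simps)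
      qed
      also have "\<dots> = cis (ph \<theta>) * ((\<Sum>x\<in>I. cis ((real (snd x) - real (fst x)) * \<theta>)) * (\<Sum>y\<in>I. cis ((real (fst y) - real (snd y)) * \<theta>)))"
        by (rule sum_cartesian_mult)
      also have "(\<Sum>y\<in>I. cis ((real (fst y) - real (snd y)) * \<theta>)) = of_real ((cmod (dirichlet_kernel M \<theta>))\<^sup>2)"
        unfolding dirichlet_kernel_norm2 I_def by (simp add: split_def)
      also have "(\<Sum>x\<in>I. cis ((real (snd x) - real (fst x)) * \<theta>)) = of_real ((cmod (dirichlet_kernel M \<theta>))\<^sup>2)"
        unfolding dirichlet_kernel_norm2 I_def by (subst sum.cartesian_product[symmetric, of "\<lambda>a b. cis ((real a - real b) * \<theta>)"], subst sum.swap, subst sum.cartesian_product) (simp add: split_def)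
      finally show ?thesis by (simp add: g_def power2_eq_square)
    qed
    ultimately show ?thesis by simp
  qed

  \<comment> \<open>Outside |theta| <= th the squared modulus of the kernel is at most c, so its
    fourth power is at most c times the square, whose integral is only linear in M by
    Parseval.\<close>
  define c where "c = 2 / (1 - cos th)"
  have "cos th \<le> 1 - th\<^sup>2 / 5"
  proof -
    have "th / 2 * (4 / 5) \<le> sin (th / 2)"
    proof -
      have "th / 2 * cos (th / 2) \<le> sin (th / 2)"
        using tan_upper(1)[of "th / 2"] th cos_gt_zero_pi[of "th / 2"] pi_gt3 by (simp add: tan_def field_simps)
      moreover have "4 / 5 \<le> cos (th / 2)"
      proof -
        have "(sin (th / 4))\<^sup>2 \<le> (th / 4)\<^sup>2"
          using th sin_x_le_x[of "th / 4"] sin_ge_zero[of "th / 4"] pi_gt3 by (intro power_mono) auto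
        also have "\<dots> \<le> (1 / 8)\<^sup>2" using th by (intro power_mono) auto
        finally show ?thesis using cos_double_sin[of "th / 4"] by (simp add: power_divide)
      qed
      then have "th / 2 * (4 / 5) \<le> th / 2 * cos (th / 2)" using th by (intro mult_left_mono) auto
      ultimately show ?thesis by linarith
    qed
    then have "(th / 2 * (4 / 5))\<^sup>2 \<le> (sin (th / 2))\<^sup>2" using th by (intro power_mono) auto
    then show ?thesis using cos_double_sin[of "th / 2"] zero_le_power2[of th]
      by (simp add: power_mult_distrib power_divide) (use zero_le_power2[of th] in linarith)
  qed
  moreover from this have "cos th < 1" using zero_less_power[OF th(1), of 2] by linarith
  ultimately have c: "0 \<le> c" "c \<le> 10 / th\<^sup>2" "c > 0"
    using th frac_le[of 2 2 "th\<^sup>2 / 5" "1 - cos th"] by (auto simp: c_def)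
  define ind where "ind \<theta> = (if \<theta> \<in> {- 1 / real M..1 / real M} then real M ^ 4 / 32 else 0)" for \<theta>
  have M0: "M > 0" "1 / real M \<le> th" using s0 s by (auto simp: M_def th_def field_simps)
  have low: "ind \<theta> - c * (cmod (dirichlet_kernel M \<theta>))\<^sup>2 \<le> g \<theta>" if "\<theta> \<in> {-pi..pi}" for \<theta>
  proof (cases "\<bar>\<theta>\<bar> \<le> th")
    case True
    define y where "y = \<bar>\<theta>\<bar> / 2"
    have y: "0 \<le> y" "y \<le> 1 / 4" "y \<le> th / 2" using True th by (auto simp: y_def)
    have "\<bar>ph \<theta>\<bar> = \<bar>(2 * real K + 1) * tan y - 2 * real K * y\<bar>"
      by (cases "\<theta> \<ge> 0") (auto simp: ph_def y_def u_def add_divide_distrib)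
    also have "\<dots> = 2 * real K * (tan y - y) + tan y"
    proof -
      have "0 \<le> 2 * real K * (tan y - y) + tan y"
        using tan_upper(1)[OF y(1,2)] y(1) by (intro add_nonneg_nonneg mult_nonneg_nonneg) auto
      moreover have "(2 * real K + 1) * tan y - 2 * real K * y = 2 * real K * (tan y - y) + tan y"
        by (simp add: algebra_simps)
      ultimately show ?thesis by simp
    qed
    also have "\<dots> \<le> 2 * real K * y ^ 3 + (y + y ^ 3)"
      using tan_upper(2)[OF y(1,2)] by (intro add_mono mult_left_mono) auto
    also have "\<dots> \<le> 1"
    proof -
      have "2 * real K * y ^ 3 \<le> 2 * (8 * real s ^ 3) * (th / 2) ^ 3"
        using K3 y th by (intro mult_mono power_mono) auto
      also have "\<dots> = 1 / 4" using s0 by (simp add: th_def field_simps)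
      finally have "2 * real K * y ^ 3 \<le> 1 / 4" .
      moreover have "y ^ 3 \<le> (1 / 4) ^ 3" using y by (intro power_mono) auto
      ultimately show ?thesis using y by (simp add: power_divide)
    qed
    finally have "\<bar>ph \<theta>\<bar> \<le> 1" .
    then have "cos 1 \<le> cos \<bar>ph \<theta>\<bar>" using pi_gt3 by (intro cos_monotone_0_pi_le) auto
    then have cp: "1 / 2 \<le> cos (ph \<theta>)" using c1 by simp
    have "ind \<theta> \<le> g \<theta>"
    proof (cases "\<theta> \<in> {- 1 / real M..1 / real M}")
      case True
      then have "\<bar>real M * \<theta>\<bar> \<le> 1" using M0 by (auto simp: abs_le_iff field_simps)
      from dirichlet_kernel_lower[OF this] have "((real M / 2)\<^sup>2)\<^sup>2 \<le> ((cmod (dirichlet_kernel M \<theta>))\<^sup>2)\<^sup>2"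
        by (intro power_mono) auto
      then have "1 / 2 * (real M ^ 4 / 16) \<le> cos (ph \<theta>) * ((cmod (dirichlet_kernel M \<theta>))\<^sup>2)\<^sup>2"
        using cp by (intro mult_mono) (auto simp: power_divide power_mult[symmetric] simp del: power_mult)
      then show ?thesis using True by (simp add: ind_def g_def)
    qed (use cp in \<open>auto simp: ind_def g_def\<close>)
    moreover have "0 \<le> c * (cmod (dirichlet_kernel M \<theta>))\<^sup>2" using c by simp
    ultimately show ?thesis by linarith
  next
    case False
    have "cos \<bar>\<theta>\<bar> \<le> cos th" using False that th by (intro cos_monotone_0_pi_le) auto
    then have ct: "1 - cos th \<le> 1 - cos \<theta>" "1 - cos th > 0" using c by (auto simp: c_def zero_less_divide_iff)
    have "(cmod (dirichlet_kernel M \<theta>))\<^sup>2 * (1 - cos th) \<le> 2"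
      using order_trans[OF mult_left_mono[OF ct(1), of "(cmod (dirichlet_kernel M \<theta>))\<^sup>2"] dirichlet_kernel_bound[of M \<theta>]] by simp
    then have "(cmod (dirichlet_kernel M \<theta>))\<^sup>2 \<le> c" using ct by (simp add: c_def field_simps)
    then have "((cmod (dirichlet_kernel M \<theta>))\<^sup>2)\<^sup>2 \<le> c * (cmod (dirichlet_kernel M \<theta>))\<^sup>2"
      unfolding power2_eq_square[of "(cmod (dirichlet_kernel M \<theta>))\<^sup>2"] by (intro mult_right_mono) auto
    moreover have "- ((cmod (dirichlet_kernel M \<theta>))\<^sup>2)\<^sup>2 \<le> g \<theta>"
    proof -
      have "(-1) * ((cmod (dirichlet_kernel M \<theta>))\<^sup>2)\<^sup>2 \<le> cos (ph \<theta>) * ((cmod (dirichlet_kernel M \<theta>))\<^sup>2)\<^sup>2"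
        by (intro mult_right_mono) auto
      then show ?thesis by (simp add: g_def)
    qed
    moreover have "ind \<theta> = 0" using False M0 by (auto simp: ind_def abs_le_iff)
    ultimately show ?thesis by linarith
  qed
  have "(ind has_integral (real M ^ 4 / 32 * (2 / real M))) {-pi..pi}"
  proof -
    have "{- 1 / real M..1 / real M} \<subseteq> {-pi..pi}" using M0 th pi_gt3 by auto
    moreover have "((\<lambda>_. real M ^ 4 / 32) has_integral (real M ^ 4 / 32 * (2 / real M))) {- 1 / real M..1 / real M}"
      using has_integral_const_real[of "real M ^ 4 / 32" "- 1 / real M" "1 / real M"] M0 by (simp add: mult.commute)
    ultimately show ?thesis unfolding ind_def[abs_def] by (subst has_integral_restrict) auto
  qed
  then have "((\<lambda>\<theta>. ind \<theta> - c * (cmod (dirichlet_kernel M \<theta>))\<^sup>2) has_integral (real M ^ 4 / 32 * (2 / real M) - c * (2 * pi * real M))) {-pi..pi}"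
    by (intro has_integral_diff has_integral_mult_right dirichlet_kernel_norm2_integral)
  from has_integral_le[OF this gi low]
  have key: "real M ^ 4 / 32 * (2 / real M) - c * (2 * pi * real M) \<le>
     (\<Sum>(x, y)\<in>I \<times> I. 2 * pi * exp (- u / 2) * lagb (K + fst x + snd y - snd x - fst y) u)" by simp
  \<comment> \<open>The constant 200 is the window of half-width 2 M = 200 s in the normalisation of
    \<open>lag_window\<close>.\<close>
  define X where "X = 13 * exp (8 * real 200 ^ 2) * lag K u"
  have "(\<Sum>(x, y)\<in>I \<times> I. 2 * pi * exp (- u / 2) * lagb (K + fst x + snd y - snd x - fst y) u)
      \<le> (\<Sum>(x, y)\<in>I \<times> I. 2 * pi * exp (- u / 2) * (2 * X))"
  proof (intro sum_mono)
    fix z assume "z \<in> I \<times> I"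
    then obtain a b d e where z: "z = ((a, b), (d, e))" "a < M" "b < M" "d < M" "e < M" by (auto simp: I_def)
    then have n: "K + a + e - b - d \<le> K + 200 * s" "K + a + e - b - d \<noteq> 0" using MK by (auto simp: M_def)
    have l: "\<bar>lag N u\<bar> \<le> X" if "N \<le> K + 200 * s" for N
      unfolding X_def u_def by (rule lag_window[OF s(1-3)]) (use that in auto)
    have "K + a + e - b - d - 1 \<le> K + 200 * s" using n by linarith
    from l[OF n(1)] l[OF this] n(2)
    have "lagb (K + a + e - b - d) u \<le> 2 * X" by (auto simp: lagb_def)
    then have "2 * pi * exp (- u / 2) * lagb (K + a + e - b - d) u \<le> 2 * pi * exp (- u / 2) * (2 * X)"
      by (intro mult_left_mono) auto
    then show "(case z of (x, y) \<Rightarrow> 2 * pi * exp (- u / 2) * lagb (K + fst x + snd y - snd x - fst y) u)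
      \<le> (case z of (x, y) \<Rightarrow> 2 * pi * exp (- u / 2) * (2 * X))"
      unfolding z(1) by simp
  qed
  also have "\<dots> = real M ^ 4 * (2 * pi * exp (- u / 2) * (2 * X))"
    by (simp add: I_def power4_eq_xxxx)
  finally have up: "(\<Sum>(x, y)\<in>I \<times> I. 2 * pi * exp (- u / 2) * lagb (K + fst x + snd y - snd x - fst y) u)
      \<le> real M ^ 4 * (2 * pi * exp (- u / 2) * (2 * X))" .
  have "c * (2 * pi * real M) \<le> (10 / th\<^sup>2) * (2 * 3.2 * real M)"
    using c pi_less_4 M0 pi_approx by (intro mult_mono) auto
  also have "\<dots> = 256 * real s ^ 2 * real M" by (simp add: th_def power_divide)
  finally have "c * (2 * pi * real M) \<le> 25600 * real s ^ 3" by (simp add: M_def power2_eq_square power3_eq_cube)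
  moreover have "real M ^ 4 / 32 * (2 / real M) = 62500 * real s ^ 3"
    using s0 by (simp add: M_def power4_eq_xxxx power3_eq_cube)
  ultimately have "36900 * real s ^ 3 \<le> real M ^ 4 * (2 * pi * exp (- u / 2) * (2 * X))" using key up by linarith
  also have "\<dots> = real s ^ 3 * (10 ^ 8 * real s * (4 * pi * exp (- u / 2) * X))"
    by (simp add: M_def power4_eq_xxxx power3_eq_cube)
  finally have "36900 \<le> 10 ^ 8 * real s * (4 * pi * exp (- u / 2) * X)" using s0 by simp
  also have "X = 13 * exp 320000 * lag K u" by (simp add: X_def)
  finally have "36900 * exp (u / 2) \<le> 10 ^ 8 * real s * (4 * pi * (13 * exp 320000 * lag K u))"
    by (simp add: exp_minus field_simps)
  also have "\<dots> = pi * (10 ^ 8 * real s * 4 * 13 * exp 320000 * lag K u)" by simp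
  also have "\<dots> \<le> 3.15 * (10 ^ 8 * real s * 4 * 13 * exp 320000 * lag K u)"
    using pi_approx lag_ge_1[of K u] by (intro mult_right_mono) (auto simp: u_def)
  finally have fin: "36900 * exp (u / 2) \<le> 3.15 * (10 ^ 8 * real s * 4 * 13 * exp 320000 * lag K u)" .
  define T where "T = real s * (exp 320000 * lag K u)"
  have "0 \<le> T" using lag_ge_1[of K u] by (simp add: T_def u_def)
  moreover have "36900 * exp (u / 2) \<le> 16380000000 * T" using fin by (simp add: T_def mult_ac)
  ultimately have "exp (u / 2) \<le> 450000 * T" by linarith
  then have "exp (u / 2) \<le> lag K u * (450000 * exp 320000 * real s)" by (simp add: T_def mult_ac)
  moreover have "u / 2 = 2 * real K + 1" by (simp add: u_def)
  ultimately show ?thesis using s0 unfolding u_def[symmetric] by (simp add: divide_le_eq)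
qed


text \<open>The scale s of the previous lemma becomes the integer part of K^(1/3). The hypothesis is
  discharged by \<open>lag_bound\<close>, whose proof reads the values as Wigner functions.\<close>

lemma lag_turning_lower:
  assumes bound: "\<And>N u. 0 \<le> u \<Longrightarrow> \<bar>lag N u\<bar> \<le> exp (u / 2)"
  shows "\<exists>c>0. \<forall>\<^sub>F K in sequentially. c * exp (2 * real K + 1) / real K powr (1 / 3) \<le> lag K (4 * real K + 2)"
proof (intro exI conjI)
  define c :: real where "c = 1 / (450000 * exp 320000)"
  show "c > 0" by (simp add: c_def)
  show "\<forall>\<^sub>F K in sequentially. c * exp (2 * real K + 1) / real K powr (1 / 3) \<le> lag K (4 * real K + 2)"
    using eventually_ge_at_top[of "2828 ^ 3"]
  proof eventually_elim
    case (elim K)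
    define r where "r = real K powr (1 / 3)"
    define s where "s = nat \<lfloor>r\<rfloor>"
    have K0: "real K > 0" using elim by (cases K) auto
    have r3: "r ^ 3 = real K" using K0 by (simp add: r_def powr_powr flip: powr_realpow)
    have "real (2828 ^ 3) \<le> real K" using elim by (intro of_nat_mono)
    then have "2828 ^ 3 \<le> r ^ 3" unfolding r3 by simp
    have r: "2828 \<le> r"
    proof (rule power_le_imp_le_base)
      show "2828 ^ Suc 2 \<le> r ^ Suc 2" using \<open>2828 ^ 3 \<le> r ^ 3\<close> by (simp add: numeral_3_eq_3)
      show "0 \<le> r" by (simp add: r_def)
    qed
    have sr: "real s \<le> r" "r < real s + 1" using r by (auto simp: s_def)
    have s1: "1 \<le> s" using sr r by linarith
    have "real s ^ 3 \<le> r ^ 3" using sr by (intro power_mono) auto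
    then have a: "s ^ 3 \<le> K" unfolding r3 by (metis of_nat_le_iff of_nat_power)
    have "r ^ 3 \<le> (2 * real s) ^ 3" using sr r s1 by (intro power_mono) auto
    then have b: "K \<le> 8 * s ^ 3" unfolding r3
      by (simp add: power_mult_distrib) (metis of_nat_le_iff of_nat_mult of_nat_numeral of_nat_power)
    have "200 * s \<le> s * s * s"
    proof -
      have "200 \<le> s" using sr r by linarith
      then have "200 * 1 \<le> s * s" by (intro mult_mono) auto
      then show ?thesis using mult_le_mono1[of 200 "s * s" s] by simp
    qed
    then have "200 * s \<le> K" using a unfolding power3_eq_cube by (rule order_trans)
    from lag_turning_lower_scale[OF bound s1 a b this]
    have "c * exp (2 * real K + 1) / real s \<le> lag K (4 * real K + 2)" by (simp add: c_def)
    moreover have "c * exp (2 * real K + 1) / r \<le> c * exp (2 * real K + 1) / real s"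
      using sr s1 r by (intro divide_left_mono) (auto simp: c_def)
    ultimately show ?case by (simp add: r_def)
  qed
qed

section \<open>Number states and their Wigner functions\<close>

lemma has_integral_derivative_zero:
  fixes F f :: "real \<Rightarrow> complex"
  assumes d: "\<And>x. (F has_vector_derivative f x) (at x)" and c: "\<And>x. isCont f x"
    and i: "integrable lborel f" and l: "(F \<longlongrightarrow> 0) at_top" "(F \<longlongrightarrow> 0) at_bot"
  shows "integral\<^sup>L lborel f = 0"
proof -
  have "(LBINT x=-\<infinity>..\<infinity>. f x) = 0 - 0"
  proof (rule interval_integral_FTC_integrable)
    show "set_integrable lborel (einterval (-\<infinity>) \<infinity>) f" using i by (simp add: set_integrable_def)
    show "((F \<circ> real_of_ereal) \<longlongrightarrow> 0) (at_right (-\<infinity>))"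
      using l(2) by (simp add: ereal_tendsto_simps1)
    show "((F \<circ> real_of_ereal) \<longlongrightarrow> 0) (at_left \<infinity>)"
      using l(1) by (simp add: ereal_tendsto_simps1)
  qed (use d c in auto)
  then show ?thesis by (simp add: interval_lebesgue_integral_def set_lebesgue_integral_def)
qed

lemma integrable_abs_power_gauss:
  "integrable lborel (\<lambda>x::real. \<bar>x\<bar> ^ k * exp (- x\<^sup>2))"
proof -
  have "integrable lborel (\<lambda>x. sqrt pi * (normal_density 0 (1 / sqrt 2) x * \<bar>x - 0\<bar> ^ k))"
    by (intro integrable_mult_right integrable_normal_moment_abs) auto
  moreover have "normal_density 0 (1 / sqrt 2) x = exp (- x\<^sup>2) / sqrt pi" for x
    by (simp add: normal_density_def power_divide)
  then have "sqrt pi * (normal_density 0 (1 / sqrt 2) x * \<bar>x - 0\<bar> ^ k) = \<bar>x\<bar> ^ k * exp (- x\<^sup>2)" for x :: real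
    by simp
  ultimately show ?thesis by (simp only:)
qed

lemma integrable_poly_gauss: "integrable lborel (\<lambda>x::real. poly r x * exp (- x\<^sup>2))"
proof -
  have "integrable lborel (\<lambda>x::real. coeff r i * (x ^ i * exp (- x\<^sup>2)))" for i
  proof (intro integrable_mult_right, rule Bochner_Integration.integrable_bound[OF integrable_abs_power_gauss[of i]])
    show "AE x::real in lborel. norm (x ^ i * exp (- x\<^sup>2)) \<le> norm (\<bar>x\<bar> ^ i * exp (- x\<^sup>2))"
      by (auto simp: abs_mult power_abs)
  qed measurable
  then have "integrable lborel (\<lambda>x::real. \<Sum>i\<le>degree r. coeff r i * (x ^ i * exp (- x\<^sup>2)))"
    by (intro Bochner_Integration.integrable_sum)
  then show ?thesis by (simp add: poly_altdef sum_distrib_right mult.assoc)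
qed

lemma poly_gauss_tendsto_0:
  "((\<lambda>x::real. poly r x * exp (- x\<^sup>2)) \<longlongrightarrow> 0) at_top" "((\<lambda>x::real. poly r x * exp (- x\<^sup>2)) \<longlongrightarrow> 0) at_bot"
proof -
  have a: "((\<lambda>x::real. x ^ i * exp (- x\<^sup>2)) \<longlongrightarrow> 0) at_top" for i
  proof -
    have "((\<lambda>x::real. x ^ i / exp x) \<longlongrightarrow> 0) at_top" by (rule tendsto_power_div_exp_0)
    moreover have "\<forall>\<^sub>F x in at_top. norm (x ^ i * exp (- x\<^sup>2)) \<le> (x::real) ^ i / exp x"
      using eventually_ge_at_top[of "1::real"]
    proof eventually_elim
      case (elim x)
      then have "exp (- x\<^sup>2) \<le> exp (- x)" by (auto simp: power2_eq_square)
      then have "x ^ i * exp (- x\<^sup>2) \<le> x ^ i * exp (- x)" using elim by (intro mult_left_mono) auto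
      then show ?case using elim by (simp add: exp_minus divide_inverse)
    qed
    ultimately show ?thesis by (rule Lim_null_comparison[rotated])
  qed
  have top: "((\<lambda>x::real. poly r x * exp (- x\<^sup>2)) \<longlongrightarrow> 0) at_top" for r
  proof -
    have "((\<lambda>x::real. \<Sum>i\<le>degree r. coeff r i * (x ^ i * exp (- x\<^sup>2))) \<longlongrightarrow> (\<Sum>i\<le>degree r. coeff r i * 0)) at_top"
      by (intro tendsto_intros a)
    then show ?thesis by (simp add: poly_altdef sum_distrib_right mult.assoc)
  qed
  show "((\<lambda>x::real. poly r x * exp (- x\<^sup>2)) \<longlongrightarrow> 0) at_top" by (rule top)
  show "((\<lambda>x::real. poly r x * exp (- x\<^sup>2)) \<longlongrightarrow> 0) at_bot"
    using top[of "pcompose r [:0, -1:]"] by (simp add: filterlim_at_bot_mirror poly_pcompose)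
qed

text \<open>As a linear functional of r this reduces the integrals over Hermite functions to
  polynomial algebra: the integration itself is contained in \<open>gauss_ft_parts\<close> and the
  single value \<open>gauss_ft_1\<close>. The frequency 2 P is that of the Wigner transform; P = 0
  yields inner products.\<close>

definition gauss_ft :: "real \<Rightarrow> real poly \<Rightarrow> complex" where
  "gauss_ft P r = (LINT y|lborel. exp (2 * \<i> * of_real (P * y)) * of_real (poly r y * exp (- y\<^sup>2)))"

lemma integrable_gauss_ft:
  "integrable lborel (\<lambda>y. exp (2 * \<i> * complex_of_real (P * y)) * of_real (poly r y * exp (- y\<^sup>2)))"
proof (rule Bochner_Integration.integrable_bound[OF integrable_poly_gauss[of r]])
  have "exp (2 * \<i> * complex_of_real (P * y)) = cis (2 * P * y)" for y
    by (simp add: cis_conv_exp mult_ac)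
  then show "AE x in lborel. norm (exp (2 * \<i> * complex_of_real (P * x)) * of_real (poly r x * exp (- x\<^sup>2))) \<le> norm (poly r x * exp (- x\<^sup>2))"
    by (auto simp: norm_mult)
  show "(\<lambda>y. exp (2 * \<i> * complex_of_real (P * y)) * of_real (poly r y * exp (- y\<^sup>2))) \<in> borel_measurable lborel"
  proof -
    have "(\<lambda>y. exp (2 * \<i> * complex_of_real (P * y)) * of_real (poly r y * exp (- y\<^sup>2))) \<in> borel_measurable borel"
      by (intro borel_measurable_continuous_onI continuous_intros)
    then show ?thesis by simp
  qed
qed

lemma gauss_ft_add: "gauss_ft P (r + s) = gauss_ft P r + gauss_ft P s"
  unfolding gauss_ft_def by (subst Bochner_Integration.integral_add[symmetric, OF integrable_gauss_ft integrable_gauss_ft]) (simp add: algebra_simps)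

lemma gauss_ft_smult: "gauss_ft P (smult c r) = of_real c * gauss_ft P r"
  unfolding gauss_ft_def by (subst integral_mult_right_zero[symmetric]) (simp add: mult_ac)

lemma gauss_ft_minus: "gauss_ft P (- r) = - gauss_ft P r"
  using gauss_ft_smult[of P "-1" r] by simp

lemma gauss_ft_diff: "gauss_ft P (r - s) = gauss_ft P r - gauss_ft P s"
  using gauss_ft_add[of P r "- s"] by (simp add: gauss_ft_minus)

text \<open>The derivative of e^(2 i P y) r(y) e^(-y^2) integrates to zero. Under the functional,
  multiplication by 2 y is therefore differentiation plus multiplication by 2 i P.\<close>

lemma gauss_ft_parts: "gauss_ft P ([:0, 2:] * r) = gauss_ft P (pderiv r) + 2 * \<i> * of_real P * gauss_ft P r"
proof -
  define F where "F y = exp (2 * \<i> * complex_of_real (P * y)) * of_real (poly r y * exp (- y\<^sup>2))" for y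
  define f where "f y = 2 * \<i> * of_real P * (exp (2 * \<i> * complex_of_real (P * y)) * of_real (poly r y * exp (- y\<^sup>2)))
     + exp (2 * \<i> * complex_of_real (P * y)) * of_real (poly (pderiv r - [:0, 2:] * r) y * exp (- y\<^sup>2))" for y
  have e: "exp (2 * \<i> * complex_of_real (P * y)) = cis (2 * P * y)" for y
    by (simp add: cis_conv_exp mult_ac)
  have nF: "norm (F y) = norm (poly r y * exp (- y\<^sup>2))" for y
    by (simp add: F_def e norm_mult abs_mult)
  have "integral\<^sup>L lborel f = 0"
  proof (rule has_integral_derivative_zero)
    fix x
    have a: "((\<lambda>y. exp (2 * \<i> * complex_of_real (P * y))) has_vector_derivative (2 * \<i> * of_real P * exp (2 * \<i> * complex_of_real (P * x)))) (at x)"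
    proof -
      have "((\<lambda>z. exp (2 * \<i> * of_real P * z)) has_field_derivative (2 * \<i> * of_real P * exp (2 * \<i> * of_real P * z))) (at z)" for z
        by (auto intro!: derivative_eq_intros)
      from has_vector_derivative_real_field[OF this, of x] show ?thesis by (simp add: mult_ac)
    qed
    have "((\<lambda>y. poly r y * exp (- y\<^sup>2)) has_real_derivative (poly (pderiv r - [:0, 2:] * r) x * exp (- x\<^sup>2))) (at x)"
      by (auto intro!: derivative_eq_intros poly_DERIV simp: algebra_simps)
    then have b: "((\<lambda>y. complex_of_real (poly r y * exp (- y\<^sup>2))) has_vector_derivative of_real (poly (pderiv r - [:0, 2:] * r) x * exp (- x\<^sup>2))) (at x)"
      using has_vector_derivative_of_real has_real_derivative_iff_has_vector_derivative by blast
    show "(F has_vector_derivative f x) (at x)"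
      unfolding F_def[abs_def] f_def using has_vector_derivative_mult[OF a b] by (simp add: add.commute mult.assoc)
    show "isCont f x" unfolding f_def by (intro continuous_intros)
  next
    show "integrable lborel f" unfolding f_def
      by (intro Bochner_Integration.integrable_add integrable_mult_right integrable_gauss_ft)
    show "(F \<longlongrightarrow> 0) at_top" "(F \<longlongrightarrow> 0) at_bot"
      using poly_gauss_tendsto_0[of r] tendsto_norm_zero_iff[of F] tendsto_norm_zero_iff[of "\<lambda>y. poly r y * exp (- y\<^sup>2)"]
      by (auto simp: nF)
  qed
  moreover have "integral\<^sup>L lborel f = 2 * \<i> * of_real P * gauss_ft P r + gauss_ft P (pderiv r - [:0, 2:] * r)"
    unfolding f_def gauss_ft_def
    by (subst Bochner_Integration.integral_add[OF integrable_mult_right[OF integrable_gauss_ft] integrable_gauss_ft]) simp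
  ultimately show ?thesis by (simp add: gauss_ft_diff algebra_simps)
qed

lemma gauss_ft_1: "gauss_ft P 1 = of_real (sqrt pi * exp (- P\<^sup>2))"
proof -
  have "complex_of_real (exp (- (sqrt 2 * P)\<^sup>2 / 2)) = char std_normal_distribution (sqrt 2 * P)"
    by (simp add: char_std_normal_distribution)
  also have "\<dots> = (CLINT x|lborel. std_normal_density x *\<^sub>R iexp (sqrt 2 * P * x))"
    unfolding char_def by (subst integral_density) auto
  also have "\<dots> = \<bar>sqrt 2\<bar> *\<^sub>R (CLINT x|lborel. std_normal_density (0 + sqrt 2 * x) *\<^sub>R iexp (sqrt 2 * P * (0 + sqrt 2 * x)))"
    by (rule lborel_integral_real_affine) simp
  also have "(CLINT x|lborel. std_normal_density (0 + sqrt 2 * x) *\<^sub>R iexp (sqrt 2 * P * (0 + sqrt 2 * x)))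
     = (CLINT x|lborel. of_real (1 / sqrt (2 * pi)) * (exp (2 * \<i> * of_real (P * x)) * of_real (poly 1 x * exp (- x\<^sup>2))))"
    by (intro Bochner_Integration.integral_cong refl)
       (simp add: std_normal_density_def power_mult_distrib scaleR_conv_of_real mult_ac real_sqrt_mult)
  also have "\<dots> = of_real (1 / sqrt (2 * pi)) * gauss_ft P 1"
    unfolding gauss_ft_def by (rule integral_mult_right_zero)
  finally have "complex_of_real (exp (- P\<^sup>2)) = of_real (sqrt 2 * (1 / sqrt (2 * pi))) * gauss_ft P 1"
    by (simp add: power_mult_distrib scaleR_conv_of_real)
  also have "sqrt 2 * (1 / sqrt (2 * pi)) = 1 / sqrt pi" by (simp add: real_sqrt_mult)
  finally show ?thesis by (simp add: field_simps)
qed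

section \<open>Hermite functions, ladder relations and orthonormality\<close>

primrec hermite_poly :: "nat \<Rightarrow> real poly" where
  "hermite_poly 0 = [:pi powr (-1/4):]"
| "hermite_poly (Suc n) = smult (1 / sqrt (2 * real (Suc n))) ([:0, 2:] * hermite_poly n - pderiv (hermite_poly n))"

lemma gauss_poly_deriv:
  "((\<lambda>x. poly r x * exp (- x\<^sup>2 / 2)) has_real_derivative (poly (pderiv r) x - x * poly r x) * exp (- x\<^sup>2 / 2)) (at x)"
  by (auto intro!: derivative_eq_intros poly_DERIV simp: algebra_simps)

lemma hermite_fun_eq: "hermite_fun n = (\<lambda>x. poly (hermite_poly n) x * exp (- x\<^sup>2 / 2))"
proof (induction n)
  case (Suc n)
  have "deriv (hermite_fun n) x = (poly (pderiv (hermite_poly n)) x - x * poly (hermite_poly n) x) * exp (- x\<^sup>2 / 2)" for x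
    unfolding Suc by (rule DERIV_imp_deriv[OF gauss_poly_deriv])
  then show ?case unfolding hermite_fun.simps by (simp only:) (simp add: Suc fun_eq_iff algebra_simps diff_divide_distrib)
qed simp

lemma hermite_raise: "[:0, 2:] * hermite_poly n - pderiv (hermite_poly n) = smult (sqrt (2 * real (Suc n))) (hermite_poly (Suc n))"
  by simp

declare hermite_poly.simps [simp del] hermite_fun.simps [simp del]

text \<open>After splitting off exp (- x^2 / 2), the creation operator acts as r -> 2 x r - r'. Its
  commutator with d/dx is multiplication by 2, which raises the eigenvalue by 2 at each step of the
  induction.\<close>

lemma hermite_lower: "pderiv (hermite_poly n) = smult (sqrt (2 * real n)) (hermite_poly (n - 1))"
proof (induction n)
  case (Suc n)
  let ?s = "sqrt (2 * real (Suc n))"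
  have s: "?s * ?s = 2 * real (Suc n)" "?s \<noteq> 0" by (auto simp del: of_nat_Suc)
  have "pderiv ([:0, 2:] * hermite_poly n - pderiv (hermite_poly n)) = smult (2 * real (Suc n)) (hermite_poly n)"
  proof (cases n)
    case 0
    then show ?thesis by (simp add: pderiv_pCons hermite_poly.simps)
  next
    case (Suc k)
    have "pderiv ([:0, 2:] * hermite_poly n - pderiv (hermite_poly n))
       = smult 2 (hermite_poly n) + ([:0, 2:] * pderiv (hermite_poly n) - pderiv (pderiv (hermite_poly n)))"
      by (simp add: pderiv_diff pderiv_mult pderiv_pCons pderiv_smult)
    also have "[:0, 2:] * pderiv (hermite_poly n) - pderiv (pderiv (hermite_poly n)) =
       smult (sqrt (2 * real n)) ([:0, 2:] * hermite_poly k - pderiv (hermite_poly k))"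
      unfolding Suc.IH using Suc by (simp add: pderiv_smult smult_diff_right)
    also have "\<dots> = smult (sqrt (2 * real n)) (smult (sqrt (2 * real n)) (hermite_poly n))"
      unfolding hermite_raise Suc ..
    also have "\<dots> = smult (2 * real n) (hermite_poly n)" by simp
    finally show ?thesis by (simp add: smult_add_left[symmetric])
  qed
  then have "pderiv (hermite_poly (Suc n)) = smult (1 / ?s) (smult (2 * real (Suc n)) (hermite_poly n))"
    by (simp add: pderiv_smult hermite_poly.simps)
  also have "1 / ?s * (2 * real (Suc n)) = ?s" using s by (simp add: field_simps)
  then have "smult (1 / ?s) (smult (2 * real (Suc n)) (hermite_poly n)) = smult ?s (hermite_poly n)" by (simp only: smult_smult)
  finally show ?case by simp
qed (simp add: pderiv_pCons hermite_poly.simps)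

definition hermite_ip :: "nat \<Rightarrow> nat \<Rightarrow> complex" where
  "hermite_ip j n = gauss_ft 0 (hermite_poly j * hermite_poly n)"

text \<open>Integration by parts turns raising on the right factor into lowering on the left one:
  the two maps are adjoint for the Gaussian weight.\<close>

lemma hermite_ip_rec: "of_real (sqrt (2 * real (Suc n))) * hermite_ip j (Suc n) = of_real (sqrt (2 * real j)) * hermite_ip (j - 1) n"
proof -
  let ?a = "hermite_poly j" and ?b = "hermite_poly n"
  have "of_real (sqrt (2 * real (Suc n))) * hermite_ip j (Suc n) = gauss_ft 0 (?a * ([:0, 2:] * ?b - pderiv ?b))"
    unfolding hermite_raise hermite_ip_def by (simp only: mult_smult_right gauss_ft_smult)
  also have "?a * ([:0, 2:] * ?b - pderiv ?b) = [:0, 2:] * (?a * ?b) - ?a * pderiv ?b"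
    by (simp add: algebra_simps)
  also have "gauss_ft 0 \<dots> = gauss_ft 0 (pderiv ?a * ?b)"
    unfolding gauss_ft_diff gauss_ft_parts pderiv_mult gauss_ft_add by (simp add: mult.commute)
  also have "\<dots> = of_real (sqrt (2 * real j)) * hermite_ip (j - 1) n"
    unfolding hermite_lower hermite_ip_def by (simp only: mult_smult_left gauss_ft_smult)
  finally show ?thesis .
qed

lemma hermite_ip: "hermite_ip j n = (if j = n then 1 else 0)"
proof (induction n arbitrary: j)
  case 0
  show ?case
  proof (cases j)
    case 0
    have "[:pi powr (-1/4):] * [:pi powr (-1/4):] = smult (1 / sqrt pi) 1"
      by (simp add: powr_add[symmetric] powr_minus powr_half_sqrt inverse_eq_divide one_pCons)
    then have "gauss_ft 0 (hermite_poly 0 * hermite_poly 0) = gauss_ft 0 (smult (1 / sqrt pi) 1)" by (simp only: hermite_poly.simps)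
    then show ?thesis unfolding 0 hermite_ip_def gauss_ft_smult gauss_ft_1 by (simp flip: of_real_mult)
  next
    case (Suc k)
    have "of_real (sqrt (2 * real (Suc k))) * hermite_ip 0 (Suc k) = 0" unfolding hermite_ip_rec by simp
    moreover have "complex_of_real (sqrt (2 * real (Suc k))) \<noteq> 0" by (simp del: of_nat_Suc)
    ultimately have "hermite_ip 0 j = 0" unfolding Suc using mult_eq_0_iff by blast
    then show ?thesis using Suc by (simp add: hermite_ip_def mult.commute)
  qed
next
  case (Suc n)
  have "of_real (sqrt (2 * real (Suc n))) * hermite_ip j (Suc n) = of_real (sqrt (2 * real j)) * (if j - 1 = n then 1 else 0)"
    unfolding hermite_ip_rec Suc ..
  also have "\<dots> = of_real (sqrt (2 * real (Suc n))) * (if j = Suc n then 1 else 0)" by (cases j) auto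
  finally show ?case by (simp del: of_nat_Suc)
qed

lemma hermite_orthonormal:
  "integrable lborel (\<lambda>x. hermite_fun j x * hermite_fun n x)"
  "(LINT x|lborel. hermite_fun j x * hermite_fun n x) = (if j = n then 1 else 0)"
proof -
  have e: "hermite_fun j x * hermite_fun n x = poly (hermite_poly j * hermite_poly n) x * exp (- x\<^sup>2)" for x
  proof -
    have "exp (- x\<^sup>2 / 2) * exp (- x\<^sup>2 / 2) = exp (- x\<^sup>2)" by (simp add: exp_add[symmetric])
    then show ?thesis by (simp add: hermite_fun_eq mult_ac)
  qed
  show "integrable lborel (\<lambda>x. hermite_fun j x * hermite_fun n x)"
    unfolding e by (rule integrable_poly_gauss)
  have "complex_of_real (LINT x|lborel. hermite_fun j x * hermite_fun n x) = hermite_ip j n"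
    unfolding e hermite_ip_def gauss_ft_def by (simp flip: integral_complex_of_real)
  then show "(LINT x|lborel. hermite_fun j x * hermite_fun n x) = (if j = n then 1 else 0)"
    by (simp add: hermite_ip split: if_splits)
qed

section \<open>Cross-Wigner functions of number states, without the factor 1 / pi\<close>

definition wig :: "(real \<Rightarrow> real) \<Rightarrow> (real \<Rightarrow> real) \<Rightarrow> real \<Rightarrow> real \<Rightarrow> complex" where
  "wig f g Q P = (LINT y|lborel. exp (2 * \<i> * of_real (P * y)) * of_real (f (Q - y) * g (Q + y)))"

definition wpoly :: "real \<Rightarrow> real poly \<Rightarrow> real poly \<Rightarrow> real poly" where
  "wpoly Q a b = pcompose a [:Q, -1:] * pcompose b [:Q, 1:]"

lemma hermite_shift_prod:
  "hermite_fun j (Q - y) * hermite_fun n (Q + y) = exp (- Q\<^sup>2) * (poly (wpoly Q (hermite_poly j) (hermite_poly n)) y * exp (- y\<^sup>2))"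
proof -
  have "exp (- (Q - y)\<^sup>2 / 2) * exp (- (Q + y)\<^sup>2 / 2) = exp (- Q\<^sup>2) * exp (- y\<^sup>2)"
    unfolding exp_add[symmetric] by (simp add: power2_eq_square field_simps)
  then show ?thesis
    by (simp add: hermite_fun_eq wpoly_def poly_pcompose mult_ac)
qed

lemma wig_integrable:
  "integrable lborel (\<lambda>y. exp (2 * \<i> * complex_of_real (P * y)) * of_real (hermite_fun j (Q - y) * hermite_fun n (Q + y)))"
proof -
  have "integrable lborel (\<lambda>y. of_real (exp (- Q\<^sup>2)) * (exp (2 * \<i> * complex_of_real (P * y)) * of_real (poly (wpoly Q (hermite_poly j) (hermite_poly n)) y * exp (- y\<^sup>2))))"
    by (intro integrable_mult_right integrable_gauss_ft)
  then show ?thesis unfolding hermite_shift_prod by (simp add: mult_ac)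
qed

lemma wig_hermite: "wig (hermite_fun j) (hermite_fun n) Q P = of_real (exp (- Q\<^sup>2)) * gauss_ft P (wpoly Q (hermite_poly j) (hermite_poly n))"
  unfolding wig_def gauss_ft_def hermite_shift_prod by (subst integral_mult_right_zero[symmetric]) (simp add: mult_ac)

lemma pderiv_wpoly: "pderiv (wpoly Q a b) = wpoly Q a (pderiv b) - wpoly Q (pderiv a) b"
  by (simp add: wpoly_def pderiv_mult pderiv_pcompose pderiv_pCons algebra_simps)

text \<open>The raised factor brings 2 (Q + y). Its y part is removed by
  \<open>gauss_ft_parts\<close>, which yields 2 i P and a derivative in y; the derivative of the
  right factor cancels against the one in the raising map, and the derivative of the left factor
  remains as a lowering term.\<close>

lemma wig_raise_right:
  "gauss_ft P (wpoly Q a ([:0, 2:] * b - pderiv b)) = 2 * (of_real Q + \<i> * of_real P) * gauss_ft P (wpoly Q a b) - gauss_ft P (wpoly Q (pderiv a) b)"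
proof -
  have "wpoly Q a ([:0, 2:] * b - pderiv b) = smult (2 * Q) (wpoly Q a b) + [:0, 2:] * wpoly Q a b - wpoly Q a (pderiv b)"
    by (rule poly_ext) (simp add: wpoly_def poly_pcompose algebra_simps)
  then show ?thesis
    by (simp only: gauss_ft_add gauss_ft_diff gauss_ft_smult gauss_ft_parts pderiv_wpoly) (simp add: algebra_simps)
qed

lemma wig_raise_left:
  "gauss_ft P (wpoly Q ([:0, 2:] * a - pderiv a) b) = 2 * (of_real Q - \<i> * of_real P) * gauss_ft P (wpoly Q a b) - gauss_ft P (wpoly Q a (pderiv b))"
proof -
  have "wpoly Q ([:0, 2:] * a - pderiv a) b = smult (2 * Q) (wpoly Q a b) - [:0, 2:] * wpoly Q a b - wpoly Q (pderiv a) b"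
    by (rule poly_ext) (simp add: wpoly_def poly_pcompose algebra_simps)
  then show ?thesis
    by (simp only: gauss_ft_add gauss_ft_diff gauss_ft_smult gauss_ft_parts pderiv_wpoly) (simp add: algebra_simps)
qed

lemma wpoly_smult: "wpoly Q (smult c a) b = smult c (wpoly Q a b)" "wpoly Q a (smult c b) = smult c (wpoly Q a b)"
  by (simp_all add: wpoly_def pcompose_smult)

abbreviation hwig :: "nat \<Rightarrow> nat \<Rightarrow> real \<Rightarrow> real \<Rightarrow> complex" where
  "hwig j n \<equiv> wig (hermite_fun j) (hermite_fun n)"

lemma hwig_rec_right:
  "of_real (sqrt (real (Suc n))) * hwig j (Suc n) Q P =
     of_real (sqrt 2) * (of_real Q + \<i> * of_real P) * hwig j n Q P - of_real (sqrt (real j)) * hwig (j - 1) n Q P"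
proof -
  have "of_real (sqrt (2 * real (Suc n))) * hwig j (Suc n) Q P =
     2 * (of_real Q + \<i> * of_real P) * hwig j n Q P - of_real (sqrt (2 * real j)) * hwig (j - 1) n Q P"
    using arg_cong[OF wig_raise_right[of P Q "hermite_poly j" "hermite_poly n", unfolded hermite_raise, unfolded hermite_lower wpoly_smult gauss_ft_smult],
        of "\<lambda>z. of_real (exp (- Q\<^sup>2)) * z"]
    unfolding wig_hermite by (simp add: algebra_simps)
  also have "2 = complex_of_real (sqrt 2) * of_real (sqrt 2)" by (simp flip: of_real_mult)
  finally have "of_real (sqrt 2) * (of_real (sqrt (real (Suc n))) * hwig j (Suc n) Q P) =
     of_real (sqrt 2) * (of_real (sqrt 2) * (of_real Q + \<i> * of_real P) * hwig j n Q P - of_real (sqrt (real j)) * hwig (j - 1) n Q P)"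
    by (simp add: real_sqrt_mult algebra_simps del: of_nat_Suc)
  then show ?thesis by simp
qed

lemma hwig_rec_left:
  "of_real (sqrt (real (Suc j))) * hwig (Suc j) n Q P =
     of_real (sqrt 2) * (of_real Q - \<i> * of_real P) * hwig j n Q P - of_real (sqrt (real n)) * hwig j (n - 1) Q P"
proof -
  have "of_real (sqrt (2 * real (Suc j))) * hwig (Suc j) n Q P =
     2 * (of_real Q - \<i> * of_real P) * hwig j n Q P - of_real (sqrt (2 * real n)) * hwig j (n - 1) Q P"
    using arg_cong[OF wig_raise_left[of P Q "hermite_poly j" "hermite_poly n", unfolded hermite_raise, unfolded hermite_lower wpoly_smult gauss_ft_smult],
        of "\<lambda>z. of_real (exp (- Q\<^sup>2)) * z"]
    unfolding wig_hermite by (simp add: algebra_simps)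
  also have "2 = complex_of_real (sqrt 2) * of_real (sqrt 2)" by (simp flip: of_real_mult)
  finally have "of_real (sqrt 2) * (of_real (sqrt (real (Suc j))) * hwig (Suc j) n Q P) =
     of_real (sqrt 2) * (of_real (sqrt 2) * (of_real Q - \<i> * of_real P) * hwig j n Q P - of_real (sqrt (real n)) * hwig j (n - 1) Q P)"
    by (simp add: real_sqrt_mult algebra_simps del: of_nat_Suc)
  then show ?thesis by simp
qed

lemma hwig_0: "hwig 0 0 Q P = of_real (exp (- (Q\<^sup>2 + P\<^sup>2)))"
proof -
  have "wpoly Q (hermite_poly 0) (hermite_poly 0) = smult (1 / sqrt pi) 1"
    by (simp add: wpoly_def hermite_poly.simps powr_add[symmetric] powr_minus powr_half_sqrt inverse_eq_divide one_pCons)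
  then show ?thesis unfolding wig_hermite by (simp only: gauss_ft_smult gauss_ft_1) (simp add: exp_diff exp_minus field_simps)
qed

lemma hwig_0_n: "hwig 0 n Q P = (of_real (sqrt 2) * (of_real Q + \<i> * of_real P)) ^ n / of_real (sqrt (fact n)) * of_real (exp (- (Q\<^sup>2 + P\<^sup>2)))"
proof (induction n)
  case (Suc n)
  have "of_real (sqrt (real (Suc n))) * hwig 0 (Suc n) Q P = of_real (sqrt 2) * (of_real Q + \<i> * of_real P) * hwig 0 n Q P"
    using hwig_rec_right[of n 0 Q P] by simp
  then have "hwig 0 (Suc n) Q P = of_real (sqrt 2) * (of_real Q + \<i> * of_real P) * hwig 0 n Q P / of_real (sqrt (real (Suc n)))"
    by (simp add: field_simps del: of_nat_Suc)
  then show ?case unfolding Suc by (simp add: real_sqrt_mult fact_Suc mult_ac del: of_nat_Suc)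
qed (simp add: hwig_0)

lemma hwig_n_0: "hwig n 0 Q P = (of_real (sqrt 2) * (of_real Q - \<i> * of_real P)) ^ n / of_real (sqrt (fact n)) * of_real (exp (- (Q\<^sup>2 + P\<^sup>2)))"
proof (induction n)
  case (Suc n)
  have "of_real (sqrt (real (Suc n))) * hwig (Suc n) 0 Q P = of_real (sqrt 2) * (of_real Q - \<i> * of_real P) * hwig n 0 Q P"
    using hwig_rec_left[of n 0 Q P] by simp
  then have "hwig (Suc n) 0 Q P = of_real (sqrt 2) * (of_real Q - \<i> * of_real P) * hwig n 0 Q P / of_real (sqrt (real (Suc n)))"
    by (simp add: field_simps del: of_nat_Suc)
  then show ?case unfolding Suc by (simp add: real_sqrt_mult fact_Suc mult_ac del: of_nat_Suc)
qed (simp add: hwig_0)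

text \<open>Raising on the right and then on the left leads back to the diagonal. The product of Q +
  i P and Q - i P produces u, the off-diagonal entry is eliminated by the relation one step below,
  and what remains is the three-term recursion of \<open>lag\<close>.\<close>

lemma hwig_diag: "hwig n n Q P = of_real (lag n (2 * (Q\<^sup>2 + P\<^sup>2)) * exp (- (Q\<^sup>2 + P\<^sup>2)))"
proof (induction n rule: less_induct)
  case (less n)
  define u where "u = 2 * (Q\<^sup>2 + P\<^sup>2)"
  define Z where "Z = of_real (sqrt 2) * (of_real Q + \<i> * of_real P)"
  define Y where "Y = of_real (sqrt 2) * (of_real Q - \<i> * of_real P)"
  have ZY: "Z * Y = of_real u"
  proof -
    have "Z * Y = (of_real (sqrt 2) * of_real (sqrt 2)) * ((of_real Q + \<i> * of_real P) * (of_real Q - \<i> * of_real P))"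
      by (simp add: Z_def Y_def)
    also have "(complex_of_real (sqrt 2) * of_real (sqrt 2)) = 2" by (simp flip: of_real_mult)
    finally show ?thesis by (simp add: u_def power2_eq_square algebra_simps)
  qed
  show ?case
  proof (cases n)
    case 0
    then show ?thesis by (simp add: hwig_0)
  next
    case (Suc k)
    define t where "t j = hwig j j Q P" for j
    have sq: "complex_of_real (sqrt (real i)) * of_real (sqrt (real i)) = of_real (real i)" for i
      by (simp flip: of_real_mult)
    have r1: "of_real (sqrt (real (Suc k))) * t (Suc k) = Z * hwig (Suc k) k Q P - of_real (sqrt (real (Suc k))) * t k"
      using hwig_rec_right[of k "Suc k" Q P] by (simp add: Z_def t_def)
    have r2: "of_real (sqrt (real (Suc k))) * hwig (Suc k) k Q P = Y * t k - of_real (sqrt (real k)) * hwig k (k - 1) Q P"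
      using hwig_rec_left[of k k Q P] by (simp add: Y_def t_def)
    have r3: "of_real (sqrt (real k)) * (Z * hwig k (k - 1) Q P) = of_real (real k) * (t k + t (k - 1))"
    proof (cases k)
      case (Suc i)
      have "of_real (sqrt (real k)) * t k = Z * hwig k i Q P - of_real (sqrt (real k)) * t i"
        using hwig_rec_right[of i k Q P] Suc by (simp add: Z_def t_def)
      then have "of_real (sqrt (real k)) * (Z * hwig k i Q P) = (of_real (sqrt (real k)) * of_real (sqrt (real k))) * (t k + t i)"
        by (simp add: algebra_simps)
      then show ?thesis using Suc by (simp only: sq) simp
    qed simp
    have "of_real (real (Suc k)) * t (Suc k) = of_real (sqrt (real (Suc k))) * (of_real (sqrt (real (Suc k))) * t (Suc k))"
      by (simp only: mult.assoc[symmetric] sq)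
    also have "\<dots> = Z * (of_real (sqrt (real (Suc k))) * hwig (Suc k) k Q P) - of_real (real (Suc k)) * t k"
      unfolding r1 by (simp only: right_diff_distrib mult.assoc[symmetric] sq) (simp only: mult_ac)
    also have "\<dots> = of_real u * t k - of_real (real k) * (t k + t (k - 1)) - of_real (real (Suc k)) * t k"
      unfolding r2 right_diff_distrib mult.assoc[symmetric] ZY using r3 by (simp add: mult_ac)
    finally have "of_real (real (Suc k)) * t (Suc k) = of_real (u - 2 * real k - 1) * t k - of_real (real k) * t (k - 1)"
      by (simp add: algebra_simps)
    also have "t k = of_real (lag k u * exp (- (Q\<^sup>2 + P\<^sup>2)))" using less Suc by (simp add: t_def u_def)
    also have "t (k - 1) = of_real (lag (k - 1) u * exp (- (Q\<^sup>2 + P\<^sup>2)))" using less Suc by (simp add: t_def u_def)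
    also have "of_real (u - 2 * real k - 1) * of_real (lag k u * exp (- (Q\<^sup>2 + P\<^sup>2))) - of_real (real k) * of_real (lag (k - 1) u * exp (- (Q\<^sup>2 + P\<^sup>2)))
       = complex_of_real ((real (Suc k) * lag (Suc k) u) * exp (- (Q\<^sup>2 + P\<^sup>2)))"
      unfolding lag_rec by (simp add: algebra_simps)
    finally show ?thesis using Suc unfolding t_def u_def[symmetric] of_real_mult
      by (simp add: mult.assoc del: of_nat_Suc)
  qed
qed

text \<open>The Wigner function of a unit vector is bounded: under the integral, 2 |f g| <= f^2 +
  g^2 gives the constant 1 in the normalisation of \<open>wig\<close>. The claim is this bound at
  the phase-space point P = 0, Q = sqrt (u / 2).\<close>

lemma lag_bound:
  assumes "0 \<le> u" shows "\<bar>lag N u\<bar> \<le> exp (u / 2)"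
proof -
  define Q where "Q = sqrt (u / 2)"
  have Q: "2 * (Q\<^sup>2 + 0\<^sup>2) = u" using assms by (simp add: Q_def)
  let ?f = "hermite_fun N"
  have i0: "integrable lborel (\<lambda>x. ?f x * ?f x)" "(LINT x|lborel. ?f x * ?f x) = 1"
    using hermite_orthonormal[of N N] by auto
  have i1: "integrable lborel (\<lambda>y. ?f (Q - y) * ?f (Q - y))" "(LINT y|lborel. ?f (Q - y) * ?f (Q - y)) = 1"
    using lborel_integrable_real_affine[OF i0(1), of "-1" Q] lborel_integral_real_affine[of "-1" "\<lambda>x. ?f x * ?f x" Q] i0(2) by auto
  have i2: "integrable lborel (\<lambda>y. ?f (Q + y) * ?f (Q + y))" "(LINT y|lborel. ?f (Q + y) * ?f (Q + y)) = 1"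
    using lborel_integrable_real_affine[OF i0(1), of "1" Q] lborel_integral_real_affine[of "1" "\<lambda>x. ?f x * ?f x" Q] i0(2) by auto
  have "norm (hwig N N Q 0) \<le> (LINT y|lborel. norm (exp (2 * \<i> * complex_of_real (0 * y)) * of_real (?f (Q - y) * ?f (Q + y))))"
    unfolding wig_def by (rule integral_norm_bound)
  also have "\<dots> \<le> (LINT y|lborel. (?f (Q - y) * ?f (Q - y)) / 2 + (?f (Q + y) * ?f (Q + y)) / 2)"
  proof (rule integral_mono)
    show "integrable lborel (\<lambda>y. norm (exp (2 * \<i> * complex_of_real (0 * y)) * of_real (?f (Q - y) * ?f (Q + y))))"
      by (intro integrable_norm wig_integrable)
    show "integrable lborel (\<lambda>y. (?f (Q - y) * ?f (Q - y)) / 2 + (?f (Q + y) * ?f (Q + y)) / 2)"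
      using i1 i2 by auto
    fix y
    have "2 * (\<bar>?f (Q - y)\<bar> * \<bar>?f (Q + y)\<bar>) \<le> (?f (Q - y))\<^sup>2 + (?f (Q + y))\<^sup>2"
      using sum_squares_bound[of "\<bar>?f (Q - y)\<bar>" "\<bar>?f (Q + y)\<bar>"] by simp
    then show "norm (exp (2 * \<i> * complex_of_real (0 * y)) * of_real (?f (Q - y) * ?f (Q + y))) \<le> (?f (Q - y) * ?f (Q - y)) / 2 + (?f (Q + y) * ?f (Q + y)) / 2"
      by (simp add: norm_mult abs_mult power2_eq_square)
  qed
  also have "\<dots> = 1" using i1 i2 by simp
  finally have "\<bar>lag N u\<bar> * exp (- Q\<^sup>2) \<le> 1" unfolding hwig_diag Q by (simp add: norm_mult)
  moreover have "Q\<^sup>2 = u / 2" using Q by simp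
  ultimately show ?thesis by (simp add: exp_minus field_simps)
qed

text \<open>Both forms of the derivative are needed: differentiating the first one again produces a
  derivative at n - 1, for which the second form leads back to n.\<close>

lemma hermite_deriv: 
  "(hermite_fun n has_real_derivative sqrt (2 * real n) * hermite_fun (n - 1) x - x * hermite_fun n x) (at x)"
  "sqrt (2 * real n) * hermite_fun (n - 1) x - x * hermite_fun n x = x * hermite_fun n x - sqrt (2 * real (Suc n)) * hermite_fun (Suc n) x"
proof -
  have p: "poly (pderiv (hermite_poly n)) x = sqrt (2 * real n) * poly (hermite_poly (n - 1)) x"
    by (simp add: hermite_lower)
  show "(hermite_fun n has_real_derivative sqrt (2 * real n) * hermite_fun (n - 1) x - x * hermite_fun n x) (at x)"
    using gauss_poly_deriv[of "hermite_poly n" x] unfolding p hermite_fun_eq by (simp add: algebra_simps)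
  have "2 * x * poly (hermite_poly n) x - poly (pderiv (hermite_poly n)) x = sqrt (2 * real (Suc n)) * poly (hermite_poly (Suc n)) x"
    using arg_cong[OF hermite_raise[of n], of "\<lambda>q. poly q x"] by (simp del: of_nat_Suc)
  then show "sqrt (2 * real n) * hermite_fun (n - 1) x - x * hermite_fun n x = x * hermite_fun n x - sqrt (2 * real (Suc n)) * hermite_fun (Suc n) x"
    unfolding p hermite_fun_eq by (simp add: algebra_simps del: of_nat_Suc) (simp only: distrib_left[symmetric] distrib_right[symmetric] mult.assoc[symmetric])
qed

lemma hermite_deriv2:
  "((\<lambda>x. sqrt (2 * real n) * hermite_fun (n - 1) x - x * hermite_fun n x) has_real_derivative
     (x\<^sup>2 - 2 * real n - 1) * hermite_fun n x) (at x)"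
proof (cases n)
  case 0
  show ?thesis unfolding 0
    by (auto intro!: derivative_eq_intros hermite_deriv(1) simp: power2_eq_square algebra_simps)
next
  case (Suc k)
  have dk: "(hermite_fun k has_real_derivative x * hermite_fun k x - sqrt (2 * real n) * hermite_fun n x) (at x)"
    using hermite_deriv(1)[of k x] unfolding hermite_deriv(2)[of k x] Suc .
  have dn: "(hermite_fun n has_real_derivative sqrt (2 * real n) * hermite_fun k x - x * hermite_fun n x) (at x)"
    using hermite_deriv(1)[of n x] Suc by simp
  have "((\<lambda>x. sqrt (2 * real n) * hermite_fun k x - x * hermite_fun n x) has_real_derivative
     (sqrt (2 * real n) * (x * hermite_fun k x - sqrt (2 * real n) * hermite_fun n x) - (hermite_fun n x + x * (sqrt (2 * real n) * hermite_fun k x - x * hermite_fun n x)))) (at x)"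
    by (rule derivative_eq_intros dk dn refl)+ simp
  moreover have "sqrt (2 * real n) * sqrt (2 * real n) = 2 * real n" by simp
  then have "(sqrt (2 * real n) * (x * hermite_fun k x - sqrt (2 * real n) * hermite_fun n x) - (hermite_fun n x + x * (sqrt (2 * real n) * hermite_fun k x - x * hermite_fun n x)))
     = (x\<^sup>2 - 2 * real n - 1) * hermite_fun n x"
    by (simp only: right_diff_distrib mult.assoc[symmetric]) (simp add: algebra_simps power2_eq_square)
  ultimately show ?thesis using Suc by (simp only: diff_Suc_1)
qed

section \<open>Operators, traces and the trace norm\<close>

interpretation config_prod: product_sigma_finite "\<lambda>_::nat. lborel :: real measure" by standard

lemma sigma_finite_config: "sigma_finite_measure (config m)"
  unfolding config_def by (rule config_prod.sigma_finite) simp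

section \<open>Inner product and norm\<close>

lemma L2D: "f \<in> L2 m \<Longrightarrow> f \<in> borel_measurable (config m)" "f \<in> L2 m \<Longrightarrow> integrable (config m) (\<lambda>x. (cmod (f x))\<^sup>2)"
  by (auto simp: L2_def)

lemma braket_integrable:
  assumes "f \<in> L2 m" "g \<in> L2 m"
  shows "integrable (config m) (\<lambda>x. cnj (f x) * g x)"
proof (rule Bochner_Integration.integrable_bound)
  show "integrable (config m) (\<lambda>x. ((cmod (f x))\<^sup>2 + (cmod (g x))\<^sup>2) / 2)"
    using L2D(2)[OF assms(1)] L2D(2)[OF assms(2)] by auto
  show "(\<lambda>x. cnj (f x) * g x) \<in> borel_measurable (config m)"
    using L2D(1)[OF assms(1)] L2D(1)[OF assms(2)]
    by (intro borel_measurable_times borel_measurable_continuous_on[of cnj] continuous_intros) auto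
  show "AE x in config m. cmod (cnj (f x) * g x) \<le> norm (((cmod (f x))\<^sup>2 + (cmod (g x))\<^sup>2) / 2)"
  proof (rule AE_I2)
    fix x
    show "cmod (cnj (f x) * g x) \<le> norm (((cmod (f x))\<^sup>2 + (cmod (g x))\<^sup>2) / 2)"
      using sum_squares_bound[of "cmod (f x)" "cmod (g x)"] by (simp add: norm_mult)
  qed
qed

lemma L2_lincomb:
  assumes "f \<in> L2 m" "g \<in> L2 m"
  shows "(\<lambda>x. a * f x + b * g x) \<in> L2 m"
proof -
  have m: "f \<in> borel_measurable (config m)" "g \<in> borel_measurable (config m)" using assms L2D by auto
  have "integrable (config m) (\<lambda>x. (cmod (a * f x + b * g x))\<^sup>2)"
  proof (rule Bochner_Integration.integrable_bound)
    show "integrable (config m) (\<lambda>x. 2 * ((cmod a)\<^sup>2 * (cmod (f x))\<^sup>2) + 2 * ((cmod b)\<^sup>2 * (cmod (g x))\<^sup>2))"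
      using L2D(2)[OF assms(1)] L2D(2)[OF assms(2)] by auto
    show "(\<lambda>x. (cmod (a * f x + b * g x))\<^sup>2) \<in> borel_measurable (config m)" using m by measurable
    have "(cmod (a * f x + b * g x))\<^sup>2 \<le> 2 * ((cmod a)\<^sup>2 * (cmod (f x))\<^sup>2) + 2 * ((cmod b)\<^sup>2 * (cmod (g x))\<^sup>2)" for x
    proof -
      have "(cmod (a * f x + b * g x))\<^sup>2 \<le> (cmod (a * f x) + cmod (b * g x))\<^sup>2"
        by (intro power_mono norm_triangle_ineq) auto
      also have "\<dots> \<le> 2 * (cmod (a * f x))\<^sup>2 + 2 * (cmod (b * g x))\<^sup>2"
        using sum_squares_bound[of "cmod (a * f x)" "cmod (b * g x)"] by (simp add: power2_sum)
      finally show ?thesis by (simp add: norm_mult power_mult_distrib)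
    qed
    then show "AE x in config m. norm ((cmod (a * f x + b * g x))\<^sup>2) \<le> norm (2 * ((cmod a)\<^sup>2 * (cmod (f x))\<^sup>2) + 2 * ((cmod b)\<^sup>2 * (cmod (g x))\<^sup>2))"
      by (auto simp: order_trans[OF _ abs_ge_self])
  qed
  then show ?thesis using m by (auto simp: L2_def)
qed

lemma L2_cmult: "f \<in> L2 m \<Longrightarrow> (\<lambda>x. a * f x) \<in> L2 m"
  using L2_lincomb[of f m f a 0] by simp

lemma L2_0: "(\<lambda>x. 0) \<in> L2 m"
  by (simp add: L2_def)

lemma L2_sum: "finite I \<Longrightarrow> (\<And>i. i \<in> I \<Longrightarrow> f i \<in> L2 m) \<Longrightarrow> (\<lambda>x. \<Sum>i\<in>I. a i * f i x) \<in> L2 m"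
proof (induction I rule: finite_induct)
  case (insert i I)
  then show ?case using L2_lincomb[of "f i" m "\<lambda>x. \<Sum>i\<in>I. a i * f i x" "a i" 1] by simp
qed (simp add: L2_0)

lemma braket_cnj: "cnj (braket m f g) = braket m g f"
  unfolding braket_def by (rule trans[OF Bochner_Integration.integral_cnj[symmetric]]) (simp add: mult.commute)

lemma braket_lincomb_right:
  assumes "f \<in> L2 m" "g \<in> L2 m" "h \<in> L2 m"
  shows "braket m h (\<lambda>x. a * f x + b * g x) = a * braket m h f + b * braket m h g"
proof -
  have "braket m h (\<lambda>x. a * f x + b * g x) = (LINT x|config m. a * (cnj (h x) * f x) + b * (cnj (h x) * g x))"
    unfolding braket_def by (simp add: algebra_simps)
  also have "\<dots> = (LINT x|config m. a * (cnj (h x) * f x)) + (LINT x|config m. b * (cnj (h x) * g x))"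
    using assms by (intro Bochner_Integration.integral_add integrable_mult_right braket_integrable)
  finally show ?thesis by (simp add: braket_def)
qed

lemma braket_cmult_left: "braket m (\<lambda>x. a * f x) h = cnj a * braket m f h"
  unfolding braket_def by (subst integral_mult_right_zero[symmetric]) (simp add: mult_ac)

lemma braket_lincomb_left:
  assumes "f \<in> L2 m" "g \<in> L2 m" "h \<in> L2 m"
  shows "braket m (\<lambda>x. a * f x + b * g x) h = cnj a * braket m f h + cnj b * braket m g h"
  using braket_lincomb_right[OF assms, of a b, THEN arg_cong[where f = cnj]] by (simp add: braket_cnj)

lemma braket_sum_right:
  assumes "finite I" "\<And>i. i \<in> I \<Longrightarrow> f i \<in> L2 m" "h \<in> L2 m"
  shows "braket m h (\<lambda>x. \<Sum>i\<in>I. a i * f i x) = (\<Sum>i\<in>I. a i * braket m h (f i))"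
  using assms
proof (induction I rule: finite_induct)
  case (insert i I)
  have "(\<lambda>x. \<Sum>i\<in>I. a i * f i x) \<in> L2 m" using insert by (intro L2_sum) auto
  then show ?case using insert braket_lincomb_right[of "f i" m "\<lambda>x. \<Sum>i\<in>I. a i * f i x" h "a i" 1] by simp
qed (simp add: braket_def)

lemma braket_self: "braket m f f = of_real ((L2norm m f)\<^sup>2)"
proof -
  have "braket m f f = (LINT x|config m. complex_of_real ((cmod (f x))\<^sup>2))"
    unfolding braket_def by (simp add: complex_norm_square mult.commute del: of_real_power)
  then show ?thesis unfolding integral_complex_of_real by (simp add: L2norm_def del: of_real_power)
qed

text \<open>The squared norm of N g - z f, the component of g orthogonal to f scaled by N, is
  nonnegative. Scaling by N avoids a division; for N = 0 the function f vanishes almost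
  everywhere.\<close>

lemma braket_bound:
  assumes "f \<in> L2 m" "g \<in> L2 m"
  shows "cmod (braket m f g) \<le> L2norm m f * L2norm m g"
proof -
  define N where "N = (L2norm m f)\<^sup>2"
  define z where "z = braket m f g"
  have h: "(\<lambda>x. of_real N * g x + (- z) * f x) \<in> L2 m" by (intro L2_lincomb assms)
  have e1: "braket m f f = of_real N" "braket m g g = of_real ((L2norm m g)\<^sup>2)" "braket m f g = z" "braket m g f = cnj z"
    by (simp_all add: braket_self N_def z_def braket_cnj)
  have e2: "braket m (\<lambda>x. of_real N * g x + (- z) * f x) (\<lambda>x. of_real N * g x + (- z) * f x)
     = of_real N * (of_real N * of_real ((L2norm m g)\<^sup>2) - cnj z * z) - z * (of_real N * cnj z - cnj z * of_real N)"
    unfolding braket_lincomb_right[OF assms(2,1) h] braket_lincomb_left[OF assms(2,1) assms(2)] braket_lincomb_left[OF assms(2,1) assms(1)] e1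
    by (simp add: algebra_simps)
  also have "\<dots> = of_real (N * (N * (L2norm m g)\<^sup>2 - (cmod z)\<^sup>2))"
    by (simp add: complex_norm_square[of z] algebra_simps del: of_real_power) 
  finally have "of_real ((L2norm m (\<lambda>x. of_real N * g x + (- z) * f x))\<^sup>2) = complex_of_real (N * (N * (L2norm m g)\<^sup>2 - (cmod z)\<^sup>2))"
    unfolding braket_self .
  then have "(L2norm m (\<lambda>x. of_real N * g x + (- z) * f x))\<^sup>2 = N * (N * (L2norm m g)\<^sup>2 - (cmod z)\<^sup>2)"
    by (simp only: of_real_eq_iff)
  then have "0 \<le> N * (N * (L2norm m g)\<^sup>2 - (cmod z)\<^sup>2)" by (metis zero_le_power2)
  show ?thesis
  proof (cases "N = 0")
    case True
    have "AE x in config m. (cmod (f x))\<^sup>2 = 0"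
    proof -
      have "(LINT x|config m. (cmod (f x))\<^sup>2) = 0" using True by (simp add: N_def L2norm_def)
      then show ?thesis using integral_nonneg_eq_0_iff_AE[OF L2D(2)[OF assms(1)]] by simp
    qed
    then have "AE x in config m. cnj (f x) * g x = 0" by eventually_elim simp
    then have "braket m f g = 0" unfolding braket_def by (rule integral_eq_zero_AE)
    then show ?thesis by (simp add: L2norm_def)
  next
    case False
    then have "N > 0" by (simp add: N_def)
    with \<open>0 \<le> N * (N * (L2norm m g)\<^sup>2 - (cmod z)\<^sup>2)\<close> have "(cmod z)\<^sup>2 \<le> (L2norm m f * L2norm m g)\<^sup>2"
      by (simp add: zero_le_mult_iff N_def power_mult_distrib)
    then show ?thesis unfolding z_def by (rule power2_le_imp_le) (simp add: L2norm_def)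
  qed
qed

lemma L2norm_triangle:
  assumes "f \<in> L2 m" "g \<in> L2 m"
  shows "L2norm m (\<lambda>x. a * f x + b * g x) \<le> cmod a * L2norm m f + cmod b * L2norm m g"
proof (rule power2_le_imp_le)
  define A where "A = cmod a * L2norm m f"
  define B where "B = cmod b * L2norm m g"
  have h: "(\<lambda>x. a * f x + b * g x) \<in> L2 m" by (intro L2_lincomb assms)
  define z where "z = braket m f g"
  have e1: "braket m f f = of_real ((L2norm m f)\<^sup>2)" "braket m g g = of_real ((L2norm m g)\<^sup>2)" "braket m f g = z" "braket m g f = cnj z"
    by (simp_all add: braket_self z_def braket_cnj)
  have "complex_of_real ((L2norm m (\<lambda>x. a * f x + b * g x))\<^sup>2) = braket m (\<lambda>x. a * f x + b * g x) (\<lambda>x. a * f x + b * g x)"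
    by (rule braket_self[symmetric])
  also have "\<dots> = a * (cnj a * of_real ((L2norm m f)\<^sup>2) + cnj b * cnj z) + b * (cnj a * z + cnj b * of_real ((L2norm m g)\<^sup>2))"
    unfolding braket_lincomb_right[OF assms h] braket_lincomb_left[OF assms assms(1)] braket_lincomb_left[OF assms assms(2)] e1 ..
  finally have "Re (complex_of_real ((L2norm m (\<lambda>x. a * f x + b * g x))\<^sup>2)) =
      Re (a * (cnj a * of_real ((L2norm m f)\<^sup>2) + cnj b * cnj z) + b * (cnj a * z + cnj b * of_real ((L2norm m g)\<^sup>2)))" by simp
  also have "\<dots> = (cmod a)\<^sup>2 * (L2norm m f)\<^sup>2 + (cmod b)\<^sup>2 * (L2norm m g)\<^sup>2 + 2 * Re (cnj a * b * z)"
    unfolding cmod_power2 by (simp add: power2_eq_square algebra_simps)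
  finally have "(L2norm m (\<lambda>x. a * f x + b * g x))\<^sup>2 = (cmod a)\<^sup>2 * (L2norm m f)\<^sup>2 + (cmod b)\<^sup>2 * (L2norm m g)\<^sup>2 + 2 * Re (cnj a * b * braket m f g)"
    by (simp only: Re_complex_of_real z_def)
  also have "Re (cnj a * b * braket m f g) \<le> cmod (cnj a * b * braket m f g)" by (rule complex_Re_le_cmod)
  also have "cmod (cnj a * b * braket m f g) \<le> cmod a * cmod b * (L2norm m f * L2norm m g)"
    unfolding norm_mult by (simp add: mult_left_mono braket_bound[OF assms])
  finally show "(L2norm m (\<lambda>x. a * f x + b * g x))\<^sup>2 \<le> (cmod a * L2norm m f + cmod b * L2norm m g)\<^sup>2"
    by (simp add: power2_sum power_mult_distrib algebra_simps)
qed (simp add: L2norm_def)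

section \<open>Bounded operators and finite mixtures of rank-one operators\<close>

lemma bounded_oper_lincomb:
  assumes "bounded_oper m A" "bounded_oper m B"
  shows "bounded_oper m (\<lambda>f x. a * A f x + b * B f x)"
proof -
  obtain CA where CA: "\<And>f. f \<in> L2 m \<Longrightarrow> L2norm m (A f) \<le> CA * L2norm m f" using assms(1) unfolding bounded_oper_def by blast
  obtain CB where CB: "\<And>f. f \<in> L2 m \<Longrightarrow> L2norm m (B f) \<le> CB * L2norm m f" using assms(2) unfolding bounded_oper_def by blast
  have in2: "A f \<in> L2 m" "B f \<in> L2 m" if "f \<in> L2 m" for f using assms that by (auto simp: bounded_oper_def)
  show ?thesis unfolding bounded_oper_def
  proof (intro conjI ballI allI)
    fix f assume "f \<in> L2 m" then show "(\<lambda>x. a * A f x + b * B f x) \<in> L2 m" by (intro L2_lincomb in2)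
  next
    fix f g c d assume fg: "f \<in> L2 m" "g \<in> L2 m"
    have "AE x in config m. A (\<lambda>u. c * f u + d * g u) x = c * A f x + d * A g x"
      "AE x in config m. B (\<lambda>u. c * f u + d * g u) x = c * B f x + d * B g x"
      using assms fg by (auto simp: bounded_oper_def)
    then show "AE x in config m. a * A (\<lambda>u. c * f u + d * g u) x + b * B (\<lambda>u. c * f u + d * g u) x =
       c * (a * A f x + b * B f x) + d * (a * A g x + b * B g x)"
      by eventually_elim (simp add: algebra_simps)
  next
    have "L2norm m (\<lambda>x. a * A f x + b * B f x) \<le> (cmod a * CA + cmod b * CB) * L2norm m f" if f: "f \<in> L2 m" for f
    proof -
      have "L2norm m (\<lambda>x. a * A f x + b * B f x) \<le> cmod a * L2norm m (A f) + cmod b * L2norm m (B f)"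
        by (intro L2norm_triangle in2 f)
      also have "\<dots> \<le> cmod a * (CA * L2norm m f) + cmod b * (CB * L2norm m f)"
        by (intro add_mono mult_left_mono CA CB f) auto
      finally show ?thesis by (simp add: algebra_simps)
    qed
    then show "\<exists>C. \<forall>f\<in>L2 m. L2norm m (\<lambda>x. a * A f x + b * B f x) \<le> C * L2norm m f" by blast
  qed
qed

definition rank1 :: "nat \<Rightarrow> wavefun \<Rightarrow> oper" where
  "rank1 m v f = (\<lambda>x. braket m v f * v x)"

lemma bounded_rank1:
  assumes "v \<in> L2 m" shows "bounded_oper m (rank1 m v)"
  unfolding bounded_oper_def
proof (intro conjI ballI allI)
  fix f assume "f \<in> L2 m" then show "rank1 m v f \<in> L2 m" unfolding rank1_def by (intro L2_cmult assms)
next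
  fix f g a b assume fg: "f \<in> L2 m" "g \<in> L2 m"
  show "AE x in config m. rank1 m v (\<lambda>u. a * f u + b * g u) x = a * rank1 m v f x + b * rank1 m v g x"
    unfolding rank1_def braket_lincomb_right[OF fg assms] by (simp add: algebra_simps)
next
  have "L2norm m (rank1 m v f) \<le> (L2norm m v)\<^sup>2 * L2norm m f" if "f \<in> L2 m" for f
  proof -
    have "L2norm m (rank1 m v f) \<le> cmod (braket m v f) * L2norm m v"
      using L2norm_triangle[OF assms assms, of "braket m v f" 0] by (simp add: rank1_def)
    also have "\<dots> \<le> (L2norm m v * L2norm m f) * L2norm m v"
      by (intro mult_right_mono braket_bound assms that) (simp add: L2norm_def)
    finally show ?thesis by (simp add: power2_eq_square algebra_simps)
  qed
  then show "\<exists>C. \<forall>f\<in>L2 m. L2norm m (rank1 m v f) \<le> C * L2norm m f" by blast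
qed

lemma bounded_sum:
  assumes "finite I" "\<And>i. i \<in> I \<Longrightarrow> bounded_oper m (A i)"
  shows "bounded_oper m (\<lambda>f x. \<Sum>i\<in>I. a i * A i f x)"
  using assms
proof (induction I rule: finite_induct)
  case empty
  have "\<exists>C. \<forall>f\<in>L2 m. L2norm m (\<lambda>x. 0) \<le> C * L2norm m f" by (intro exI[of _ 0]) (simp add: L2norm_def)
  then show ?case by (simp add: bounded_oper_def L2_0)
next
  case (insert i I)
  then show ?case using bounded_oper_lincomb[of m "A i" "\<lambda>f x. \<Sum>i\<in>I. a i * A i f x" "a i" 1] by simp
qed

definition mixture :: "nat \<Rightarrow> 'i set \<Rightarrow> ('i \<Rightarrow> real) \<Rightarrow> ('i \<Rightarrow> wavefun) \<Rightarrow> oper" where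
  "mixture m I c v f = (\<lambda>x. \<Sum>i\<in>I. of_real (c i) * rank1 m (v i) f x)"

lemma bounded_mixture: "finite I \<Longrightarrow> (\<And>i. i \<in> I \<Longrightarrow> v i \<in> L2 m) \<Longrightarrow> bounded_oper m (mixture m I c v)"
  unfolding mixture_def[abs_def] by (intro bounded_sum bounded_rank1)

lemma braket_mixture:
  assumes "finite I" "\<And>i. i \<in> I \<Longrightarrow> v i \<in> L2 m" "h \<in> L2 m"
  shows "braket m h (mixture m I c v f) = (\<Sum>i\<in>I. of_real (c i) * braket m (v i) f * braket m h (v i))"
  using braket_sum_right[OF assms(1) assms(2) assms(3), where a = "\<lambda>i. of_real (c i) * braket m (v i) f"]
  by (simp add: mixture_def rank1_def mult.assoc)

lemma braket_mixture_self:
  assumes "finite I" "\<And>i. i \<in> I \<Longrightarrow> v i \<in> L2 m" "f \<in> L2 m"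
  shows "braket m f (mixture m I c v f) = of_real (\<Sum>i\<in>I. c i * (cmod (braket m (v i) f))\<^sup>2)"
proof -
  have "braket m f (mixture m I c v f) = (\<Sum>i\<in>I. of_real (c i) * braket m (v i) f * braket m f (v i))"
    using assms by (intro braket_mixture)
  also have "\<dots> = (\<Sum>i\<in>I. of_real (c i * (cmod (braket m (v i) f))\<^sup>2))"
    by (intro sum.cong refl) (simp add: complex_norm_square braket_cnj mult.assoc del: of_real_power)
  finally show ?thesis by simp
qed

lemma positive_mixture:
  assumes "finite I" "\<And>i. i \<in> I \<Longrightarrow> v i \<in> L2 m" "\<And>i. i \<in> I \<Longrightarrow> 0 \<le> c i"
  shows "positive_oper m (mixture m I c v)"
  unfolding positive_oper_def
proof (intro conjI ballI)
  show "bounded_oper m (mixture m I c v)" using assms by (intro bounded_mixture)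
  fix f assume "f \<in> L2 m"
  then have "braket m f (mixture m I c v f) = of_real (\<Sum>i\<in>I. c i * (cmod (braket m (v i) f))\<^sup>2)"
    using assms by (intro braket_mixture_self)
  moreover have "0 \<le> (\<Sum>i\<in>I. c i * (cmod (braket m (v i) f))\<^sup>2)" using assms by (intro sum_nonneg) auto
  ultimately show "Im (braket m f (mixture m I c v f)) = 0" "0 \<le> Re (braket m f (mixture m I c v f))"
    by (simp_all only: Im_complex_of_real Re_complex_of_real)
qed

lemma infsum_ennreal_finite_support:
  assumes "finite F" "F \<subseteq> A" "\<And>x. x \<in> F \<Longrightarrow> 0 \<le> f x" "\<And>x. x \<in> A - F \<Longrightarrow> f x = 0"
  shows "(\<Sum>\<^sub>\<infinity>x\<in>A. ennreal (f x)) = ennreal (\<Sum>x\<in>F. f x)"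
proof -
  have "(\<Sum>\<^sub>\<infinity>x\<in>A. ennreal (f x)) = (\<Sum>\<^sub>\<infinity>x\<in>F. ennreal (f x))"
    using assms by (intro infsum_cong_neutral) auto
  also have "\<dots> = (\<Sum>x\<in>F. ennreal (f x))" using assms by simp
  also have "\<dots> = ennreal (\<Sum>x\<in>F. f x)" using assms by (intro sum_ennreal) auto
  finally show ?thesis .
qed

lemma quadratic_form_nonneg:
  fixes x y :: complex
  assumes "0 < A" "C\<^sup>2 \<le> A * B"
  shows "0 \<le> A * (cmod x)\<^sup>2 + B * (cmod y)\<^sup>2 - 2 * C * Re (cnj x * y)"
proof -
  have "A * (A * (cmod x)\<^sup>2 + B * (cmod y)\<^sup>2 - 2 * C * Re (cnj x * y))
     = (cmod (of_real A * x - of_real C * y))\<^sup>2 + (A * B - C\<^sup>2) * (cmod y)\<^sup>2"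
    unfolding cmod_power2 by (simp add: power2_eq_square algebra_simps)
  also have "\<dots> \<ge> 0" using assms by simp
  finally show ?thesis using assms(1) by (simp add: zero_le_mult_iff)
qed


lemma braket_fock_total_number:
  "total_number m (fock m n) x = of_nat (\<Sum>j<m. n j) * fock m n x"
proof -
  have "mode_number j (fock m n) x = of_nat (n j) * fock m n x" if j: "j < m" for j
  proof -
    define c where "c = (\<Prod>i\<in>{..<m} - {j}. hermite_fun (n i) (x i))"
    define h where "h = hermite_fun (n j)"
    define h1 where "h1 t = sqrt (2 * real (n j)) * hermite_fun (n j - 1) t - t * hermite_fun (n j) t" for t
    have split: "fock m n (x(j := t)) = complex_of_real (h t * c)" for t
    proof -
      have "(\<Prod>i<m. hermite_fun (n i) ((x(j := t)) i)) = h t * (\<Prod>i\<in>{..<m} - {j}. hermite_fun (n i) ((x(j := t)) i))"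
        using j by (subst prod.remove[of _ j]) (auto simp: h_def)
      also have "(\<Prod>i\<in>{..<m} - {j}. hermite_fun (n i) ((x(j := t)) i)) = c"
        unfolding c_def by (intro prod.cong) auto
      finally show ?thesis by (simp only: fock_def)
    qed
    have d1: "((\<lambda>t. complex_of_real (h t * c)) has_vector_derivative complex_of_real (h1 t * c)) (at t)" for t
    proof -
      have "((\<lambda>t. h t * c) has_real_derivative h1 t * c) (at t)"
        unfolding h_def h1_def by (intro DERIV_cmult_right hermite_deriv)
      then show ?thesis by (simp only: has_real_derivative_iff_has_vector_derivative has_vector_derivative_of_real)
    qed
    have d2: "((\<lambda>t. complex_of_real (h1 t * c)) has_vector_derivative complex_of_real ((t\<^sup>2 - 2 * real (n j) - 1) * h t * c)) (at t)" for t
    proof -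
      have "((\<lambda>t. h1 t * c) has_real_derivative (t\<^sup>2 - 2 * real (n j) - 1) * h t * c) (at t)"
        unfolding h_def h1_def by (intro DERIV_cmult_right hermite_deriv2)
      then show ?thesis by (simp only: has_real_derivative_iff_has_vector_derivative has_vector_derivative_of_real)
    qed
    have p1: "p_op j (fock m n) (x(j := t)) = - \<i> * complex_of_real (h1 t * c)" for t
    proof -
      have "(\<lambda>s. fock m n ((x(j := t))(j := s))) = (\<lambda>s. complex_of_real (h s * c))" by (simp add: split)
      then show ?thesis unfolding p_op_def using vector_derivative_at[OF d1[of t]] by simp
    qed
    have p2: "p_op j (p_op j (fock m n)) x = - complex_of_real (((x j)\<^sup>2 - 2 * real (n j) - 1) * h (x j) * c)"
    proof -
      have "((\<lambda>t. - \<i> * complex_of_real (h1 t * c)) has_vector_derivative - \<i> * complex_of_real (((x j)\<^sup>2 - 2 * real (n j) - 1) * h (x j) * c)) (at (x j))"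
        by (rule has_vector_derivative_mult_right[OF d2])
      then have "vector_derivative (\<lambda>t. p_op j (fock m n) (x(j := t))) (at (x j)) = - \<i> * complex_of_real (((x j)\<^sup>2 - 2 * real (n j) - 1) * h (x j) * c)"
        unfolding p1 by (rule vector_derivative_at)
      then show ?thesis by (subst p_op_def) simp
    qed
    have f: "fock m n x = complex_of_real (h (x j) * c)" using split[of "x j"] by simp
    show ?thesis unfolding mode_number_def p2 unfolding q_op_def f
      by (simp add: power2_eq_square algebra_simps)
  qed
  then show ?thesis by (simp add: total_number_def sum_distrib_right)
qed

text \<open>The difference of the state and the vacuum has exactly one negative eigenvalue. Its absolute value is
  therefore the difference plus a multiple of one rank-one projection, which yields its trace.\<close>
lemma trace_norm_rank1_perturbation:
  fixes I :: "'i set" and m :: nat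
  defines "f0 \<equiv> fock m (\<lambda>_. 0)"
  assumes I: "finite I" "i0 \<in> I" "\<And>i. i \<in> I \<Longrightarrow> 0 \<le> lam i" "\<And>i. i \<in> I \<Longrightarrow> v i \<in> L2 m"
    and f0: "f0 \<in> L2 m" "braket m f0 f0 = 1"
    and orth: "\<And>i. i \<in> I \<Longrightarrow> braket m (v i0) (v i) = (if i = i0 then 1 else 0)"
    and over: "\<And>i. i \<in> I \<Longrightarrow> braket m f0 (v i) = (if i = i0 then of_real c else 0)"
    and c: "0 < c" "c < 1" and w: "0 < lam i0" "lam i0 \<le> 1"
    and F: "finite F" "F \<subseteq> fock_index m" "z \<in> F" "fock m z = f0"
    and fock: "\<And>n. n \<in> fock_index m \<Longrightarrow> fock m n \<in> L2 m"
      "\<And>n. n \<in> fock_index m \<Longrightarrow> braket m f0 (fock m n) = (if n = z then 1 else 0)"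
    and coef: "\<And>i n. i \<in> I \<Longrightarrow> n \<in> fock_index m \<Longrightarrow> braket m (v i) (fock m n) = of_real (phi i n)"
      "\<And>i n. i \<in> I \<Longrightarrow> n \<in> fock_index m - F \<Longrightarrow> phi i n = 0"
      "(\<Sum>n\<in>F. (phi i0 n)\<^sup>2) = 1" "(\<Sum>n\<in>F. \<Sum>i\<in>I. lam i * (phi i n)\<^sup>2) = 1"
  shows "trace_dist m (mixture m I lam v) (vacuum m) \<le> ennreal ((1 - lam i0) + sqrt (1 - c\<^sup>2))"
proof -
  define w where "w = lam i0"
  have w01: "0 < w" "w \<le> 1" using w by (auto simp: w_def)
  have c2: "c\<^sup>2 < 1" using c by (simp add: power_less_one_iff abs_square_less_1)
  \<comment> \<open>On the span of \<open>v i0\<close> and \<open>f0\<close> the difference is w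
    |v><v| - |f0><f0| with overlap c; it has trace w - 1 and determinant - w (1 - c^2). So
    \<open>disc\<close> is the discriminant of its characteristic polynomial and - l is the negative
    eigenvalue.\<close>
  define disc where "disc = (1 - w)\<^sup>2 + 4 * (w * (1 - c\<^sup>2))"
  define D where "D = sqrt disc"
  have disc0: "disc > 0" using w01 c2 by (auto simp: disc_def intro!: add_nonneg_pos mult_pos_pos)
  have D: "D > 0" "D\<^sup>2 = disc" using disc0 by (auto simp: D_def)
  define l where "l = ((1 - w) + D) / 2"
  have l0: "l > 0" using D w01 by (simp add: l_def)
  have leq: "l\<^sup>2 + (w - 1) * l = w * (1 - c\<^sup>2)"
  proof -
    have "4 * (l\<^sup>2 + (w - 1) * l) = D\<^sup>2 - (1 - w)\<^sup>2" by (simp add: l_def power2_eq_square field_simps)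
    then show ?thesis unfolding D disc_def by simp
  qed
  \<comment> \<open>Coordinates of an eigenvector for - l; q is defined so that its squared norm is
    l q.\<close>
  define al be where "al = - w * c" and "be = w + l"
  define q where "q = be\<^sup>2 - w * c\<^sup>2"
  have q: "q = be * D"
  proof -
    have "q = (w + l)\<^sup>2 - w + w * (1 - c\<^sup>2)" by (simp add: q_def be_def algebra_simps)
    also have "\<dots> = (w + l) * (w + 2 * l - 1)" unfolding leq[symmetric] by (simp add: power2_eq_square algebra_simps)
    finally show ?thesis by (simp add: be_def l_def field_simps)
  qed
  have q0: "q > 0" using q D w01 l0 by (simp add: be_def)
  \<comment> \<open>The rank-one operator of the eigenvector times 2 / q is 2 l times the projection
    on it, so adding it flips the eigenvalue - l to l.\<close>
  define ka where "ka = 2 / q"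
  define vv where "vv x = of_real al * v i0 x + of_real be * f0 x" for x
  have v0: "v i0 \<in> L2 m" using I by auto
  have vL: "vv \<in> L2 m" unfolding vv_def[abs_def] by (intro L2_lincomb v0 f0)
  define A where "A f = (\<lambda>x. mixture m I lam v f x - vacuum m f x)" for f
  have bv: "braket m vv g = of_real al * braket m (v i0) g + of_real be * braket m f0 g" if "g \<in> L2 m" for g
    unfolding vv_def[abs_def] by (subst braket_lincomb_left[OF v0 f0(1) that]) simp
  have vac: "vacuum m = rank1 m f0" by (simp add: vacuum_def rank1_def f0_def fun_eq_iff)
  have bm: "bounded_oper m (mixture m I lam v)" using I by (intro bounded_mixture)
  have bA: "bounded_oper m A"
    using bounded_oper_lincomb[OF bm bounded_rank1[OF f0(1)], of 1 "-1"] by (simp add: A_def[abs_def] vac)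
  have AL: "A f \<in> L2 m" "mixture m I lam v f \<in> L2 m" if "f \<in> L2 m" for f
    using bA bm that unfolding bounded_oper_def by blast+
  have bA_right: "braket m h (A f) = braket m h (mixture m I lam v f) - braket m f0 f * braket m h f0"
    if "f \<in> L2 m" "h \<in> L2 m" for f h
    using braket_lincomb_right[OF AL(2)[OF that(1)] f0(1) that(2), of 1 "- braket m f0 f"]
    by (simp add: A_def vac rank1_def)
  have eig: "braket m vv (A g) = - of_real l * braket m vv g" if g: "g \<in> L2 m" for g
  proof -
    have m1: "braket m (v i0) (mixture m I lam v g) = of_real w * braket m (v i0) g"
    proof -
      have "braket m (v i0) (mixture m I lam v g) = (\<Sum>i\<in>I. of_real (lam i) * braket m (v i) g * braket m (v i0) (v i))"
        using I v0 by (intro braket_mixture)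
      also have "\<dots> = (\<Sum>i\<in>I. if i = i0 then of_real (lam i) * braket m (v i) g else 0)"
        by (intro sum.cong refl) (auto simp: orth)
      finally show ?thesis using I by (simp add: w_def)
    qed
    have m2: "braket m f0 (mixture m I lam v g) = of_real (w * c) * braket m (v i0) g"
    proof -
      have "braket m f0 (mixture m I lam v g) = (\<Sum>i\<in>I. of_real (lam i) * braket m (v i) g * braket m f0 (v i))"
        using I f0 by (intro braket_mixture)
      also have "\<dots> = (\<Sum>i\<in>I. if i = i0 then of_real (lam i) * braket m (v i) g * of_real c else 0)"
        by (intro sum.cong refl) (auto simp: over)
      finally show ?thesis using I by (simp add: w_def mult_ac)
    qed
    have vf: "braket m (v i0) f0 = of_real c"
      using over[OF I(2)] braket_cnj[of m f0 "v i0"] by simp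
    have "braket m vv (A g) = of_real al * (of_real w * braket m (v i0) g - braket m f0 g * of_real c)
       + of_real be * (of_real (w * c) * braket m (v i0) g - braket m f0 g)"
      unfolding bv[OF AL(1)[OF g]] bA_right[OF g v0] bA_right[OF g f0(1)] m1 m2 vf f0(2) by simp
    also have "\<dots> = of_real (w * (al + be * c)) * braket m (v i0) g - of_real (al * c + be) * braket m f0 g"
      by (simp add: algebra_simps)
    also have "w * (al + be * c) = - l * al" by (simp add: al_def be_def algebra_simps)
    also have "al * c + be = l * be"
      using leq by (simp add: al_def be_def power2_eq_square algebra_simps)
    finally have e: "braket m vv (A g) = of_real (- l * al) * braket m (v i0) g - of_real (l * be) * braket m f0 g" .
    show ?thesis unfolding e bv[OF g] by (simp add: algebra_simps)
  qed
  have nv: "braket m vv vv = of_real (l * q)"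
  proof -
    have "braket m vv vv = of_real al * braket m (v i0) vv + of_real be * braket m f0 vv" by (rule bv[OF vL])
    also have "braket m (v i0) vv = of_real (al + be * c)"
      unfolding vv_def[abs_def] using braket_lincomb_right[OF v0 f0(1) v0, of "of_real al" "of_real be"] orth[OF I(2)] over[OF I(2)]
        braket_cnj[of m f0 "v i0"] by simp
    also have "braket m f0 vv = of_real (al * c + be)"
      unfolding vv_def[abs_def] using braket_lincomb_right[OF v0 f0(1) f0(1), of "of_real al" "of_real be"] over[OF I(2)] f0(2) by simp
    also have "of_real al * of_real (al + be * c) + of_real be * of_real (al * c + be) = complex_of_real (al * (al + be * c) + be * (al * c + be))" by simp
    also have "al * c + be = l * be"
      using leq by (simp add: al_def be_def power2_eq_square algebra_simps)
    also have "al * (al + be * c) + be * (l * be) = l * q"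
      by (simp add: q_def al_def be_def power2_eq_square algebra_simps)
    finally show ?thesis .
  qed
  define P where "P f = (\<lambda>x. A f x + of_real ka * rank1 m vv f x)" for f
  have bP: "bounded_oper m P"
    using bounded_oper_lincomb[OF bA bounded_rank1[OF vL], of 1 "of_real ka"] by (simp add: P_def[abs_def])
  have PL: "P f \<in> L2 m" if "f \<in> L2 m" for f using bP that unfolding bounded_oper_def by blast
  have Pf: "braket m f (P f) = of_real ((\<Sum>i\<in>I. lam i * (cmod (braket m (v i) f))\<^sup>2) - (cmod (braket m f0 f))\<^sup>2 + ka * (cmod (braket m vv f))\<^sup>2)"
    if f: "f \<in> L2 m" for f
  proof -
    have "braket m f (P f) = braket m f (A f) + of_real ka * (braket m vv f * braket m f vv)"
      using braket_lincomb_right[OF AL(1)[OF f] vL f, of 1 "of_real ka * braket m vv f"]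
      by (simp add: P_def rank1_def mult.assoc)
    also have "braket m f (A f) = of_real (\<Sum>i\<in>I. lam i * (cmod (braket m (v i) f))\<^sup>2) - braket m f0 f * braket m f f0"
      unfolding bA_right[OF f f] using braket_mixture_self[OF I(1) I(4) f, where c = lam] by simp
    also have "braket m f0 f * braket m f f0 = of_real ((cmod (braket m f0 f))\<^sup>2)"
      unfolding complex_norm_square braket_cnj ..
    also have "braket m vv f * braket m f vv = of_real ((cmod (braket m vv f))\<^sup>2)"
      unfolding complex_norm_square braket_cnj ..
    finally show ?thesis by simp
  qed
  \<comment> \<open>Of the mixture only the term \<open>i0\<close> is kept. What remains is a
    quadratic form in the two overlaps x and y, and its determinant equals w.\<close>
  have pos: "0 \<le> (\<Sum>i\<in>I. lam i * (cmod (braket m (v i) f))\<^sup>2) - (cmod (braket m f0 f))\<^sup>2 + ka * (cmod (braket m vv f))\<^sup>2"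
    if f: "f \<in> L2 m" for f
  proof -
    define x y where "x = braket m (v i0) f" and "y = braket m f0 f"
    have "w * (cmod x)\<^sup>2 \<le> (\<Sum>i\<in>I. lam i * (cmod (braket m (v i) f))\<^sup>2)"
      unfolding w_def x_def using I by (intro member_le_sum) auto
    moreover have "0 \<le> (w + ka * al\<^sup>2) * (cmod x)\<^sup>2 + (ka * be\<^sup>2 - 1) * (cmod y)\<^sup>2 - 2 * (- ka * al * be) * Re (cnj x * y)"
    proof (rule quadratic_form_nonneg)
      show "0 < w + ka * al\<^sup>2" using w01 q0 by (intro add_pos_nonneg) (auto simp: ka_def)
      have "ka * q = 2" using q0 by (simp add: ka_def)
      then have kb: "ka * be\<^sup>2 = 2 + ka * w * c\<^sup>2" by (simp add: q_def algebra_simps)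
      have "(w + ka * al\<^sup>2) * (ka * be\<^sup>2 - 1) - (- ka * al * be)\<^sup>2 = w * (ka * be\<^sup>2) - w - ka * al\<^sup>2"
        by (simp add: power2_eq_square algebra_simps)
      also have "\<dots> = w" unfolding kb by (simp add: al_def power2_eq_square algebra_simps)
      finally show "(- ka * al * be)\<^sup>2 \<le> (w + ka * al\<^sup>2) * (ka * be\<^sup>2 - 1)" using w01 by linarith
    qed
    moreover have "(cmod (braket m vv f))\<^sup>2 = al\<^sup>2 * (cmod x)\<^sup>2 + be\<^sup>2 * (cmod y)\<^sup>2 + 2 * (al * be) * Re (cnj x * y)"
      unfolding bv[OF f] x_def[symmetric] y_def[symmetric] cmod_power2 by (simp add: power2_eq_square algebra_simps)
    ultimately show ?thesis unfolding y_def[symmetric] by (simp add: algebra_simps)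
  qed
  have absP: "is_abs_oper m A P"
    unfolding is_abs_oper_def positive_oper_def
  proof (intro conjI ballI bP)
    fix f assume f: "f \<in> L2 m"
    show "Im (braket m f (P f)) = 0" unfolding Pf[OF f] by (rule Im_complex_of_real)
    show "0 \<le> Re (braket m f (P f))" unfolding Pf[OF f] using pos[OF f] by (simp only: Re_complex_of_real)
  next
    fix f g assume f: "f \<in> L2 m" and g: "g \<in> L2 m"
    define s t where "s = of_real ka * braket m vv f" and "t = of_real ka * braket m vv g"
    have PfL: "P f = (\<lambda>x. 1 * A f x + s * vv x)" "P g = (\<lambda>x. 1 * A g x + t * vv x)"
      by (simp_all add: P_def rank1_def s_def t_def mult.assoc)
    have e: "braket m (A f) vv = - of_real l * cnj (braket m vv f)"
      using arg_cong[OF eig[OF f], of cnj] by (simp add: braket_cnj)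
    have "braket m (P f) (P g) = braket m (P f) (A g) + t * braket m (P f) vv"
      unfolding PfL(2) using braket_lincomb_right[OF AL(1)[OF g] vL PL[OF f], of 1 t] by simp
    also have "braket m (P f) (A g) = braket m (A f) (A g) + cnj s * braket m vv (A g)"
      unfolding PfL(1) using braket_lincomb_left[OF AL(1)[OF f] vL AL(1)[OF g], of 1 s] by simp
    also have "braket m (P f) vv = braket m (A f) vv + cnj s * braket m vv vv"
      unfolding PfL(1) using braket_lincomb_left[OF AL(1)[OF f] vL vL, of 1 s] by simp
    also have "braket m (A f) (A g) + cnj s * braket m vv (A g) + t * (braket m (A f) vv + cnj s * braket m vv vv)
       = braket m (A f) (A g) + of_real (ka * (ka * (l * q) - 2 * l)) * cnj (braket m vv f) * braket m vv g"
      unfolding e eig[OF g] nv s_def t_def by (simp add: algebra_simps)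
    also have "ka * (l * q) - 2 * l = 0" using q0 by (simp add: ka_def)
    finally show "braket m (P f) (P g) = braket m (A f) (A g)" by simp
  qed
  define d where "d n = (\<Sum>i\<in>I. lam i * (phi i n)\<^sup>2) - (if n = z then 1 else 0) + ka * (al * phi i0 n + be * (if n = z then 1 else 0))\<^sup>2" for n
  have Pn: "braket m (fock m n) (P (fock m n)) = of_real (d n)" if n: "n \<in> fock_index m" for n
  proof -
    have "(\<Sum>i\<in>I. lam i * (cmod (braket m (v i) (fock m n)))\<^sup>2) = (\<Sum>i\<in>I. lam i * (phi i n)\<^sup>2)"
      by (intro sum.cong refl) (simp add: coef(1) n)
    moreover have "cmod (braket m vv (fock m n)) = \<bar>al * phi i0 n + be * (if n = z then 1 else 0)\<bar>"
    proof -
      have "braket m vv (fock m n) = of_real (al * phi i0 n + be * (if n = z then 1 else 0))"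
        unfolding bv[OF fock(1)[OF n]] using coef(1)[OF I(2) n] fock(2)[OF n] by simp
      then show ?thesis by (simp only: norm_of_real)
    qed
    ultimately show ?thesis unfolding Pf[OF fock(1)[OF n]] d_def using fock(2)[OF n] by simp
  qed
  have d0: "0 \<le> d n" if "n \<in> fock_index m" for n
    using pos[OF fock(1)[OF that]] Pn[OF that] unfolding Pf[OF fock(1)[OF that]] by (simp only: of_real_eq_iff)
  have "trace_pos m P = (\<Sum>\<^sub>\<infinity>n\<in>fock_index m. ennreal (d n))"
    unfolding trace_pos_def by (intro infsum_cong) (simp add: Pn)
  also have "\<dots> = ennreal (\<Sum>n\<in>F. d n)"
  proof (rule infsum_ennreal_finite_support[OF F(1,2)])
    show "0 \<le> d n" if "n \<in> F" for n using d0 F(2) that by auto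
    show "d n = 0" if "n \<in> fock_index m - F" for n
      using coef(2)[OF _ that] that F(3) I(2) by (auto simp: d_def)
  qed
  \<comment> \<open>The difference of two states has trace 0, so only the added part 2 l
    remains.\<close>
  also have "(\<Sum>n\<in>F. d n) = 2 * l"
  proof -
    have "z \<in> fock_index m" using F by auto
    then have pz: "phi i0 z = c"
      using coef(1)[OF I(2), of z] over[OF I(2)] braket_cnj[of m f0 "v i0"] unfolding F(4) by simp
    have "(\<Sum>n\<in>F. (al * phi i0 n + be * (if n = z then 1 else 0))\<^sup>2)
       = (\<Sum>n\<in>F. al\<^sup>2 * (phi i0 n)\<^sup>2 + (if n = z then 2 * al * be * phi i0 n + be\<^sup>2 else 0))"
      by (intro sum.cong refl) (simp add: power2_eq_square algebra_simps)
    also have "\<dots> = al\<^sup>2 * 1 + (2 * al * be * c + be\<^sup>2)"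
      unfolding sum.distrib sum_distrib_left[symmetric] coef(3) using F(1,3) pz by simp
    also have "\<dots> = al * (al + be * c) + be * (al * c + be)" by (simp add: power2_eq_square algebra_simps)
    also have "al * c + be = l * be"
      using leq by (simp add: al_def be_def power2_eq_square algebra_simps)
    also have "al * (al + be * c) + be * (l * be) = l * q"
      by (simp add: q_def al_def be_def power2_eq_square algebra_simps)
    finally have s: "(\<Sum>n\<in>F. (al * phi i0 n + be * (if n = z then 1 else 0))\<^sup>2) = l * q" .
    have "(\<Sum>n\<in>F. d n) = 1 - 1 + ka * (l * q)"
      unfolding d_def sum.distrib sum_subtractf sum_distrib_left[symmetric] s coef(4) using F(1,3) by simp
    then show ?thesis using q0 by (simp add: ka_def)
  qed
  finally have tr: "trace_pos m P = ennreal (2 * l)" .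
  \<comment> \<open>The trace norm is an infimum over absolute values, so one of them suffices for
    an upper bound.\<close>
  have "trace_norm m A \<le> ennreal (2 * l)"
    unfolding trace_norm_def tr[symmetric] using absP by (intro INF_lower) auto
  then have "trace_dist m (mixture m I lam v) (vacuum m) \<le> ennreal (2 * l) / 2"
    unfolding trace_dist_def A_def[abs_def] by (intro divide_right_mono_ennreal)
  also have "ennreal (2 * l) / 2 = ennreal l"
    using divide_ennreal[of "2 * l" 2] l0 by simp
  also have "l \<le> (1 - w) + sqrt (1 - c\<^sup>2)"
  proof -
    have "disc \<le> ((1 - w) + 2 * sqrt (1 - c\<^sup>2))\<^sup>2"
    proof -
      define S where "S = sqrt (1 - c\<^sup>2)"
      have S: "0 \<le> S" "S\<^sup>2 = 1 - c\<^sup>2" using c2 by (auto simp: S_def)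
      have "w * S\<^sup>2 \<le> 1 * S\<^sup>2" using w01 by (intro mult_right_mono) auto
      then have "disc \<le> (1 - w)\<^sup>2 + 4 * S\<^sup>2" unfolding disc_def S(2)[symmetric] by simp
      also have "\<dots> \<le> (1 - w)\<^sup>2 + 4 * S\<^sup>2 + 4 * ((1 - w) * S)" using w01 S by simp
      also have "\<dots> = ((1 - w) + 2 * S)\<^sup>2" by (simp add: power2_eq_square algebra_simps)
      finally show ?thesis unfolding S_def .
    qed
    then have "D \<le> \<bar>(1 - w) + 2 * sqrt (1 - c\<^sup>2)\<bar>" unfolding D_def by (metis real_sqrt_abs real_sqrt_le_iff)
    then show ?thesis using w01 c2 by (simp add: l_def)
  qed
  finally show ?thesis by (simp add: w_def ennreal_leI)
qed

section \<open>The product state\<close>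

definition product_fun :: "nat \<Rightarrow> (nat \<Rightarrow> real \<Rightarrow> real) \<Rightarrow> wavefun" where
  "product_fun m g = (\<lambda>x. complex_of_real (\<Prod>j<m. g j (x j)))"

lemma fock_product_fun: "fock m n = product_fun m (\<lambda>j. hermite_fun (n j))"
  by (simp add: fock_def product_fun_def)

lemma product_fun_measurable:
  assumes "\<And>j. j < m \<Longrightarrow> g j \<in> borel_measurable borel"
  shows "product_fun m g \<in> borel_measurable (config m)"
proof -
  have "(\<lambda>x. g j (x j)) \<in> borel_measurable (Pi\<^sub>M {..<m} (\<lambda>_. lborel))" if "j < m" for j
    using assms[OF that] that by (intro measurable_compose[OF measurable_component_singleton]) auto
  then have "(\<lambda>x. \<Prod>j<m. g j (x j)) \<in> borel_measurable (config m)" unfolding config_def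
    by (intro borel_measurable_prod) auto
  then show ?thesis unfolding product_fun_def
    by (intro borel_measurable_continuous_on[of complex_of_real] continuous_intros)
qed

lemma product_fun_L2:
  assumes "\<And>j. j < m \<Longrightarrow> g j \<in> borel_measurable borel" "\<And>j. j < m \<Longrightarrow> integrable lborel (\<lambda>x. g j x * g j x)"
  shows "product_fun m g \<in> L2 m"
proof -
  have "integrable (Pi\<^sub>M {..<m} (\<lambda>_. lborel)) (\<lambda>x. \<Prod>j\<in>{..<m}. (\<lambda>y. g j y * g j y) (x j))"
    using assms by (intro config_prod.product_integrable_prod) auto
  moreover have "(\<lambda>x. \<Prod>j\<in>{..<m}. (\<lambda>y. g j y * g j y) (x j)) = (\<lambda>x. (cmod (product_fun m g x))\<^sup>2)"
    by (auto simp: product_fun_def power2_eq_square prod.distrib fun_eq_iff simp del: of_real_prod)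
  ultimately show ?thesis using product_fun_measurable[OF assms(1)] by (simp add: L2_def config_def)
qed

lemma braket_product_fun:
  assumes "\<And>j. j < m \<Longrightarrow> integrable lborel (\<lambda>x. g j x * h j x)"
  shows "braket m (product_fun m g) (product_fun m h) = of_real (\<Prod>j<m. LINT x|lborel. g j x * h j x)"
proof -
  have "integral\<^sup>L (Pi\<^sub>M {..<m} (\<lambda>_. lborel)) (\<lambda>x. \<Prod>j\<in>{..<m}. (\<lambda>y. g j y * h j y) (x j)) = (\<Prod>j<m. LINT x|lborel. g j x * h j x)"
    using assms by (intro config_prod.product_integral_prod) auto
  moreover have "cnj (product_fun m g x) * product_fun m h x = complex_of_real (\<Prod>j\<in>{..<m}. (\<lambda>y. g j y * h j y) (x j))" for x
    by (simp add: product_fun_def prod.distrib)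
  ultimately show ?thesis by (simp only: braket_def config_def integral_complex_of_real)
qed

lemma hermite_measurable [measurable]: "hermite_fun n \<in> borel_measurable borel"
  unfolding hermite_fun_eq by (intro borel_measurable_continuous_onI continuous_intros) auto

text \<open>Converts a sum over the set S of modes that are in |K> into a product over the modes; it
  factorises both the diagonal and the kernel of the tensor power.\<close>

lemma sum_Pow_prod:
  fixes f g :: "'a \<Rightarrow> 'b :: comm_semiring_1"
  assumes "finite A"
  shows "(\<Sum>S\<in>Pow A. \<Prod>j\<in>A. if j \<in> S then f j else g j) = (\<Prod>j\<in>A. f j + g j)"
proof -
  have "(\<Prod>j\<in>A. if j \<in> S then f j else g j) = (\<Prod>j\<in>S. f j) * (\<Prod>j\<in>A - S. g j)" if "S \<in> Pow A" for S
  proof -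
    have "A \<inter> {j. j \<in> S} = S" "A \<inter> - {j. j \<in> S} = A - S" using that by auto
    then show ?thesis using prod.If_cases[OF assms, of "\<lambda>j. j \<in> S" f g] by (simp only:)
  qed
  then show ?thesis unfolding prod_add[OF assms] by (intro sum.cong refl)
qed

section \<open>The two components of one mode and their number-state coefficients\<close>

definition superpos :: "real \<Rightarrow> nat \<Rightarrow> real \<Rightarrow> real" where
  "superpos \<eta> k x = sqrt (1 - \<eta>) * hermite_fun 0 x + sqrt \<eta> * hermite_fun k x"

definition mode_state :: "real \<Rightarrow> nat \<Rightarrow> nat \<Rightarrow> bool \<Rightarrow> real \<Rightarrow> real" where
  "mode_state \<eta> k K b = (if b then hermite_fun K else superpos \<eta> k)"

definition mode_coef :: "real \<Rightarrow> nat \<Rightarrow> nat \<Rightarrow> bool \<Rightarrow> nat \<Rightarrow> real" where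
  "mode_coef \<eta> k K b n = (if b then (if n = K then 1 else 0)
     else (if n = 0 then sqrt (1 - \<eta>) else if n = k then sqrt \<eta> else 0))"

lemma mode_state_measurable [measurable]: "mode_state \<eta> k K b \<in> borel_measurable borel"
  by (cases b) (simp_all add: mode_state_def superpos_def[abs_def])

lemma mode_state_hermite:
  assumes "0 < k"
  shows "integrable lborel (\<lambda>x. mode_state \<eta> k K b x * hermite_fun n x)"
    "(LINT x|lborel. mode_state \<eta> k K b x * hermite_fun n x) = mode_coef \<eta> k K b n"
proof -
  have e: "mode_state \<eta> k K False x * hermite_fun n x =
      sqrt (1 - \<eta>) * (hermite_fun 0 x * hermite_fun n x) + sqrt \<eta> * (hermite_fun k x * hermite_fun n x)" for x
    by (simp add: mode_state_def superpos_def algebra_simps)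
  show "integrable lborel (\<lambda>x. mode_state \<eta> k K b x * hermite_fun n x)"
  proof (cases b)
    case True
    then show ?thesis by (simp add: mode_state_def hermite_orthonormal)
  next
    case False
    then have b: "b = False" by simp
    show ?thesis unfolding b e
      by (intro Bochner_Integration.integrable_add integrable_mult_right hermite_orthonormal)
  qed
  show "(LINT x|lborel. mode_state \<eta> k K b x * hermite_fun n x) = mode_coef \<eta> k K b n"
  proof (cases b)
    case True
    then show ?thesis by (auto simp: mode_state_def mode_coef_def hermite_orthonormal)
  next
    case False
    have "(LINT x|lborel. sqrt (1 - \<eta>) * (hermite_fun 0 x * hermite_fun n x) + sqrt \<eta> * (hermite_fun k x * hermite_fun n x))
       = (LINT x|lborel. sqrt (1 - \<eta>) * (hermite_fun 0 x * hermite_fun n x)) + (LINT x|lborel. sqrt \<eta> * (hermite_fun k x * hermite_fun n x))"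
      by (intro Bochner_Integration.integral_add integrable_mult_right hermite_orthonormal)
    also have "\<dots> = mode_coef \<eta> k K False n"
      using assms by (auto simp: hermite_orthonormal mode_coef_def)
    finally show ?thesis using False by (simp add: e)
  qed
qed

lemma mode_state_ip:
  assumes "0 < k" "k < K" "0 \<le> \<eta>" "\<eta> \<le> 1"
  shows "integrable lborel (\<lambda>x. mode_state \<eta> k K b x * mode_state \<eta> k K b' x)"
    "(LINT x|lborel. mode_state \<eta> k K b x * mode_state \<eta> k K b' x) = (if b = b' then 1 else 0)"
proof -
  have e: "mode_state \<eta> k K b x * mode_state \<eta> k K b' x = (if b' then mode_state \<eta> k K b x * hermite_fun K x
     else sqrt (1 - \<eta>) * (mode_state \<eta> k K b x * hermite_fun 0 x) + sqrt \<eta> * (mode_state \<eta> k K b x * hermite_fun k x))" for x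
    by (simp add: mode_state_def superpos_def algebra_simps)
  note i = mode_state_hermite(1)[OF assms(1), of \<eta> K b]
  show "integrable lborel (\<lambda>x. mode_state \<eta> k K b x * mode_state \<eta> k K b' x)"
    unfolding e by (cases b') (auto simp only: if_True if_False intro!: Bochner_Integration.integrable_add integrable_mult_right i)
  show "(LINT x|lborel. mode_state \<eta> k K b x * mode_state \<eta> k K b' x) = (if b = b' then 1 else 0)"
  proof (cases b')
    case True
    then show ?thesis unfolding e using assms by (simp add: mode_state_hermite(2) mode_coef_def)
  next
    case False
    have "(LINT x|lborel. sqrt (1 - \<eta>) * (mode_state \<eta> k K b x * hermite_fun 0 x) + sqrt \<eta> * (mode_state \<eta> k K b x * hermite_fun k x))
      = (LINT x|lborel. sqrt (1 - \<eta>) * (mode_state \<eta> k K b x * hermite_fun 0 x)) + (LINT x|lborel. sqrt \<eta> * (mode_state \<eta> k K b x * hermite_fun k x))"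
      by (intro Bochner_Integration.integral_add integrable_mult_right i)
    also have "\<dots> = (if b = b' then 1 else 0)"
      using assms False by (auto simp: mode_state_hermite(2) mode_coef_def)
    finally show ?thesis using False unfolding e by simp
  qed
qed

definition tensor_weight :: "nat \<Rightarrow> real \<Rightarrow> nat set \<Rightarrow> real" where
  "tensor_weight m p S = (\<Prod>j<m. if j \<in> S then p else 1 - p)"

definition tensor_vec :: "nat \<Rightarrow> real \<Rightarrow> nat \<Rightarrow> nat \<Rightarrow> nat set \<Rightarrow> wavefun" where
  "tensor_vec m \<eta> k K S = product_fun m (\<lambda>j. mode_state \<eta> k K (j \<in> S))"

definition tensor_coef :: "nat \<Rightarrow> real \<Rightarrow> nat \<Rightarrow> nat \<Rightarrow> nat set \<Rightarrow> (nat \<Rightarrow> nat) \<Rightarrow> real" where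
  "tensor_coef m \<eta> k K S n = (\<Prod>j<m. mode_coef \<eta> k K (j \<in> S) (n j))"

text \<open>The tensor power is multiplied out: S is the set of modes in |K>. This presents it as a
  finite mixture of orthonormal product vectors, the form that
  \<open>trace_norm_rank1_perturbation\<close> needs.\<close>

definition rho :: "nat \<Rightarrow> real \<Rightarrow> real \<Rightarrow> nat \<Rightarrow> nat \<Rightarrow> oper" where
  "rho m p \<eta> k K = mixture m (Pow {..<m}) (tensor_weight m p) (tensor_vec m \<eta> k K)"

section \<open>Trace, energy and distance to the vacuum of the tensor power\<close>

context
  fixes \<eta> p :: real and k K m :: nat
  assumes k: "0 < k" "k < K" and eta: "0 \<le> \<eta>" "\<eta> \<le> 1" and p: "0 \<le> p" "p \<le> 1"
begin

lemma tensor_vec_L2: "tensor_vec m \<eta> k K S \<in> L2 m"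
  unfolding tensor_vec_def by (intro product_fun_L2 mode_state_measurable mode_state_ip k eta)

lemma fock_L2: "fock m n \<in> L2 m"
  unfolding fock_product_fun by (intro product_fun_L2 hermite_measurable hermite_orthonormal)

lemma braket_tensor_fock: "braket m (tensor_vec m \<eta> k K S) (fock m n) = of_real (tensor_coef m \<eta> k K S n)"
  unfolding tensor_vec_def fock_product_fun tensor_coef_def
  by (subst braket_product_fun) (simp_all add: mode_state_hermite k)

lemma braket_fock_fock: "braket m (fock m n) (fock m n') = (if \<forall>j<m. n j = n' j then 1 else 0)"
proof -
  have "braket m (fock m n) (fock m n') = of_real (\<Prod>j<m. if n j = n' j then 1 else 0)"
    unfolding fock_product_fun by (subst braket_product_fun) (simp_all add: hermite_orthonormal)
  also have "(\<Prod>j<m. if n j = n' j then 1 else 0) = (if \<forall>j<m. n j = n' j then 1 else (0::real))"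
    by (auto intro!: prod.neutral)
  finally show ?thesis by auto
qed

lemma braket_tensor_tensor:
  assumes "S \<subseteq> {..<m}" "S' \<subseteq> {..<m}"
  shows "braket m (tensor_vec m \<eta> k K S) (tensor_vec m \<eta> k K S') = (if S = S' then 1 else 0)"
proof -
  have "braket m (tensor_vec m \<eta> k K S) (tensor_vec m \<eta> k K S') = of_real (\<Prod>j<m. if (j \<in> S) = (j \<in> S') then 1 else 0)"
    unfolding tensor_vec_def by (subst braket_product_fun) (simp_all add: mode_state_ip k eta)
  also have "(\<Prod>j<m. if (j \<in> S) = (j \<in> S') then 1 else 0) = (if S = S' then 1 else (0::real))"
  proof (cases "S = S'")
    case False
    then obtain j where "j < m" "(j \<in> S) \<noteq> (j \<in> S')" using assms by blast
    then show ?thesis using False by (auto intro!: prod_zero)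
  qed simp
  finally show ?thesis by auto
qed

lemma tensor_weight_nonneg: "0 \<le> tensor_weight m p S"
  unfolding tensor_weight_def using p by (intro prod_nonneg) auto

lemma positive_rho: "positive_oper m (rho m p \<eta> k K)"
  unfolding rho_def by (intro positive_mixture tensor_vec_L2 tensor_weight_nonneg) simp

definition occ_prob :: "nat \<Rightarrow> real" where
  "occ_prob n = (if n = K then p else 0) + (1 - p) * (mode_coef \<eta> k K False n)\<^sup>2"

lemma occ_prob_nonneg: "0 \<le> occ_prob n"
  using p by (simp add: occ_prob_def)

lemma occ_prob_sum: "(\<Sum>n\<in>{0, k, K}. g n * occ_prob n) = (1 - p) * ((1 - \<eta>) * g 0 + \<eta> * g k) + p * g K"
  using k eta by (simp add: occ_prob_def mode_coef_def algebra_simps)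

lemma tensor_diag: "(\<Sum>S\<in>Pow {..<m}. tensor_weight m p S * (tensor_coef m \<eta> k K S n)\<^sup>2) = (\<Prod>j<m. occ_prob (n j))"
proof -
  have "tensor_weight m p S * (tensor_coef m \<eta> k K S n)\<^sup>2 =
     (\<Prod>j<m. if j \<in> S then (if n j = K then p else 0) else (1 - p) * (mode_coef \<eta> k K False (n j))\<^sup>2)" for S
    unfolding tensor_weight_def tensor_coef_def prod_power_distrib prod.distrib[symmetric]
    by (intro prod.cong refl) (auto simp: mode_coef_def)
  then show ?thesis by (simp add: sum_Pow_prod occ_prob_def)
qed

lemma braket_fock_rho: "braket m (fock m n) (rho m p \<eta> k K (fock m n)) = of_real (\<Prod>j<m. occ_prob (n j))"
proof -
  have "braket m (fock m n) (rho m p \<eta> k K (fock m n))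
      = of_real (\<Sum>S\<in>Pow {..<m}. tensor_weight m p S * (cmod (braket m (tensor_vec m \<eta> k K S) (fock m n)))\<^sup>2)"
    unfolding rho_def by (intro braket_mixture_self tensor_vec_L2 fock_L2) simp
  also have "(\<Sum>S\<in>Pow {..<m}. tensor_weight m p S * (cmod (braket m (tensor_vec m \<eta> k K S) (fock m n)))\<^sup>2)
      = (\<Prod>j<m. occ_prob (n j))"
    unfolding braket_tensor_fock tensor_diag[symmetric] by simp
  finally show ?thesis .
qed

abbreviation "supp \<equiv> {..<m} \<rightarrow>\<^sub>E {0, k, K}"

lemma supp: "finite supp" "supp \<subseteq> fock_index m"
  by (auto simp: fock_index_def finite_PiE)

lemma outside_supp:
  assumes "n \<in> fock_index m - supp"
  obtains j where "j < m" "n j \<notin> {0, k, K}"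
  using assms by (auto simp: fock_index_def PiE_def Pi_def)

lemma prod_sum_supp: "(\<Sum>n\<in>supp. \<Prod>j<m. g j (n j)) = (\<Prod>j<m. \<Sum>y\<in>{0, k, K}. g j y :: real)"
  by (rule prod_sum_PiE[symmetric]) auto

lemma density_rho: "density_oper m (rho m p \<eta> k K)"
proof -
  have "trace_pos m (rho m p \<eta> k K) = (\<Sum>\<^sub>\<infinity>n\<in>fock_index m. ennreal (\<Prod>j<m. occ_prob (n j)))"
    unfolding trace_pos_def braket_fock_rho by (simp only: Re_complex_of_real)
  also have "\<dots> = ennreal (\<Sum>n\<in>supp. \<Prod>j<m. occ_prob (n j))"
  proof (intro infsum_ennreal_finite_support supp prod_nonneg occ_prob_nonneg)
    fix n assume "n \<in> fock_index m - supp"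
    then obtain j where "j < m" "n j \<notin> {0, k, K}" by (rule outside_supp)
    then have "occ_prob (n j) = 0" by (auto simp: occ_prob_def mode_coef_def)
    with \<open>j < m\<close> show "(\<Prod>j<m. occ_prob (n j)) = 0" by (intro prod_zero) auto
  qed
  also have "(\<Sum>n\<in>supp. \<Prod>j<m. occ_prob (n j)) = 1"
    using prod_sum_supp[of "\<lambda>_. occ_prob"] occ_prob_sum[of "\<lambda>_. 1"] by simp
  finally show ?thesis by (simp add: density_oper_def positive_rho)
qed

lemma energy_rho: "energy m (rho m p \<eta> k K) = ennreal (real m * ((1 - p) * \<eta> * real k + p * real K))"
proof -
  have t: "total_number m (fock m n) = (\<lambda>x. of_nat (\<Sum>j<m. n j) * fock m n x)" for n
    using braket_fock_total_number by blast
  have b: "braket m (total_number m (fock m n)) (rho m p \<eta> k K (fock m n)) = of_real ((\<Sum>j<m. real (n j)) * (\<Prod>j<m. occ_prob (n j)))" for n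
    unfolding t braket_cmult_left braket_fock_rho by simp
  have "energy m (rho m p \<eta> k K) = (\<Sum>\<^sub>\<infinity>n\<in>fock_index m. ennreal ((\<Sum>j<m. real (n j)) * (\<Prod>j<m. occ_prob (n j))))"
    unfolding energy_def b by (simp only: Re_complex_of_real)
  also have "\<dots> = ennreal (\<Sum>n\<in>supp. (\<Sum>j<m. real (n j)) * (\<Prod>j<m. occ_prob (n j)))"
  proof (intro infsum_ennreal_finite_support supp mult_nonneg_nonneg prod_nonneg sum_nonneg occ_prob_nonneg)
    fix n assume "n \<in> fock_index m - supp"
    then obtain j where "j < m" "n j \<notin> {0, k, K}" by (rule outside_supp)
    then have "occ_prob (n j) = 0" by (auto simp: occ_prob_def mode_coef_def)
    with \<open>j < m\<close> have "(\<Prod>j<m. occ_prob (n j)) = 0" by (intro prod_zero) auto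
    then show "(\<Sum>j<m. real (n j)) * (\<Prod>j<m. occ_prob (n j)) = 0" by simp
  qed auto
  \<comment> \<open>Each factor \<open>n i\<close> from the sum is absorbed into the i-th factor of
    the product, so that every summand factorises over the modes.\<close>
  also have "(\<Sum>n\<in>supp. (\<Sum>j<m. real (n j)) * (\<Prod>j<m. occ_prob (n j))) =
      (\<Sum>i<m. \<Sum>n\<in>supp. \<Prod>j<m. (if j = i then real (n j) else 1) * occ_prob (n j))"
    unfolding sum_distrib_right
  proof (subst sum.swap, intro sum.cong refl)
    fix i n assume "i \<in> {..<m}"
    then have "(\<Prod>j<m. if j = i then real (n j) else 1) = real (n i)" by (simp add: prod.delta)
    then show "real (n i) * (\<Prod>j<m. occ_prob (n j)) = (\<Prod>j<m. (if j = i then real (n j) else 1) * occ_prob (n j))"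
      by (simp add: prod.distrib)
  qed
  also have "\<dots> = (\<Sum>i<m. (1 - p) * \<eta> * real k + p * real K)"
  proof (intro sum.cong refl)
    fix i assume i: "i \<in> {..<m}"
    have "(\<Sum>n\<in>supp. \<Prod>j<m. (if j = i then real (n j) else 1) * occ_prob (n j))
       = (\<Prod>j<m. \<Sum>y\<in>{0, k, K}. (if j = i then real y else 1) * occ_prob y)"
      by (rule prod_sum_supp)
    also have "\<dots> = (\<Prod>j<m. if j = i then (1 - p) * \<eta> * real k + p * real K else 1)"
      unfolding occ_prob_sum by (intro prod.cong refl) (auto simp: algebra_simps)
    also have "\<dots> = (1 - p) * \<eta> * real k + p * real K" using i by (simp add: prod.delta)
    finally show "(\<Sum>n\<in>supp. \<Prod>j<m. (if j = i then real (n j) else 1) * occ_prob (n j)) = (1 - p) * \<eta> * real k + p * real K" .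
  qed
  finally show ?thesis by simp
qed

text \<open>Since K > 0, the eigenvector with S = {} is the only one that overlaps the vacuum. So
  the general bound applies with largest relevant weight (1 - p)^m and overlap (1 - eta)^(m/2), and
  Bernoulli's inequality makes both terms linear under the root and outside it.\<close>

lemma trace_dist_rho:
  assumes "0 < \<eta>" "\<eta> < 1" "p < 1" "0 < m"
  shows "trace_dist m (rho m p \<eta> k K) (vacuum m) \<le> ennreal (real m * p + sqrt (real m * \<eta>))"
proof -
  define z where "z = (\<lambda>j\<in>{..<m}. 0::nat)"
  define c where "c = sqrt (1 - \<eta>) ^ m"
  have fz: "fock m z = fock m (\<lambda>_. 0)"
    unfolding fock_def by (intro ext arg_cong[where f = complex_of_real] prod.cong) (auto simp: z_def)
  have zi: "z \<in> fock_index m" "z \<in> supp" by (auto simp: z_def fock_index_def)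
  have w: "tensor_weight m p {} = (1 - p) ^ m" by (simp add: tensor_weight_def)
  have c01: "0 < c" "c < 1" using assms by (simp_all add: c_def power_less_one_iff)
  have "trace_dist m (mixture m (Pow {..<m}) (tensor_weight m p) (tensor_vec m \<eta> k K)) (vacuum m)
      \<le> ennreal ((1 - tensor_weight m p {}) + sqrt (1 - c\<^sup>2))"
  proof (rule trace_norm_rank1_perturbation[where F = supp and z = z and phi = "tensor_coef m \<eta> k K"])
    show "braket m (fock m (\<lambda>_. 0)) (fock m (\<lambda>_. 0)) = 1" by (simp add: braket_fock_fock)
    show "braket m (tensor_vec m \<eta> k K {}) (tensor_vec m \<eta> k K S) = (if S = {} then 1 else 0)" if "S \<in> Pow {..<m}" for S
      using that by (subst braket_tensor_tensor) auto
    show "braket m (fock m (\<lambda>_. 0)) (tensor_vec m \<eta> k K S) = (if S = {} then of_real c else 0)" if S: "S \<in> Pow {..<m}" for S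
    proof -
      have "braket m (fock m (\<lambda>_. 0)) (tensor_vec m \<eta> k K S) = of_real (tensor_coef m \<eta> k K S (\<lambda>_. 0))"
        by (subst braket_cnj[symmetric], subst braket_tensor_fock) simp
      also have "tensor_coef m \<eta> k K S (\<lambda>_. 0) = (if S = {} then c else 0)"
      proof (cases "S = {}")
        case False
        then obtain j where "j \<in> S" "j < m" using S by auto
        then have "mode_coef \<eta> k K (j \<in> S) 0 = 0" using k by (simp add: mode_coef_def)
        with \<open>j < m\<close> have "tensor_coef m \<eta> k K S (\<lambda>_. 0) = 0" unfolding tensor_coef_def by (intro prod_zero) auto
        then show ?thesis using False by simp
      qed (simp add: tensor_coef_def mode_coef_def c_def)
      finally show ?thesis by simp
    qed
    show "0 < tensor_weight m p {}" "tensor_weight m p {} \<le> 1" unfolding w using assms p by (auto intro: power_le_one)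
    show "braket m (fock m (\<lambda>_. 0)) (fock m n) = (if n = z then 1 else 0)" if "n \<in> fock_index m" for n
      using that unfolding braket_fock_fock by (auto simp: z_def fock_index_def fun_eq_iff PiE_def extensional_def)
    show "tensor_coef m \<eta> k K S n = 0" if n: "n \<in> fock_index m - supp" for S n
    proof -
      obtain j where "j < m" "n j \<notin> {0, k, K}" by (rule outside_supp[OF n])
      then have "mode_coef \<eta> k K (j \<in> S) (n j) = 0" by (auto simp: mode_coef_def)
      with \<open>j < m\<close> show ?thesis unfolding tensor_coef_def by (intro prod_zero) auto
    qed
    show "(\<Sum>n\<in>supp. (tensor_coef m \<eta> k K {} n)\<^sup>2) = 1"
    proof -
      have "(\<Sum>n\<in>supp. (tensor_coef m \<eta> k K {} n)\<^sup>2) = (\<Sum>n\<in>supp. \<Prod>j<m. (mode_coef \<eta> k K False (n j))\<^sup>2)"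
        by (simp add: tensor_coef_def prod_power_distrib)
      also have "\<dots> = (\<Prod>j<m. \<Sum>y\<in>{0, k, K}. (mode_coef \<eta> k K False y)\<^sup>2)" by (rule prod_sum_supp)
      also have "\<dots> = 1" using k eta by (simp add: mode_coef_def)
      finally show ?thesis .
    qed
    show "(\<Sum>n\<in>supp. \<Sum>S\<in>Pow {..<m}. tensor_weight m p S * (tensor_coef m \<eta> k K S n)\<^sup>2) = 1"
      unfolding tensor_diag using prod_sum_supp[of "\<lambda>_. occ_prob"] occ_prob_sum[of "\<lambda>_. 1"] by simp
    show "finite (Pow {..<m})" "{} \<in> Pow {..<m}" by simp_all
    show "0 \<le> tensor_weight m p S" for S by (rule tensor_weight_nonneg)
    show "tensor_vec m \<eta> k K S \<in> L2 m" for S by (rule tensor_vec_L2)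
    show "fock m (\<lambda>_. 0) \<in> L2 m" "fock m n \<in> L2 m" for n by (rule fock_L2)+
    show "0 < c" "c < 1" by (rule c01)+
    show "finite supp" "supp \<subseteq> fock_index m" by (rule supp)+
    show "z \<in> supp" "fock m z = fock m (\<lambda>_. 0)" by (rule zi fz)+
    show "braket m (tensor_vec m \<eta> k K S) (fock m n) = of_real (tensor_coef m \<eta> k K S n)" for S n
      by (rule braket_tensor_fock)
  qed
  also have "(1 - tensor_weight m p {}) + sqrt (1 - c\<^sup>2) \<le> real m * p + sqrt (real m * \<eta>)"
  proof (intro add_mono real_sqrt_le_mono)
    show "1 - tensor_weight m p {} \<le> real m * p"
      using Bernoulli_inequality[of "- p" m] p by (simp add: w)
    have "c\<^sup>2 = (1 - \<eta>) ^ m" using assms by (simp add: c_def power_mult[symmetric] mult.commute[of m] power_mult)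
    then show "1 - c\<^sup>2 \<le> real m * \<eta>" using Bernoulli_inequality[of "- \<eta>" m] eta by simp
  qed
  finally show ?thesis by (simp add: rho_def ennreal_leI)
qed

end

section \<open>The Wigner function of the product state\<close>

lemma lag_continuous: "continuous_on S (lag n)"
proof (induction n rule: less_induct)
  case (less n)
  consider "n = 0" | "n = 1" | k where "n = Suc (Suc k)" by (metis One_nat_def not0_implies_Suc)
  then show ?case
  proof cases
    case 3
    have "lag n = (\<lambda>u. ((u - 2 * real k - 3) * lag (Suc k) u - real (Suc k) * lag k u) / real (Suc (Suc k)))"
      by (simp add: 3 fun_eq_iff)
    then show ?thesis using less[of k] less[of "Suc k"] 3 by (auto intro!: continuous_intros)
  next
    case 1
    have "lag n = (\<lambda>u. 1)" by (simp add: 1 fun_eq_iff)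
    then show ?thesis by simp
  next
    case 2
    have "lag n = (\<lambda>u. u - 1)" by (simp add: 2 fun_eq_iff)
    then show ?thesis by (auto intro!: continuous_intros)
  qed
qed

text \<open>The Wigner function of one mode, divided by that of the vacuum.\<close>
definition wig_ratio :: "real \<Rightarrow> real \<Rightarrow> nat \<Rightarrow> nat \<Rightarrow> real \<Rightarrow> real \<Rightarrow> real" where
  "wig_ratio p \<eta> k K Q P = (1 - p) * ((1 - \<eta>) + 2 * (sqrt (1 - \<eta>) * sqrt \<eta>) *
      Re ((of_real (sqrt 2) * (of_real Q + \<i> * of_real P)) ^ k) / sqrt (fact k) + \<eta> * lag k (2 * (Q\<^sup>2 + P\<^sup>2)))
    + p * lag K (2 * (Q\<^sup>2 + P\<^sup>2))"

definition mode_wigner :: "real \<Rightarrow> real \<Rightarrow> nat \<Rightarrow> nat \<Rightarrow> real \<Rightarrow> real \<Rightarrow> real" where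
  "mode_wigner p \<eta> k K Q P = exp (- (Q\<^sup>2 + P\<^sup>2)) * wig_ratio p \<eta> k K Q P / pi"

definition rho_wigner :: "nat \<Rightarrow> real \<Rightarrow> real \<Rightarrow> nat \<Rightarrow> nat \<Rightarrow> point \<Rightarrow> point \<Rightarrow> real" where
  "rho_wigner m p \<eta> k K q P = (\<Prod>j<m. mode_wigner p \<eta> k K (q j) (P j))"

definition mode_kernel :: "real \<Rightarrow> real \<Rightarrow> nat \<Rightarrow> nat \<Rightarrow> real \<Rightarrow> real \<Rightarrow> real" where
  "mode_kernel p \<eta> k K s t = p * (hermite_fun K s * hermite_fun K t) + (1 - p) * (superpos \<eta> k s * superpos \<eta> k t)"

lemma hwig_cnj: "hwig k 0 Q P = cnj (hwig 0 k Q P)"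
  by (simp add: hwig_0_n hwig_n_0)

text \<open>Expanding the superposition leaves five integrals over pairs of number states. The two
  coherence terms are complex conjugates of each other and add up to twice a real part.\<close>

lemma mode_kernel_wigner:
  assumes "0 \<le> \<eta>" "\<eta> \<le> 1"
  shows "has_bochner_integral lborel (\<lambda>y. exp (2 * \<i> * complex_of_real (P * y)) * of_real (mode_kernel p \<eta> k K (Q - y) (Q + y)))
     (of_real (pi * mode_wigner p \<eta> k K Q P))"
proof -
  define e where "e a b y = exp (2 * \<i> * complex_of_real (P * y)) * of_real (hermite_fun a (Q - y) * hermite_fun b (Q + y))" for a b y
  define s where "s = sqrt (1 - \<eta>) * sqrt \<eta>"
  have he: "has_bochner_integral lborel (e a b) (hwig a b Q P)" for a b
    unfolding e_def[abs_def] wig_def using has_bochner_integral_integrable[OF wig_integrable] by simp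
  have "has_bochner_integral lborel (\<lambda>y. of_real p * e K K y + (of_real ((1 - p) * (1 - \<eta>)) * e 0 0 y
       + (of_real ((1 - p) * s) * e 0 k y + (of_real ((1 - p) * s) * e k 0 y + of_real ((1 - p) * \<eta>) * e k k y))))
     (of_real p * hwig K K Q P + (of_real ((1 - p) * (1 - \<eta>)) * hwig 0 0 Q P
       + (of_real ((1 - p) * s) * hwig 0 k Q P + (of_real ((1 - p) * s) * hwig k 0 Q P + of_real ((1 - p) * \<eta>) * hwig k k Q P))))"
    by (intro has_bochner_integral_add has_bochner_integral_mult_right he)
  moreover have "of_real p * e K K y + (of_real ((1 - p) * (1 - \<eta>)) * e 0 0 y
       + (of_real ((1 - p) * s) * e 0 k y + (of_real ((1 - p) * s) * e k 0 y + of_real ((1 - p) * \<eta>) * e k k y)))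
     = exp (2 * \<i> * complex_of_real (P * y)) * of_real (mode_kernel p \<eta> k K (Q - y) (Q + y))" for y
  proof -
    have sq: "sqrt (1 - \<eta>) * sqrt (1 - \<eta>) = 1 - \<eta>" "sqrt \<eta> * sqrt \<eta> = \<eta>" using assms by auto
    have sp: "superpos \<eta> k a * superpos \<eta> k b = (sqrt (1 - \<eta>) * sqrt (1 - \<eta>)) * (hermite_fun 0 a * hermite_fun 0 b)
       + s * (hermite_fun 0 a * hermite_fun k b) + s * (hermite_fun k a * hermite_fun 0 b) + (sqrt \<eta> * sqrt \<eta>) * (hermite_fun k a * hermite_fun k b)" for a b
      by (simp add: superpos_def s_def algebra_simps)
    show ?thesis unfolding mode_kernel_def sp sq e_def by (simp add: algebra_simps)
  qed
  moreover have "of_real p * hwig K K Q P + (of_real ((1 - p) * (1 - \<eta>)) * hwig 0 0 Q P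
       + (of_real ((1 - p) * s) * hwig 0 k Q P + (of_real ((1 - p) * s) * hwig k 0 Q P + of_real ((1 - p) * \<eta>) * hwig k k Q P)))
     = of_real (pi * mode_wigner p \<eta> k K Q P)"
  proof -
    define E where "E = exp (- (Q\<^sup>2 + P\<^sup>2))"
    define R where "R = Re ((of_real (sqrt 2) * (of_real Q + \<i> * of_real P)) ^ k) / sqrt (fact k) * E"
    have "hwig 0 k Q P + hwig k 0 Q P = of_real (2 * R)"
    proof -
      have "Re (hwig 0 k Q P) = R" unfolding hwig_0_n R_def E_def[symmetric] by simp
      then show ?thesis unfolding hwig_cnj complex_add_cnj by simp
    qed
    then have "of_real ((1 - p) * s) * hwig 0 k Q P + of_real ((1 - p) * s) * hwig k 0 Q P = of_real ((1 - p) * s * (2 * R))"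
      by (simp only: distrib_left[symmetric] of_real_mult)
    then have "of_real p * hwig K K Q P + (of_real ((1 - p) * (1 - \<eta>)) * hwig 0 0 Q P
       + (of_real ((1 - p) * s) * hwig 0 k Q P + (of_real ((1 - p) * s) * hwig k 0 Q P + of_real ((1 - p) * \<eta>) * hwig k k Q P)))
      = complex_of_real (p * (lag K (2 * (Q\<^sup>2 + P\<^sup>2)) * E) + ((1 - p) * (1 - \<eta>) * E + ((1 - p) * s * (2 * R) + (1 - p) * \<eta> * (lag k (2 * (Q\<^sup>2 + P\<^sup>2)) * E))))"
      unfolding hwig_diag[of K] hwig_diag[of k] hwig_0 E_def[symmetric] by (simp add: add.assoc[symmetric])
    also have "\<dots> = complex_of_real (pi * mode_wigner p \<eta> k K Q P)"
    proof (intro arg_cong[where f = complex_of_real])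
      define c where "c = Re ((of_real (sqrt 2) * (of_real Q + \<i> * of_real P)) ^ k) / sqrt (fact k)"
      have R: "R = c * E" by (simp add: R_def c_def)
      have wr: "wig_ratio p \<eta> k K Q P = (1 - p) * ((1 - \<eta>) + 2 * s * c + \<eta> * lag k (2 * (Q\<^sup>2 + P\<^sup>2))) + p * lag K (2 * (Q\<^sup>2 + P\<^sup>2))"
        by (simp add: wig_ratio_def c_def s_def)
      have pm: "pi * mode_wigner p \<eta> k K Q P = E * wig_ratio p \<eta> k K Q P" by (simp add: mode_wigner_def E_def)
      show "p * (lag K (2 * (Q\<^sup>2 + P\<^sup>2)) * E) + ((1 - p) * (1 - \<eta>) * E + ((1 - p) * s * (2 * R) + (1 - p) * \<eta> * (lag k (2 * (Q\<^sup>2 + P\<^sup>2)) * E))) = pi * mode_wigner p \<eta> k K Q P"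
        unfolding R pm wr by (simp add: algebra_simps)
    qed
    finally show ?thesis .
  qed
  ultimately show ?thesis by (simp only:)
qed

lemma mode_wigner_continuous: "continuous_on UNIV (\<lambda>(Q, P). mode_wigner p \<eta> k K Q P)"
  unfolding mode_wigner_def wig_ratio_def split_def
  by (intro continuous_intros continuous_on_compose2[OF lag_continuous]) auto

text \<open>The kernel is a sum over S for the action on functions, but by
  \<open>sum_Pow_prod\<close> also a product over the modes. The phase factor splits in the same
  way, and Fubini on the product measure reduces the integral to one mode.\<close>

lemma is_wigner_rho:
  assumes k: "0 < k" "k < K" and eta: "0 \<le> \<eta>" "\<eta> \<le> 1" and p: "0 \<le> p" "p \<le> 1"
  shows "is_wigner m (rho m p \<eta> k K) (rho_wigner m p \<eta> k K)"
proof -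
  define v where "v = tensor_vec m \<eta> k K"
  define Kf where "Kf x y = (\<Sum>S\<in>Pow {..<m}. of_real (tensor_weight m p S) * (v S x * v S y))" for x y
  have vL: "v S \<in> L2 m" for S unfolding v_def by (rule tensor_vec_L2[OF k eta p])
  have vm: "v S \<in> borel_measurable (config m)" for S using vL by (rule L2D)
  have cv: "cnj (v S x) = v S x" for S x by (simp add: v_def tensor_vec_def product_fun_def)
  have Kprod: "Kf x y = (\<Prod>j<m. of_real (mode_kernel p \<eta> k K (x j) (y j)))" for x y
  proof -
    have "of_real (tensor_weight m p S) * (v S x * v S y) = complex_of_real (\<Prod>j<m. if j \<in> S then p * (hermite_fun K (x j) * hermite_fun K (y j))
        else (1 - p) * (superpos \<eta> k (x j) * superpos \<eta> k (y j)))" for S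
      unfolding tensor_weight_def v_def tensor_vec_def product_fun_def of_real_mult[symmetric] prod.distrib[symmetric]
      by (intro arg_cong[where f = complex_of_real] prod.cong refl) (auto simp: mode_state_def)
    then have "Kf x y = complex_of_real (\<Sum>S\<in>Pow {..<m}. \<Prod>j<m. if j \<in> S then p * (hermite_fun K (x j) * hermite_fun K (y j))
        else (1 - p) * (superpos \<eta> k (x j) * superpos \<eta> k (y j)))"
      by (simp only: Kf_def of_real_sum)
    also have "\<dots> = complex_of_real (\<Prod>j<m. mode_kernel p \<eta> k K (x j) (y j))"
      by (subst sum_Pow_prod) (simp_all add: mode_kernel_def)
    finally show ?thesis by simp
  qed
  have ker: "is_kernel m (rho m p \<eta> k K) Kf"
    unfolding is_kernel_def
  proof (intro conjI ballI)
    have "(\<lambda>z. v S (fst z)) \<in> borel_measurable (config m \<Otimes>\<^sub>M config m)" "(\<lambda>z. v S (snd z)) \<in> borel_measurable (config m \<Otimes>\<^sub>M config m)" for S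
      by (rule measurable_compose[OF measurable_fst vm], rule measurable_compose[OF measurable_snd vm])
    then show "(\<lambda>(x, y). Kf x y) \<in> borel_measurable (config m \<Otimes>\<^sub>M config m)"
      unfolding Kf_def split_def by (intro borel_measurable_sum borel_measurable_times) auto
    fix f assume f: "f \<in> L2 m"
    have i: "integrable (config m) (\<lambda>y. v S y * f y)" for S
      using braket_integrable[OF vL f] by (simp add: cv)
    show "AE x in config m. integrable (config m) (\<lambda>y. Kf x y * f y) \<and> rho m p \<eta> k K f x = (LINT y|config m. Kf x y * f y)"
    proof (rule AE_I2)
      fix x
      have e: "Kf x y * f y = (\<Sum>S\<in>Pow {..<m}. of_real (tensor_weight m p S) * v S x * (v S y * f y))" for y
        unfolding Kf_def sum_distrib_right by (intro sum.cong refl) simp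
      have "integrable (config m) (\<lambda>y. Kf x y * f y)"
        unfolding e by (intro Bochner_Integration.integrable_sum integrable_mult_right i)
      moreover have "(LINT y|config m. Kf x y * f y) = (\<Sum>S\<in>Pow {..<m}. of_real (tensor_weight m p S) * v S x * braket m (v S) f)"
        unfolding e braket_def cv by (subst Bochner_Integration.integral_sum) (auto intro: integrable_mult_right i)
      moreover have "rho m p \<eta> k K f x = (\<Sum>S\<in>Pow {..<m}. of_real (tensor_weight m p S) * v S x * braket m (v S) f)"
        unfolding rho_def mixture_def rank1_def v_def[symmetric] by (intro sum.cong refl) simp
      ultimately show "integrable (config m) (\<lambda>y. Kf x y * f y) \<and> rho m p \<eta> k K f x = (LINT y|config m. Kf x y * f y)" by simp
    qed
  qed
  show ?thesis unfolding is_wigner_def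
  proof (intro conjI exI[of _ Kf] ker ballI)
    have "continuous_on UNIV (\<lambda>(q :: point, P :: point). rho_wigner m p \<eta> k K q P)"
      unfolding rho_wigner_def split_def
    proof (intro continuous_on_prod)
      fix j
      have "continuous_on UNIV (\<lambda>z :: point \<times> point. (fst z j, snd z j))"
      proof (rule continuous_on_Pair)
        show "continuous_on UNIV (\<lambda>z :: point \<times> point. fst z j)"
          by (rule continuous_on_compose2[OF continuous_on_product_coordinates[of j] continuous_on_fst[OF continuous_on_id]]) simp
        show "continuous_on UNIV (\<lambda>z :: point \<times> point. snd z j)"
          by (rule continuous_on_compose2[OF continuous_on_product_coordinates[of j] continuous_on_snd[OF continuous_on_id]]) simp
      qed
      from continuous_on_compose2[OF mode_wigner_continuous this]
      show "continuous_on UNIV (\<lambda>z :: point \<times> point. mode_wigner p \<eta> k K (fst z j) (snd z j))" by simp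
    qed
    then show "continuous_on (space (config m) \<times> space (config m)) (\<lambda>(q, P). rho_wigner m p \<eta> k K q P)"
      by (rule continuous_on_subset) simp
    fix q P
    define F where "F = (\<lambda>y. exp (2 * \<i> * complex_of_real (\<Sum>j<m. P j * y j)) * Kf (\<lambda>j\<in>{..<m}. q j - y j) (\<lambda>j\<in>{..<m}. q j + y j))"
    define h where "h j y = exp (2 * \<i> * complex_of_real (P j * y)) * of_real (mode_kernel p \<eta> k K (q j - y) (q j + y))" for j y
    have hb: "has_bochner_integral lborel (h j) (of_real (pi * mode_wigner p \<eta> k K (q j) (P j)))" for j
      unfolding h_def[abs_def] by (rule mode_kernel_wigner[OF eta])
    have Fh: "F y = (\<Prod>j\<in>{..<m}. h j (y j))" for y
    proof -
      have "exp (2 * \<i> * complex_of_real (\<Sum>j<m. P j * y j)) = (\<Prod>j<m. exp (2 * \<i> * complex_of_real (P j * y j)))"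
        by (simp add: exp_sum[symmetric] sum_distrib_left)
      moreover have "Kf (\<lambda>j\<in>{..<m}. q j - y j) (\<lambda>j\<in>{..<m}. q j + y j) = (\<Prod>j<m. of_real (mode_kernel p \<eta> k K (q j - y j) (q j + y j)))"
        unfolding Kprod by (intro prod.cong refl) simp
      ultimately show ?thesis unfolding F_def h_def prod.distrib by simp
    qed
    have "integrable (config m) F"
      unfolding config_def Fh using hb by (intro config_prod.product_integrable_prod) (auto simp: has_bochner_integral_iff)
    moreover have "integral\<^sup>L (config m) F = (\<Prod>j<m. integral\<^sup>L lborel (h j))"
      unfolding config_def Fh using hb by (intro config_prod.product_integral_prod) (auto simp: has_bochner_integral_iff)
    then have "integral\<^sup>L (config m) F = of_real (pi ^ m * rho_wigner m p \<eta> k K q P)"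
      using hb by (simp add: has_bochner_integral_iff rho_wigner_def prod.distrib)
    ultimately have "integrable (config m) F \<and> complex_of_real (rho_wigner m p \<eta> k K q P) = integral\<^sup>L (config m) F / complex_of_real (pi ^ m)"
      by simp
    then show "let F = \<lambda>y. exp (2 * \<i> * complex_of_real (\<Sum>j<m. P j * y j)) * Kf (\<lambda>j\<in>{..<m}. q j - y j) (\<lambda>j\<in>{..<m}. q j + y j)
          in integrable (config m) F \<and> complex_of_real (rho_wigner m p \<eta> k K q P) = integral\<^sup>L (config m) F / complex_of_real (pi ^ m)"
      unfolding Let_def F_def .
  qed
qed

text \<open>Makes the vacuum a member of the family, so that the results on its density, kernel and
  Wigner function can be reused. The values 1 and 2 are placeholders for number states of weight
  zero.\<close>

lemma vacuum_eq_rho: "vacuum m = rho m 0 0 1 2"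
proof (intro ext)
  fix f x
  have v: "tensor_vec m 0 1 2 {} = fock m (\<lambda>_. 0)"
    by (simp add: tensor_vec_def fock_product_fun mode_state_def superpos_def[abs_def])
  have w: "tensor_weight m 0 S = (if S = {} then 1 else 0)" if S: "S \<in> Pow {..<m}" for S
  proof (cases "S = {}")
    case False
    then obtain j where "j \<in> S" "j < m" using S by auto
    then show ?thesis using False unfolding tensor_weight_def by (auto intro!: prod_zero)
  qed (simp add: tensor_weight_def)
  have "rho m 0 0 1 2 f x = (\<Sum>S\<in>Pow {..<m}. if S = {} then rank1 m (tensor_vec m 0 1 2 S) f x else 0)"
    unfolding rho_def mixture_def by (intro sum.cong refl) (simp add: w)
  also have "\<dots> = rank1 m (tensor_vec m 0 1 2 {}) f x" by (simp add: sum.delta)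
  finally have e: "rho m 0 0 1 2 f x = rank1 m (tensor_vec m 0 1 2 {}) f x" .
  show "vacuum m f x = rho m 0 0 1 2 f x" unfolding e v by (simp add: vacuum_def rank1_def)
qed

section \<open>The vacuum as a Gaussian state\<close>

lemma sum_lessThan_add: "(\<Sum>i<a + b. f i) = (\<Sum>i<a. f i) + (\<Sum>i<b. f (a + i) :: 'a :: comm_monoid_add)" for a b :: nat
  by (induction b) (simp_all add: add.assoc)

lemma sum_diagonal_form:
  fixes v :: "nat \<Rightarrow> real"
  assumes "i < n"
  shows "(\<Sum>j<n. v i * (if i = j then c else 0) * v j) = c * (v i)\<^sup>2"
proof -
  have "(\<Sum>j<n. v i * (if i = j then c else 0) * v j) = (\<Sum>j<n. if j = i then c * (v i)\<^sup>2 else 0)"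
    by (intro sum.cong refl) (auto simp: power2_eq_square)
  then show ?thesis using assms by simp
qed

lemma gaussian_state_vacuum: "gaussian_state m (vacuum m)"
proof -
  have "density_oper m (rho m 0 0 1 2)" by (rule density_rho) auto
  moreover have "is_wigner m (rho m 0 0 1 2) (rho_wigner m 0 0 1 2)" by (rule is_wigner_rho) auto
  moreover have "gaussian_fun m (rho_wigner m 0 0 1 2)"
    unfolding gaussian_fun_def
  proof (intro exI conjI allI impI ballI)
    \<comment> \<open>The goals here and below fix the witnesses: prefactor pi^(-m), mean 0, and
      twice the identity as inverse covariance matrix.\<close>
    show "0 < 1 / pi ^ m" by simp
    show "(if i = j then 2 else 0 :: real) = (if j = i then 2 else 0)" for i j :: nat by simp
    fix v :: "nat \<Rightarrow> real" assume "\<exists>i<2 * m. v i \<noteq> 0"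
    then obtain i where i: "i < 2 * m" "v i \<noteq> 0" by blast
    have "(\<Sum>i<2 * m. \<Sum>j<2 * m. v i * (if i = j then 2 else 0) * v j) = (\<Sum>i<2 * m. 2 * (v i)\<^sup>2)"
      by (intro sum.cong refl sum_diagonal_form) auto
    also have "\<dots> > 0" using i by (intro sum_pos2[of _ i]) auto
    finally show "0 < (\<Sum>i<2 * m. \<Sum>j<2 * m. v i * (if i = j then 2 else 0) * v j)" .
  next
    fix q P :: point
    have "(\<Sum>i<2 * m. \<Sum>j<2 * m. (phase_point m q P i - 0) * (if i = j then 2 else 0) * (phase_point m q P j - 0))
       = (\<Sum>i<m + m. 2 * (phase_point m q P i)\<^sup>2)"
      unfolding mult_2[of m] diff_zero
    proof (intro sum.cong refl)
      fix i assume "i \<in> {..<m + m}"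
      then show "(\<Sum>j<m + m. phase_point m q P i * (if i = j then 2 else 0) * phase_point m q P j) = 2 * (phase_point m q P i)\<^sup>2"
        using sum_diagonal_form[of i "m + m" "phase_point m q P" 2] by simp
    qed
    also have "\<dots> = 2 * (\<Sum>j<m. (q j)\<^sup>2 + (P j)\<^sup>2)"
      unfolding sum_lessThan_add by (simp add: phase_point_def sum_distrib_left sum.distrib)
    finally have "- (\<Sum>i<2 * m. \<Sum>j<2 * m. (phase_point m q P i - 0) * (if i = j then 2 else 0) * (phase_point m q P j - 0)) / 2
        = (\<Sum>j<m. - ((q j)\<^sup>2 + (P j)\<^sup>2))" by (simp add: sum_negf[symmetric])
    moreover have "rho_wigner m 0 0 1 2 q P = 1 / pi ^ m * exp (\<Sum>j<m. - ((q j)\<^sup>2 + (P j)\<^sup>2))"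
      by (simp add: rho_wigner_def mode_wigner_def wig_ratio_def exp_sum prod_dividef)
    ultimately show "rho_wigner m 0 0 1 2 q P = 1 / pi ^ m * exp (- (\<Sum>i<2 * m. \<Sum>j<2 * m. (phase_point m q P i - 0) * (if i = j then 2 else 0) * (phase_point m q P j - 0)) / 2)"
      by simp
  qed
  ultimately show ?thesis unfolding gaussian_state_def vacuum_eq_rho by blast
qed

text \<open>The vacuum is itself Gaussian, so the convex combination with one term approximates it
  with error zero; this uses that the zero operator is its own absolute value.\<close>

lemma vacuum_in_closed_hull: "vacuum m \<in> closed_gaussian_hull m"
proof -
  define Z where "Z = (\<lambda>(f :: wavefun) (x :: point). 0 :: complex)"
  have "positive_oper m Z"
    using positive_mixture[of "{} :: nat set" "\<lambda>_. Z undefined" m "\<lambda>_. 0"] by (simp add: Z_def mixture_def[abs_def])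
  then have "is_abs_oper m Z Z" by (simp add: is_abs_oper_def)
  moreover have "trace_pos m Z = 0" by (simp add: trace_pos_def Z_def braket_def)
  ultimately have "trace_norm m Z \<le> 0"
    unfolding trace_norm_def using INF_lower[of Z "{P. is_abs_oper m Z P}" "trace_pos m"] by simp
  then have tn: "trace_norm m Z = 0" by simp
  define \<tau> where "\<tau> = (\<lambda>f x. \<Sum>k<Suc 0. complex_of_real ((\<lambda>_. 1) k) * (\<lambda>_. vacuum m) k f x)"
  have "\<tau> \<in> gaussian_hull m"
    unfolding gaussian_hull_def mem_Collect_eq
    by (intro exI[of _ "Suc 0"] exI[of _ "\<lambda>_. 1"] exI[of _ "\<lambda>_. vacuum m"] conjI) (auto simp: gaussian_state_vacuum \<tau>_def)
  moreover have "(\<lambda>f x. vacuum m f x - \<tau> f x) = Z" by (simp add: \<tau>_def Z_def)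
  moreover have "bounded_oper m (vacuum m)"
    using gaussian_state_vacuum[of m] by (simp add: gaussian_state_def density_oper_def positive_oper_def)
  ultimately show ?thesis unfolding closed_gaussian_hull_def
    by (intro CollectI conjI allI impI bexI[of _ \<tau>]) (simp_all add: tn)
qed

lemma dist_gaussian_hull_le: "dist_gaussian_hull m \<rho> \<le> trace_dist m \<rho> (vacuum m)"
  unfolding dist_gaussian_hull_def by (rule INF_lower[OF vacuum_in_closed_hull])

section \<open>Gaussian means\<close>

text \<open>A class of integrands for which integrability, Fubini and integration by parts against
  the Gaussian hold uniformly; it is closed under the algebraic operations and, by
  \<open>poly_bdd_ln\<close>, under logarithms of functions bounded away from 0. The growth bound is
  a product in Q and P so that the dominating function factorises.\<close>

definition poly_bdd :: "(real \<Rightarrow> real \<Rightarrow> real) \<Rightarrow> bool" where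
  "poly_bdd g \<longleftrightarrow> continuous_on UNIV (\<lambda>z. g (fst z) (snd z)) \<and>
     (\<exists>C N. \<forall>Q P. \<bar>g Q P\<bar> \<le> C * ((1 + Q\<^sup>2) * (1 + P\<^sup>2)) ^ N)"

text \<open>The density is the Wigner function of the one-mode vacuum.\<close>

definition gauss_mean :: "(real \<Rightarrow> real \<Rightarrow> real) \<Rightarrow> real" where
  "gauss_mean g = (LINT z|lborel. g (fst z) (snd z) * (exp (- ((fst z)\<^sup>2 + (snd z)\<^sup>2)) / pi))"

lemma poly_bdd_bound_ge_1: "(1::real) \<le> (1 + Q\<^sup>2) * (1 + P\<^sup>2)"
  by (simp add: distrib_left distrib_right)

lemma pbE:
  assumes "poly_bdd g"
  obtains C N where "0 \<le> C" "\<And>Q P. \<bar>g Q P\<bar> \<le> C * ((1 + Q\<^sup>2) * (1 + P\<^sup>2)) ^ N"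
proof -
  obtain C N where CN: "\<And>Q P. \<bar>g Q P\<bar> \<le> C * ((1 + Q\<^sup>2) * (1 + P\<^sup>2)) ^ N"
    using assms by (auto simp: poly_bdd_def)
  have "0 \<le> C" using order_trans[OF abs_ge_zero CN[of 0 0]] by simp
  with CN that show thesis by blast
qed

section \<open>Functions of polynomial growth\<close>

lemma poly_bdd_const: "poly_bdd (\<lambda>Q P. c)"
proof -
  have "\<forall>(Q::real) (P::real). \<bar>c\<bar> \<le> \<bar>c\<bar> * ((1 + Q\<^sup>2) * (1 + P\<^sup>2)) ^ 0" by simp
  then show ?thesis unfolding poly_bdd_def by (intro conjI continuous_on_const) blast
qed

lemma poly_bdd_coord: "poly_bdd (\<lambda>Q P. Q)" "poly_bdd (\<lambda>Q P. P)"
proof -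
  have a: "\<bar>x\<bar> \<le> 1 + x\<^sup>2" for x :: real
    using sum_squares_bound[of "\<bar>x\<bar>" 1] zero_le_power2[of x] by simp
  have b: "\<bar>x\<bar> \<le> (1 + x\<^sup>2) * (1 + y\<^sup>2)" for x y :: real
  proof -
    have "(1 + x\<^sup>2) * 1 \<le> (1 + x\<^sup>2) * (1 + y\<^sup>2)" by (intro mult_left_mono) auto
    then show ?thesis unfolding mult_1_right by (rule order_trans[OF a])
  qed
  have "\<bar>Q\<bar> \<le> 1 * ((1 + Q\<^sup>2) * (1 + P\<^sup>2)) ^ 1" "\<bar>P\<bar> \<le> 1 * ((1 + Q\<^sup>2) * (1 + P\<^sup>2)) ^ 1" for Q P :: real
    using b[of Q P] b[of P Q] by (simp_all add: mult.commute)
  moreover have "continuous_on UNIV (\<lambda>z :: real \<times> real. fst z)" "continuous_on UNIV (\<lambda>z :: real \<times> real. snd z)"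
    by (intro continuous_intros)+
  ultimately show "poly_bdd (\<lambda>Q P. Q)" "poly_bdd (\<lambda>Q P. P)"
    unfolding poly_bdd_def by blast+
qed

lemma poly_bdd_add:
  assumes "poly_bdd g" "poly_bdd h" shows "poly_bdd (\<lambda>Q P. g Q P + h Q P)"
proof -
  obtain C N where C: "0 \<le> C" "\<And>Q P. \<bar>g Q P\<bar> \<le> C * ((1 + Q\<^sup>2) * (1 + P\<^sup>2)) ^ N" using pbE[OF assms(1)] by blast
  obtain D M where D: "0 \<le> D" "\<And>Q P. \<bar>h Q P\<bar> \<le> D * ((1 + Q\<^sup>2) * (1 + P\<^sup>2)) ^ M" using pbE[OF assms(2)] by blast
  have "\<bar>g Q P + h Q P\<bar> \<le> (C + D) * ((1 + Q\<^sup>2) * (1 + P\<^sup>2)) ^ (N + M)" for Q P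
  proof -
    let ?b = "(1 + Q\<^sup>2) * (1 + P\<^sup>2)"
    have "C * ?b ^ N \<le> C * ?b ^ (N + M)" "D * ?b ^ M \<le> D * ?b ^ (N + M)"
      using C D poly_bdd_bound_ge_1 by (auto intro!: mult_left_mono power_increasing)
    then have "C * ?b ^ N + D * ?b ^ M \<le> (C + D) * ?b ^ (N + M)" by (simp only: distrib_right add_mono)
    with C(2)[of Q P] D(2)[of Q P] show ?thesis by linarith
  qed
  moreover have "continuous_on UNIV (\<lambda>z. g (fst z) (snd z) + h (fst z) (snd z))"
    using assms by (auto simp: poly_bdd_def intro!: continuous_intros)
  ultimately show ?thesis unfolding poly_bdd_def by blast
qed

lemma poly_bdd_mult:
  assumes "poly_bdd g" "poly_bdd h" shows "poly_bdd (\<lambda>Q P. g Q P * h Q P)"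
proof -
  obtain C N where C: "0 \<le> C" "\<And>Q P. \<bar>g Q P\<bar> \<le> C * ((1 + Q\<^sup>2) * (1 + P\<^sup>2)) ^ N" using pbE[OF assms(1)] by blast
  obtain D M where D: "0 \<le> D" "\<And>Q P. \<bar>h Q P\<bar> \<le> D * ((1 + Q\<^sup>2) * (1 + P\<^sup>2)) ^ M" using pbE[OF assms(2)] by blast
  have "\<bar>g Q P * h Q P\<bar> \<le> (C * D) * ((1 + Q\<^sup>2) * (1 + P\<^sup>2)) ^ (N + M)" for Q P
    using mult_mono[OF C(2)[of Q P] D(2)[of Q P] order_trans[OF abs_ge_zero C(2)[of Q P]] abs_ge_zero]
    by (simp add: abs_mult power_add mult_ac)
  moreover have "continuous_on UNIV (\<lambda>z. g (fst z) (snd z) * h (fst z) (snd z))"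
    using assms by (auto simp: poly_bdd_def intro!: continuous_intros)
  ultimately show ?thesis unfolding poly_bdd_def by blast
qed

lemma poly_bdd_cmult: "poly_bdd g \<Longrightarrow> poly_bdd (\<lambda>Q P. c * g Q P)"
  using poly_bdd_mult[OF poly_bdd_const] .

lemma poly_bdd_minus: "poly_bdd g \<Longrightarrow> poly_bdd (\<lambda>Q P. - g Q P)"
  using poly_bdd_cmult[of g "-1"] by simp

lemma poly_bdd_diff: "poly_bdd g \<Longrightarrow> poly_bdd h \<Longrightarrow> poly_bdd (\<lambda>Q P. g Q P - h Q P)"
  using poly_bdd_add[of g "\<lambda>Q P. - h Q P"] poly_bdd_minus[of h] by simp

lemma poly_bdd_power: "poly_bdd g \<Longrightarrow> poly_bdd (\<lambda>Q P. g Q P ^ n)"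
  by (induction n) (auto intro: poly_bdd_const poly_bdd_mult)

lemma poly_bdd_poly: "poly_bdd g \<Longrightarrow> poly_bdd (\<lambda>Q P. poly r (g Q P))"
  by (induction r) (auto intro: poly_bdd_const poly_bdd_mult poly_bdd_add)

lemma poly_bdd_bounded:
  assumes "poly_bdd g" "continuous_on UNIV (\<lambda>z. h (fst z) (snd z))" "\<And>Q P. \<bar>h Q P\<bar> \<le> g Q P"
  shows "poly_bdd h"
proof -
  obtain C N where C: "0 \<le> C" "\<And>Q P. \<bar>g Q P\<bar> \<le> C * ((1 + Q\<^sup>2) * (1 + P\<^sup>2)) ^ N" using pbE[OF assms(1)] by blast
  have "\<bar>h Q P\<bar> \<le> C * ((1 + Q\<^sup>2) * (1 + P\<^sup>2)) ^ N" for Q P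
    using assms(3)[of Q P] C(2)[of Q P] by linarith
  then show ?thesis using assms(2) unfolding poly_bdd_def by blast
qed

lemmas poly_bdd_intros = poly_bdd_const poly_bdd_coord poly_bdd_add poly_bdd_mult poly_bdd_diff poly_bdd_minus poly_bdd_power poly_bdd_poly

definition gp :: "nat \<Rightarrow> real \<Rightarrow> real" where
  "gp N x = poly ([:1, 0, 1:] ^ N) x * exp (- x\<^sup>2)"

lemma gp: "gp N x = (1 + x\<^sup>2) ^ N * exp (- x\<^sup>2)" "0 \<le> gp N x" "integrable lborel (gp N)"
  using integrable_poly_gauss[of "[:1, 0, 1:] ^ N"] by (simp_all add: gp_def[abs_def] power2_eq_square)

lemma poly_bdd_gauss_bound:
  assumes "poly_bdd g"
  obtains C N where "0 \<le> C" "\<And>Q P. \<bar>g Q P * (exp (- (Q\<^sup>2 + P\<^sup>2)) / pi)\<bar> \<le> C * (gp N Q * gp N P)"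
proof -
  obtain C N where C: "0 \<le> C" "\<And>Q P. \<bar>g Q P\<bar> \<le> C * ((1 + Q\<^sup>2) * (1 + P\<^sup>2)) ^ N" using pbE[OF assms(1)] by blast
  have "\<bar>g Q P * (exp (- (Q\<^sup>2 + P\<^sup>2)) / pi)\<bar> \<le> C * (gp N Q * gp N P)" for Q P
  proof -
    have e: "exp (- (Q\<^sup>2 + P\<^sup>2)) / pi \<le> exp (- Q\<^sup>2) * exp (- P\<^sup>2)"
      using pi_gt3 by (simp add: exp_add[symmetric] divide_le_eq)
    have "\<bar>g Q P * (exp (- (Q\<^sup>2 + P\<^sup>2)) / pi)\<bar> = \<bar>g Q P\<bar> * (exp (- (Q\<^sup>2 + P\<^sup>2)) / pi)" by (simp add: abs_mult)
    also have "\<dots> \<le> (C * ((1 + Q\<^sup>2) * (1 + P\<^sup>2)) ^ N) * (exp (- Q\<^sup>2) * exp (- P\<^sup>2))"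
      using C e order_trans[OF abs_ge_zero C(2)[of Q P]] by (intro mult_mono) auto
    finally show ?thesis by (simp add: gp(1) power_mult_distrib mult_ac)
  qed
  with C(1) that show thesis by blast
qed

lemma integrable_prod_lborel:
  fixes f g :: "real \<Rightarrow> real"
  assumes "integrable lborel f" "integrable lborel g"
  shows "integrable lborel (\<lambda>z. f (fst z) * g (snd z))"
proof -
  have "integrable (lborel \<Otimes>\<^sub>M lborel) (\<lambda>z. f (fst z) * g (snd z))"
  proof (rule lborel_pair.Fubini_integrable)
    show "(\<lambda>z. f (fst z) * g (snd z)) \<in> borel_measurable (lborel \<Otimes>\<^sub>M lborel)"
      using assms[THEN borel_measurable_integrable] by measurable
    show "integrable lborel (\<lambda>x. LINT y|lborel. norm (f (fst (x, y)) * g (snd (x, y))))"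
      using assms by (simp add: abs_mult)
    show "AE x in lborel. integrable lborel (\<lambda>y. f (fst (x, y)) * g (snd (x, y)))"
      using assms by simp
  qed
  then show ?thesis by (simp add: lborel_prod)
qed

lemma poly_bdd_measurable: "poly_bdd g \<Longrightarrow> (\<lambda>z. g (fst z) (snd z)) \<in> borel_measurable borel"
  by (simp add: poly_bdd_def borel_measurable_continuous_onI)

lemma poly_bdd_integrable:
  assumes "poly_bdd g"
  shows "integrable lborel (\<lambda>z. g (fst z) (snd z) * (exp (- ((fst z)\<^sup>2 + (snd z)\<^sup>2)) / pi))"
proof -
  obtain C N where C: "0 \<le> C" "\<And>Q P. \<bar>g Q P * (exp (- (Q\<^sup>2 + P\<^sup>2)) / pi)\<bar> \<le> C * (gp N Q * gp N P)"
    using poly_bdd_gauss_bound[OF assms] by blast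
  show ?thesis
  proof (rule Bochner_Integration.integrable_bound)
    show "integrable lborel (\<lambda>z. C * (gp N (fst z) * gp N (snd z)))"
      by (intro integrable_mult_right integrable_prod_lborel gp)
    show "(\<lambda>z. g (fst z) (snd z) * (exp (- ((fst z)\<^sup>2 + (snd z)\<^sup>2)) / pi)) \<in> borel_measurable lborel"
    proof -
      have "(\<lambda>z. g (fst z) (snd z) * (exp (- ((fst z)\<^sup>2 + (snd z)\<^sup>2)) / pi)) \<in> borel_measurable borel"
        by (intro borel_measurable_times poly_bdd_measurable assms borel_measurable_continuous_onI continuous_intros) auto
      then show ?thesis by simp
    qed
    show "AE z in lborel. norm (g (fst z) (snd z) * (exp (- ((fst z)\<^sup>2 + (snd z)\<^sup>2)) / pi)) \<le> norm (C * (gp N (fst z) * gp N (snd z)))"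
      using C gp(2) by (auto simp: abs_mult)
  qed
qed

lemma poly_bdd_section:
  assumes "poly_bdd g"
  shows "continuous_on UNIV (\<lambda>Q. g Q P)" "continuous_on UNIV (\<lambda>P. g Q P)"
    "integrable lborel (\<lambda>Q. g Q P * (exp (- (Q\<^sup>2 + P\<^sup>2)) / pi))"
    "integrable lborel (\<lambda>P. g Q P * (exp (- (Q\<^sup>2 + P\<^sup>2)) / pi))"
proof -
  have c: "continuous_on UNIV (\<lambda>z. g (fst z) (snd z))" using assms by (simp add: poly_bdd_def)
  have "continuous_on UNIV (\<lambda>Q. (Q, P))" "continuous_on UNIV (\<lambda>P. (Q, P))" by (intro continuous_intros)+
  from continuous_on_compose2[OF c this(1)] continuous_on_compose2[OF c this(2)]
  show c1: "continuous_on UNIV (\<lambda>Q. g Q P)" and c2: "continuous_on UNIV (\<lambda>P. g Q P)" by simp_all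
  obtain C N where C: "0 \<le> C" "\<And>Q P. \<bar>g Q P * (exp (- (Q\<^sup>2 + P\<^sup>2)) / pi)\<bar> \<le> C * (gp N Q * gp N P)"
    using poly_bdd_gauss_bound[OF assms] by blast
  show "integrable lborel (\<lambda>Q. g Q P * (exp (- (Q\<^sup>2 + P\<^sup>2)) / pi))"
  proof (rule Bochner_Integration.integrable_bound)
    show "integrable lborel (\<lambda>Q. C * (gp N Q * gp N P))" by (intro integrable_mult_right integrable_mult_left gp)
    show "(\<lambda>Q. g Q P * (exp (- (Q\<^sup>2 + P\<^sup>2)) / pi)) \<in> borel_measurable lborel"
      using borel_measurable_continuous_onI[OF c1] by simp
  qed (use C gp(2) in \<open>auto simp: abs_mult\<close>)
  show "integrable lborel (\<lambda>P. g Q P * (exp (- (Q\<^sup>2 + P\<^sup>2)) / pi))"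
  proof (rule Bochner_Integration.integrable_bound)
    show "integrable lborel (\<lambda>P. C * (gp N Q * gp N P))" by (intro integrable_mult_right gp)
    show "(\<lambda>P. g Q P * (exp (- (Q\<^sup>2 + P\<^sup>2)) / pi)) \<in> borel_measurable lborel"
      using borel_measurable_continuous_onI[OF c2] by simp
  qed (use C gp(2) in \<open>auto simp: abs_mult\<close>)
qed

section \<open>Rules for Gaussian means\<close>

lemma gauss_mean_add: "poly_bdd g \<Longrightarrow> poly_bdd h \<Longrightarrow> gauss_mean (\<lambda>Q P. g Q P + h Q P) = gauss_mean g + gauss_mean h"
  unfolding gauss_mean_def by (subst Bochner_Integration.integral_add[symmetric, OF poly_bdd_integrable poly_bdd_integrable]) (simp_all add: algebra_simps add_divide_distrib)

lemma gauss_mean_cmult: "gauss_mean (\<lambda>Q P. c * g Q P) = c * gauss_mean g"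
  unfolding gauss_mean_def by (subst integral_mult_right_zero[symmetric]) (simp add: mult_ac)

lemma gauss_mean_diff: "poly_bdd g \<Longrightarrow> poly_bdd h \<Longrightarrow> gauss_mean (\<lambda>Q P. g Q P - h Q P) = gauss_mean g - gauss_mean h"
  using gauss_mean_add[of g "\<lambda>Q P. (-1) * h Q P"] gauss_mean_cmult[of "-1" h] poly_bdd_cmult[of h "-1"] by simp

lemma gauss_mean_mono: "poly_bdd g \<Longrightarrow> poly_bdd h \<Longrightarrow> (\<And>Q P. g Q P \<le> h Q P) \<Longrightarrow> gauss_mean g \<le> gauss_mean h"
  unfolding gauss_mean_def by (intro integral_mono poly_bdd_integrable mult_right_mono) auto

lemma gauss_mean_iterated:
  assumes "poly_bdd g"
  shows "gauss_mean g = (LINT Q|lborel. LINT P|lborel. g Q P * (exp (- (Q\<^sup>2 + P\<^sup>2)) / pi))"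
    "gauss_mean g = (LINT P|lborel. LINT Q|lborel. g Q P * (exp (- (Q\<^sup>2 + P\<^sup>2)) / pi))"
proof -
  have "integrable (lborel \<Otimes>\<^sub>M lborel) (\<lambda>(Q, P). g Q P * (exp (- (Q\<^sup>2 + P\<^sup>2)) / pi))"
    using poly_bdd_integrable[OF assms] by (simp add: lborel_prod split_def)
  from lborel_pair.integral_fst[OF this] lborel_pair.integral_snd[OF this]
  show "gauss_mean g = (LINT Q|lborel. LINT P|lborel. g Q P * (exp (- (Q\<^sup>2 + P\<^sup>2)) / pi))"
    "gauss_mean g = (LINT P|lborel. LINT Q|lborel. g Q P * (exp (- (Q\<^sup>2 + P\<^sup>2)) / pi))"
    by (simp_all add: gauss_mean_def lborel_prod split_def)
qed

lemma integral_derivative_zero_real: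
  fixes F f :: "real \<Rightarrow> real"
  assumes d: "\<And>x. (F has_real_derivative f x) (at x)" and c: "continuous_on UNIV f"
    and i: "integrable lborel f" and b: "\<And>x. \<bar>F x\<bar> \<le> C * gp N x"
  shows "integral\<^sup>L lborel f = 0"
proof -
  have "((\<lambda>x. C * gp N x) \<longlongrightarrow> C * 0) at_top" "((\<lambda>x. C * gp N x) \<longlongrightarrow> C * 0) at_bot"
    unfolding gp_def by (intro tendsto_intros poly_gauss_tendsto_0)+
  then have l: "(F \<longlongrightarrow> 0) at_top" "(F \<longlongrightarrow> 0) at_bot"
    using b by (auto intro!: Lim_null_comparison[where g = "\<lambda>x. C * gp N x"])
  have "integral\<^sup>L lborel (\<lambda>x. complex_of_real (f x)) = 0"
  proof (rule has_integral_derivative_zero)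
    show "((\<lambda>x. complex_of_real (F x)) has_vector_derivative complex_of_real (f x)) (at x)" for x
      using d[of x] by (simp add: has_real_derivative_iff_has_vector_derivative has_vector_derivative_of_real)
    show "isCont (\<lambda>x. complex_of_real (f x)) x" for x
      using c by (auto simp: continuous_on_eq_continuous_at intro!: continuous_intros)
    show "integrable lborel (\<lambda>x. complex_of_real (f x))" using i by simp
    show "((\<lambda>x. complex_of_real (F x)) \<longlongrightarrow> 0) at_top" "((\<lambda>x. complex_of_real (F x)) \<longlongrightarrow> 0) at_bot"
      using l tendsto_of_real[of F 0, where 'a = complex] by auto
  qed
  then show ?thesis by simp
qed

text \<open>For every P the Q-integral of a Q-derivative vanishes; d is that derivative with the
  Gaussian factor divided out.\<close>

lemma gauss_mean_divergence:
  assumes g: "poly_bdd g" "poly_bdd d"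
    and "\<And>Q P. ((\<lambda>Q. g Q P * exp (- (Q\<^sup>2 + P\<^sup>2))) has_real_derivative d Q P * exp (- (Q\<^sup>2 + P\<^sup>2))) (at Q)"
  shows "gauss_mean d = 0"
proof -
  obtain C N where C: "0 \<le> C" "\<And>Q P. \<bar>g Q P * (exp (- (Q\<^sup>2 + P\<^sup>2)) / pi)\<bar> \<le> C * (gp N Q * gp N P)"
    using poly_bdd_gauss_bound[OF assms(1)] by blast
  have "(LINT Q|lborel. d Q P * (exp (- (Q\<^sup>2 + P\<^sup>2)) / pi)) = 0" for P
  proof (rule integral_derivative_zero_real)
    show "((\<lambda>Q. g Q P * (exp (- (Q\<^sup>2 + P\<^sup>2)) / pi)) has_real_derivative d Q P * (exp (- (Q\<^sup>2 + P\<^sup>2)) / pi)) (at Q)" for Q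
      using DERIV_cdivide[OF assms(3)[of P Q], of pi] by simp
    show "continuous_on UNIV (\<lambda>Q. d Q P * (exp (- (Q\<^sup>2 + P\<^sup>2)) / pi))"
      by (intro continuous_intros poly_bdd_section g) simp
    show "integrable lborel (\<lambda>Q. d Q P * (exp (- (Q\<^sup>2 + P\<^sup>2)) / pi))" by (intro poly_bdd_section g)
    show "\<bar>g Q P * (exp (- (Q\<^sup>2 + P\<^sup>2)) / pi)\<bar> \<le> (C * gp N P) * gp N Q" for Q using C(2)[of Q P] by (simp add: mult_ac)
  qed
  then show ?thesis by (simp add: gauss_mean_iterated(2)[OF g(2)])
qed

lemma gauss_mean_swap: "poly_bdd g \<Longrightarrow> poly_bdd (\<lambda>Q P. g P Q) \<and> gauss_mean (\<lambda>Q P. g P Q) = gauss_mean g"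
proof -
  assume g: "poly_bdd g"
  obtain C N where C: "0 \<le> C" "\<And>Q P. \<bar>g Q P\<bar> \<le> C * ((1 + Q\<^sup>2) * (1 + P\<^sup>2)) ^ N" using pbE[OF g] by blast
  have "continuous_on UNIV (\<lambda>z. g (fst (snd z, fst z)) (snd (snd z, fst z)))"
    by (rule continuous_on_compose2[OF _ continuous_on_swap[unfolded prod.swap_def]]) (use g in \<open>auto simp: poly_bdd_def\<close>)
  moreover have "\<bar>g P Q\<bar> \<le> C * ((1 + Q\<^sup>2) * (1 + P\<^sup>2)) ^ N" for Q P using C(2)[of P Q] by (simp add: mult.commute)
  ultimately have s: "poly_bdd (\<lambda>Q P. g P Q)" unfolding poly_bdd_def by auto
  then show "poly_bdd (\<lambda>Q P. g P Q) \<and> gauss_mean (\<lambda>Q P. g P Q) = gauss_mean g"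
    using gauss_mean_iterated(1)[OF s] gauss_mean_iterated(2)[OF g] by (simp add: add.commute)
qed

lemma gauss_mean_one: "gauss_mean (\<lambda>Q P. 1) = 1"
proof -
  have i: "(LINT x|lborel. exp (- x\<^sup>2)) = sqrt pi"
  proof -
    have "complex_of_real (LINT x|lborel. exp (- x\<^sup>2)) = gauss_ft 0 1" by (simp add: gauss_ft_def)
    then show ?thesis unfolding gauss_ft_1 by (simp add: of_real_eq_iff del: of_real_mult)
  qed
  have "gauss_mean (\<lambda>Q P. 1) = (LINT Q|lborel. LINT P|lborel. exp (- Q\<^sup>2) / pi * exp (- P\<^sup>2))"
    unfolding gauss_mean_iterated(1)[OF poly_bdd_const] by (simp add: exp_diff exp_minus field_simps)
  also have "\<dots> = 1" by (simp add: i)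
  finally show ?thesis .
qed

lemma radial_deriv:
  "((\<lambda>Q. exp (- (Q\<^sup>2 + P\<^sup>2))) has_real_derivative - (2 * Q) * exp (- (Q\<^sup>2 + P\<^sup>2))) (at Q)"
  "((\<lambda>Q. poly r (Q\<^sup>2 + P\<^sup>2)) has_real_derivative poly (pderiv r) (Q\<^sup>2 + P\<^sup>2) * (2 * Q)) (at Q)"
  "((\<lambda>P. exp (- (Q\<^sup>2 + P\<^sup>2))) has_real_derivative - (2 * P) * exp (- (Q\<^sup>2 + P\<^sup>2))) (at P)"
  "((\<lambda>P. poly r (Q\<^sup>2 + P\<^sup>2)) has_real_derivative poly (pderiv r) (Q\<^sup>2 + P\<^sup>2) * (2 * P)) (at P)"
  by (auto intro!: derivative_eq_intros DERIV_chain2[OF poly_DERIV])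

text \<open>Integration by parts for the exponentially distributed variable Q^2 + P^2, without polar
  coordinates: the divergence of the field (Q r, P r) times the Gaussian integrates to zero, and its
  two halves are exchanged by swapping Q and P.\<close>

lemma gauss_mean_radial:
  "gauss_mean (\<lambda>Q P. (Q\<^sup>2 + P\<^sup>2) * poly r (Q\<^sup>2 + P\<^sup>2)) =
     gauss_mean (\<lambda>Q P. poly r (Q\<^sup>2 + P\<^sup>2)) + gauss_mean (\<lambda>Q P. (Q\<^sup>2 + P\<^sup>2) * poly (pderiv r) (Q\<^sup>2 + P\<^sup>2))"
proof -
  define d where "d Q P = poly r (Q\<^sup>2 + P\<^sup>2) + 2 * Q\<^sup>2 * poly (pderiv r) (Q\<^sup>2 + P\<^sup>2) - 2 * Q\<^sup>2 * poly r (Q\<^sup>2 + P\<^sup>2)" for Q P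
  have pd: "poly_bdd d" unfolding d_def[abs_def] by (intro poly_bdd_intros)
  have z: "gauss_mean d = 0"
  proof (rule gauss_mean_divergence[OF _ pd])
    show "poly_bdd (\<lambda>Q P. Q * poly r (Q\<^sup>2 + P\<^sup>2))" by (intro poly_bdd_intros)
    show "((\<lambda>Q. Q * poly r (Q\<^sup>2 + P\<^sup>2) * exp (- (Q\<^sup>2 + P\<^sup>2))) has_real_derivative d Q P * exp (- (Q\<^sup>2 + P\<^sup>2))) (at Q)" for Q P
    proof (rule DERIV_cong[OF DERIV_mult[OF DERIV_mult[OF DERIV_ident radial_deriv(2)] radial_deriv(1)]])
      have "(1 * a + b * (2 * Q) * Q) * E + - (2 * Q) * E * (Q * a) = (a + 2 * Q\<^sup>2 * b - 2 * Q\<^sup>2 * a) * E" for a b E :: real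
        by (simp add: algebra_simps power2_eq_square)
      then show "(1 * poly r (Q\<^sup>2 + P\<^sup>2) + poly (pderiv r) (Q\<^sup>2 + P\<^sup>2) * (2 * Q) * Q) * exp (- (Q\<^sup>2 + P\<^sup>2)) +
          - (2 * Q) * exp (- (Q\<^sup>2 + P\<^sup>2)) * (Q * poly r (Q\<^sup>2 + P\<^sup>2)) = d Q P * exp (- (Q\<^sup>2 + P\<^sup>2))"
        unfolding d_def .
    qed
  qed
  have "0 = gauss_mean (\<lambda>Q P. d Q P + d P Q)"
    using gauss_mean_swap[OF pd] z by (simp add: gauss_mean_add pd)
  also have "(\<lambda>Q P. d Q P + d P Q) = (\<lambda>Q P. 2 * ((poly r (Q\<^sup>2 + P\<^sup>2) + (Q\<^sup>2 + P\<^sup>2) * poly (pderiv r) (Q\<^sup>2 + P\<^sup>2)) - (Q\<^sup>2 + P\<^sup>2) * poly r (Q\<^sup>2 + P\<^sup>2)))"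
  proof (intro ext)
    fix Q P :: real
    have c: "P\<^sup>2 + Q\<^sup>2 = Q\<^sup>2 + P\<^sup>2" by simp
    have "(a + 2 * Q\<^sup>2 * b - 2 * Q\<^sup>2 * a) + (a + 2 * P\<^sup>2 * b - 2 * P\<^sup>2 * a) = 2 * ((a + (Q\<^sup>2 + P\<^sup>2) * b) - (Q\<^sup>2 + P\<^sup>2) * a)" for a b :: real
      by (simp add: algebra_simps)
    then show "d Q P + d P Q = 2 * ((poly r (Q\<^sup>2 + P\<^sup>2) + (Q\<^sup>2 + P\<^sup>2) * poly (pderiv r) (Q\<^sup>2 + P\<^sup>2)) - (Q\<^sup>2 + P\<^sup>2) * poly r (Q\<^sup>2 + P\<^sup>2))"
      unfolding d_def c .
  qed
  also have "gauss_mean \<dots> = 2 * (gauss_mean (\<lambda>Q P. poly r (Q\<^sup>2 + P\<^sup>2)) + gauss_mean (\<lambda>Q P. (Q\<^sup>2 + P\<^sup>2) * poly (pderiv r) (Q\<^sup>2 + P\<^sup>2)) - gauss_mean (\<lambda>Q P. (Q\<^sup>2 + P\<^sup>2) * poly r (Q\<^sup>2 + P\<^sup>2)))"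
    unfolding gauss_mean_cmult by (subst gauss_mean_diff, (intro poly_bdd_intros)+, subst gauss_mean_add, (intro poly_bdd_intros)+) simp
  finally show ?thesis by simp
qed

lemma gauss_mean_moment: "gauss_mean (\<lambda>Q P. (Q\<^sup>2 + P\<^sup>2) ^ n) = fact n"
proof (induction n)
  case 0
  then show ?case by (simp add: gauss_mean_one)
next
  case (Suc n)
  have "gauss_mean (\<lambda>Q P. (Q\<^sup>2 + P\<^sup>2) ^ Suc n) = gauss_mean (\<lambda>Q P. (Q\<^sup>2 + P\<^sup>2) ^ n) + gauss_mean (\<lambda>Q P. (Q\<^sup>2 + P\<^sup>2) * poly (pderiv (monom 1 n)) (Q\<^sup>2 + P\<^sup>2))"
    using gauss_mean_radial[of "monom 1 n"] by (simp add: poly_monom)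
  also have "(\<lambda>Q P. (Q\<^sup>2 + P\<^sup>2) * poly (pderiv (monom 1 n)) (Q\<^sup>2 + P\<^sup>2)) = (\<lambda>Q P. real n * (Q\<^sup>2 + P\<^sup>2) ^ n)" for Q P :: real
    by (cases n) (auto simp: pderiv_monom poly_monom fun_eq_iff)
  finally show ?case unfolding gauss_mean_cmult Suc by (simp add: algebra_simps)
qed

text \<open>Powers of z = sqrt 2 (Q + i P), normalised so that |z|^2 is the argument u of
  \<open>lag\<close>; the coherence is a multiple of Re z^k.\<close>

definition zpow :: "nat \<Rightarrow> real \<Rightarrow> real \<Rightarrow> complex" where
  "zpow n Q P = (of_real (sqrt 2) * (of_real Q + \<i> * of_real P)) ^ n"

lemma poly_bdd_zpow: "poly_bdd (\<lambda>Q P. Re (zpow n Q P)) \<and> poly_bdd (\<lambda>Q P. Im (zpow n Q P))"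
proof (induction n)
  case 0
  then show ?case by (auto simp: zpow_def intro: poly_bdd_intros)
next
  case (Suc n)
  have "Re (zpow (Suc n) Q P) = sqrt 2 * (Q * Re (zpow n Q P) - P * Im (zpow n Q P))"
    "Im (zpow (Suc n) Q P) = sqrt 2 * (Q * Im (zpow n Q P) + P * Re (zpow n Q P))" for Q P
    by (simp_all add: zpow_def algebra_simps)
  then show ?case using Suc by (auto intro!: poly_bdd_intros)
qed

text \<open>An angular average without polar coordinates. The rotation field Q d/dP - P d/dQ
  annihilates radial factors, the Gaussian included, and maps Im z^n to n Re z^n; since it is free
  of divergence, the result has mean zero. In the proof \<open>d1\<close> and \<open>d2\<close> are
  its two parts.\<close>

lemma gauss_mean_zpow:
  assumes "0 < n"
  shows "gauss_mean (\<lambda>Q P. poly r (Q\<^sup>2 + P\<^sup>2) * Re (zpow n Q P)) = 0"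
proof -
  define I where "I Q P = Im (zpow n Q P)" for Q P
  define dz where "dz Q P = of_nat n * of_real (sqrt 2) * zpow (n - 1) Q P" for Q P
  have dQ: "((\<lambda>Q. zpow n Q P) has_vector_derivative dz Q P) (at Q)" for Q P
  proof -
    have "((\<lambda>w. (of_real (sqrt 2) * (w + \<i> * of_real P)) ^ n) has_field_derivative (of_nat n * (of_real (sqrt 2) * (w + \<i> * of_real P)) ^ (n - 1) * of_real (sqrt 2))) (at w)" for w
      by (auto intro!: derivative_eq_intros)
    from has_vector_derivative_real_field[OF this, of Q] show ?thesis by (simp add: zpow_def dz_def mult_ac)
  qed
  have dP: "((\<lambda>P. zpow n Q P) has_vector_derivative \<i> * dz Q P) (at P)" for Q P
  proof -
    have "((\<lambda>w. (of_real (sqrt 2) * (of_real Q + \<i> * w)) ^ n) has_field_derivative (of_nat n * (of_real (sqrt 2) * (of_real Q + \<i> * w)) ^ (n - 1) * (of_real (sqrt 2) * \<i>))) (at w)" for w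
      by (auto intro!: derivative_eq_intros)
    from has_vector_derivative_real_field[OF this, of P] show ?thesis by (simp add: zpow_def dz_def mult_ac)
  qed
  have IQ: "((\<lambda>Q. I Q P) has_real_derivative Im (dz Q P)) (at Q)" for Q P
    using bounded_linear.has_vector_derivative[OF bounded_linear_Im dQ[of P Q]]
    by (simp add: I_def[abs_def] has_real_derivative_iff_has_vector_derivative)
  have IP: "((\<lambda>P. I Q P) has_real_derivative Re (dz Q P)) (at P)" for Q P
    using bounded_linear.has_vector_derivative[OF bounded_linear_Im dP[of Q P]]
    by (simp add: I_def[abs_def] has_real_derivative_iff_has_vector_derivative)
  have rot: "Q * Re (dz Q P) - P * Im (dz Q P) = real n * Re (zpow n Q P)" for Q P
  proof -
    have "zpow n Q P = of_real (sqrt 2) * (of_real Q + \<i> * of_real P) * zpow (n - 1) Q P"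
      using assms by (cases n) (simp_all add: zpow_def)
    then show ?thesis by (simp add: dz_def algebra_simps)
  qed
  have pI: "poly_bdd I" unfolding I_def[abs_def] using poly_bdd_zpow by blast
  have pdz: "poly_bdd (\<lambda>Q P. Im (dz Q P))" "poly_bdd (\<lambda>Q P. Re (dz Q P))"
    unfolding dz_def using poly_bdd_zpow[of "n - 1"] by (auto intro!: poly_bdd_intros)
  define d1 where "d1 Q P = - P * (Im (dz Q P) * poly r (Q\<^sup>2 + P\<^sup>2) + I Q P * (2 * Q * (poly (pderiv r) (Q\<^sup>2 + P\<^sup>2) - poly r (Q\<^sup>2 + P\<^sup>2))))" for Q P
  define d2 where "d2 Q P = Q * (Re (dz Q P) * poly r (Q\<^sup>2 + P\<^sup>2) + I Q P * (2 * P * (poly (pderiv r) (Q\<^sup>2 + P\<^sup>2) - poly r (Q\<^sup>2 + P\<^sup>2))))" for Q P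
  have pd: "poly_bdd d1" "poly_bdd d2" unfolding d1_def[abs_def] d2_def[abs_def] by (intro poly_bdd_intros pI pdz)+
  have "gauss_mean d1 = 0"
  proof (rule gauss_mean_divergence[OF _ pd(1)])
    show "poly_bdd (\<lambda>Q P. - P * (I Q P * poly r (Q\<^sup>2 + P\<^sup>2)))" by (intro poly_bdd_intros pI)
    show "((\<lambda>Q. - P * (I Q P * poly r (Q\<^sup>2 + P\<^sup>2)) * exp (- (Q\<^sup>2 + P\<^sup>2))) has_real_derivative d1 Q P * exp (- (Q\<^sup>2 + P\<^sup>2))) (at Q)" for Q P
    proof (rule DERIV_cong[OF DERIV_mult[OF DERIV_cmult[OF DERIV_mult[OF IQ radial_deriv(2)]] radial_deriv(1)]])
      have "(- P * (i * a + b * (2 * Q) * j)) * E + - (2 * Q) * E * (- P * (j * a)) = - P * (i * a + j * (2 * Q * (b - a))) * E" for a b i j E :: real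
        by (simp add: algebra_simps)
      then show "- P * (Im (dz Q P) * poly r (Q\<^sup>2 + P\<^sup>2) + poly (pderiv r) (Q\<^sup>2 + P\<^sup>2) * (2 * Q) * I Q P) * exp (- (Q\<^sup>2 + P\<^sup>2)) +
          - (2 * Q) * exp (- (Q\<^sup>2 + P\<^sup>2)) * (- P * (I Q P * poly r (Q\<^sup>2 + P\<^sup>2))) = d1 Q P * exp (- (Q\<^sup>2 + P\<^sup>2))"
        unfolding d1_def .
    qed
  qed
  moreover have "gauss_mean (\<lambda>P Q. d2 Q P) = 0"
  proof (rule gauss_mean_divergence)
    show "poly_bdd (\<lambda>P Q. Q * (I Q P * poly r (Q\<^sup>2 + P\<^sup>2)))" by (rule gauss_mean_swap[THEN conjunct1]) (intro poly_bdd_intros pI)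
    show "poly_bdd (\<lambda>P Q. d2 Q P)" by (rule gauss_mean_swap[THEN conjunct1, OF pd(2)])
    show "((\<lambda>P. Q * (I Q P * poly r (Q\<^sup>2 + P\<^sup>2)) * exp (- (P\<^sup>2 + Q\<^sup>2))) has_real_derivative d2 Q P * exp (- (P\<^sup>2 + Q\<^sup>2))) (at P)" for Q P
      unfolding add.commute[of "_\<^sup>2" "Q\<^sup>2"]
    proof (rule DERIV_cong[OF DERIV_mult[OF DERIV_cmult[OF DERIV_mult[OF IP radial_deriv(4)]] radial_deriv(3)]])
      have "(Q * (i * a + b * (2 * P) * j)) * E + - (2 * P) * E * (Q * (j * a)) = Q * (i * a + j * (2 * P * (b - a))) * E" for a b i j E :: real
        by (simp add: algebra_simps)
      then show "Q * (Re (dz Q P) * poly r (Q\<^sup>2 + P\<^sup>2) + poly (pderiv r) (Q\<^sup>2 + P\<^sup>2) * (2 * P) * I Q P) * exp (- (Q\<^sup>2 + P\<^sup>2)) +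
          - (2 * P) * exp (- (Q\<^sup>2 + P\<^sup>2)) * (Q * (I Q P * poly r (Q\<^sup>2 + P\<^sup>2))) = d2 Q P * exp (- (Q\<^sup>2 + P\<^sup>2))"
        unfolding d2_def .
    qed
  qed
  then have "gauss_mean d2 = 0" using gauss_mean_swap[OF pd(2)] by simp
  ultimately have "gauss_mean (\<lambda>Q P. d1 Q P + d2 Q P) = 0" by (simp add: gauss_mean_add pd)
  moreover have "d1 Q P + d2 Q P = real n * (poly r (Q\<^sup>2 + P\<^sup>2) * Re (zpow n Q P))" for Q P
  proof -
    have "d1 Q P + d2 Q P = poly r (Q\<^sup>2 + P\<^sup>2) * (Q * Re (dz Q P) - P * Im (dz Q P))"
      by (simp add: d1_def d2_def algebra_simps)
    then show ?thesis unfolding rot by simp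
  qed
  ultimately have "real n * gauss_mean (\<lambda>Q P. poly r (Q\<^sup>2 + P\<^sup>2) * Re (zpow n Q P)) = 0" by (simp add: gauss_mean_cmult)
  then show ?thesis using assms by simp
qed

section \<open>Means of Laguerre functions\<close>

lemma lag_poly: "\<exists>r. \<forall>u. lag n u = poly r u"
proof (induction n rule: less_induct)
  case (less n)
  consider "n = 0" | "n = Suc 0" | k where "n = Suc (Suc k)" by (metis not0_implies_Suc)
  then show ?case
  proof cases
    case 1
    then show ?thesis by (auto intro!: exI[of _ 1])
  next
    case 2
    then show ?thesis by (auto intro!: exI[of _ "[:-1, 1:]"])
  next
    case 3
    have "Suc k < n" "k < n" using 3 by auto
    from less[OF this(1)] less[OF this(2)]
    obtain a b where ab: "\<And>u. lag (Suc k) u = poly a u" "\<And>u. lag k u = poly b u"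
      by blast
    show ?thesis
    proof (intro exI allI)
      fix u
      have "poly [:- 2 * real k - 3, 1:] u = u - 2 * real k - 3" by simp
      then show "lag n u = poly (smult (1 / real (Suc (Suc k))) ([:- 2 * real k - 3, 1:] * a - smult (real (Suc k)) b)) u"
        unfolding 3 lag.simps(3) ab poly_smult poly_diff poly_mult by (simp only: mult_1_left times_divide_eq_left)
    qed
  qed
qed

lemma lag_at_0: "lag (Suc n) 0 = - lag n 0"
proof (induction n)
  case (Suc n)
  have "real (Suc (Suc n)) * lag (Suc (Suc n)) 0 = - (2 * real (Suc n) + 1) * lag (Suc n) 0 - real (Suc n) * lag n 0"
    using lag_rec[of "Suc n" 0] by simp
  also have "\<dots> = real (Suc (Suc n)) * (- lag (Suc n) 0)" unfolding Suc by (simp add: algebra_simps)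
  finally show ?case by (simp only: mult_cancel_left of_nat_eq_0_iff) simp
qed simp

text \<open>The trace and the mean of q^2 + p^2 in a number state. \<open>gauss_mean_radial\<close>
  with the derivative formula expresses the second mean J through the first mean I at n and n - 1;
  the recursion of \<open>lag\<close> then gives I at n + 1, and the value 1 propagates.\<close>

lemma gauss_mean_lag:
  "gauss_mean (\<lambda>Q P. lag n (2 * (Q\<^sup>2 + P\<^sup>2))) = 1" (is ?A)
  "gauss_mean (\<lambda>Q P. (Q\<^sup>2 + P\<^sup>2) * lag n (2 * (Q\<^sup>2 + P\<^sup>2))) = 2 * real n + 1" (is ?B)
proof -
  have pl: "poly_bdd (\<lambda>Q P. lag n (2 * (Q\<^sup>2 + P\<^sup>2)))" for n
  proof -
    obtain r where "\<And>u. lag n u = poly r u" using lag_poly by blast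
    then show ?thesis by (auto intro!: poly_bdd_intros)
  qed
  define I J where "I n = gauss_mean (\<lambda>Q P. lag n (2 * (Q\<^sup>2 + P\<^sup>2)))"
    and "J n = gauss_mean (\<lambda>Q P. (Q\<^sup>2 + P\<^sup>2) * lag n (2 * (Q\<^sup>2 + P\<^sup>2)))" for n
  have JI: "J n = I n + real n * (I n + I (n - 1))" for n
  proof -
    obtain r where r: "\<And>u. lag n u = poly r u" using lag_poly by blast
    define r2 where "r2 = pcompose r [:0, 2:]"
    have p2: "poly r2 x = lag n (2 * x)" for x by (simp add: r2_def poly_pcompose r mult.commute)
    have "x * poly (pderiv r2) x = real n * (lag n (2 * x) + lag (n - 1) (2 * x))" if "0 \<le> x" for x
    \<comment> \<open>\<open>lag_deriv\<close> divides by u, so the origin is covered by the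
      alternating signs of \<open>lag_at_0\<close>.\<close>
    proof (cases "x = 0")
      case True
      then show ?thesis using lag_at_0[of "n - 1"] by (cases n) auto
    next
      case False
      have "(lag n has_real_derivative poly (pderiv r) (2 * x)) (at (2 * x))"
      proof -
        have "lag n = poly r" by (rule ext) (rule r)
        then show ?thesis using poly_DERIV[of r "2 * x"] by simp
      qed
      from DERIV_unique[OF this lag_deriv[of "2 * x" n]] False that
      have "poly (pderiv r) (2 * x) = real n * (lag n (2 * x) + lag (n - 1) (2 * x)) / (2 * x)" by simp
      moreover have "poly (pderiv r2) x = 2 * poly (pderiv r) (2 * x)"
        by (simp add: r2_def pderiv_pcompose poly_pcompose pderiv_pCons mult.commute)
      ultimately show ?thesis using False by simp
    qed
    then have "(\<lambda>Q P. (Q\<^sup>2 + P\<^sup>2) * poly (pderiv r2) (Q\<^sup>2 + P\<^sup>2)) = (\<lambda>Q P. real n * (lag n (2 * (Q\<^sup>2 + P\<^sup>2)) + lag (n - 1) (2 * (Q\<^sup>2 + P\<^sup>2))))"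
      by (simp add: fun_eq_iff)
    moreover have "gauss_mean (\<lambda>Q P. lag n (2 * (Q\<^sup>2 + P\<^sup>2)) + lag (n - 1) (2 * (Q\<^sup>2 + P\<^sup>2))) = I n + I (n - 1)"
      unfolding I_def by (rule gauss_mean_add[OF pl pl])
    ultimately show ?thesis using gauss_mean_radial[of r2] unfolding p2 I_def[symmetric] J_def[symmetric] by (simp only: gauss_mean_cmult)
  qed
  have rec: "real (Suc n) * I (Suc n) = 2 * J n - (2 * real n + 1) * I n - real n * I (n - 1)" for n
  proof -
    have "(\<lambda>Q P. real (Suc n) * lag (Suc n) (2 * (Q\<^sup>2 + P\<^sup>2))) =
      (\<lambda>Q P. (2 * ((Q\<^sup>2 + P\<^sup>2) * lag n (2 * (Q\<^sup>2 + P\<^sup>2))) - (2 * real n + 1) * lag n (2 * (Q\<^sup>2 + P\<^sup>2))) - real n * lag (n - 1) (2 * (Q\<^sup>2 + P\<^sup>2)))"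
      unfolding lag_rec by (simp add: fun_eq_iff algebra_simps)
    then have "real (Suc n) * I (Suc n) = gauss_mean (\<lambda>Q P. (2 * ((Q\<^sup>2 + P\<^sup>2) * lag n (2 * (Q\<^sup>2 + P\<^sup>2))) - (2 * real n + 1) * lag n (2 * (Q\<^sup>2 + P\<^sup>2))) - real n * lag (n - 1) (2 * (Q\<^sup>2 + P\<^sup>2)))"
      unfolding I_def gauss_mean_cmult[symmetric] by simp
    also have "\<dots> = 2 * J n - (2 * real n + 1) * I n - real n * I (n - 1)"
      by (subst gauss_mean_diff, (intro poly_bdd_intros pl)+, subst gauss_mean_diff, (intro poly_bdd_intros pl)+) (simp add: gauss_mean_cmult I_def J_def)
    finally show ?thesis .
  qed
  have I: "I n = 1" for n
  proof (induction n rule: less_induct)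
    case (less n)
    show ?case
    proof (cases n)
      case 0
      then show ?thesis by (simp add: I_def gauss_mean_one)
    next
      case (Suc k)
      have "I k = 1" using less Suc by simp
      moreover have "real k * I (k - 1) = real k" using less[of "k - 1"] Suc by (cases k) auto
      ultimately have "real (Suc k) * I (Suc k) = real (Suc k)"
        unfolding rec JI by (simp add: algebra_simps)
      then show ?thesis using Suc by simp
    qed
  qed
  show ?A using I[of n] by (simp add: I_def)
  show ?B using JI[of n] I by (simp add: J_def)
qed

section \<open>The entropy deficit\<close>

text \<open>Phase space is a product of a position and a momentum space, not of the modes. So Fubini
  is applied in two stages: the momentum integral factorises for fixed positions, and then the
  position integral factorises.\<close>

lemma config_integral_prod:
  assumes g: "\<And>j. j < m \<Longrightarrow> poly_bdd (g j)"
  defines "k \<equiv> \<lambda>j Q P. g j Q P * (exp (- (Q\<^sup>2 + P\<^sup>2)) / pi)"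
  shows "integrable (config m \<Otimes>\<^sub>M config m) (\<lambda>z. \<Prod>j<m. k j (fst z j) (snd z j))"
    "integral\<^sup>L (config m \<Otimes>\<^sub>M config m) (\<lambda>z. \<Prod>j<m. k j (fst z j) (snd z j)) = (\<Prod>j<m. gauss_mean (g j))"
proof -
  interpret C: pair_sigma_finite "config m" "config m"
    by (intro pair_sigma_finite.intro sigma_finite_config)
  have ki: "integrable (lborel \<Otimes>\<^sub>M lborel) (\<lambda>z. k j (fst z) (snd z))" if "j < m" for j
    using poly_bdd_integrable[OF g[OF that]] by (simp add: k_def lborel_prod)
  have ks: "integrable lborel (\<lambda>P. k j Q P)" if "j < m" for j Q
    unfolding k_def by (intro poly_bdd_section g that)
  have ki1: "integrable lborel (\<lambda>Q. LINT P|lborel. k j Q P)" if "j < m" for j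
    using lborel_pair.integrable_fst'[OF ki[OF that]] by simp
  have ki2: "integrable lborel (\<lambda>Q. LINT P|lborel. norm (k j Q P))" if "j < m" for j
    using lborel_pair.integrable_fst'[OF integrable_norm[OF ki[OF that]]] by simp
  have comp: "(\<lambda>x. x j) \<in> borel_measurable (config m)" if "j < m" for j
    unfolding config_def using measurable_component_singleton[of j "{..<m}" "\<lambda>_. lborel"] that by simp
  have meas: "(\<lambda>z. \<Prod>j<m. k j (fst z j) (snd z j)) \<in> borel_measurable (config m \<Otimes>\<^sub>M config m)"
  proof (rule borel_measurable_prod)
    fix j assume "j \<in> {..<m}"
    then have j: "j < m" by simp
    have "(\<lambda>z. (fst z j, snd z j)) \<in> borel_measurable (config m \<Otimes>\<^sub>M config m)"
      by (intro borel_measurable_Pair measurable_compose[OF measurable_fst comp[OF j]] measurable_compose[OF measurable_snd comp[OF j]])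
    moreover have "(\<lambda>w. k j (fst w) (snd w)) \<in> borel_measurable borel"
      using borel_measurable_integrable[OF ki[OF j]] by (simp add: lborel_prod)
    ultimately show "(\<lambda>z. k j (fst z j) (snd z j)) \<in> borel_measurable (config m \<Otimes>\<^sub>M config m)"
      using measurable_compose[of "\<lambda>z. (fst z j, snd z j)" "config m \<Otimes>\<^sub>M config m" borel "\<lambda>w. k j (fst w) (snd w)" borel] by simp
  qed
  have sec: "integrable (config m) (\<lambda>y. \<Prod>j<m. k j (x j) (y j))"
    "(LINT y|config m. (\<Prod>j<m. k j (x j) (y j))) = (\<Prod>j<m. LINT P|lborel. k j (x j) P)" for x
    unfolding config_def using ks
    by (auto intro!: config_prod.product_integrable_prod[where f = "\<lambda>j P. k j (x j) P"] config_prod.product_integral_prod[where f = "\<lambda>j P. k j (x j) P"])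
  have secn: "(LINT y|config m. (\<Prod>j<m. norm (k j (x j) (y j)))) = (\<Prod>j<m. LINT P|lborel. norm (k j (x j) P))" for x
    unfolding config_def using ks
    by (intro config_prod.product_integral_prod[where f = "\<lambda>j P. norm (k j (x j) P)"]) auto
  show i: "integrable (config m \<Otimes>\<^sub>M config m) (\<lambda>z. \<Prod>j<m. k j (fst z j) (snd z j))"
  proof (rule C.Fubini_integrable[OF meas])
    have "integrable (config m) (\<lambda>x. \<Prod>j<m. LINT P|lborel. norm (k j (x j) P))"
      unfolding config_def using ki2
      by (intro config_prod.product_integrable_prod[where f = "\<lambda>j Q. LINT P|lborel. norm (k j Q P)"]) auto
    then show "integrable (config m) (\<lambda>x. LINT y|config m. norm (\<Prod>j<m. k j (fst (x, y) j) (snd (x, y) j)))"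
      by (simp only: fst_conv snd_conv prod_norm[symmetric] secn)
    show "AE x in config m. integrable (config m) (\<lambda>y. \<Prod>j<m. k j (fst (x, y) j) (snd (x, y) j))"
      using sec(1) by simp
  qed
  have "integral\<^sup>L (config m \<Otimes>\<^sub>M config m) (\<lambda>z. \<Prod>j<m. k j (fst z j) (snd z j)) = (LINT x|config m. LINT y|config m. (\<Prod>j<m. k j (x j) (y j)))"
    using C.integral_fst'[OF i] by simp
  also have "\<dots> = (LINT x|config m. (\<Prod>j<m. LINT P|lborel. k j (x j) P))" by (simp only: sec(2))
  also have "\<dots> = (\<Prod>j<m. LINT Q|lborel. LINT P|lborel. k j Q P)"
    unfolding config_def using ki1
    by (intro config_prod.product_integral_prod[where f = "\<lambda>j Q. LINT P|lborel. k j Q P"]) auto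
  also have "\<dots> = (\<Prod>j<m. gauss_mean (g j))"
    by (intro prod.cong refl) (simp add: k_def gauss_mean_iterated(1) g)
  finally show "integral\<^sup>L (config m \<Otimes>\<^sub>M config m) (\<lambda>z. \<Prod>j<m. k j (fst z j) (snd z j)) = (\<Prod>j<m. gauss_mean (g j))" .
qed

text \<open>Matches the form of \<open>diff_entropy\<close>; integrability excludes the case of
  infinity minus infinity.\<close>

lemma ennreal_parts_integral:
  assumes "integrable M (F :: 'a \<Rightarrow> real)"
  shows "enn2ereal (\<integral>\<^sup>+x. ennreal (- F x) \<partial>M) - enn2ereal (\<integral>\<^sup>+x. ennreal (F x) \<partial>M) = ereal (- integral\<^sup>L M F)"
proof -
  have fin: "(\<integral>\<^sup>+x. ennreal (F x) \<partial>M) \<noteq> \<infinity>" "(\<integral>\<^sup>+x. ennreal (- F x) \<partial>M) \<noteq> \<infinity>"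
    using assms by (auto simp: real_integrable_def)
  have e: "enn2ereal X = ereal (enn2real X)" if "X \<noteq> \<infinity>" for X
    using that by (cases X) (auto simp: enn2ereal_ennreal)
  show ?thesis unfolding e[OF fin(1)] e[OF fin(2)] by (simp add: real_lebesgue_integral_def[OF assms])
qed

lemma poly_bdd_ln:
  assumes f: "poly_bdd f" and c: "0 < c" "\<And>Q P. c \<le> f Q P"
  shows "poly_bdd (\<lambda>Q P. ln (f Q P))"
proof (rule poly_bdd_bounded)
  show "poly_bdd (\<lambda>Q P. f Q P + 1 / c)" by (intro poly_bdd_intros f)
  have nz: "f Q P > 0" for Q P using c order_less_le_trans by blast
  show "continuous_on UNIV (\<lambda>z. ln (f (fst z) (snd z)))"
    using f nz by (intro continuous_on_ln) (auto simp: poly_bdd_def less_imp_neq[OF nz, symmetric])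
  show "\<bar>ln (f Q P)\<bar> \<le> f Q P + 1 / c" for Q P
  proof -
    have "ln (f Q P) \<le> f Q P" using ln_bound[OF nz] .
    moreover have "- ln (f Q P) \<le> 1 / f Q P" using ln_bound[of "1 / f Q P"] nz[of Q P] by (simp add: ln_div)
    moreover have "1 / f Q P \<le> 1 / c" using c nz[of Q P] by (intro divide_left_mono) auto
    moreover have "0 < 1 / c" using c(1) by simp
    ultimately show ?thesis using nz[of Q P] unfolding abs_le_iff by linarith
  qed
qed

text \<open>W ln W is a sum over modes i of products in which only the i-th factor carries a
  logarithm, and all other factors integrate to 1. The ln pi from the vacuum density cancels the one
  in \<open>h0\<close>. The result is m times the relative entropy to the vacuum minus the excess of
  q^2 + p^2 over its vacuum mean 1.\<close>

lemma entropy_deficit_product: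
  assumes f: "poly_bdd f" and c: "0 < c" "\<And>Q P. c \<le> f Q P" and one: "gauss_mean f = 1"
    and W: "\<And>q P. W q P = (\<Prod>j<m. exp (- ((q j)\<^sup>2 + (P j)\<^sup>2)) * f (q j) (P j) / pi)"
  shows "entropy_deficit m W = ereal (real m * (1 + gauss_mean (\<lambda>Q P. f Q P * ln (f Q P)) - gauss_mean (\<lambda>Q P. (Q\<^sup>2 + P\<^sup>2) * f Q P)))"
proof -
  have nz: "f Q P > 0" for Q P using c order_less_le_trans by blast
  define l where "l Q P = ln (f Q P) - (Q\<^sup>2 + P\<^sup>2) - ln pi" for Q P
  have pl: "poly_bdd (\<lambda>Q P. f Q P * l Q P)" unfolding l_def[abs_def] by (intro poly_bdd_intros f poly_bdd_ln[OF f c])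
  define g where "g i j = (if j = i then (\<lambda>Q P. f Q P * l Q P) else f)" for i j :: nat
  have pg: "poly_bdd (g i j)" for i j using pl f by (simp add: g_def)
  have lw: "ln (exp (- (Q\<^sup>2 + P\<^sup>2)) * f Q P / pi) = l Q P" for Q P
    using nz[of Q P] by (simp add: ln_div ln_mult l_def)
  have pos: "exp (- (Q\<^sup>2 + P\<^sup>2)) * f Q P / pi > 0" for Q P using nz[of Q P] by simp
  define F where "F z = W (fst z) (snd z) * ln (W (fst z) (snd z))" for z
  have Fs: "F z = (\<Sum>i<m. \<Prod>j<m. g i j (fst z j) (snd z j) * (exp (- ((fst z j)\<^sup>2 + (snd z j)\<^sup>2)) / pi))" for z
  proof -
    have "ln (W (fst z) (snd z)) = (\<Sum>i<m. l (fst z i) (snd z i))"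
      unfolding W by (subst ln_prod) (use nz in \<open>auto simp: less_imp_neq[OF nz, symmetric] lw[simplified]\<close>)
    then have "F z = (\<Sum>i<m. W (fst z) (snd z) * l (fst z i) (snd z i))"
      by (simp add: F_def sum_distrib_left)
    also have "\<dots> = (\<Sum>i<m. \<Prod>j<m. g i j (fst z j) (snd z j) * (exp (- ((fst z j)\<^sup>2 + (snd z j)\<^sup>2)) / pi))"
    proof (intro sum.cong refl)
      fix i assume i: "i \<in> {..<m}"
      have "l (fst z i) (snd z i) = (\<Prod>j<m. if j = i then l (fst z j) (snd z j) else 1)"
        using i by (simp add: prod.delta)
      then have "W (fst z) (snd z) * l (fst z i) (snd z i) = (\<Prod>j<m. exp (- ((fst z j)\<^sup>2 + (snd z j)\<^sup>2)) * f (fst z j) (snd z j) / pi * (if j = i then l (fst z j) (snd z j) else 1))"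
        unfolding W prod.distrib by simp
      also have "\<dots> = (\<Prod>j<m. g i j (fst z j) (snd z j) * (exp (- ((fst z j)\<^sup>2 + (snd z j)\<^sup>2)) / pi))"
        by (intro prod.cong refl) (simp add: g_def)
      finally show "W (fst z) (snd z) * l (fst z i) (snd z i) = (\<Prod>j<m. g i j (fst z j) (snd z j) * (exp (- ((fst z j)\<^sup>2 + (snd z j)\<^sup>2)) / pi))" .
    qed
    finally show ?thesis .
  qed
  have Fi: "integrable (config m \<Otimes>\<^sub>M config m) F"
    unfolding Fs by (intro Bochner_Integration.integrable_sum config_integral_prod pg)
  have "integral\<^sup>L (config m \<Otimes>\<^sub>M config m) F = (\<Sum>i<m. \<Prod>j<m. gauss_mean (g i j))"
    unfolding Fs config_integral_prod(2)[OF pg, symmetric] by (rule Bochner_Integration.integral_sum) (rule config_integral_prod(1)[OF pg])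
  also have "\<dots> = (\<Sum>i<m. gauss_mean (\<lambda>Q P. f Q P * l Q P))"
  proof (intro sum.cong refl)
    fix i assume "i \<in> {..<m}"
    then show "(\<Prod>j<m. gauss_mean (g i j)) = gauss_mean (\<lambda>Q P. f Q P * l Q P)"
      by (subst prod.remove[of _ i]) (auto simp: g_def one)
  qed
  also have "\<dots> = real m * gauss_mean (\<lambda>Q P. f Q P * l Q P)" by simp
  also have "gauss_mean (\<lambda>Q P. f Q P * l Q P) = gauss_mean (\<lambda>Q P. f Q P * ln (f Q P)) - gauss_mean (\<lambda>Q P. (Q\<^sup>2 + P\<^sup>2) * f Q P) - ln pi"
  proof -
    have "(\<lambda>Q P. f Q P * l Q P) = (\<lambda>Q P. (f Q P * ln (f Q P) - (Q\<^sup>2 + P\<^sup>2) * f Q P) - ln pi * f Q P)"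
      by (simp add: l_def fun_eq_iff algebra_simps)
    then have "gauss_mean (\<lambda>Q P. f Q P * l Q P) = gauss_mean (\<lambda>Q P. (f Q P * ln (f Q P) - (Q\<^sup>2 + P\<^sup>2) * f Q P) - ln pi * f Q P)" by simp
    also have "\<dots> = gauss_mean (\<lambda>Q P. f Q P * ln (f Q P) - (Q\<^sup>2 + P\<^sup>2) * f Q P) - gauss_mean (\<lambda>Q P. ln pi * f Q P)"
      by (rule gauss_mean_diff) (intro poly_bdd_intros f poly_bdd_ln[OF f c])+
    also have "gauss_mean (\<lambda>Q P. f Q P * ln (f Q P) - (Q\<^sup>2 + P\<^sup>2) * f Q P) = gauss_mean (\<lambda>Q P. f Q P * ln (f Q P)) - gauss_mean (\<lambda>Q P. (Q\<^sup>2 + P\<^sup>2) * f Q P)"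
      by (rule gauss_mean_diff) (intro poly_bdd_intros f poly_bdd_ln[OF f c])+
    finally show ?thesis by (simp add: gauss_mean_cmult one)
  qed
  finally have int: "integral\<^sup>L (config m \<Otimes>\<^sub>M config m) F = real m * (gauss_mean (\<lambda>Q P. f Q P * ln (f Q P)) - gauss_mean (\<lambda>Q P. (Q\<^sup>2 + P\<^sup>2) * f Q P) - ln pi)" .
  have "diff_entropy m W = ereal (- integral\<^sup>L (config m \<Otimes>\<^sub>M config m) F)"
    unfolding diff_entropy_def split_def F_def[symmetric] by (rule ennreal_parts_integral[OF Fi])
  then show ?thesis unfolding entropy_deficit_def int h0_def by (simp add: algebra_simps)
qed

section \<open>Lower bound for the relative entropy of one mode\<close>

lemma phi_nonneg: "0 < t \<Longrightarrow> 0 \<le> t * ln t - t + (1::real)"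
proof -
  assume t: "0 < t"
  have "- ln t \<le> 1 / t - 1" using ln_le_minus_one[of "1 / t"] t by (simp add: ln_div)
  then have "t * (- ln t) \<le> t * (1 / t - 1)" using t by (intro mult_left_mono) auto
  then show ?thesis using t by (simp add: algebra_simps)
qed

text \<open>The difference of the two sides vanishes at t = 1, and its derivative ln t - (t - 1) / 2
  has the sign of t - 1: below 1 because ln t <= t - 1, and up to 2 because ln t >= (t - 1) /
  t.\<close>

lemma phi_quadratic:
  assumes "0 < t" "t \<le> (2::real)" shows "(t - 1)\<^sup>2 / 4 \<le> t * ln t - t + 1"
proof -
  define h where "h t = t * ln t - t + 1 - (t - 1)\<^sup>2 / 4" for t :: real
  have d: "(h has_real_derivative (ln x - (x - 1) / 2)) (at x)" if "0 < x" for x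
    unfolding h_def[abs_def] using that by (auto intro!: derivative_eq_intros simp: field_simps)
  have "h 1 \<le> h t"
  proof (cases "1 \<le> t")
    case True
    show ?thesis
    proof (rule DERIV_nonneg_imp_nondecreasing[OF True])
      fix x assume x: "1 \<le> x" "x \<le> t"
      have "- ln x \<le> 1 / x - 1" using ln_le_minus_one[of "1 / x"] x by (simp add: ln_div)
      moreover have "(x - 1) / 2 \<le> (x - 1) / x" using x assms by (intro divide_left_mono) auto
      moreover have "(x - 1) / x = 1 - 1 / x" using x by (simp add: field_simps)
      ultimately have "0 \<le> ln x - (x - 1) / 2" by linarith
      then show "\<exists>y. (h has_real_derivative y) (at x) \<and> 0 \<le> y" using d[of x] x by auto
    qed
  next
    case False
    then have "t \<le> 1" by simp
    then show ?thesis
    proof (rule DERIV_nonpos_imp_nonincreasing)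
      fix x assume x: "t \<le> x" "x \<le> 1"
      then have "ln x \<le> x - 1" using assms by (intro ln_le_minus_one) auto
      then have "ln x - (x - 1) / 2 \<le> 0" using x by (simp add: field_simps)
      then show "\<exists>y. (h has_real_derivative y) (at x) \<and> y \<le> 0" using d[of x] x assms by (meson order_less_le_trans)
    qed
  qed
  then show ?thesis by (simp add: h_def)
qed

lemma wig_ratio_eq:
  "wig_ratio p \<eta> k K Q P = (1 - p) * ((1 - \<eta>) + (2 * (sqrt (1 - \<eta>) * sqrt \<eta>) / sqrt (fact k)) * Re (zpow k Q P)
     + \<eta> * lag k (2 * (Q\<^sup>2 + P\<^sup>2))) + p * lag K (2 * (Q\<^sup>2 + P\<^sup>2))"
  by (simp add: wig_ratio_def zpow_def)

lemma poly_bdd_lag: "poly_bdd (\<lambda>Q P. lag n (2 * (Q\<^sup>2 + P\<^sup>2)))"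
proof -
  obtain r where r: "\<And>u. lag n u = poly r u" using lag_poly by blast
  show ?thesis unfolding r by (intro poly_bdd_intros)
qed

lemma poly_bdd_wig_ratio: "poly_bdd (wig_ratio p \<eta> k K)"
  unfolding wig_ratio_eq[abs_def] using poly_bdd_zpow[of k] by (intro poly_bdd_intros poly_bdd_lag) auto

text \<open>The coherence drops out of both means, because its angular average vanishes against any
  radial factor; this is why it costs no energy beyond that of the populations.\<close>

lemma gauss_mean_wig_ratio:
  assumes "0 < k"
  shows "gauss_mean (wig_ratio p \<eta> k K) = 1"
    "gauss_mean (\<lambda>Q P. (Q\<^sup>2 + P\<^sup>2) * wig_ratio p \<eta> k K Q P) = 1 + 2 * ((1 - p) * \<eta> * real k + p * real K)"
proof -
  define a where "a = 2 * (sqrt (1 - \<eta>) * sqrt \<eta>) / sqrt (fact k)"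
  have lin: "gauss_mean (\<lambda>Q P. h Q P * wig_ratio p \<eta> k K Q P) = (1 - p) * (1 - \<eta>) * gauss_mean h + (1 - p) * a * gauss_mean (\<lambda>Q P. h Q P * Re (zpow k Q P))
     + (1 - p) * \<eta> * gauss_mean (\<lambda>Q P. h Q P * lag k (2 * (Q\<^sup>2 + P\<^sup>2))) + p * gauss_mean (\<lambda>Q P. h Q P * lag K (2 * (Q\<^sup>2 + P\<^sup>2)))"
    if h: "poly_bdd h" for h
  proof -
    have pz: "poly_bdd (\<lambda>Q P. Re (zpow k Q P))" using poly_bdd_zpow by blast
    have "(\<lambda>Q P. h Q P * wig_ratio p \<eta> k K Q P) = (\<lambda>Q P. (((1 - p) * (1 - \<eta>)) * h Q P + ((1 - p) * a) * (h Q P * Re (zpow k Q P))) +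
       (((1 - p) * \<eta>) * (h Q P * lag k (2 * (Q\<^sup>2 + P\<^sup>2))) + p * (h Q P * lag K (2 * (Q\<^sup>2 + P\<^sup>2)))))"
      unfolding wig_ratio_eq a_def[symmetric] by (simp add: fun_eq_iff algebra_simps)
    then have "gauss_mean (\<lambda>Q P. h Q P * wig_ratio p \<eta> k K Q P) = gauss_mean (\<lambda>Q P. (((1 - p) * (1 - \<eta>)) * h Q P + ((1 - p) * a) * (h Q P * Re (zpow k Q P))) +
       (((1 - p) * \<eta>) * (h Q P * lag k (2 * (Q\<^sup>2 + P\<^sup>2))) + p * (h Q P * lag K (2 * (Q\<^sup>2 + P\<^sup>2)))))" by simp
    also have "\<dots> = gauss_mean (\<lambda>Q P. ((1 - p) * (1 - \<eta>)) * h Q P + ((1 - p) * a) * (h Q P * Re (zpow k Q P))) +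
       gauss_mean (\<lambda>Q P. ((1 - p) * \<eta>) * (h Q P * lag k (2 * (Q\<^sup>2 + P\<^sup>2))) + p * (h Q P * lag K (2 * (Q\<^sup>2 + P\<^sup>2))))"
      by (rule gauss_mean_add) (intro poly_bdd_intros h pz poly_bdd_lag)+
    also have "gauss_mean (\<lambda>Q P. ((1 - p) * (1 - \<eta>)) * h Q P + ((1 - p) * a) * (h Q P * Re (zpow k Q P))) =
        gauss_mean (\<lambda>Q P. ((1 - p) * (1 - \<eta>)) * h Q P) + gauss_mean (\<lambda>Q P. ((1 - p) * a) * (h Q P * Re (zpow k Q P)))"
      by (rule gauss_mean_add) (intro poly_bdd_intros h pz)+
    also have "gauss_mean (\<lambda>Q P. ((1 - p) * \<eta>) * (h Q P * lag k (2 * (Q\<^sup>2 + P\<^sup>2))) + p * (h Q P * lag K (2 * (Q\<^sup>2 + P\<^sup>2)))) =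
        gauss_mean (\<lambda>Q P. ((1 - p) * \<eta>) * (h Q P * lag k (2 * (Q\<^sup>2 + P\<^sup>2)))) + gauss_mean (\<lambda>Q P. p * (h Q P * lag K (2 * (Q\<^sup>2 + P\<^sup>2))))"
      by (rule gauss_mean_add) (intro poly_bdd_intros h poly_bdd_lag)+
    finally show ?thesis unfolding gauss_mean_cmult by simp
  qed
  have z: "gauss_mean (\<lambda>Q P. Re (zpow k Q P)) = 0" "gauss_mean (\<lambda>Q P. (Q\<^sup>2 + P\<^sup>2) * Re (zpow k Q P)) = 0"
    using gauss_mean_zpow[OF assms, of 1] gauss_mean_zpow[OF assms, of "[:0, 1:]"] by simp_all
  show "gauss_mean (wig_ratio p \<eta> k K) = 1"
    using lin[OF poly_bdd_const[of 1]] unfolding mult_1 gauss_mean_one z gauss_mean_lag by (simp add: field_simps)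
  have "poly_bdd (\<lambda>Q P. Q\<^sup>2 + P\<^sup>2)" by (intro poly_bdd_intros)
  from lin[OF this] show "gauss_mean (\<lambda>Q P. (Q\<^sup>2 + P\<^sup>2) * wig_ratio p \<eta> k K Q P) = 1 + 2 * ((1 - p) * \<eta> * real k + p * real K)"
    using gauss_mean_moment[of 1] unfolding z gauss_mean_lag by (simp add: field_simps)
qed

lemma cmod_zpow: "(cmod (zpow k Q P))\<^sup>2 = (2 * (Q\<^sup>2 + P\<^sup>2)) ^ k"
proof -
  have "(cmod (of_real (sqrt 2) * (of_real Q + \<i> * of_real P)))\<^sup>2 = 2 * (Q\<^sup>2 + P\<^sup>2)"
    by (simp add: norm_mult power_mult_distrib cmod_power2)
  then show ?thesis unfolding zpow_def norm_power by (metis power_mult mult.commute)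
qed

text \<open>The square splits into half of |z|^(2k) and half of Re z^(2k); the second part averages
  to zero and the first one is a factorial moment.\<close>

lemma gauss_mean_Re_zpow_square:
  assumes "0 < k"
  shows "gauss_mean (\<lambda>Q P. (Re (zpow k Q P))\<^sup>2) = 2 ^ k * fact k / 2"
proof -
  have e: "(Re (zpow k Q P))\<^sup>2 = (2 ^ k / 2) * (Q\<^sup>2 + P\<^sup>2) ^ k + (1 / 2) * Re (zpow (2 * k) Q P)" for Q P
  proof -
    have "zpow (2 * k) Q P = (zpow k Q P)\<^sup>2" by (simp add: zpow_def power_mult[symmetric] mult.commute)
    then have "Re (zpow (2 * k) Q P) = (Re (zpow k Q P))\<^sup>2 - (Im (zpow k Q P))\<^sup>2" by (simp add: power2_eq_square)
    moreover have "(Re (zpow k Q P))\<^sup>2 + (Im (zpow k Q P))\<^sup>2 = 2 ^ k * (Q\<^sup>2 + P\<^sup>2) ^ k"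
      using cmod_zpow[of k Q P] by (simp only: cmod_power2 power_mult_distrib)
    ultimately show ?thesis by argo
  qed
  have pz: "poly_bdd (\<lambda>Q P. Re (zpow (2 * k) Q P))" using poly_bdd_zpow by blast
  have "gauss_mean (\<lambda>Q P. (Re (zpow k Q P))\<^sup>2) = gauss_mean (\<lambda>Q P. (2 ^ k / 2) * (Q\<^sup>2 + P\<^sup>2) ^ k) + gauss_mean (\<lambda>Q P. (1 / 2) * Re (zpow (2 * k) Q P))"
    unfolding e by (rule gauss_mean_add) (intro poly_bdd_intros pz)+
  also have "\<dots> = 2 ^ k * fact k / 2"
    unfolding gauss_mean_cmult gauss_mean_moment using gauss_mean_zpow[of "2 * k" 1] assms by simp
  finally show ?thesis .
qed

text \<open>Let x = Q^2 + P^2 and split f - 1 = T + d with T the coherence, whose mean square is B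
  2^k / 2. For x <= X the bound of \<open>phi_quadratic\<close> applies, T^2 <= 2 (f - 1)^2 + 2 d^2,
  and \<open>lag_bound\<close> gives |d| <= 2 (p + eta) e^X. For x > X the integrand is only known
  to be nonnegative, so the lost part of T^2 is estimated as in Chebyshev's inequality by (x / X)^2
  times its radial envelope; the mean of that produces (k + 1) (k + 2), the ratio of two
  factorials.\<close>

lemma relative_entropy_lower:
  assumes k: "0 < k" and p: "0 \<le> p" "p \<le> 1" and eta: "0 \<le> \<eta>" "\<eta> \<le> 1" and X: "0 < X"
    and c: "0 < c" "\<And>Q P. c \<le> wig_ratio p \<eta> k K Q P"
    and up: "\<And>Q P. Q\<^sup>2 + P\<^sup>2 \<le> X \<Longrightarrow> wig_ratio p \<eta> k K Q P \<le> 2"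
  defines "f \<equiv> wig_ratio p \<eta> k K" and "B \<equiv> 4 * (1 - p)\<^sup>2 * ((1 - \<eta>) * \<eta>)"
  shows "B * 2 ^ k / 8 * (1 / 2 - real ((k + 1) * (k + 2)) / X\<^sup>2) - (p + \<eta>)\<^sup>2 * exp (2 * X)
     \<le> gauss_mean (\<lambda>Q P. f Q P * ln (f Q P) - f Q P + 1)"
proof -
  define a where "a = (1 - p) * (2 * (sqrt (1 - \<eta>) * sqrt \<eta>) / sqrt (fact k))"
  define T where "T Q P = a * Re (zpow k Q P)" for Q P
  define D where "D = (p + \<eta>)\<^sup>2 * exp (2 * X)"
  have a2: "a\<^sup>2 = B / fact k"
    using eta by (simp add: a_def B_def power_mult_distrib power_divide)
  have aux: "(1 / 8) * (A - N) - D' \<le> F" if "t \<le> 2 * s + 2 * e" "s / 4 \<le> F" "A = t" "0 \<le> N" "e \<le> 4 * D'"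
    for A N t s e F D' :: real using that by argo
  have B0: "0 \<le> B" using eta by (simp add: B_def)
  have nz: "f Q P > 0" for Q P using c order_less_le_trans unfolding f_def by blast
  have pt: "(1 / 8) * (a\<^sup>2 * (Re (zpow k Q P))\<^sup>2 - (B * 2 ^ k / (fact k * X\<^sup>2)) * (Q\<^sup>2 + P\<^sup>2) ^ (k + 2)) - D \<le> f Q P * ln (f Q P) - f Q P + 1" for Q P
  proof -
    define x where "x = Q\<^sup>2 + P\<^sup>2"
    have x0: "0 \<le> x" by (simp add: x_def)
    show ?thesis
    proof (cases "x \<le> X")
      case True
      define d where "d = f Q P - 1 - T Q P"
      have le: "\<bar>lag n (2 * x)\<bar> \<le> exp X" for n
        using lag_bound[of "2 * x" n] x0 True by (intro order_trans[OF lag_bound]) auto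
      have de: "d = ((1 - p) * (1 - \<eta>) - 1) + (1 - p) * (\<eta> * lag k (2 * x)) + p * lag K (2 * x)"
        by (simp add: d_def f_def wig_ratio_eq T_def a_def x_def algebra_simps)
      have "\<bar>d\<bar> \<le> \<bar>(1 - p) * (1 - \<eta>) - 1\<bar> + \<bar>(1 - p) * (\<eta> * lag k (2 * x))\<bar> + \<bar>p * lag K (2 * x)\<bar>"
        unfolding de by linarith
      also have "\<bar>(1 - p) * (1 - \<eta>) - 1\<bar> \<le> (p + \<eta>) * 1"
      proof -
        have "(1 - p) * (1 - \<eta>) - 1 = - (p + \<eta>) + p * \<eta>" by (simp add: algebra_simps)
        moreover have "0 \<le> p * \<eta>" "p * \<eta> \<le> p" using p eta by (auto intro: mult_left_le)
        ultimately show ?thesis using eta by (simp add: abs_le_iff)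
      qed
      also have "(p + \<eta>) * 1 \<le> (p + \<eta>) * exp X" using p eta X by (intro mult_left_mono) auto
      also have "\<bar>(1 - p) * (\<eta> * lag k (2 * x))\<bar> \<le> 1 * (\<eta> * exp X)"
        unfolding abs_mult using p eta le[of k] by (intro mult_mono) auto
      also have "\<bar>p * lag K (2 * x)\<bar> \<le> p * exp X"
        unfolding abs_mult using p le[of K] by (intro mult_mono) auto
      finally have dd: "\<bar>d\<bar> \<le> 2 * ((p + \<eta>) * exp X)" by (simp add: algebra_simps)
      have "d\<^sup>2 = \<bar>d\<bar>\<^sup>2" by simp
      also have "\<dots> \<le> (2 * ((p + \<eta>) * exp X))\<^sup>2" using dd by (intro power_mono) auto
      also have "\<dots> = 4 * D" by (simp add: D_def power_mult_distrib exp_double)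
      finally have d4: "d\<^sup>2 \<le> 4 * D" .
      have "(T Q P)\<^sup>2 \<le> 2 * (f Q P - 1)\<^sup>2 + 2 * d\<^sup>2"
      proof -
        have "0 \<le> (f Q P - 1 + d)\<^sup>2" by simp
        moreover have T: "T Q P = f Q P - 1 - d" by (simp add: d_def)
        ultimately show ?thesis unfolding T by (simp add: power2_eq_square algebra_simps)
      qed
      moreover have "(f Q P - 1)\<^sup>2 / 4 \<le> f Q P * ln (f Q P) - f Q P + 1"
        using nz[of Q P] up[of Q P] True by (intro phi_quadratic) (auto simp: x_def f_def)
      moreover have "a\<^sup>2 * (Re (zpow k Q P))\<^sup>2 = (T Q P)\<^sup>2" by (simp add: T_def power_mult_distrib)
      moreover have "0 \<le> (B * 2 ^ k / (fact k * X\<^sup>2)) * (Q\<^sup>2 + P\<^sup>2) ^ (k + 2)"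
        using B0 by (intro mult_nonneg_nonneg divide_nonneg_nonneg) auto
      ultimately show ?thesis using d4 aux by metis
    next
      case False
      have "(Re (zpow k Q P))\<^sup>2 \<le> (2 * x) ^ k"
        unfolding x_def cmod_zpow[symmetric] cmod_power2 by simp
      also have "\<dots> \<le> (2 * x) ^ k * (x / X)\<^sup>2"
      proof -
        have "1 ^ 2 \<le> (x / X)\<^sup>2" using False X by (intro power_mono) auto
        then have "(2 * x) ^ k * 1 \<le> (2 * x) ^ k * (x / X)\<^sup>2" using x0 by (intro mult_left_mono) auto
        then show ?thesis by simp
      qed
      finally have "a\<^sup>2 * (Re (zpow k Q P))\<^sup>2 \<le> B / fact k * ((2 * x) ^ k * (x / X)\<^sup>2)"
        unfolding a2 using B0 by (intro mult_left_mono) auto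
      also have "\<dots> = (B * 2 ^ k / (fact k * X\<^sup>2)) * x ^ (k + 2)"
        by (simp add: power_mult_distrib power_divide power_add power2_eq_square)
      finally have "a\<^sup>2 * (Re (zpow k Q P))\<^sup>2 - (B * 2 ^ k / (fact k * X\<^sup>2)) * (Q\<^sup>2 + P\<^sup>2) ^ (k + 2) \<le> 0"
        by (simp add: x_def)
      moreover have "0 \<le> D" by (simp add: D_def)
      moreover have "0 \<le> f Q P * ln (f Q P) - f Q P + 1" by (rule phi_nonneg[OF nz])
      ultimately show ?thesis by argo
    qed
  qed
  have pz: "poly_bdd (\<lambda>Q P. Re (zpow k Q P))" using poly_bdd_zpow by blast
  have pf: "poly_bdd f" "poly_bdd (\<lambda>Q P. ln (f Q P))" unfolding f_def using poly_bdd_wig_ratio poly_bdd_ln[OF poly_bdd_wig_ratio c] by auto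
  have "gauss_mean (\<lambda>Q P. (1 / 8) * (a\<^sup>2 * (Re (zpow k Q P))\<^sup>2 - (B * 2 ^ k / (fact k * X\<^sup>2)) * (Q\<^sup>2 + P\<^sup>2) ^ (k + 2)) - D * 1)
      \<le> gauss_mean (\<lambda>Q P. f Q P * ln (f Q P) - f Q P + 1)"
    using pt by (intro gauss_mean_mono) (intro poly_bdd_intros pz pf, intro poly_bdd_intros pz pf, simp)
  moreover have "gauss_mean (\<lambda>Q P. (1 / 8) * (a\<^sup>2 * (Re (zpow k Q P))\<^sup>2 - (B * 2 ^ k / (fact k * X\<^sup>2)) * (Q\<^sup>2 + P\<^sup>2) ^ (k + 2)) - D * 1)
     = gauss_mean (\<lambda>Q P. (1 / 8) * (a\<^sup>2 * (Re (zpow k Q P))\<^sup>2 - (B * 2 ^ k / (fact k * X\<^sup>2)) * (Q\<^sup>2 + P\<^sup>2) ^ (k + 2))) - gauss_mean (\<lambda>Q P. D * 1)"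
    by (rule gauss_mean_diff) (intro poly_bdd_intros pz)+
  moreover have "gauss_mean (\<lambda>Q P. a\<^sup>2 * (Re (zpow k Q P))\<^sup>2 - (B * 2 ^ k / (fact k * X\<^sup>2)) * (Q\<^sup>2 + P\<^sup>2) ^ (k + 2))
     = gauss_mean (\<lambda>Q P. a\<^sup>2 * (Re (zpow k Q P))\<^sup>2) - gauss_mean (\<lambda>Q P. (B * 2 ^ k / (fact k * X\<^sup>2)) * (Q\<^sup>2 + P\<^sup>2) ^ (k + 2))"
    by (rule gauss_mean_diff) (intro poly_bdd_intros pz)+
  ultimately have "(1 / 8) * (a\<^sup>2 * (2 ^ k * fact k / 2) - B * 2 ^ k / (fact k * X\<^sup>2) * fact (k + 2)) - D
      \<le> gauss_mean (\<lambda>Q P. f Q P * ln (f Q P) - f Q P + 1)"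
    unfolding gauss_mean_cmult gauss_mean_Re_zpow_square[OF k] gauss_mean_moment gauss_mean_one by simp
  moreover have "a\<^sup>2 * (2 ^ k * fact k / 2) - B * 2 ^ k / (fact k * X\<^sup>2) * fact (k + 2) = B * 2 ^ k * (1 / 2 - real ((k + 1) * (k + 2)) / X\<^sup>2)"
  proof -
    have "fact (k + 2) = real ((k + 1) * (k + 2)) * fact k" by (simp add: algebra_simps)
    then show ?thesis unfolding a2 by (simp add: right_diff_distrib)
  qed
  ultimately show ?thesis by (simp add: D_def)
qed

text \<open>Since f has mean 1, f ln f and f ln f - f + 1 have the same mean; the excess of q^2 +
  p^2 over the vacuum is twice the energy of the mode.\<close>

lemma entropy_deficit_rho:
  assumes k: "0 < k" and p: "0 \<le> p" "p \<le> 1" and eta: "0 \<le> \<eta>" "\<eta> \<le> 1" and X: "0 < X"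
    and c: "0 < c" "\<And>Q P. c \<le> wig_ratio p \<eta> k K Q P"
    and up: "\<And>Q P. Q\<^sup>2 + P\<^sup>2 \<le> X \<Longrightarrow> wig_ratio p \<eta> k K Q P \<le> 2"
  shows "ereal (real m * (4 * (1 - p)\<^sup>2 * ((1 - \<eta>) * \<eta>) * 2 ^ k / 8 * (1 / 2 - real ((k + 1) * (k + 2)) / X\<^sup>2) - (p + \<eta>)\<^sup>2 * exp (2 * X)
      - 2 * ((1 - p) * \<eta> * real k + p * real K))) \<le> entropy_deficit m (rho_wigner m p \<eta> k K)"
proof -
  define f where "f = wig_ratio p \<eta> k K"
  have pf: "poly_bdd f" "poly_bdd (\<lambda>Q P. ln (f Q P))" unfolding f_def using poly_bdd_wig_ratio poly_bdd_ln[OF poly_bdd_wig_ratio c] by auto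
  have "gauss_mean (\<lambda>Q P. f Q P * ln (f Q P) - f Q P + 1) = gauss_mean (\<lambda>Q P. f Q P * ln (f Q P) - f Q P) + gauss_mean (\<lambda>Q P. 1)"
    by (rule gauss_mean_add) (intro poly_bdd_intros pf)+
  also have "gauss_mean (\<lambda>Q P. f Q P * ln (f Q P) - f Q P) = gauss_mean (\<lambda>Q P. f Q P * ln (f Q P)) - gauss_mean f"
    by (rule gauss_mean_diff) (intro poly_bdd_intros pf)+
  finally have "gauss_mean (\<lambda>Q P. f Q P * ln (f Q P) - f Q P + 1) = gauss_mean (\<lambda>Q P. f Q P * ln (f Q P))"
    by (simp add: gauss_mean_one f_def gauss_mean_wig_ratio(1)[OF k])
  then have "entropy_deficit m (rho_wigner m p \<eta> k K) = ereal (real m * (gauss_mean (\<lambda>Q P. f Q P * ln (f Q P) - f Q P + 1) - 2 * ((1 - p) * \<eta> * real k + p * real K)))"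
    using entropy_deficit_product[OF poly_bdd_wig_ratio c gauss_mean_wig_ratio(1)[OF k], of "rho_wigner m p \<eta> k K" m]
    by (simp add: rho_wigner_def mode_wigner_def f_def gauss_mean_wig_ratio(2)[OF k])
  then show ?thesis
    using relative_entropy_lower[OF k p eta X c up] unfolding f_def by (simp add: mult_left_mono)
qed

section \<open>Positivity and choice of the parameters\<close>

text \<open>The function r ln (2 e / r) has derivative ln (2 / r), hence increases on (0, 1]. That
  its values at 1/3 and 3/8 lie on both sides of 1 amounts to 6 e < e^3 and e^8 < (16 e /
  3)^3.\<close>

lemma r_star_unique: "\<exists>!r. is_r_star r"
proof -
  define g :: "real \<Rightarrow> real" where "g r = r * ln (2 * exp 1 / r)" for r
  have d: "(g has_real_derivative ln (2 * exp 1 / x) - 1) (at x)" if "0 < x" for x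
    unfolding g_def[abs_def] using that by (auto intro!: derivative_eq_intros simp: field_simps)
  have mono: "g x < g y" if "0 < x" "x < y" "y \<le> 1" for x y
  proof (rule DERIV_pos_imp_increasing[OF that(2)])
    fix t assume t: "x \<le> t" "t \<le> y"
    have "exp 1 < 2 * exp 1 / t" using t that by (simp add: field_simps)
    then have "ln (exp 1) < ln (2 * exp 1 / t)" using t that by (subst ln_less_cancel_iff) auto
    then show "\<exists>z. (g has_real_derivative z) (at t) \<and> 0 < z" using d[of t] t that by auto
  qed
  have "(6::real) < exp 1 ^ 2"
  proof -
    have "(5/2::real) \<le> exp 1" using exp_lower_Taylor_quadratic[of 1] by simp
    then have "(5/2::real)\<^sup>2 \<le> exp 1 ^ 2" by (intro power_mono) auto
    then show ?thesis by (simp add: power2_eq_square)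
  qed
  then have "6 * exp 1 < (exp 1 :: real) ^ 3" by (simp add: power3_eq_cube power2_eq_square)
  then have "ln (6 * exp 1) < ln ((exp 1 :: real) ^ 3)" by (subst ln_less_cancel_iff) auto
  then have lo: "g (1/3) < 1" by (simp add: g_def ln_realpow)
  have "(exp 1 :: real) ^ 8 < (16/3 * exp 1) ^ 3"
  proof -
    have "(exp 1 :: real) ^ 5 \<le> (272/100) ^ 5" using e_less_272 by (intro power_mono) auto
    also have "\<dots> < (16/3) ^ 3" by (simp add: power_divide eval_nat_numeral)
    finally have "exp 1 ^ 3 * exp 1 ^ 5 < exp 1 ^ 3 * (16/3 :: real) ^ 3"
      by (rule mult_strict_left_mono) simp
    moreover have "(exp 1 :: real) ^ 8 = exp 1 ^ 3 * exp 1 ^ 5" by (simp only: power_add[symmetric]) simp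
    moreover have "(16/3 * exp 1) ^ 3 = exp 1 ^ 3 * (16/3 :: real) ^ 3" by (simp only: power_mult_distrib mult.commute)
    ultimately show ?thesis by metis
  qed
  then have "ln ((exp 1 :: real) ^ 8) < ln ((16/3 * exp 1) ^ 3)" by (subst ln_less_cancel_iff) auto
  then have hi: "1 < g (3/8)" by (simp add: g_def ln_realpow)
  have "\<exists>x\<ge>1/3. x \<le> 3/8 \<and> g x = 1"
  proof (rule IVT')
    show "continuous_on {1/3..3/8} g" 
    proof (rule DERIV_atLeastAtMost_imp_continuous_on)
      fix x :: real assume "1/3 \<le> x"
      then have "0 < x" by simp
      from d[OF this] show "\<exists>y. (g has_real_derivative y) (at x)" by blast
    qed
  qed (use lo hi in auto)
  then obtain r where r: "1/3 \<le> r" "r \<le> 3/8" "g r = 1" by auto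
  have "g r \<noteq> g (1/3)" "g r \<noteq> g (3/8)" using r lo hi by simp_all
  then have "r \<noteq> 1/3" "r \<noteq> 3/8" by blast+
  then have "is_r_star r" using r unfolding is_r_star_def g_def[symmetric] by linarith
  moreover have "s = r" if "is_r_star s" for s
  proof (rule ccontr)
    assume "s \<noteq> r"
    moreover have "1/3 < s" "s < 3/8" "g s = 1" using that by (simp_all add: is_r_star_def g_def)
    ultimately show False using r mono[of s r] mono[of r s] by linarith
  qed
  ultimately show ?thesis by blast
qed

text \<open>The product form is the defining equation of \<open>r_star\<close>. The two summands of
  \<open>c_star\<close> are the forms in which it arises: the shift of the turning point against L,
  and the logarithmic term in k. The bound 39/50 leaves room below the rate 8/10 of the error
  terms.\<close>

lemma r_star: "1/3 < r_star" "r_star < 3/8" "r_star * (1 + b_star) = 1"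
  and b_star_pos: "0 < b_star"
  and c_star_eq: "c_star = 4 * r_star / 3 + 1 / (6 * b_star)"
  and c_star_bounds: "0 < c_star" "c_star < 1"
  and gamma_exp_bounds: "0 < gamma_exp" "gamma_exp < 39/50" 
  and beta_exp_bounds: "0 < beta_exp" "beta_exp < 1"
proof -
  have rs: "is_r_star r_star" unfolding r_star_def by (rule theI'[OF r_star_unique])
  then show r: "1/3 < r_star" "r_star < 3/8" by (auto simp: is_r_star_def)
  have "ln (2 * exp 1 / r_star) = 1 + b_star"
    using r by (simp add: b_star_def ln_div ln_mult)
  then show e: "r_star * (1 + b_star) = 1" using rs by (simp add: is_r_star_def)
  have b: "b_star = 1 / r_star - 1" using e r by (simp add: field_simps)
  have b1: "5/3 < b_star" "b_star < 2" using r unfolding b by (simp_all add: field_simps)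
  then show b0: "0 < b_star" by simp
  have rb: "r_star * b_star = 1 - r_star" using e by (simp add: algebra_simps)
  show c: "c_star = 4 * r_star / 3 + 1 / (6 * b_star)"
  proof -
    have "(4 * r_star / 3 + 1 / (6 * b_star)) * b_star = 4 / 3 * (r_star * b_star) + 1 / 6"
      using b0 by (simp add: distrib_right)
    also have "\<dots> = 3/2 - 4 * r_star / 3" unfolding rb by (simp add: field_simps)
    finally show ?thesis unfolding c_star_def using b0 by (simp add: nonzero_divide_eq_eq)
  qed
  show c0: "0 < c_star" unfolding c using r b0 by (simp add: add_pos_pos)
  have "1 / (6 * b_star) < 1/10" using b1 by (simp add: field_simps)
  then show c1: "c_star < 1" unfolding c using r by simp
  have l2: "2/3 \<le> ln (2::real)" by (rule ln2_ge_two_thirds)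
  have l1: "ln (2::real) < 1" using ln2_le_25_over_36 by simp
  have "1/3 * (2/3) \<le> r_star * ln 2" using r l2 by (intro mult_mono) auto
  then show "gamma_exp < 39/50" by (simp add: gamma_exp_def)
  have "r_star * ln 2 \<le> 3/8 * 1" using r l1 l2 by (intro mult_mono) auto
  then show "0 < gamma_exp" by (simp add: gamma_exp_def)
  show "beta_exp < 1" unfolding beta_exp_def using c0 l2 by (simp add: mult_pos_pos)
  have "c_star * ln 2 < 1 * 1" using c0 c1 l1 l2 by (intro mult_strict_mono) auto
  then show "0 < beta_exp" by (simp add: beta_exp_def)
qed

text \<open>Exact to second order at y = 1. The weaker ln y <= y - 1 would lose the factor sqrt k in
  \<open>ln_fact_lower\<close>, and with it a power in the final estimate.\<close>

lemma ln_le_half_diff: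
  assumes "1 \<le> (y::real)" shows "ln y \<le> (y - 1 / y) / 2"
proof -
  define h where "h y = (y - 1 / y) / 2 - ln y" for y :: real
  have "h 1 \<le> h y"
  proof (rule DERIV_nonneg_imp_nondecreasing[OF assms])
    fix x :: real assume x: "1 \<le> x" "x \<le> y"
    have "(h has_real_derivative ((1 - 1 / x)\<^sup>2 / 2)) (at x)"
      unfolding h_def[abs_def] using x by (auto intro!: derivative_eq_intros simp: field_simps power2_eq_square)
    then show "\<exists>z. (h has_real_derivative z) (at x) \<and> 0 \<le> z" by force
  qed
  then show ?thesis by (simp add: h_def)
qed

text \<open>Stirling's lower bound with the factor sqrt k but without its constant. The summand 1 /
  (4 k) closes the induction: the error of one step is 1 / (4 x (x + 1)), which telescopes.\<close>

lemma ln_fact_lower: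
  assumes "0 < k" shows "(real k + 1/2) * ln (real k) - real k + 1 / (4 * real k) \<le> ln (fact k)"
  using assms
proof (induction k rule: nat_induct_non_zero)
  case 1
  then show ?case by simp
next
  case (Suc k)
  define x where "x = real k"
  have x: "1 \<le> x" using Suc by (simp add: x_def)
  have "ln (x + 1) = ln x + ln ((x + 1) / x)" using x by (simp add: ln_div)
  also have "ln ((x + 1) / x) \<le> ((x + 1) / x - 1 / ((x + 1) / x)) / 2" using x by (intro ln_le_half_diff) simp
  finally have l: "ln (x + 1) \<le> ln x + (2 * x + 1) / (2 * x * (x + 1))" using x by (simp add: field_simps)
  have "(x + 1/2) * ln (x + 1) \<le> (x + 1/2) * (ln x + (2 * x + 1) / (2 * x * (x + 1)))"
    using x by (intro mult_left_mono l) auto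
  also have "\<dots> = (x + 1/2) * ln x + (1 + (1 / (4 * x) - 1 / (4 * (x + 1))))"
  proof -
    have "(x + 1/2) * ((2 * x + 1) / (2 * x * (x + 1))) = 1 + (1 / (4 * x) - 1 / (4 * (x + 1)))"
      using x by (simp add: divide_simps) (simp add: algebra_simps)
    then show ?thesis by (simp add: distrib_left)
  qed
  finally have "(x + 1 + 1/2) * ln (x + 1) - (x + 1) + 1 / (4 * (x + 1)) \<le> ln (x + 1) + ((x + 1/2) * ln x - x + 1 / (4 * x))"
    by (simp add: algebra_simps)
  also have "\<dots> \<le> ln (x + 1) + ln (fact k)" using Suc.IH by (simp add: x_def)
  also have "\<dots> = ln (fact (Suc k))" using x by (simp add: x_def ln_mult add.commute)
  finally show ?case by (simp add: x_def add.commute)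
qed

text \<open>The coherence is at most twice the root of eta u^k / k!. The bound a is left free
  because it is a constant before the turning point and grows with u beyond it.\<close>

lemma wig_ratio_bounds_aux:
  assumes eta: "0 \<le> \<eta>" "\<eta> \<le> 1" and p: "0 \<le> p" "p \<le> 1"
    and a: "\<eta> * (2 * (Q\<^sup>2 + P\<^sup>2)) ^ k / fact k \<le> a\<^sup>2" "0 \<le> a"
  shows "\<bar>wig_ratio p \<eta> k K Q P - ((1 - p) * ((1 - \<eta>) + \<eta> * lag k (2 * (Q\<^sup>2 + P\<^sup>2))) + p * lag K (2 * (Q\<^sup>2 + P\<^sup>2)))\<bar> \<le> 2 * a"
proof -
  define R where "R = 2 * (sqrt (1 - \<eta>) * sqrt \<eta>) / sqrt (fact k) * Re (zpow k Q P)"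
  have c: "2 * (sqrt (1 - \<eta>) * sqrt \<eta>) / sqrt (fact k) \<le> 2 * (1 * sqrt \<eta>) / sqrt (fact k)"
    using eta by (intro divide_right_mono mult_left_mono mult_right_mono) auto
  have "\<bar>R\<bar> = 2 * (sqrt (1 - \<eta>) * sqrt \<eta>) / sqrt (fact k) * \<bar>Re (zpow k Q P)\<bar>"
    unfolding R_def abs_mult abs_divide using eta by simp
  also have "\<dots> \<le> 2 * (1 * sqrt \<eta>) / sqrt (fact k) * cmod (zpow k Q P)"
    using eta by (intro mult_mono c abs_Re_le_cmod) auto
  also have "\<dots> = 2 * sqrt (\<eta> * (2 * (Q\<^sup>2 + P\<^sup>2)) ^ k / fact k)"
    unfolding cmod_zpow[symmetric] using eta by (simp add: real_sqrt_mult real_sqrt_divide)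
  also have "\<dots> \<le> 2 * a" using a by (simp add: real_le_lsqrt)
  finally have R: "\<bar>R\<bar> \<le> 2 * a" .
  have "wig_ratio p \<eta> k K Q P - ((1 - p) * ((1 - \<eta>) + \<eta> * lag k (2 * (Q\<^sup>2 + P\<^sup>2))) + p * lag K (2 * (Q\<^sup>2 + P\<^sup>2))) = (1 - p) * R"
    by (simp add: wig_ratio_eq R_def algebra_simps)
  moreover have "\<bar>(1 - p) * R\<bar> \<le> 1 * (2 * a)" unfolding abs_mult using R p by (intro mult_mono) auto
  ultimately show ?thesis by simp
qed

text \<open>Two regimes, separated by the turning point u0 of |K>. Before it the main term is at
  least (15/16)^2, while the coherence costs at most 2/16 and the negative parts of the two number
  states at most 1/16 each. Beyond it, with t = u / u0, the coherence is at most t^K / 8 because k <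
  K, and \<open>lag_growth\<close> carries the lower bound 1/8 for p |K> at u0 to p |K> >= t^K /
  8.\<close>

lemma wig_ratio_ge:
  assumes k: "0 < k" "k < K" and p: "0 < p" "p \<le> 1/16" and eta: "0 < \<eta>" "\<eta> \<le> 1/16"
    and h2: "1/8 \<le> p * lag K (4 * real K + 2)"
    and h3: "\<eta> * (4 * real K + 2) ^ k / fact k \<le> 1/256"
    and h4: "\<eta> * exp (2 * real k) \<le> 1/16"
    and h5: "96 * (J + 2) ^ 3 + J \<le> K" "p * exp (2 * real K + 1 - 2 * real J) \<le> 1/16"
  shows "1/4 \<le> wig_ratio p \<eta> k K Q P"
proof -
  define u where "u = 2 * (Q\<^sup>2 + P\<^sup>2)"
  define u0 where "u0 = 4 * real K + 2"
  have u: "0 \<le> u" by (simp add: u_def)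
  have u0: "0 < u0" by (simp add: u0_def add_nonneg_pos)
  have f: "wig_ratio p \<eta> k K Q P \<ge> (1 - p) * ((1 - \<eta>) + \<eta> * lag k u) + p * lag K u - 2 * a"
    if "\<eta> * u ^ k / fact k \<le> a\<^sup>2" "0 \<le> a" for a
    using wig_ratio_bounds_aux[of \<eta> p Q P k a K] that p eta unfolding u_def by (auto simp: abs_le_iff)
  have pe: "15/16 * (15/16) \<le> (1 - p) * (1 - \<eta>)" using p eta by (intro mult_mono) auto
  show ?thesis
  proof (cases "u \<le> u0")
    case True
    have "\<eta> * u ^ k / fact k \<le> \<eta> * u0 ^ k / fact k"
      using eta u True by (intro divide_right_mono mult_left_mono power_mono) auto
    also have "\<dots> \<le> (1/16)\<^sup>2" using h3 by (simp add: u0_def power2_eq_square)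
    finally have f': "wig_ratio p \<eta> k K Q P \<ge> (1 - p) * ((1 - \<eta>) + \<eta> * lag k u) + p * lag K u - 2 * (1/16)"
      by (intro f) auto
    have s: "- (1/16) \<le> \<eta> * lag k u"
    proof (cases "4 * real k \<le> u + 2")
      case True
      then have "0 \<le> lag k u" using lag_ge_1[of k u] by simp
      then have "0 \<le> \<eta> * lag k u" using eta by simp
      then show ?thesis by simp
    next
      case False
      have "\<bar>lag k u\<bar> \<le> exp (u / 2)" by (rule lag_bound[OF u])
      also have "\<dots> \<le> exp (2 * real k)" using False by simp
      finally have "\<eta> * \<bar>lag k u\<bar> \<le> \<eta> * exp (2 * real k)" using eta by (intro mult_left_mono) auto
      moreover have "- (\<eta> * lag k u) \<le> \<eta> * \<bar>lag k u\<bar>" using eta mult_left_mono[of "- lag k u" "\<bar>lag k u\<bar>" \<eta>] by simp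
      ultimately show ?thesis using h4 by linarith
    qed
    have "(1 - p) * (- (1/16)) \<le> (1 - p) * (\<eta> * lag k u)" using s p by (intro mult_left_mono) auto
    moreover have "- (1/16) \<le> (1 - p) * (- (1/16))" using p by simp
    ultimately have s': "- (1/16) \<le> (1 - p) * (\<eta> * lag k u)" by linarith
    have t: "- (1/16) \<le> p * lag K u"
    proof (cases "4 * real K + 2 - 4 * real J \<le> u")
      case True
      then have "0 < lag K u" by (rule lag_pos[OF h5(1)])
      then have "0 \<le> p * lag K u" using p by simp
      then show ?thesis by simp
    next
      case False
      have "\<bar>lag K u\<bar> \<le> exp (u / 2)" by (rule lag_bound[OF u])
      also have "\<dots> \<le> exp (2 * real K + 1 - 2 * real J)" using False by simp
      finally have "p * \<bar>lag K u\<bar> \<le> p * exp (2 * real K + 1 - 2 * real J)" using p by (intro mult_left_mono) auto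
      moreover have "- (p * lag K u) \<le> p * \<bar>lag K u\<bar>" using p mult_left_mono[of "- lag K u" "\<bar>lag K u\<bar>" p] by simp
      ultimately show ?thesis using h5(2) by linarith
    qed
    have "(1 - p) * ((1 - \<eta>) + \<eta> * lag k u) = (1 - p) * (1 - \<eta>) + (1 - p) * (\<eta> * lag k u)"
      by (rule distrib_left)
    then show ?thesis using f' pe s' t by linarith
  next
    case False
    define t where "t = u / u0"
    have t1: "1 \<le> t" using False u0 by (simp add: t_def)
    have ut: "u = u0 * t" using u0 by (simp add: t_def)
    have "\<eta> * u ^ k / fact k = (\<eta> * u0 ^ k / fact k) * t ^ k" by (simp add: ut power_mult_distrib)
    also have "\<dots> \<le> (1/256) * t ^ (2 * K)"
      using h3 t1 k eta u0 by (intro mult_mono power_increasing) (auto simp: u0_def)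
    also have "\<dots> = (t ^ K / 16)\<^sup>2" by (simp add: power_divide power_mult[symmetric] mult.commute)
    finally have f': "wig_ratio p \<eta> k K Q P \<ge> (1 - p) * ((1 - \<eta>) + \<eta> * lag k u) + p * lag K u - 2 * (t ^ K / 16)"
      using t1 by (intro f) auto
    have "1/8 * t ^ K \<le> (p * lag K u0) * t ^ K" using h2 t1 by (intro mult_right_mono) (auto simp: u0_def)
    also have "\<dots> = p * (lag K u0 * (u / u0) ^ K)" by (simp add: t_def)
    also have "\<dots> \<le> p * lag K u" using p False u0 by (intro mult_left_mono lag_growth) (auto simp: u0_def)
    finally have g: "1/8 * t ^ K \<le> p * lag K u" .
    have "1 \<le> lag k u" using False k by (intro lag_ge_1) (auto simp: u0_def)
    then have "(1 - p) * ((1 - \<eta>) + 0) \<le> (1 - p) * ((1 - \<eta>) + \<eta> * lag k u)"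
      using p eta by (intro mult_left_mono add_left_mono) auto
    then show ?thesis using f' pe g by simp
  qed
qed

text \<open>Provides the range t <= 2 that \<open>phi_quadratic\<close> requires on the
  disc.\<close>

lemma wig_ratio_le:
  assumes p: "0 < p" "p \<le> 1/16" and eta: "0 < \<eta>" "\<eta> \<le> 1/16"
    and h3: "\<eta> * (4 * real K + 2) ^ k / fact k \<le> 1/256"
    and X: "X \<le> 2 * real K + 1" "(p + \<eta>) * exp X \<le> 1/2" and x: "Q\<^sup>2 + P\<^sup>2 \<le> X"
  shows "wig_ratio p \<eta> k K Q P \<le> 2"
proof -
  define u where "u = 2 * (Q\<^sup>2 + P\<^sup>2)"
  have u: "0 \<le> u" "u \<le> 2 * X" using x by (auto simp: u_def)
  have "\<eta> * u ^ k / fact k \<le> \<eta> * (4 * real K + 2) ^ k / fact k"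
    using eta u X by (intro divide_right_mono mult_left_mono power_mono) auto
  also have "\<dots> \<le> (1/16)\<^sup>2" using h3 by (simp add: power2_eq_square)
  finally have "\<eta> * (2 * (Q\<^sup>2 + P\<^sup>2)) ^ k / fact k \<le> (1/16)\<^sup>2" by (simp only: u_def)
  then have f: "wig_ratio p \<eta> k K Q P \<le> (1 - p) * ((1 - \<eta>) + \<eta> * lag k u) + p * lag K u + 2 * (1/16)"
    using wig_ratio_bounds_aux[of \<eta> p Q P k "1/16" K] p eta unfolding u_def abs_le_iff by linarith
  have b: "\<bar>lag n u\<bar> \<le> exp X" for n
    using lag_bound[OF u(1), of n] u by (auto intro: order_trans)
  have "(1 - p) * ((1 - \<eta>) + \<eta> * lag k u) \<le> (1 - p) * (1 + \<eta> * exp X)"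
    using p eta b[of k] by (intro mult_left_mono add_mono) auto
  also have "\<dots> \<le> 1 * (1 + \<eta> * exp X)" using p eta by (intro mult_right_mono) auto
  finally have "(1 - p) * ((1 - \<eta>) + \<eta> * lag k u) \<le> 1 + \<eta> * exp X" by simp
  moreover have "p * lag K u \<le> p * exp X" using p b[of K] by (intro mult_left_mono) auto
  moreover have "(p + \<eta>) * exp X = p * exp X + \<eta> * exp X" by (rule distrib_right)
  ultimately show ?thesis using f X(2) by linarith
qed

text \<open>K is the least index with the lower inequality; its failure at K - 1 gives the upper
  one, and e^2 is the effect of the last step on exp (2 K). Large L rules out all indices up to K0,
  since exp (2 N + 1 - L) falls below A there. Together the inequalities say that 2 K + 1 - L is
  (4/3) ln K up to a constant.\<close>

lemma exists_balanced_index: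
  assumes A: "0 < (A::real)"
  shows "\<forall>\<^sub>F L in at_top. \<exists>K\<ge>K0. A * real K powr (4/3) \<le> exp (2 * real K + 1 - L) \<and>
      exp (2 * real K + 1 - L) \<le> A * exp 2 * real K powr (4/3)"
proof -
  define N1 where "N1 = max K0 2"
  have "\<forall>\<^sub>F L in at_top. 2 * real N1 + 1 - ln A < L" by (rule eventually_gt_at_top)
  then show ?thesis
  proof eventually_elim
    case (elim L)
    define G where "G N \<longleftrightarrow> 1 \<le> N \<and> A * real N powr (4/3) \<le> exp (2 * real N + 1 - L)" for N
    define K where "K = (LEAST N. G N)"
    have "\<forall>\<^sub>F N in sequentially. 1 \<le> N \<and> A * real N powr (4/3) \<le> exp (2 * real N + 1 - L)"
      by (intro eventually_conj eventually_ge_at_top) (use A in real_asymp)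
    then have "\<exists>N. G N" unfolding G_def by (auto simp: eventually_sequentially)
    then have K: "G K" unfolding K_def by (rule LeastI_ex)
    have "\<not> G N" if "N \<le> N1" for N
    proof
      assume G: "G N"
      have "A * 1 \<le> A * real N powr (4/3)" using G A by (intro mult_left_mono ge_one_powr_ge_zero) (auto simp: G_def)
      also have "\<dots> \<le> exp (2 * real N + 1 - L)" using G by (simp add: G_def)
      also have "\<dots> < exp (ln A)" using elim that by simp
      finally show False using A by simp
    qed
    then have KN: "N1 < K" using K by (meson not_less)
    have "\<not> G (K - 1)" unfolding K_def by (rule not_less_Least) (use KN in \<open>simp add: K_def\<close>)
    moreover have "1 \<le> K - 1" using KN unfolding N1_def by (auto simp: max_def split: if_splits)
    ultimately have "exp (2 * real (K - 1) + 1 - L) < A * real (K - 1) powr (4/3)" by (auto simp: G_def)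
    also have "\<dots> \<le> A * real K powr (4/3)" using A by (intro mult_left_mono powr_mono2) auto
    finally have "exp 2 * exp (2 * real (K - 1) + 1 - L) \<le> exp 2 * (A * real K powr (4/3))" by simp
    moreover have "exp 2 * exp (2 * real (K - 1) + 1 - L) = exp (2 * real K + 1 - L)"
      using KN by (simp add: exp_add[symmetric] of_nat_diff)
    ultimately have "exp (2 * real K + 1 - L) \<le> exp 2 * (A * real K powr (4/3))" by metis
    then show ?case using K KN by (intro exI[of _ K]) (auto simp: G_def N1_def mult_ac)
  qed
qed

text \<open>The left-hand side is \<open>\<eta> * u ^ k / fact k\<close> at the turning point \<open>u = 2 * Y\<close> of the number state \<open>K\<close>.
  By the equation for \<open>r_star\<close>, \<open>k * ln (2 * e * Y / k)\<close> has the tangent \<open>Y + b_star * (k - r_star * Y)\<close>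
  at \<open>k = r_star * Y\<close>; the term \<open>ln Y / (6 * b_star)\<close> balances the remaining powers of \<open>Y\<close>.\<close>
lemma coherence_at_turning_point:
  assumes k: "0 < k" "real k \<le> r_star * Y + ln Y / (6 * b_star) - n0" and Y: "0 < Y" "Y \<le> 4 * real k"
    and L: "Y \<le> L + 4/3 * ln Y + D" and n0: "3/2 * ln 4 + D + ln 256 \<le> b_star * n0"
  shows "exp (- L) / (2 * real k) * (2 * Y) ^ k / fact k \<le> 1/256"
proof -
  define x where "x = real k"
  have x: "1 \<le> x" using k by (simp add: x_def)
  define S where "S = - L - ln (2 * x) + x * ln (2 * Y) - ln (fact k)"
  have "exp (- L) / (2 * real k) * (2 * Y) ^ k / fact k = exp S"
  proof -
    have "(2 * Y) ^ k = exp (x * ln (2 * Y))" using Y by (simp add: x_def exp_of_nat_mult)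
    then show ?thesis using x by (simp add: S_def exp_diff exp_add exp_minus x_def[symmetric] field_simps)
  qed
  moreover have "S \<le> - ln 256"
  proof -
    have "2 / r_star = exp b_star" using r_star(1) by (simp add: b_star_def)
    then have rb: "2 = r_star * exp b_star" using r_star(1) by (simp add: field_simps)
    have "ln (2 * Y) = ln (r_star * exp b_star) + ln Y" using Y rb by (simp add: ln_mult)
    also have "\<dots> = b_star + ln (r_star * Y)" using Y r_star(1) by (simp add: ln_mult)
    also have "ln (r_star * Y) = ln x + ln (r_star * Y / x)" using Y x r_star(1) by (simp add: ln_div)
    also have "\<dots> \<le> ln x + (r_star * Y / x - 1)"
      using Y x r_star(1) by (intro add_left_mono ln_le_minus_one) auto
    finally have "x * ln (2 * Y) \<le> x * (b_star + (ln x + (r_star * Y / x - 1)))" using x by simp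
    also have "\<dots> = b_star * x + x * ln x + r_star * Y - x" using x by (simp add: algebra_simps)
    finally have 1: "x * ln (2 * Y) \<le> b_star * x + x * ln x + r_star * Y - x" .
    have "(x + 1/2) * ln x - x + 1 / (4 * x) \<le> ln (fact k)" using ln_fact_lower[OF k(1)] by (simp add: x_def)
    moreover have "0 \<le> 1 / (4 * x)" using x by simp
    moreover have "(x + 1/2) * ln x = x * ln x + ln x / 2" by (simp add: algebra_simps)
    ultimately have 2: "x * ln x + ln x / 2 - x \<le> ln (fact k)" by linarith
    have "b_star * x \<le> b_star * (r_star * Y + ln Y / (6 * b_star) - n0)"
      using k(2) b_star_pos by (intro mult_left_mono) (auto simp: x_def)
    also have "\<dots> = (r_star * (1 + b_star)) * Y - r_star * Y + ln Y / 6 - b_star * n0"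
      using b_star_pos by (simp add: field_simps)
    finally have 3: "b_star * x \<le> Y - r_star * Y + ln Y / 6 - b_star * n0" by (simp only: r_star(3) mult_1)
    have "ln Y \<le> ln (4 * x)" using Y x by (simp add: x_def)
    then have 4: "ln Y \<le> ln 4 + ln x" using x by (simp add: ln_mult)
    have 5: "ln (2 * x) = ln 2 + ln x" "0 \<le> ln (2::real)" using x by (simp_all add: ln_mult)
    \<comment> \<open>The coefficients 4/3 from L, -1 from eta, -1/2 from Stirling and 1/6 from the
      choice of k add up to 0 once ln x is exchanged for ln Y; the constant left over is absorbed by
      \<open>n0\<close>.\<close>
    show ?thesis unfolding S_def using 1 2 3 4 5 L n0 by argo
  qed
  ultimately have "exp (- L) / (2 * real k) * (2 * Y) ^ k / fact k \<le> exp (- ln 256)" by simp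
  then show ?thesis by (simp add: exp_minus)
qed

text \<open>Here \<open>exp (- L)\<close> bounds the energy of one mode, half of it in each of the two excitations.\<close>
definition good_mode :: "real \<Rightarrow> real \<Rightarrow> nat \<Rightarrow> nat \<Rightarrow> real \<Rightarrow> real \<Rightarrow> bool" where
  "good_mode C L k K \<eta> p \<longleftrightarrow> 2 \<le> k \<and> k < K \<and> 0 < \<eta> \<and> \<eta> < 1 \<and> 0 < p \<and> p < 1 \<and>
     \<eta> * real k = exp (- L) / 2 \<and> p * real K = exp (- L) / 2 \<and>
     (\<forall>Q P. 1/4 \<le> wig_ratio p \<eta> k K Q P) \<and>
     (\<exists>X>0. (\<forall>Q P. Q\<^sup>2 + P\<^sup>2 \<le> X \<longrightarrow> wig_ratio p \<eta> k K Q P \<le> 2) \<and>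
       C * (exp (- (gamma_exp * L)) / L powr beta_exp)
         \<le> 4 * (1 - p)\<^sup>2 * ((1 - \<eta>) * \<eta>) * 2 ^ k / 8 * (1 / 2 - real ((k + 1) * (k + 2)) / X\<^sup>2)
            - (p + \<eta>)\<^sup>2 * exp (2 * X) - 2 * ((1 - p) * \<eta> * real k + p * real K))"

lemma good_mode_at_index:
  assumes A: "0 < A"
    and lagK: "\<forall>\<^sub>F K in sequentially. exp (2 * real K + 1) / (4 * A) / real K powr (1/3) \<le> lag K (4 * real K + 2)"
  shows "\<exists>C>0. \<forall>\<^sub>F K in sequentially. \<forall>L. A * real K powr (4/3) \<le> exp (2 * real K + 1 - L) \<and>
      exp (2 * real K + 1 - L) \<le> A * exp 2 * real K powr (4/3) \<longrightarrow> (\<exists>k \<eta> p. good_mode C L k K \<eta> p)"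
proof -
  define M where "M = A * exp 2"
  \<comment> \<open>Meets the last hypothesis of \<open>coherence_at_turning_point\<close> with D =
    ln A + 2.\<close>
  define n0 where "n0 = \<bar>3/2 * ln 4 + (ln A + 2) + ln 256\<bar> / b_star"
  \<comment> \<open>Collects the bounded losses in the lower bound for k: the exchange of ln x for
    ln Y, the constant A, the offset \<open>n0\<close> and rounding down.\<close>
  define C2 where "C2 = 4 * r_star / 3 * ln 3 - r_star * ln A + n0 + 1"
  define C4 where "C4 = exp (- (C2 * ln 2)) / 2"
  define w where "w = 1 / (6 * b_star)"
  have M: "0 < M" using A by (simp add: M_def)
  have C4: "0 < C4" by (simp add: C4_def)
  have w0: "0 < w" using b_star_pos by (simp add: w_def)
  have n0: "0 \<le> n0" "3/2 * ln 4 + (ln A + 2) + ln 256 \<le> b_star * n0"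
    using b_star_pos by (simp_all add: n0_def)
  have e2: "\<forall>\<^sub>F K in sequentially. w * ln (2 * real K + 1) \<le> 5/1000 * (2 * real K + 1) - 2"
    by real_asymp
  have e3: "\<forall>\<^sub>F K in sequentially. n0 + 1 \<le> (2 * real K + 1) / 12"
    by real_asymp
  have e4: "\<forall>\<^sub>F K in sequentially. M * real K powr (4/3) * exp (- (24/100) * (2 * real K + 1)) \<le> 1/16"
    by real_asymp
  have e5: "\<forall>\<^sub>F K in sequentially. M / 2 * real K powr (1/3) * exp (- 2 * ln (real K)) \<le> 1/16"
    by real_asymp
  have e6: "\<forall>\<^sub>F K in sequentially. 96 * (ln (real K) + 3) ^ 3 + (ln (real K) + 1) \<le> real K"
    by real_asymp
  have e7: "\<forall>\<^sub>F K in sequentially. 0 \<le> 4/3 * ln (real K) + ln A"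
    by real_asymp
  have e7': "\<forall>\<^sub>F K in sequentially. 4/3 * ln (real K) + ln A + 2 \<le> (2 * real K + 1) / 2"
    by real_asymp
  \<comment> \<open>All errors decay like exp (- 8 L / 10) up to powers of L, or faster; since
    \<open>gamma_exp\<close> < 78/100, they are negligible against the gain.\<close>
  have "\<forall>\<^sub>F L in at_top. (M * L powr (4/3)) powr (6/5) * exp (- (8/10) * L) + 2 * exp (- L) \<le> C4 / 64 * (exp (- (78/100) * L) / L)"
    using M C4 by real_asymp
  then obtain L0 where L0: "\<And>L. L0 \<le> L \<Longrightarrow> (M * L powr (4/3)) powr (6/5) * exp (- (8/10) * L) + 2 * exp (- L) \<le> C4 / 64 * (exp (- (78/100) * L) / L)"
    by (auto simp: eventually_at_top_linorder)
  have e8: "\<forall>\<^sub>F K in sequentially. L0 \<le> real K" by real_asymp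
  have e9: "\<forall>\<^sub>F K in sequentially. 100 \<le> K" by (rule eventually_ge_at_top)
  have "\<forall>\<^sub>F K in sequentially. \<forall>L. A * real K powr (4/3) \<le> exp (2 * real K + 1 - L) \<and>
      exp (2 * real K + 1 - L) \<le> A * exp 2 * real K powr (4/3) \<longrightarrow> (\<exists>k \<eta> p. good_mode (C4 / 64) L k K \<eta> p)"
    using lagK e2 e3 e4 e5 e6 e7 e7' e8 e9
  proof eventually_elim
    case (elim K)
    show ?case
    proof (intro allI impI, elim conjE)
      fix L
      define Y where "Y = 2 * real K + 1"
      define x where "x = real K"
      have Yx: "Y = 2 * x + 1" by (simp add: Y_def x_def)
      have x1: "100 \<le> x" using elim(10) by (simp add: x_def)
      assume "A * real K powr (4/3) \<le> exp (2 * real K + 1 - L)" "exp (2 * real K + 1 - L) \<le> A * exp 2 * real K powr (4/3)"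
      then have lo: "A * x powr (4/3) \<le> exp (Y - L)" and up: "exp (Y - L) \<le> M * x powr (4/3)"
        by (simp_all add: Y_def x_def M_def)
      have "ln (A * x powr (4/3)) \<le> ln (exp (Y - L))" using lo A x1 by (subst ln_le_cancel_iff) auto
      then have lo': "4/3 * ln x + ln A \<le> Y - L" using A x1 by (simp add: ln_mult ln_powr)
      have "ln (exp (Y - L)) \<le> ln (M * x powr (4/3))" using up M x1 by (subst ln_le_cancel_iff) auto
      then have up': "Y - L \<le> 4/3 * ln x + ln A + 2" using A x1 by (simp add: ln_mult ln_powr M_def)
      have LY: "L \<le> Y" "Y / 2 \<le> L" using lo' up' elim(7,8) by (simp_all add: x_def Y_def)
      have xL: "x \<le> L" using LY Yx by simp
      define kr where "kr = r_star * Y + ln Y / (6 * b_star) - n0"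
      define k where "k = nat \<lfloor>kr\<rfloor>"
      have lnY: "0 \<le> ln Y" using Yx x1 by simp
      have "kr = r_star * Y + w * ln Y - n0" by (simp add: kr_def w_def)
      moreover have "r_star * Y \<le> 3/8 * Y" "1/3 * Y \<le> r_star * Y" 
        using r_star(1,2) Yx x1 by (intro mult_right_mono; simp)+
      moreover have "w * ln Y \<le> 5/1000 * Y - 2" "n0 + 1 \<le> Y / 12" using elim(2,3) by (simp_all add: Y_def)
      moreover have "0 \<le> w * ln Y" using w0 lnY by simp
      \<comment> \<open>The upper bound keeps 2 k well below Y and k small enough for the disc
        chosen below; the lower one gives the hypothesis Y <= 4 k of
        \<open>coherence_at_turning_point\<close>.\<close>
      ultimately have kr: "kr + 2 \<le> 38/100 * Y" "Y / 4 + 1 \<le> kr" using n0 by linarith+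
      have "0 \<le> kr" using kr(2) Yx x1 by linarith
      then have k: "real k \<le> kr" "kr - 1 \<le> real k" unfolding k_def by linarith+
      have k4: "Y \<le> 4 * real k" "real k + 2 \<le> 38/100 * Y" using k kr by linarith+
      have k2: "2 \<le> k" using k4 Yx x1 by linarith
      have kK: "k < K" using k4 Yx x1 by (simp add: x_def)
      define p where "p = exp (- L) / (2 * x)"
      define \<eta> where "\<eta> = exp (- L) / (2 * real k)"
      have p0: "0 < p" "p \<le> exp (- L) / 2" 
        unfolding p_def using x1 by (simp, intro divide_left_mono) auto
      have eta0: "0 < \<eta>" "\<eta> \<le> exp (- L) / 2" 
        unfolding \<eta>_def using k2 by (simp, intro divide_left_mono) auto
      \<comment> \<open>The number 76/100 is twice 38/100, so this covers exp (2 k). It is small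
        because Y - L is only logarithmic in K.\<close>
      have sm: "exp (- L) * exp (76/100 * Y) \<le> 1/16"
      proof -
        have "exp (- L) * exp (76/100 * Y) = exp (Y - L) * exp (- (24/100) * Y)"
          by (simp add: exp_add[symmetric])
        also have "\<dots> \<le> (M * x powr (4/3)) * exp (- (24/100) * Y)" using up by (intro mult_right_mono) auto
        also have "\<dots> \<le> 1/16" using elim(4) by (simp add: x_def Y_def)
        finally show ?thesis .
      qed
      have sm': "exp (- L) * exp t \<le> 1/16" if "t \<le> 76/100 * Y" for t
      proof -
        have "exp (- L) * exp t \<le> exp (- L) * exp (76/100 * Y)" using that by simp
        then show ?thesis using sm by linarith
      qed
      have e16: "exp (- L) \<le> 1/16" using sm'[of 0] Yx x1 by simp
      have p16: "p \<le> 1/16" and eta16: "\<eta> \<le> 1/16" using p0 eta0 e16 by linarith+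
      have u0: "4 * real K + 2 = 2 * Y" by (simp add: Y_def)
      have h2: "1/8 \<le> p * lag K (4 * real K + 2)"
      proof -
        have "x powr (4/3) = x powr 1 * x powr (1/3)" by (simp only: powr_add[symmetric]) simp
        then have xx: "x powr (4/3) = x * x powr (1/3)" using x1 by simp
        have "1/8 = (A * x powr (4/3)) / (8 * A * (x * x powr (1/3)))" unfolding xx using A x1 by simp
        also have "\<dots> \<le> exp (Y - L) / (8 * A * (x * x powr (1/3)))" using lo A x1 by (intro divide_right_mono) auto
        also have "\<dots> = p * (exp (2 * real K + 1) / (4 * A) / real K powr (1/3))"
          by (simp add: p_def exp_diff exp_minus x_def[symmetric] Y_def field_simps)
        also have "\<dots> \<le> p * lag K (4 * real K + 2)" using elim(1) p0 by (intro mult_left_mono) auto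
        finally show ?thesis .
      qed
      have h3: "\<eta> * (4 * real K + 2) ^ k / fact k \<le> 1/256"
        unfolding u0 \<eta>_def
      proof (rule coherence_at_turning_point)
        have "ln x \<le> ln Y" using Yx x1 by simp
        then show "Y \<le> L + 4/3 * ln Y + (ln A + 2)" using up' by linarith
      qed (use k2 k(1) k4(1) n0(2) Yx x1 in \<open>auto simp: kr_def\<close>)
      have h4: "\<eta> * exp (2 * real k) \<le> 1/16"
      proof -
        have "\<eta> * exp (2 * real k) \<le> exp (- L) * exp (2 * real k)" using eta0 by (intro mult_right_mono) auto
        also have "\<dots> \<le> 1/16" using k4 by (intro sm') simp
        finally show ?thesis .
      qed
      \<comment> \<open>Then exp (- 2 J) <= K^(-2) beats the factor K^(1/3) that p exp Y still
        carries, while 96 (J + 2)^3 is only polylogarithmic in K.\<close>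
      define J where "J = nat \<lceil>ln x\<rceil>"
      have lnx: "0 \<le> ln x" using x1 by simp
      have J: "ln x \<le> real J" "real J \<le> ln x + 1" unfolding J_def using lnx by linarith+
      have h5: "96 * (J + 2) ^ 3 + J \<le> K"
      proof -
        have "(real J + 2) ^ 3 \<le> (ln x + 3) ^ 3" using J by (intro power_mono) auto
        then have "96 * (real J + 2) ^ 3 + real J \<le> 96 * (ln x + 3) ^ 3 + (ln x + 1)"
          using J by linarith
        also have "\<dots> \<le> real K" using elim(6) by (simp add: x_def)
        finally have "real (96 * (J + 2) ^ 3 + J) \<le> real K" by (simp add: add.commute)
        then show ?thesis by (simp only: of_nat_le_iff)
      qed
      have h5': "p * exp (2 * real K + 1 - 2 * real J) \<le> 1/16"
      proof -
        have "x powr (4/3) = x powr 1 * x powr (1/3)" by (simp only: powr_add[symmetric]) simp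
        then have xx: "x powr (4/3) = x * x powr (1/3)" using x1 by simp
        have "p * exp (2 * real K + 1 - 2 * real J) = exp (Y - L) / (2 * x) * exp (- 2 * real J)"
          by (simp add: p_def exp_diff exp_minus Y_def field_simps)
        also have "\<dots> \<le> (M * x powr (4/3)) / (2 * x) * exp (- 2 * ln x)"
          using up x1 J M by (intro mult_mono divide_right_mono) auto
        also have "\<dots> = M / 2 * x powr (1/3) * exp (- 2 * ln x)" unfolding xx using x1 by simp
        also have "\<dots> \<le> 1/16" using elim(5) by (simp add: x_def)
        finally show ?thesis .
      qed
      have pos: "\<forall>Q P. 1/4 \<le> wig_ratio p \<eta> k K Q P"
        using wig_ratio_ge[OF _ kK p0(1) p16 eta0(1) eta16 h2 h3 h4 h5 h5'] k2 by simp
      \<comment> \<open>The factor 6/10 meets two demands: the square of X must exceed 2 (k + 1) (k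
        + 2) by a fixed ratio, where k + 2 <= 38/100 Y, and exp (2 X - 2 L), about exp (- 8 L / 10),
        must be below exp (- \<open>gamma_exp\<close> L).\<close>
      define X where "X = 6/10 * Y"
      have X0: "0 < X" using Yx x1 by (simp add: X_def)
      have "(p + \<eta>) * exp X \<le> exp (- L) * exp X" using p0 eta0 by (intro mult_right_mono) auto
      also have "\<dots> \<le> 1/16" using Yx x1 by (intro sm') (simp add: X_def)
      finally have pX: "(p + \<eta>) * exp X \<le> 1/2" by simp
      have le2: "\<forall>Q P. Q\<^sup>2 + P\<^sup>2 \<le> X \<longrightarrow> wig_ratio p \<eta> k K Q P \<le> 2"
        using wig_ratio_le[OF p0(1) p16 eta0(1) eta16 h3 _ pX] Yx x1 by (simp add: X_def Y_def)
      \<comment> \<open>This is the origin of the two exponents: in - L - ln L +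
        (\<open>r_star\<close> L + \<open>c_star\<close> ln L) ln 2 the coefficients of L and ln L
        are - \<open>gamma_exp\<close> and - \<open>beta_exp\<close>.\<close>
      have main: "C4 * (exp (- (gamma_exp * L)) / L powr beta_exp) \<le> \<eta> * 2 ^ k"
      proof -
        have L1: "1 \<le> L" using xL x1 by simp
        have "ln Y \<le> ln (3 * x)" using Yx x1 by simp
        then have lnY3: "ln Y \<le> ln x + ln 3" using x1 by (simp add: ln_mult)
        have lnLY: "ln L \<le> ln Y" using LY L1 by simp
        have "r_star * (L + 4/3 * (ln Y - ln 3) + ln A) \<le> r_star * Y"
        proof (intro mult_left_mono)
          show "L + 4/3 * (ln Y - ln 3) + ln A \<le> Y" using lo' lnY3 by argo
        qed (use r_star(1) in simp)
        moreover have "r_star * (L + 4/3 * (ln Y - ln 3) + ln A) = r_star * L + 4 * r_star / 3 * ln Y - 4 * r_star / 3 * ln 3 + r_star * ln A"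
          by (simp add: field_simps)
        ultimately have "r_star * L + (4 * r_star / 3 * ln Y + ln Y / (6 * b_star)) - C2 \<le> real k"
          using k(2) unfolding kr_def C2_def by linarith
        moreover have "4 * r_star / 3 * ln Y + ln Y / (6 * b_star) = c_star * ln Y"
          by (simp add: c_star_eq algebra_simps)
        moreover have "c_star * ln L \<le> c_star * ln Y" using lnLY c_star_bounds by (intro mult_left_mono) auto
        ultimately have kl: "r_star * L + c_star * ln L - C2 \<le> real k" by linarith
        have "exp ((r_star * L + c_star * ln L - C2) * ln 2) \<le> exp (real k * ln 2)" using kl by simp
        also have "\<dots> = 2 ^ k" by (simp add: exp_of_nat_mult)
        finally have two: "exp ((r_star * L + c_star * ln L - C2) * ln 2) \<le> 2 ^ k" .
        have "C4 * (exp (- (gamma_exp * L)) / L powr beta_exp) = exp (- L) / (2 * L) * exp ((r_star * L + c_star * ln L - C2) * ln 2)"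
        proof -
          have "exp (- (C2 * ln 2)) * (exp (- (gamma_exp * L)) / L powr beta_exp) = exp (- (C2 * ln 2) - gamma_exp * L - beta_exp * ln L)"
            using L1 by (simp add: powr_def exp_diff exp_minus exp_add field_simps)
          also have "\<dots> = exp (- L - ln L + (r_star * L + c_star * ln L - C2) * ln 2)"
            by (simp add: gamma_exp_def beta_exp_def algebra_simps)
          also have "\<dots> = exp (- L) / L * exp ((r_star * L + c_star * ln L - C2) * ln 2)"
            using L1 by (simp only: exp_add exp_diff) simp
          finally show ?thesis by (simp add: C4_def)
        qed
        also have "\<dots> \<le> \<eta> * 2 ^ k"
        proof (intro mult_mono two)
          show "exp (- L) / (2 * L) \<le> \<eta>" unfolding \<eta>_def using k4 LY k2 L1 by (intro divide_left_mono) auto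
        qed (use eta0 in auto)
        finally show ?thesis .
      qed
      have L1: "1 \<le> L" using xL x1 by simp
      have err: "(p + \<eta>)\<^sup>2 * exp (2 * X) + 2 * ((1 - p) * \<eta> * real k + p * real K) \<le> C4 / 64 * (exp (- (gamma_exp * L)) / L powr beta_exp)"
      proof -
        have "(p + \<eta>)\<^sup>2 \<le> (exp (- L))\<^sup>2" using p0 eta0 by (intro power_mono) auto
        then have "(p + \<eta>)\<^sup>2 * exp (2 * X) \<le> (exp (- L))\<^sup>2 * exp (2 * X)" by (intro mult_right_mono) auto
        also have "\<dots> = exp (Y - L) powr (6/5) * exp (- (8/10) * L)"
          by (simp add: powr_def exp_add[symmetric] exp_double[symmetric] X_def algebra_simps)
        also have "\<dots> \<le> (M * L powr (4/3)) powr (6/5) * exp (- (8/10) * L)"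
        proof (intro mult_right_mono powr_mono2)
          have "M * x powr (4/3) \<le> M * L powr (4/3)" using xL x1 M by (intro mult_left_mono powr_mono2) auto
          then show "exp (Y - L) \<le> M * L powr (4/3)" using up by linarith
        qed auto
        finally have 1: "(p + \<eta>)\<^sup>2 * exp (2 * X) \<le> (M * L powr (4/3)) powr (6/5) * exp (- (8/10) * L)" .
        have "(1 - p) * (\<eta> * real k) \<le> 1 * (\<eta> * real k)" using p0 eta0 by (intro mult_right_mono) auto
        also have "\<dots> = exp (- L) / 2" using k2 by (simp add: \<eta>_def)
        finally have 2: "(1 - p) * \<eta> * real k \<le> exp (- L) / 2" by (simp only: mult.assoc)
        have 3: "p * real K = exp (- L) / 2" using x1 by (simp add: p_def x_def)
        have "L0 \<le> L" using elim(9) xL by (simp add: x_def)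
        note 4 = L0[OF this]
        have "exp (- (78/100) * L) / L \<le> exp (- (gamma_exp * L)) / L powr beta_exp"
        proof (intro frac_le)
          have "gamma_exp * L \<le> 78/100 * L" using gamma_exp_bounds L1 by (intro mult_right_mono) auto
          then show "exp (- (78/100) * L) \<le> exp (- (gamma_exp * L))" by simp
          have "L powr beta_exp \<le> L powr 1" using L1 beta_exp_bounds by (intro powr_mono) auto
          then show "L powr beta_exp \<le> L" using L1 by simp
        qed (use L1 in auto)
        then have "C4 / 64 * (exp (- (78/100) * L) / L) \<le> C4 / 64 * (exp (- (gamma_exp * L)) / L powr beta_exp)"
          using C4 by (intro mult_left_mono) auto
        then show ?thesis using 1 2 3 4 by argo
      qed
      have fac: "\<eta> * 2 ^ k / 32 \<le> 4 * (1 - p)\<^sup>2 * ((1 - \<eta>) * \<eta>) * 2 ^ k / 8 * (1 / 2 - real ((k + 1) * (k + 2)) / X\<^sup>2)"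
      proof -
        have "real ((k + 1) * (k + 2)) \<le> (38/100 * Y) * (38/100 * Y)"
          unfolding of_nat_mult using k4 Yx x1 by (intro mult_mono) auto
        also have "\<dots> = (38/60)\<^sup>2 * X\<^sup>2" by (simp add: X_def power2_eq_square)
        finally have "real ((k + 1) * (k + 2)) / X\<^sup>2 \<le> (38/60)\<^sup>2" using X0 by (simp add: field_simps)
        moreover have "(38/60)\<^sup>2 \<le> (41/100 :: real)" by (simp add: power2_eq_square)
        ultimately have a: "9/100 \<le> 1 / 2 - real ((k + 1) * (k + 2)) / X\<^sup>2" by argo
        have b: "(15/16)\<^sup>2 \<le> (1 - p)\<^sup>2" using p16 by (intro power_mono) auto
        have c: "15/16 * \<eta> \<le> (1 - \<eta>) * \<eta>" using eta16 eta0 by (intro mult_right_mono) auto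
        have "\<eta> * 2 ^ k / 32 \<le> (4 * (15/16)\<^sup>2 * (15/16 * \<eta>) * 2 ^ k / 8) * (9/100)"
          using eta0 by (simp add: power2_eq_square field_simps)
        also have "\<dots> \<le> 4 * (1 - p)\<^sup>2 * ((1 - \<eta>) * \<eta>) * 2 ^ k / 8 * (1 / 2 - real ((k + 1) * (k + 2)) / X\<^sup>2)"
          using a b c eta0 eta16 by (intro mult_mono divide_right_mono) auto
        finally show ?thesis .
      qed
      \<comment> \<open>The gain is at least C4 / 32 in these units, and half of it pays for the
        errors.\<close>
      have "good_mode (C4 / 64) L k K \<eta> p"
        unfolding good_mode_def
      proof (intro conjI exI[of _ X])
        show "C4 / 64 * (exp (- (gamma_exp * L)) / L powr beta_exp)
         \<le> 4 * (1 - p)\<^sup>2 * ((1 - \<eta>) * \<eta>) * 2 ^ k / 8 * (1 / 2 - real ((k + 1) * (k + 2)) / X\<^sup>2)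
            - (p + \<eta>)\<^sup>2 * exp (2 * X) - 2 * ((1 - p) * \<eta> * real k + p * real K)"
          using main err fac by argo
      qed (use k2 kK eta0 eta16 p0 p16 pos X0 le2 x1 in \<open>auto simp: \<eta>_def p_def x_def\<close>)
      then show "\<exists>k \<eta> p. good_mode (C4 / 64) L k K \<eta> p" by blast
    qed
  qed
  then show ?thesis using C4 by (intro exI[of _ "C4 / 64"]) auto
qed

lemma good_mode_exists: "\<exists>C>0. \<forall>\<^sub>F L in at_top. \<exists>k K \<eta> p. good_mode C L k K \<eta> p"
proof -
  obtain c where c: "0 < c" "\<forall>\<^sub>F K in sequentially. c * exp (2 * real K + 1) / real K powr (1 / 3) \<le> lag K (4 * real K + 2)"
    using lag_turning_lower[OF lag_bound] by blast
  define A where "A = 1 / (4 * c)"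
  have A: "0 < A" using c by (simp add: A_def)
  have "\<forall>\<^sub>F K in sequentially. exp (2 * real K + 1) / (4 * A) / real K powr (1/3) \<le> lag K (4 * real K + 2)"
    using c by (simp add: A_def mult.commute)
  from good_mode_at_index[OF A this] obtain C K0 where C: "0 < C"
    and K0: "\<And>K L. K0 \<le> K \<Longrightarrow> A * real K powr (4/3) \<le> exp (2 * real K + 1 - L) \<Longrightarrow>
      exp (2 * real K + 1 - L) \<le> A * exp 2 * real K powr (4/3) \<Longrightarrow> \<exists>k \<eta> p. good_mode C L k K \<eta> p"
    unfolding eventually_sequentially by blast
  have "\<forall>\<^sub>F L in at_top. \<exists>k K \<eta> p. good_mode C L k K \<eta> p"
    using exists_balanced_index[OF A, of K0] by eventually_elim (use K0 in blast)
  then show ?thesis using C by blast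
qed

section \<open>The states of the theorem\<close>

text \<open>One-mode quantities are multiplied by m. With L = (1 + zeta) ln m this turns exp (- L)
  into m^(-zeta) and exp (- \<open>gamma_exp\<close> L) into the power of m in the deficit.\<close>

lemma good_mode_state:
  fixes \<zeta> :: real
  assumes m: "2 \<le> m" and z: "0 < \<zeta>" and C: "0 < C"
    and g: "good_mode C ((1 + \<zeta>) * ln (real m)) k K \<eta> p"
  shows "density_oper m (rho m p \<eta> k K)" (is ?dens)
    and "is_wigner m (rho m p \<eta> k K) (rho_wigner m p \<eta> k K)" (is ?wig)
    and "0 < rho_wigner m p \<eta> k K q P" (is ?pos)
    and "energy m (rho m p \<eta> k K) \<le> ennreal (real m powr (- \<zeta>))" (is ?energy)
    and "dist_gaussian_hull m (rho m p \<eta> k K) \<le> trace_dist m (rho m p \<eta> k K) (vacuum m)" (is ?hull)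
    and "trace_dist m (rho m p \<eta> k K) (vacuum m) \<le> ennreal (real m powr (- \<zeta> / 2))" (is ?dist)
    and "ereal (C * (real m powr (1 - gamma_exp * (1 + \<zeta>)) / ((1 + \<zeta>) * ln (real m)) powr beta_exp))
       \<le> entropy_deficit m (rho_wigner m p \<eta> k K)" (is ?deficit)
proof -
  define L where "L = (1 + \<zeta>) * ln (real m)"
  have g': "2 \<le> k" "k < K" "0 < \<eta>" "\<eta> < 1" "0 < p" "p < 1" "\<eta> * real k = exp (- L) / 2" "p * real K = exp (- L) / 2"
    and pos: "\<And>Q P. 1/4 \<le> wig_ratio p \<eta> k K Q P"
    using g by (simp_all add: good_mode_def L_def)
  obtain X where X: "0 < X" "\<And>Q P. Q\<^sup>2 + P\<^sup>2 \<le> X \<Longrightarrow> wig_ratio p \<eta> k K Q P \<le> 2"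
    "C * (exp (- (gamma_exp * L)) / L powr beta_exp)
         \<le> 4 * (1 - p)\<^sup>2 * ((1 - \<eta>) * \<eta>) * 2 ^ k / 8 * (1 / 2 - real ((k + 1) * (k + 2)) / X\<^sup>2)
            - (p + \<eta>)\<^sup>2 * exp (2 * X) - 2 * ((1 - p) * \<eta> * real k + p * real K)"
    using g unfolding good_mode_def L_def[symmetric] by blast
  have prm: "0 < k" "k < K" "0 \<le> \<eta>" "\<eta> \<le> 1" "0 \<le> p" "p \<le> 1" using g' by auto
  have eL: "exp (- L) = real m powr (- (1 + \<zeta>))" using m by (simp add: L_def powr_def algebra_simps)
  have mL: "real m * exp (- L) = real m powr (- \<zeta>)"
  proof -
    have "real m * exp (- L) = real m powr 1 * real m powr (- (1 + \<zeta>))" using m by (simp add: eL)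
    then show ?thesis by (simp only: powr_add[symmetric]) simp
  qed
  show ?dens by (intro density_rho prm)
  show ?wig by (intro is_wigner_rho prm)
  show ?pos
    unfolding rho_wigner_def mode_wigner_def
  proof (rule prod_pos)
    fix j
    have "0 < wig_ratio p \<eta> k K (q j) (P j)" using pos[of "q j" "P j"] by simp
    then show "0 < exp (- ((q j)\<^sup>2 + (P j)\<^sup>2)) * wig_ratio p \<eta> k K (q j) (P j) / pi" by simp
  qed
  show ?hull by (rule dist_gaussian_hull_le)
  have "(1 - p) * \<eta> * real k + p * real K \<le> exp (- L)"
  proof -
    have "(1 - p) * (\<eta> * real k) \<le> 1 * (\<eta> * real k)" using g' by (intro mult_right_mono) auto
    then show ?thesis using g'(7,8) unfolding mult.assoc[symmetric] by simp
  qed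
  then have "real m * ((1 - p) * \<eta> * real k + p * real K) \<le> real m * exp (- L)" by (intro mult_left_mono) auto
  then show ?energy
    using prm by (subst energy_rho) (auto intro!: ennreal_leI simp: mL)
  \<comment> \<open>Since k and K are at least 2, both p and eta are at most exp (- L) / 4. With s =
    m^(-zeta/2) <= 1 the sum is at most s^2 / 4 + s / 2 <= s.\<close>
  have "real m * p + sqrt (real m * \<eta>) \<le> real m powr (- \<zeta> / 2)"
  proof -
    define s where "s = real m powr (- \<zeta> / 2)"
    have s0: "0 \<le> s" by (simp add: s_def)
    have s1: "s \<le> 1" using powr_mono[of "- \<zeta> / 2" 0 "real m"] m z by (simp add: s_def)
    have s2: "s\<^sup>2 = real m * exp (- L)" unfolding mL s_def power2_eq_square by (simp add: powr_add[symmetric])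
    have "p * 2 \<le> p * real K" "\<eta> * 2 \<le> \<eta> * real k" using g' by (intro mult_left_mono; simp)+
    then have "p \<le> exp (- L) / 4" "\<eta> \<le> exp (- L) / 4" using g'(7,8) by linarith+
    then have "real m * p \<le> real m * (exp (- L) / 4)" "real m * \<eta> \<le> real m * (exp (- L) / 4)" by (intro mult_left_mono; simp)+
    then have p: "real m * p \<le> s\<^sup>2 / 4" and e: "real m * \<eta> \<le> (s / 2)\<^sup>2" by (simp_all add: s2 power_divide)
    have "sqrt (real m * \<eta>) \<le> s / 2" using e s0 by (intro real_le_lsqrt) auto
    moreover have "s\<^sup>2 \<le> s" using s0 s1 by (simp add: power2_eq_square mult_left_le)
    ultimately show ?thesis using p s0 unfolding s_def[symmetric] by linarith
  qed
  then show ?dist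
    using g' m by (intro order_trans[OF trace_dist_rho ennreal_leI]) auto
  have "C * (real m powr (1 - gamma_exp * (1 + \<zeta>)) / L powr beta_exp) = real m * (C * (exp (- (gamma_exp * L)) / L powr beta_exp))"
  proof -
    have "exp (- (gamma_exp * L)) = real m powr (- (gamma_exp * (1 + \<zeta>)))" using m by (simp add: L_def powr_def mult.assoc)
    moreover have "real m powr (1 - gamma_exp * (1 + \<zeta>)) = real m powr 1 * real m powr (- (gamma_exp * (1 + \<zeta>)))"
      by (simp only: powr_add[symmetric]) simp
    ultimately show ?thesis using m by simp
  qed
  also have "\<dots> \<le> real m * (4 * (1 - p)\<^sup>2 * ((1 - \<eta>) * \<eta>) * 2 ^ k / 8 * (1 / 2 - real ((k + 1) * (k + 2)) / X\<^sup>2)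
            - (p + \<eta>)\<^sup>2 * exp (2 * X) - 2 * ((1 - p) * \<eta> * real k + p * real K))"
    by (intro mult_left_mono X(3)) auto
  finally show ?deficit
    unfolding L_def[symmetric]
    by (intro order_trans[OF _ entropy_deficit_rho[OF prm(1,5,6,3,4) X(1) _ pos X(2)]]) simp_all
qed

theorem mainTheorem2:
  shows "(\<exists>!r. is_r_star r) \<and>
    (\<exists>C1>0. \<forall>\<zeta>::real. 0 < \<zeta> \<and> \<zeta> < (1 - gamma_exp) / gamma_exp \<longrightarrow>
      (\<exists>(\<rho> :: nat \<Rightarrow> oper) (W :: nat \<Rightarrow> point \<Rightarrow> point \<Rightarrow> real).
        (\<forall>\<^sub>F m in sequentially.
           density_oper m (\<rho> m) \<and> is_wigner m (\<rho> m) (W m) \<and>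
           (\<forall>q\<in>space (config m). \<forall>p\<in>space (config m). W m q p > 0) \<and>
           energy m (\<rho> m) \<le> ennreal (real m powr (- \<zeta>)) \<and>
           dist_gaussian_hull m (\<rho> m) \<le> trace_dist m (\<rho> m) (vacuum m) \<and>
           trace_dist m (\<rho> m) (vacuum m) \<le> ennreal (real m powr (- \<zeta> / 2)) \<and>
           entropy_deficit m (W m) \<ge>
             ereal (C1 * (real m powr (1 - gamma_exp * (1 + \<zeta>)) /
                          ((1 + \<zeta>) * ln (real m)) powr beta_exp))) \<and>
        (\<lambda>m. energy m (\<rho> m)) \<longlonglongrightarrow> 0 \<and>
        (\<lambda>m. trace_dist m (\<rho> m) (vacuum m)) \<longlonglongrightarrow> 0 \<and>
        (\<lambda>m. dist_gaussian_hull m (\<rho> m)) \<longlonglongrightarrow> 0 \<and>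
        (\<lambda>m. entropy_deficit m (W m)) \<longlonglongrightarrow> \<infinity>))"
proof -
  obtain C where C: "0 < C" and good: "\<forall>\<^sub>F L in at_top. \<exists>k K \<eta> p. good_mode C L k K \<eta> p"
    using good_mode_exists by blast
  show ?thesis
  proof (intro conjI r_star_unique exI[of _ C] C allI impI, elim conjE)
    fix \<zeta> :: real assume z: "0 < \<zeta>" "\<zeta> < (1 - gamma_exp) / gamma_exp"
    define G where "G m t \<longleftrightarrow> good_mode C ((1 + \<zeta>) * ln (real m)) (fst t) (fst (snd t)) (fst (snd (snd t))) (snd (snd (snd t)))" for m t
    \<comment> \<open>All parameters are chosen as one tuple. For small m without good parameters
      the choice is arbitrary, which is harmless because only eventual properties and limits are
      claimed.\<close>
    define t where "t m = (SOME t. G m t)" for m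
    define \<rho> where "\<rho> m = rho m (snd (snd (snd (t m)))) (fst (snd (snd (t m)))) (fst (t m)) (fst (snd (t m)))" for m
    define W where "W m = rho_wigner m (snd (snd (snd (t m)))) (fst (snd (snd (t m)))) (fst (t m)) (fst (snd (t m)))" for m
    define R where "R m = C * (real m powr (1 - gamma_exp * (1 + \<zeta>)) / ((1 + \<zeta>) * ln (real m)) powr beta_exp)" for m :: nat
    have "filterlim (\<lambda>m. (1 + \<zeta>) * ln (real m)) at_top sequentially" using z(1) by real_asymp
    then have "\<forall>\<^sub>F m in sequentially. \<exists>k K \<eta> p. good_mode C ((1 + \<zeta>) * ln (real m)) k K \<eta> p"
      using good unfolding filterlim_iff by blast
    then have "\<forall>\<^sub>F m in sequentially. 2 \<le> m \<and> G m (t m)"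
    proof (intro eventually_conj eventually_ge_at_top, eventually_elim)
      case (elim m)
      then have "\<exists>t. G m t" unfolding G_def by auto
      then show ?case unfolding t_def by (rule someI_ex)
    qed
    then have ev: "\<forall>\<^sub>F m in sequentially.
           density_oper m (\<rho> m) \<and> is_wigner m (\<rho> m) (W m) \<and>
           (\<forall>q\<in>space (config m). \<forall>p\<in>space (config m). W m q p > 0) \<and>
           energy m (\<rho> m) \<le> ennreal (real m powr (- \<zeta>)) \<and>
           dist_gaussian_hull m (\<rho> m) \<le> trace_dist m (\<rho> m) (vacuum m) \<and>
           trace_dist m (\<rho> m) (vacuum m) \<le> ennreal (real m powr (- \<zeta> / 2)) \<and>
           ereal (R m) \<le> entropy_deficit m (W m)"
    proof eventually_elim
      case (elim m)
      then have m: "2 \<le> m"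
        and g: "good_mode C ((1 + \<zeta>) * ln (real m)) (fst (t m)) (fst (snd (t m))) (fst (snd (snd (t m)))) (snd (snd (snd (t m))))"
        unfolding G_def by blast+
      show ?case
        unfolding \<rho>_def W_def R_def by (intro conjI ballI good_mode_state[OF m z(1) C g])
    qed
    have lim0: "(\<lambda>m. ennreal (real m powr (- a))) \<longlonglongrightarrow> 0" if "0 < a" for a
    proof -
      have "(\<lambda>m. real m powr (- a)) \<longlonglongrightarrow> 0" using that by real_asymp
      then have "(\<lambda>m. ennreal (real m powr (- a))) \<longlonglongrightarrow> ennreal 0" by (intro tendsto_ennrealI)
      then show ?thesis by simp
    qed
    have E: "(\<lambda>m. energy m (\<rho> m)) \<longlonglongrightarrow> 0"
      using ev by (intro tendsto_sandwich[OF _ _ tendsto_const lim0[OF z(1)]]) (auto elim: eventually_mono)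
    have lim2: "(\<lambda>m. ennreal (real m powr (- \<zeta> / 2))) \<longlonglongrightarrow> 0" using lim0[of "\<zeta> / 2"] z(1) by simp
    have T: "(\<lambda>m. trace_dist m (\<rho> m) (vacuum m)) \<longlonglongrightarrow> 0"
      using ev by (intro tendsto_sandwich[OF _ _ tendsto_const lim2]) (auto elim: eventually_mono)
    have H: "(\<lambda>m. dist_gaussian_hull m (\<rho> m)) \<longlonglongrightarrow> 0"
      using ev by (intro tendsto_sandwich[OF _ _ tendsto_const T]) (auto elim: eventually_mono)
    define d where "d = 1 - gamma_exp * (1 + \<zeta>)"
    \<comment> \<open>The upper bound on zeta says exactly that the power of m is positive, so that
      it wins over the power of ln m in the denominator.\<close>
    have d: "0 < d" using z gamma_exp_bounds by (simp add: d_def field_simps)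
    define a where "a = 1 + \<zeta>"
    have a: "0 < a" using z by (simp add: a_def)
    have "filterlim R at_top sequentially"
      unfolding R_def unfolding d_def[symmetric] unfolding a_def[symmetric] using d a C by real_asymp
    have D: "(\<lambda>m. entropy_deficit m (W m)) \<longlonglongrightarrow> \<infinity>"
      unfolding tendsto_PInfty
    proof
      fix r
      have "\<forall>\<^sub>F m in sequentially. r < R m"
        using \<open>filterlim R at_top sequentially\<close> by (simp add: filterlim_at_top_dense)
      then show "\<forall>\<^sub>F m in sequentially. ereal r < entropy_deficit m (W m)"
        using ev
      proof eventually_elim
        case (elim m)
        then have "ereal r < ereal (R m)" by simp
        also have "\<dots> \<le> entropy_deficit m (W m)" using elim by blast
        finally show ?case .
      qed
    qed
    show "\<exists>(\<rho> :: nat \<Rightarrow> oper) (W :: nat \<Rightarrow> point \<Rightarrow> point \<Rightarrow> real).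
        (\<forall>\<^sub>F m in sequentially.
           density_oper m (\<rho> m) \<and> is_wigner m (\<rho> m) (W m) \<and>
           (\<forall>q\<in>space (config m). \<forall>p\<in>space (config m). W m q p > 0) \<and>
           energy m (\<rho> m) \<le> ennreal (real m powr (- \<zeta>)) \<and>
           dist_gaussian_hull m (\<rho> m) \<le> trace_dist m (\<rho> m) (vacuum m) \<and>
           trace_dist m (\<rho> m) (vacuum m) \<le> ennreal (real m powr (- \<zeta> / 2)) \<and>
           entropy_deficit m (W m) \<ge>
             ereal (C * (real m powr (1 - gamma_exp * (1 + \<zeta>)) /
                          ((1 + \<zeta>) * ln (real m)) powr beta_exp))) \<and>
        (\<lambda>m. energy m (\<rho> m)) \<longlonglongrightarrow> 0 \<and>
        (\<lambda>m. trace_dist m (\<rho> m) (vacuum m)) \<longlonglongrightarrow> 0 \<and>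
        (\<lambda>m. dist_gaussian_hull m (\<rho> m)) \<longlonglongrightarrow> 0 \<and>
        (\<lambda>m. entropy_deficit m (W m)) \<longlonglongrightarrow> \<infinity>"
      by (intro exI[of _ \<rho>] exI[of _ W] conjI E T H D ev[unfolded R_def])
  qed
qed

end
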